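(* If $G$ is a graph with $\mathrm{mlt}(G)\le 3$ or $\mathrm{gcr}(G)\le 4$, then $\mathrm{mlt}(G)=\mathrm{gcr}(G)$.
   Context: For a graph $G$ on $\{1,\dots,n\}$ with $m$ edges: the MLE of the Gaussian graphical model of $G$ from data $X_1,\dots,X_N\in\mathbb{R}^n$, $S=\frac1N\sum X_kX_k^T$, exists if the minimum of $\operatorname{tr}(SK)-\log\det K$ over positive definite $K$ with $K_{ij}=0$ for non-edges $ij$ ($i\neq j$) is attained; $\mathrm{mlt}(G)$ is the smallest $N$ such that for i.i.d. samples from a distribution mutually absolutely continuous with respect to Lebesgue measure the MLE exists almost surely. The generic completion rank $\mathrm{gcr}(G)$ is the smallest $d+1$ such that the orthogonal projection of the set of symmetric $n\times n$ matrices of rank $d+1$ onto the coordinates given by the diagonal entries and the entries indexed by edges of $G$ has dimension $m+n$. *)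

theory Defs
  imports "HOL-Analysis.Analysis" "HOL-Probability.Probability"
begin

text \<open>
  Graphs have vertex set the finite type \<open>'n\<close>, so that \<open>n = CARD('n)\<close>, and are given by their
  set \<open>E\<close> of edges, which are two-element sets of vertices; \<open>m = card E\<close>.
\<close>

definition simple_graph :: "'n::finite set set \<Rightarrow> bool" where
  "simple_graph E \<longleftrightarrow> (\<forall>e\<in>E. card e = 2)"

definition symmetric_matrix :: "real^'n^'n \<Rightarrow> bool" where
  "symmetric_matrix A \<longleftrightarrow> transpose A = A"

definition positive_definite :: "real^'n^'n \<Rightarrow> bool" where
  "positive_definite A \<longleftrightarrow> symmetric_matrix A \<and> (\<forall>x. x \<noteq> 0 \<longrightarrow> 0 < x \<bullet> (A *v x))"


section \<open>Maximum likelihood threshold\<close>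

definition concentration_matrices :: "'n::finite set set \<Rightarrow> (real^'n^'n) set" where
  "concentration_matrices E =
     {K. positive_definite K \<and> (\<forall>i j. i \<noteq> j \<and> {i, j} \<notin> E \<longrightarrow> K $ i $ j = 0)}"

definition sample_covariance :: "nat \<Rightarrow> (nat \<Rightarrow> real^'n) \<Rightarrow> real^'n^'n" where
  "sample_covariance N X = (1 / real N) *\<^sub>R (\<Sum>k=1..N. (\<chi> i j. X k $ i * X k $ j))"

definition neg_log_likelihood :: "real^'n^'n \<Rightarrow> real^'n^'n \<Rightarrow> real" where
  "neg_log_likelihood S K = trace (S ** K) - ln (det K)"

definition mle_exists :: "'n::finite set set \<Rightarrow> nat \<Rightarrow> (nat \<Rightarrow> real^'n) \<Rightarrow> bool" where
  "mle_exists E N X \<longleftrightarrow>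
     (\<exists>K\<in>concentration_matrices E. \<forall>K'\<in>concentration_matrices E.
        neg_log_likelihood (sample_covariance N X) K
          \<le> neg_log_likelihood (sample_covariance N X) K')"

definition equiv_lebesgue_distribution :: "(real^'n) measure \<Rightarrow> bool" where
  "equiv_lebesgue_distribution \<mu> \<longleftrightarrow>
     prob_space \<mu> \<and> sets \<mu> = sets borel \<and>
     absolutely_continuous lborel \<mu> \<and> absolutely_continuous \<mu> lborel"

text \<open>
  The law of \<open>N\<close> i.i.d. samples is the \<open>N\<close>-fold product measure. It is equivalent to Lebesgue
  measure whichever \<open>\<mu>\<close> is chosen, so quantifying over all \<open>\<mu>\<close> or fixing one makes no difference.
\<close>

definition mlt :: "'n::finite set set \<Rightarrow> nat" where
  "mlt E = (LEAST N. 1 \<le> N \<and>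
     (\<forall>\<mu>. equiv_lebesgue_distribution \<mu> \<longrightarrow>
        (AE X in (\<Pi>\<^sub>M k\<in>{1..N}. \<mu>). mle_exists E N X)))"


section \<open>Dimension\<close>

text \<open>
  The dimension of a semialgebraic set \<open>A\<close> is the largest \<open>k\<close> such that \<open>A\<close> contains a homeomorphic
  copy of a nonempty open subset of a \<open>k\<close>-dimensional Euclidean space; it agrees with the Krull
  dimension of the Zariski closure of \<open>A\<close>. As \<open>k\<close> cannot exceed the dimension of the ambient space
  \<open>'a\<close>, the \<open>k\<close>-dimensional Euclidean spaces can be taken to be the linear subspaces of \<open>'a\<close>.
  The definition is only used for semialgebraic sets.
\<close>

definition set_dimension :: "'a::euclidean_space set \<Rightarrow> nat" where
  "set_dimension A =
     Sup {k. \<exists>(L::'a set) U T. subspace L \<and> dim L = k \<and> openin (top_of_set L) U \<and> U \<noteq> {} \<and>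
                     T \<subseteq> A \<and> U homeomorphic T}"

lemma set_dimension_openin:
  fixes A V :: "'a::euclidean_space set"
  assumes V: "subspace V" and A: "A \<subseteq> V" and U: "openin (top_of_set V) U" "U \<noteq> {}" "U \<subseteq> A"
  shows "set_dimension A = dim V"
  unfolding set_dimension_def
proof (rule cSup_eq_maximum)
  show "dim V \<in> {k. \<exists>(L::'a set) U T. subspace L \<and> dim L = k \<and> openin (top_of_set L) U \<and> U \<noteq> {} \<and>
                     T \<subseteq> A \<and> U homeomorphic T}"
    using V U homeomorphic_refl by blast
next
  fix k assume "k \<in> {k. \<exists>(L::'a set) U T. subspace L \<and> dim L = k \<and> openin (top_of_set L) U \<and> U \<noteq> {} \<and>
                     T \<subseteq> A \<and> U homeomorphic T}"
  then obtain L W T :: "'a set" where L: "subspace L" "dim L = k" and W: "openin (top_of_set L) W" "W \<noteq> {}"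
    and T: "T \<subseteq> A" "W homeomorphic T"
    by blast
  obtain f g where fg: "homeomorphism W T f g"
    using T(2) unfolding homeomorphic_def by blast
  have "continuous_on W f" "inj_on f W"
    using fg unfolding homeomorphism_def by (auto intro: inj_on_inverseI)
  moreover have "f \<in> W \<rightarrow> V"
    using fg T(1) A unfolding homeomorphism_def by blast
  ultimately show "k \<le> dim V"
    using invariance_of_dimension_subspaces[OF W(1) L(1) V] W(2) L(2) by blast
qed


section \<open>Generic completion rank\<close>

text \<open>
  The orthogonal projection onto the coordinates indexed by the diagonal and the edges. Its image
  is kept inside the space of matrices, where the symmetric matrices supported on these positions
  form a linear subspace of dimension \<open>m + n\<close>.
\<close>

definition graph_projection :: "'n::finite set set \<Rightarrow> real^'n^'n \<Rightarrow> real^'n^'n" where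
  "graph_projection E A = (\<chi> i j. if i = j \<or> {i, j} \<in> E then A $ i $ j else 0)"

definition symmetric_of_rank :: "nat \<Rightarrow> (real^'n^'n) set" where
  "symmetric_of_rank r = {A. symmetric_matrix A \<and> rank A = r}"

definition gcr :: "'n::finite set set \<Rightarrow> nat" where
  "gcr E = (LEAST r. 1 \<le> r \<and>
     set_dimension (graph_projection E ` symmetric_of_rank r) = card E + CARD('n))"

end

theory Submission
  imports Defs "HOL-Computational_Algebra.Polynomial"
begin

text \<open>
  Let \<open>g\<close> be the least number \<open>N\<close> of samples for which some configuration carries no nonzero
  equilibrium stress, that is, no symmetric matrix supported on the diagonal and the edges that
  kills all samples. The estimate exists if and only if the samples carry no nonzero positive
  semidefinite stress. Being stress-free is the nonvanishing of a polynomial, a Gram determinant,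
  hence holds almost everywhere once it holds somewhere; so the maximum likelihood threshold is at
  most \<open>g\<close>. The generic completion rank equals \<open>g\<close>: at a stress-free configuration the map
  \<open>X \<mapsto> X X\<^sup>T\<close> followed by the projection is a submersion, and conversely, if the projection has
  full dimension then the coordinates of a polynomial parametrization are algebraically
  independent, so that their differentials are independent at some point.

  It remains to see that generic existence with \<open>N \<le> 3\<close> samples forces \<open>g \<le> N\<close>. If there is no
  stress-free configuration, then the graph contains an edge (\<open>N = 1\<close>), a cycle (\<open>N = 2\<close>) or a
  circuit of the two-dimensional rigidity matroid (\<open>N = 3\<close>), and each of these has a nonzero
  positive semidefinite stress for all configurations in a nonempty open set. For circuits this is
  proved along 1-extensions and gluings over triangles, for 3-connected circuits, and along
  2-sums in general. If the completion rank is at most four, then the threshold is either at most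
  three or equal to four.
\<close>

section \<open>Circuits of the two-dimensional rigidity matroid\<close>

text \<open>Row i of the sample matrix holds the i-th coordinates of all samples. For three samples
  the rows can be read as homogeneous coordinates of points in the plane, and a symmetric matrix w
  supported on the graph with \<open>w ** X = 0\<close> is, up to rescaling of rows, an equilibrium
  stress of a planar framework; hence the two-dimensional rigidity matroid. Counting yields stresses
  but says nothing about their signs, and semidefiniteness alone may be lost under perturbation. The
  induction over 3-connected circuits therefore carries a stronger invariant: the stress spans the
  space of all stresses, its kernel is as small as possible (\<open>super_psd\<close>), and no entry
  at an edge is zero. Together these persist at all nearby configurations. A degree-three reduction
  may destroy 3-connectivity; the graph is then cut at a tight part with three attachment vertices,
  which is where the gluing over a triangle comes from. For the completion rank the obstacle is that
  symmetric matrices of rank r may be indefinite: products X X^T suffice to show that a dimension is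
  attained, but the converse needs the larger family P B P^T.\<close>

definition induced :: "'a set set \<Rightarrow> 'a set \<Rightarrow> 'a set set" where
  "induced E S = {e \<in> E. e \<subseteq> S}"

definition neighbors :: "'a set set \<Rightarrow> 'a \<Rightarrow> 'a set" where
  "neighbors E v = {u. u \<noteq> v \<and> {u, v} \<in> E}"

lemma ex_min_card:
  fixes F :: "'a set set"
  assumes "F \<noteq> {}"
  shows "\<exists>Q\<in>F. \<forall>Q'\<in>F. card Q \<le> card Q'"
  using assms ex_has_least_nat[of "\<lambda>Q. Q \<in> F" _ card] by blast

locale finite_graph =
  fixes V :: "'a set" and E :: "'a set set"
  assumes finite_V: "finite V"
    and edge: "\<And>e. e \<in> E \<Longrightarrow> e \<subseteq> V \<and> card e = 2"
begin

abbreviation edges_in :: "'a set \<Rightarrow> nat" where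
  "edges_in S \<equiv> card (induced E S)"

abbreviation nbr :: "'a \<Rightarrow> 'a set" where
  "nbr \<equiv> neighbors E"

lemma finite_E: "finite E"
  using finite_V edge by (intro finite_subset[of E "Pow V"]) auto

lemma finite_induced [simp]: "finite (induced E S)"
  using finite_E by (auto simp: induced_def)

lemma induced_V: "induced E V = E"
  using edge by (auto simp: induced_def)

lemma nbr_subset: "nbr v \<subseteq> V - {v}"
  using edge by (auto simp: neighbors_def)

lemma finite_nbr [simp]: "finite (nbr v)"
  using nbr_subset finite_V by (meson finite_Diff finite_subset)

lemma nbr_sym: "u \<in> nbr v \<longleftrightarrow> v \<in> nbr u"
  by (auto simp: neighbors_def insert_commute)

lemma edge_pair:
  assumes "e \<in> E" "v \<in> e"
  obtains u where "e = {u, v}" "u \<in> nbr v"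
proof -
  from edge[OF assms(1)] have "card e = 2" by simp
  then obtain a b where ab: "e = {a, b}" "a \<noteq> b" by (auto simp: card_2_iff)
  show thesis
  proof (cases "v = a")
    case True
    then show ?thesis using ab assms that[of b] by (auto simp: neighbors_def insert_commute)
  next
    case False
    then show ?thesis using ab assms that[of a] by (auto simp: neighbors_def)
  qed
qed

lemma edges_at_card: "card {e \<in> E. v \<in> e \<and> e \<subseteq> insert v S} = card (nbr v \<inter> S)"
proof -
  have "bij_betw (\<lambda>u. {u, v}) (nbr v \<inter> S) {e \<in> E. v \<in> e \<and> e \<subseteq> insert v S}"
    unfolding bij_betw_def
  proof
    show "inj_on (\<lambda>u. {u, v}) (nbr v \<inter> S)"
      by (auto simp: inj_on_def doubleton_eq_iff)
    show "(\<lambda>u. {u, v}) ` (nbr v \<inter> S) = {e \<in> E. v \<in> e \<and> e \<subseteq> insert v S}"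
    proof
      show "(\<lambda>u. {u, v}) ` (nbr v \<inter> S) \<subseteq> {e \<in> E. v \<in> e \<and> e \<subseteq> insert v S}"
        by (auto simp: neighbors_def)
      show "{e \<in> E. v \<in> e \<and> e \<subseteq> insert v S} \<subseteq> (\<lambda>u. {u, v}) ` (nbr v \<inter> S)"
      proof
        fix e assume e: "e \<in> {e \<in> E. v \<in> e \<and> e \<subseteq> insert v S}"
        then obtain u where "e = {u, v}" "u \<in> nbr v" using edge_pair by blast
        then show "e \<in> (\<lambda>u. {u, v}) ` (nbr v \<inter> S)"
          using e by (auto simp: neighbors_def)
      qed
    qed
  qed
  then show ?thesis by (simp add: bij_betw_same_card)
qed

lemma degree_card: "card {e \<in> E. v \<in> e} = card (nbr v)"
proof -
  have "{e \<in> E. v \<in> e} = {e \<in> E. v \<in> e \<and> e \<subseteq> insert v V}" using edge by auto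
  moreover have "nbr v \<inter> V = nbr v" using nbr_subset by blast
  ultimately show ?thesis using edges_at_card[of v V] by simp
qed

lemma edges_in_insert:
  assumes "v \<notin> S"
  shows "edges_in (insert v S) = edges_in S + card (nbr v \<inter> S)"
proof -
  have "induced E (insert v S) = induced E S \<union> {e \<in> E. v \<in> e \<and> e \<subseteq> insert v S}"
    by (auto simp: induced_def)
  moreover have "induced E S \<inter> {e \<in> E. v \<in> e \<and> e \<subseteq> insert v S} = {}"
    using assms by (auto simp: induced_def)
  ultimately have "edges_in (insert v S) = edges_in S + card {e \<in> E. v \<in> e \<and> e \<subseteq> insert v S}"
    using finite_E by (simp add: card_Un_disjoint)
  then show ?thesis by (simp add: edges_at_card)
qed

lemma edges_in_remove:
  assumes "v \<in> S"
  shows "edges_in S = edges_in (S - {v}) + card (nbr v \<inter> S)"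
proof -
  have "nbr v \<inter> (S - {v}) = nbr v \<inter> S" using nbr_subset by blast
  then show ?thesis using edges_in_insert[of v "S - {v}"] assms by (simp add: insert_absorb)
qed

lemma edges_in_small: "card S \<le> 1 \<Longrightarrow> finite S \<Longrightarrow> edges_in S = 0"
proof -
  assume S: "card S \<le> 1" "finite S"
  have "e \<notin> induced E S" for e
  proof
    assume "e \<in> induced E S"
    then have "card e = 2" "e \<subseteq> S" using edge by (auto simp: induced_def)
    then show False using card_mono[OF S(2), of e] S(1) by simp
  qed
  then have "induced E S = {}" by blast
  then show ?thesis by simp
qed

lemma edges_in_supermodular:
  "edges_in S + edges_in T \<le> edges_in (S \<union> T) + edges_in (S \<inter> T)"
proof -
  have "edges_in S + edges_in T = card (induced E S \<union> induced E T) + card (induced E S \<inter> induced E T)"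
    by (rule card_Un_Int) auto
  also have "induced E S \<inter> induced E T = induced E (S \<inter> T)" by (auto simp: induced_def)
  also have "card (induced E S \<union> induced E T) \<le> edges_in (S \<union> T)"
    by (intro card_mono finite_induced) (auto simp: induced_def)
  finally show ?thesis by simp
qed

text \<open>Inclusion and exclusion counts the edges inside S or inside T; equality in
  supermodularity leaves none for the rest of the union.\<close>

lemma no_cross_edge:
  assumes "edges_in (S \<union> T) + edges_in (S \<inter> T) \<le> edges_in S + edges_in T"
    and "e \<in> E" "e \<subseteq> S \<union> T"
  shows "e \<subseteq> S \<or> e \<subseteq> T"
proof -
  have "edges_in S + edges_in T = card (induced E S \<union> induced E T) + card (induced E S \<inter> induced E T)"
    by (rule card_Un_Int) auto
  also have "induced E S \<inter> induced E T = induced E (S \<inter> T)" by (auto simp: induced_def)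
  finally have "edges_in (S \<union> T) \<le> card (induced E S \<union> induced E T)" using assms(1) by simp
  moreover have "induced E S \<union> induced E T \<subseteq> induced E (S \<union> T)" by (auto simp: induced_def)
  ultimately have "induced E S \<union> induced E T = induced E (S \<union> T)"
    by (intro card_seteq finite_induced) auto
  moreover have "e \<in> induced E (S \<union> T)" using assms by (auto simp: induced_def)
  ultimately show ?thesis by (auto simp: induced_def)
qed

lemma degree_sum:
  assumes "D \<subseteq> V"
  shows "(\<Sum>v\<in>D. card (nbr v)) + edges_in (V - D) = card E + edges_in D"
proof -
  have fD: "finite D" using assms finite_V finite_subset by blast
  have "(\<Sum>v\<in>D. card (nbr v)) = (\<Sum>v\<in>D. \<Sum>e\<in>E. if v \<in> e then 1 else 0)"
    unfolding degree_card[symmetric] using finite_E by (simp add: sum.If_cases Int_def)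
  also have "\<dots> = (\<Sum>e\<in>E. \<Sum>v\<in>D. if v \<in> e then 1 else 0)" by (rule sum.swap)
  also have "\<dots> = (\<Sum>e\<in>E. card (e \<inter> D))"
    using fD by (simp add: sum.If_cases Int_def conj_commute)
  finally have 1: "(\<Sum>v\<in>D. card (nbr v)) = (\<Sum>e\<in>E. card (e \<inter> D))" .
  have 2: "card (e \<inter> D) + (if e \<subseteq> V - D then 1 else 0) = 1 + (if e \<subseteq> D then 1 else 0)" if "e \<in> E" for e
  proof -
    from edge[OF that] obtain a b where "e = {a, b}" "a \<noteq> b" "a \<in> V" "b \<in> V"
      by (auto simp: card_2_iff)
    then show ?thesis by (cases "a \<in> D"; cases "b \<in> D") (auto simp: Int_insert_left)
  qed
  have "(\<Sum>e\<in>E. card (e \<inter> D)) + edges_in (V - D)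
      = (\<Sum>e\<in>E. card (e \<inter> D) + (if e \<subseteq> V - D then 1 else 0))"
    using finite_E by (simp add: sum.distrib sum.If_cases induced_def Int_def)
  also have "\<dots> = (\<Sum>e\<in>E. 1 + (if e \<subseteq> D then 1 else 0))" using 2 by (intro sum.cong) auto
  also have "\<dots> = card E + (\<Sum>e\<in>E. if e \<subseteq> D then 1 else 0)"
    by (simp only: sum.distrib card_eq_sum)
  also have "\<dots> = card E + edges_in D"
    using finite_E by (simp add: sum.If_cases induced_def Int_def)
  finally show ?thesis using 1 by simp
qed

text \<open>An overlap in one vertex contains no edge, so edge counts add while the vertex count
  drops by three. Three sets with 2 k - 3 edges on k vertices thus unite to a set with at least as
  many edges as the same formula gives for the union.\<close>

lemma triangle_union:
  assumes f: "finite X1" "finite X2" "finite X3"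
    and I: "X1 \<inter> X2 = {e3}" "X1 \<inter> X3 = {e2}" "X2 \<inter> X3 = {e1}" and dist: "e1 \<noteq> e2"
  shows "card (X1 \<union> X2 \<union> X3) + 3 = card X1 + card X2 + card X3"
    and "card (induced E X1 \<union> induced E X2 \<union> induced E X3) = edges_in X1 + edges_in X2 + edges_in X3"
proof -
  let ?U = "X1 \<union> X2 \<union> X3"
  have cardU: "card ?U + 3 = card X1 + card X2 + card X3"
  proof -
    have "card (X1 \<union> X2) + 1 = card X1 + card X2" using f I(1) card_Un_Int[of X1 X2] by simp
    moreover have "(X1 \<union> X2) \<inter> X3 = {e1, e2}" using I by auto
    then have "card ?U + 2 = card (X1 \<union> X2) + card X3"
      using f dist card_Un_Int[of "X1 \<union> X2" X3] by simp
    ultimately show ?thesis by simp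
  qed
  have disj: "induced E X1 \<inter> induced E X2 = {}" "(induced E X1 \<union> induced E X2) \<inter> induced E X3 = {}"
  proof -
    have *: "\<not> (e \<subseteq> {x})" if "e \<in> E" for e x
    proof
      assume "e \<subseteq> {x}"
      then have "card e \<le> 1" using card_mono[of "{x}" e] by simp
      then show False using edge[OF that] by simp
    qed
    show "induced E X1 \<inter> induced E X2 = {}" using I(1) * by (auto simp: induced_def) (metis Int_subset_iff)
    show "(induced E X1 \<union> induced E X2) \<inter> induced E X3 = {}"
      using I(2,3) * by (auto simp: induced_def) (metis Int_subset_iff)+
  qed
  show "card ?U + 3 = card X1 + card X2 + card X3" by (fact cardU)
  show "card (induced E X1 \<union> induced E X2 \<union> induced E X3) = edges_in X1 + edges_in X2 + edges_in X3"
    using disj by (simp add: card_Un_disjoint)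
qed

lemma restrict: "S \<subseteq> V \<Longrightarrow> finite_graph S (induced E S)"
  using finite_V edge by unfold_locales (auto simp: induced_def intro: finite_subset)

end


section \<open>Connectivity and edge counts in circuits\<close>

definition three_connected :: "'a set \<Rightarrow> 'a set set \<Rightarrow> bool" where
  "three_connected V E \<longleftrightarrow>
     (\<forall>P Q. P \<noteq> {} \<and> Q \<noteq> {} \<and> P \<inter> Q = {} \<and> P \<union> Q \<subseteq> V \<and> card (V - (P \<union> Q)) \<le> 2 \<longrightarrow>
        (\<exists>p\<in>P. \<exists>q\<in>Q. {p, q} \<in> E))"

lemma three_connectedD:
  assumes "three_connected V E" "P \<noteq> {}" "Q \<noteq> {}" "P \<inter> Q = {}" "P \<union> Q \<subseteq> V" "card (V - (P \<union> Q)) \<le> 2"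
  obtains p q where "p \<in> P" "q \<in> Q" "{p, q} \<in> E"
  using assms unfolding three_connected_def by metis

text \<open>By Laman's theorem a graph is independent in the generic rigidity matroid of the plane
  when every set of k vertices, k at least two, spans at most 2 k - 3 edges. A circuit exceeds this
  by one on its full vertex set and nowhere else; only these counts enter the proofs.\<close>

locale circuit = finite_graph +
  assumes card_E: "card E + 2 = 2 * card V"
    and card_V: "2 \<le> card V"
    and sparse: "\<And>S. S \<subseteq> V \<Longrightarrow> S \<noteq> V \<Longrightarrow> 2 \<le> card S \<Longrightarrow> edges_in S + 3 \<le> 2 * card S"
begin

definition tight :: "'a set \<Rightarrow> bool" where
  "tight S \<longleftrightarrow> S \<subseteq> V \<and> S \<noteq> V \<and> 2 \<le> card S \<and> edges_in S + 3 = 2 * card S"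

lemma finite_sub: "S \<subseteq> V \<Longrightarrow> finite S"
  using finite_V finite_subset by blast

lemma card_sub: "S \<subseteq> V \<Longrightarrow> card S \<le> card V"
  using finite_V card_mono by blast

lemma edges_in_V: "edges_in V + 2 = 2 * card V"
  using card_E induced_V by simp

lemma not_tightD: "S \<subseteq> V \<Longrightarrow> 2 \<le> card S \<Longrightarrow> 2 * card S \<le> edges_in S + 2 \<Longrightarrow> S = V"
  using sparse[of S] by (cases "S = V") auto

lemma tightI: "S \<subseteq> V \<Longrightarrow> S \<noteq> V \<Longrightarrow> 2 \<le> card S \<Longrightarrow> 2 * card S \<le> edges_in S + 3 \<Longrightarrow> tight S"
  using sparse[of S] unfolding tight_def by auto

lemma card_V4: "4 \<le> card V"
proof (rule ccontr)
  assume "\<not> 4 \<le> card V"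
  then have "card V = 2 \<or> card V = 3" using card_V by auto
  moreover have "card E \<le> card V choose 2"
  proof -
    have "E \<subseteq> {e. e \<subseteq> V \<and> card e = 2}" using edge by auto
    moreover have "finite {e. e \<subseteq> V \<and> card e = 2}" using finite_V by auto
    ultimately have "card E \<le> card {e. e \<subseteq> V \<and> card e = 2}" by (intro card_mono)
    then show ?thesis using finite_V by (simp add: n_subsets)
  qed
  ultimately show False using card_E by (auto simp: choose_two)
qed

lemma degree_ge_3: "v \<in> V \<Longrightarrow> 3 \<le> card (nbr v)"
proof -
  assume v: "v \<in> V"
  have "card (V - {v}) = card V - 1" using v finite_V by simp
  moreover from this have "edges_in (V - {v}) + 3 \<le> 2 * card (V - {v})"
    using card_V4 v by (intro sparse) auto
  moreover have "edges_in V = edges_in (V - {v}) + card (nbr v \<inter> V)"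
    using edges_in_remove[OF v] .
  moreover have "nbr v \<inter> V = nbr v" using nbr_subset by blast
  ultimately show ?thesis using edges_in_V card_V4 by simp
qed

text \<open>Supermodularity squeezes: union and intersection are proper sets and obey the sparse
  bound, while their edge counts add up to at least those of two tight sets. Equality holds
  throughout, which also rules out edges across.\<close>

lemma tight_union:
  assumes "tight S" "tight T" "2 \<le> card (S \<inter> T)" "S \<union> T \<noteq> V"
  shows "tight (S \<union> T)"
    and "\<And>e. e \<in> E \<Longrightarrow> e \<subseteq> S \<union> T \<Longrightarrow> e \<subseteq> S \<or> e \<subseteq> T"
proof -
  have f: "finite S" "finite T" using assms finite_sub unfolding tight_def by blast+
  have c: "card (S \<union> T) + card (S \<inter> T) = card S + card T" using f card_Un_Int[of S T] by simp
  have "S \<subseteq> V" "T \<subseteq> V" "S \<noteq> V" using assms unfolding tight_def by blast+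
  then have sub: "S \<union> T \<subseteq> V" "S \<inter> T \<subseteq> V" "S \<inter> T \<noteq> V" by blast+
  have ge: "card (S \<union> T) \<ge> 2"
    using assms(1) f card_mono[of "S \<union> T" S] unfolding tight_def by simp
  have 1: "edges_in (S \<union> T) + 3 \<le> 2 * card (S \<union> T)" using sparse sub assms(4) ge by blast
  have 2: "edges_in (S \<inter> T) + 3 \<le> 2 * card (S \<inter> T)" using sparse sub assms(3) by blast
  have 3: "edges_in S + 3 = 2 * card S" "edges_in T + 3 = 2 * card T" using assms unfolding tight_def by auto
  have 4: "edges_in S + edges_in T \<le> edges_in (S \<union> T) + edges_in (S \<inter> T)" by (rule edges_in_supermodular)
  show "tight (S \<union> T)" using 1 2 3 4 c sub assms(4) ge by (intro tightI) linarith+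
  have "edges_in (S \<union> T) + edges_in (S \<inter> T) \<le> edges_in S + edges_in T" using 1 2 3 c by linarith
  then show "\<And>e. e \<in> E \<Longrightarrow> e \<subseteq> S \<union> T \<Longrightarrow> e \<subseteq> S \<or> e \<subseteq> T" using no_cross_edge by blast
qed

text \<open>All degrees are at least three, so a vertex with all its neighbours in S raises the
  count from 2 k - 3 on k vertices to at least 2 (k + 1) - 2 on k + 1 vertices, which only the full
  vertex set attains.\<close>

lemma tight_full_nbr:
  assumes "S \<subseteq> V" "2 * card S \<le> edges_in S + 3" "v \<in> V" "v \<notin> S" "nbr v \<subseteq> S"
  shows "insert v S = V"
proof -
  have "finite S" using finite_sub assms by blast
  moreover have "card (nbr v) \<ge> 3" using degree_ge_3 assms by blast
  moreover have "card (nbr v) \<le> card S" using assms(5) \<open>finite S\<close> card_mono by blast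
  moreover have "nbr v \<inter> S = nbr v" using assms by auto
  ultimately show ?thesis
    using edges_in_insert[OF assms(4)] assms by (intro not_tightD) auto
qed

text \<open>After removal of z the sparse bound drops by two, so two edges must be lost; a tight
  pair is a single edge and loses only one.\<close>

lemma tight_degree:
  assumes "tight S" "z \<in> S"
  shows "1 \<le> card (nbr z \<inter> S)" and "3 \<le> card S \<Longrightarrow> 2 \<le> card (nbr z \<inter> S)"
proof -
  have f: "finite S" using assms finite_sub unfolding tight_def by blast
  have c: "card (S - {z}) = card S - 1" using assms f by simp
  have e: "edges_in S = edges_in (S - {z}) + card (nbr z \<inter> S)" using edges_in_remove assms by blast
  have t: "edges_in S + 3 = 2 * card S" "2 \<le> card S" "S \<subseteq> V" "S \<noteq> V" using assms unfolding tight_def by auto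
  show *: "2 \<le> card (nbr z \<inter> S)" if "3 \<le> card S"
  proof -
    have "edges_in (S - {z}) + 3 \<le> 2 * card (S - {z})"
      using t c that by (intro sparse) auto
    then show ?thesis using e t c that by simp
  qed
  show "1 \<le> card (nbr z \<inter> S)"
  proof (cases "card S = 2")
    case True
    then have "edges_in (S - {z}) = 0" using c f by (intro edges_in_small) auto
    then show ?thesis using e t True by simp
  next
    case False
    then show ?thesis using * t by simp
  qed
qed

lemma tight_insert:
  assumes "tight S" "v \<in> V" "v \<notin> S" "card (nbr v \<inter> S) = 2" "insert v S \<noteq> V"
  shows "tight (insert v S)"
proof -
  have f: "finite S" using assms finite_sub unfolding tight_def by blast
  have t: "S \<subseteq> V" "2 \<le> card S" "edges_in S + 3 = 2 * card S" using assms(1) unfolding tight_def by auto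
  show ?thesis
    using assms(2-) edges_in_insert[OF assms(3)] f t by (intro tightI) auto
qed

text \<open>The sets meet pairwise in one vertex, so by \<open>triangle_union\<close> their union is
  dense enough for \<open>tight_full_nbr\<close>: it is everything except v. The count is then
  exact, and each edge avoiding v lies inside one of the sets. Their sizes add up to
  \<open>card V + 2\<close>, at least seven, so one of them has three vertices or more, and the two
  neighbours of v in it separate it from the rest.\<close>

lemma independent_tight_triangle:
  assumes conn: "three_connected V E" and n: "5 \<le> card V"
    and v: "v \<in> V" "nbr v = {e1, e2, e3}" and dist: "e1 \<noteq> e2" "e1 \<noteq> e3" "e2 \<noteq> e3"
    and X1: "tight X1" "v \<notin> X1" "e1 \<notin> X1" "e2 \<in> X1" "e3 \<in> X1"
    and X2: "tight X2" "v \<notin> X2" "e2 \<notin> X2" "e1 \<in> X2" "e3 \<in> X2"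
    and X3: "tight X3" "v \<notin> X3" "e3 \<notin> X3" "e1 \<in> X3" "e2 \<in> X3"
    and small: "card (X1 \<inter> X2) < 2" "card (X1 \<inter> X3) < 2" "card (X2 \<inter> X3) < 2"
  shows False
proof -
  have sub: "X1 \<subseteq> V" "X2 \<subseteq> V" "X3 \<subseteq> V" using X1 X2 X3 unfolding tight_def by auto
  then have f: "finite X1" "finite X2" "finite X3" using finite_sub by blast+
  have single: "A = {x}" if "card A < 2" "finite A" "x \<in> A" for A and x :: 'a
  proof -
    have "card {x} = card A" using that card_mono[of A "{x}"] by simp
    then show ?thesis using that card_seteq[of A "{x}"] by auto
  qed
  have I: "X1 \<inter> X2 = {e3}" "X1 \<inter> X3 = {e2}" "X2 \<inter> X3 = {e1}"
    using single[OF small(1)] single[OF small(2)] single[OF small(3)] f X1 X2 X3 by blast+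
  let ?U = "X1 \<union> X2 \<union> X3"
  let ?I = "induced E X1 \<union> induced E X2 \<union> induced E X3"
  have cardU: "card ?U + 3 = card X1 + card X2 + card X3"
    and cI: "card ?I = edges_in X1 + edges_in X2 + edges_in X3"
    using triangle_union[OF f I] dist by auto
  have IU: "?I \<subseteq> induced E ?U" by (auto simp: induced_def)
  then have le: "card ?I \<le> edges_in ?U" by (intro card_mono finite_induced)
  have tights: "edges_in X1 + 3 = 2 * card X1" "edges_in X2 + 3 = 2 * card X2" "edges_in X3 + 3 = 2 * card X3"
    using X1 X2 X3 unfolding tight_def by auto
  have U: "insert v ?U = V"
    using sub X1 X2 X3 v tights cI le cardU by (intro tight_full_nbr) auto
  have vU: "v \<notin> ?U" using X1 X2 X3 by auto
  then have "edges_in V = edges_in ?U + card (nbr v \<inter> ?U)"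
    using edges_in_insert[of v ?U] U by simp
  moreover have "nbr v \<inter> ?U = {e1, e2, e3}" using v X1 X2 X3 by auto
  moreover have "card V = card ?U + 1" using U vU f by (metis Suc_eq_plus1 card_insert_disjoint finite_Un)
  ultimately have "edges_in ?U = card ?I" using edges_in_V dist cI tights cardU by simp
  then have eq: "?I = induced E ?U" using IU by (intro card_seteq finite_induced) auto
  have sep: False
    if X: "X \<subseteq> V" "v \<notin> X" "nbr v \<inter> X = {a, b}" "3 \<le> card X" "finite X"
      and ab: "a \<noteq> b" and cover: "\<And>e. e \<in> E \<Longrightarrow> v \<notin> e \<Longrightarrow> e \<inter> (X - {a, b}) \<noteq> {} \<Longrightarrow> e \<subseteq> X"
    for X a b
  proof -
    have ne: "X - {a, b} \<noteq> {}"
    proof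
      assume "X - {a, b} = {}"
      then have "card X \<le> card {a, b}" by (intro card_mono) auto
      then show False using X ab by simp
    qed
    have "V - ((X - {a, b}) \<union> (V - X)) \<subseteq> {a, b}" by auto
    then have "card (V - ((X - {a, b}) \<union> (V - X))) \<le> card {a, b}" by (intro card_mono) auto
    then have c2: "card (V - ((X - {a, b}) \<union> (V - X))) \<le> 2" using ab by simp
    have "(X - {a, b}) \<inter> (V - X) = {}" "(X - {a, b}) \<union> (V - X) \<subseteq> V" "V - X \<noteq> {}" using X v by auto
    then obtain p q where pq: "p \<in> X - {a, b}" "q \<in> V - X" "{p, q} \<in> E"
      using three_connectedD[OF conn ne] c2 by metis
    show False
    proof (cases "q = v")
      case True
      then have "p \<in> nbr v" using pq X unfolding neighbors_def by auto
      then show False using pq X by auto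
    next
      case False
      then have "{p, q} \<subseteq> X" using pq X by (intro cover) auto
      then show False using pq by auto
    qed
  qed
  have inI: "e \<subseteq> X1 \<or> e \<subseteq> X2 \<or> e \<subseteq> X3" if "e \<in> E" "v \<notin> e" for e
  proof -
    have "e \<in> induced E ?U" using that edge[OF that(1)] U by (auto simp: induced_def)
    then show ?thesis unfolding eq[symmetric] by (auto simp: induced_def)
  qed
  have "card V = card ?U + 1" using U vU f by (metis Suc_eq_plus1 card_insert_disjoint finite_Un)
  then consider "3 \<le> card X1" | "3 \<le> card X2" | "3 \<le> card X3" using cardU n by linarith
  then show False
  proof cases
    case 1
    have "e \<subseteq> X1" if e: "e \<in> E" "v \<notin> e" "e \<inter> (X1 - {e2, e3}) \<noteq> {}" for e
      using inI[OF e(1,2)] e(3) I by blast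
    moreover have "nbr v \<inter> X1 = {e2, e3}" using v X1 by auto
    ultimately show False
      using sep[of X1 e2 e3] 1 sub X1 f dist by blast
  next
    case 2
    have "e \<subseteq> X2" if e: "e \<in> E" "v \<notin> e" "e \<inter> (X2 - {e1, e3}) \<noteq> {}" for e
      using inI[OF e(1,2)] e(3) I by blast
    moreover have "nbr v \<inter> X2 = {e1, e3}" using v X2 by auto
    ultimately show False
      using sep[of X2 e1 e3] 2 sub X2 f dist by blast
  next
    case 3
    have "e \<subseteq> X3" if e: "e \<in> E" "v \<notin> e" "e \<inter> (X3 - {e1, e2}) \<noteq> {}" for e
      using inI[OF e(1,2)] e(3) I by blast
    moreover have "nbr v \<inter> X3 = {e1, e2}" using v X3 by auto
    ultimately show False
      using sep[of X3 e1 e2] 3 sub X3 f dist by blast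
  qed
qed

definition critical :: "'a \<Rightarrow> 'a \<Rightarrow> 'a set \<Rightarrow> bool" where
  "critical v e X \<longleftrightarrow> tight X \<and> v \<notin> X \<and> e \<notin> X \<and> nbr v - {e} \<subseteq> X"

lemma complement_tight:
  assumes "tight R"
  shows "(\<Sum>v\<in>V - R. card (nbr v)) = edges_in (V - R) + 2 * card (V - R) + 1"
proof -
  have "R \<subseteq> V" using assms unfolding tight_def by auto
  then have "card (V - R) = card V - card R" "card R \<le> card V" "V - (V - R) = R"
    using finite_V by (auto simp: card_Diff_subset finite_sub card_sub)
  then show ?thesis
    using degree_sum[of "V - R"] card_E assms unfolding tight_def by auto
qed

text \<open>The sparse bound on the complement of Q, compared with the degree sum over Q, leaves
  room for few edges inside Q. Applied to all subsets, the bound says that Q spans a forest.\<close>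

lemma cubic_set_edges:
  assumes "Q \<subseteq> V" "Q \<noteq> {}" "2 \<le> card (V - Q)" "\<And>u. u \<in> Q \<Longrightarrow> card (nbr u) = 3"
  shows "edges_in Q + 1 \<le> card Q"
proof -
  have "V - Q \<noteq> V" using assms by auto
  then have "edges_in (V - Q) + 3 \<le> 2 * card (V - Q)" using assms by (intro sparse) auto
  moreover have "card (V - Q) = card V - card Q" "card Q \<le> card V"
    using assms finite_V by (auto simp: card_Diff_subset finite_sub card_sub)
  moreover have "(\<Sum>v\<in>Q. card (nbr v)) = 3 * card Q" using assms by simp
  ultimately show ?thesis using degree_sum[OF assms(1)] card_E by linarith
qed

text \<open>With all degrees outside at least four, the k vertices of the complement would span at
  least 2 k - 1 edges by \<open>complement_tight\<close>, too many for a proper subset.\<close>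

lemma exists_cubic_outside:
  assumes "tight R" "2 \<le> card (V - R)"
  shows "\<exists>u \<in> V - R. card (nbr u) = 3"
proof (rule ccontr)
  assume "\<not> ?thesis"
  then have "4 \<le> card (nbr u)" if "u \<in> V - R" for u
    using degree_ge_3[of u] that by force
  then have "(\<Sum>u\<in>V - R. 4) \<le> (\<Sum>u\<in>V - R. card (nbr u))" by (intro sum_mono)
  moreover have "edges_in (V - R) + 3 \<le> 2 * card (V - R)"
  proof (rule sparse)
    have "R \<noteq> {}" "R \<subseteq> V" using assms unfolding tight_def by auto
    then show "V - R \<noteq> V" by blast
  qed (use assms in auto)
  ultimately show False using complement_tight[OF assms(1)] by simp
qed

lemma low_degree_vertex:
  assumes "M \<subseteq> V" "M \<noteq> {}" "edges_in M + 1 \<le> card M"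
  shows "\<exists>u\<in>M. card (nbr u \<inter> M) \<le> 1"
proof (rule ccontr)
  interpret M: finite_graph M "induced E M" using restrict[OF assms(1)] .
  assume "\<not> ?thesis"
  then have *: "2 \<le> card (nbr u \<inter> M)" if "u \<in> M" for u using that by force
  have eq: "neighbors (induced E M) u = nbr u \<inter> M" if "u \<in> M" for u
    using that by (auto simp: neighbors_def induced_def)
  have "(\<Sum>u\<in>M. 2) \<le> (\<Sum>u\<in>M. card (neighbors (induced E M) u))"
    using * eq by (intro sum_mono) auto
  also have "\<dots> = 2 * edges_in M"
    using M.degree_sum[of M] M.induced_V M.edges_in_small[of "{}"] by simp
  finally show False using assms by simp
qed

text \<open>
  Deleting a vertex \<open>v\<close> of degree three and joining its neighbours other than \<open>e\<close> yields a circuit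
  precisely when no critical set for \<open>v\<close> and \<open>e\<close> exists. The proof follows a largest tight set.
\<close>

lemma exists_admissible:
  assumes conn: "three_connected V E" and n: "5 \<le> card V"
  shows "\<exists>v\<in>V. \<exists>e\<in>nbr v. card (nbr v) = 3 \<and> \<not> (\<exists>X. critical v e X)"
proof (rule ccontr)
  assume "\<not> ?thesis"
  then have crit: "\<exists>X. critical v e X" if "v \<in> V" "card (nbr v) = 3" "e \<in> nbr v" for v e
    using that by blast
  define N where "N = {v \<in> V. card (nbr v) = 3}"
  have NV: "N \<subseteq> V" by (auto simp: N_def)
  \<comment> \<open>The average degree is just below four, so some vertex is cubic; not all are,
    since 4 n - 4 exceeds 3 n for n at least five.\<close>
  have degs: "(\<Sum>v\<in>V. card (nbr v)) + 4 = 4 * card V"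
    using degree_sum[of V] edges_in_V card_E edges_in_small[of "{}"] by simp
  have "N \<noteq> {}"
  proof
    assume "N = {}"
    then have "4 \<le> card (nbr v)" if "v \<in> V" for v using degree_ge_3[OF that] that by (force simp: N_def)
    then have "(\<Sum>v\<in>V. 4) \<le> (\<Sum>v\<in>V. card (nbr v))" by (intro sum_mono)
    then show False using degs by simp
  qed
  moreover have "V - N \<noteq> {}"
  proof
    assume "V - N = {}"
    then have "(\<Sum>v\<in>V. card (nbr v)) = (\<Sum>v\<in>V. 3)" by (intro sum.cong) (auto simp: N_def)
    then show False using degs n by simp
  qed
  moreover have "N \<inter> (V - N) = {}" "N \<union> (V - N) \<subseteq> V" using NV by auto
  moreover have "V - (N \<union> (V - N)) = {}" by blast
  then have "card (V - (N \<union> (V - N))) \<le> 2" by (metis card.empty zero_le)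
  \<comment> \<open>Connectivity gives an edge from a cubic v to a vertex c of higher degree. A
    critical set for v and c, enlarged by v, is a tight set leaving the noncubic c outside; it
    starts the search for a largest one.\<close>
  ultimately obtain v c where vc: "v \<in> N" "c \<in> V - N" "{v, c} \<in> E"
    using three_connectedD[OF conn] by metis
  then have "c \<in> nbr v" by (auto simp: neighbors_def insert_commute)
  with vc crit obtain X where X: "critical v c X" unfolding N_def by blast
  have Xt: "tight X" "v \<notin> X" "c \<notin> X" "nbr v - {c} \<subseteq> X" using X unfolding critical_def by auto
  have fX: "finite X" "X \<subseteq> V" using Xt finite_sub unfolding tight_def by auto
  have "nbr v \<inter> X = nbr v - {c}" using Xt by auto
  then have "card (nbr v \<inter> X) = 2" using vc \<open>c \<in> nbr v\<close> by (simp add: N_def)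
  moreover have c_out: "c \<notin> insert v X" using vc Xt by auto
  then have "insert v X \<noteq> V" using vc by blast
  ultimately have tR0: "tight (insert v X)" using Xt vc NV by (intro tight_insert) auto
  have "card X \<ge> 2" using Xt(1) unfolding tight_def by auto
  then have c3: "3 \<le> card (insert v X)" using Xt fX by simp
  \<comment> \<open>A noncubic vertex is required outside so that maximality becomes useful: a
    larger tight set has only cubic vertices in its complement, where the forest bound
    applies.\<close>
  define F where "F = {R. tight R \<and> 3 \<le> card R \<and> (\<exists>z\<in>V - R. z \<notin> N)}"
  have "insert v X \<in> F" using tR0 c3 vc c_out unfolding F_def by blast
  moreover have "finite F"
    using finite_V by (intro finite_subset[of F "Pow V"]) (auto simp: F_def tight_def)
  ultimately have "Max (card ` F) \<in> card ` F" "\<And>R'. R' \<in> F \<Longrightarrow> card R' \<le> Max (card ` F)"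
    by (auto intro: Max_in)
  then obtain R where RF: "R \<in> F" and Rmax: "\<And>R'. R' \<in> F \<Longrightarrow> card R' \<le> card R"
    by (elim imageE) metis
  have R: "tight R" "3 \<le> card R" using RF by (auto simp: F_def)
  obtain z where z: "z \<in> V - R" "z \<notin> N" using RF by (auto simp: F_def)
  have RV: "R \<subseteq> V" "finite R" using R finite_sub unfolding tight_def by auto
  define D where "D = V - R"
  have fD: "finite D" using finite_V by (simp add: D_def)
  have D2: "2 \<le> card D"
  proof (rule ccontr)
    assume "\<not> 2 \<le> card D"
    moreover have "z \<in> D" using z by (simp add: D_def)
    ultimately have "D = {z}" using fD card_le_Suc0_iff_eq[of D] by auto
    then have "card (nbr z) = 3"
      using complement_tight[OF R(1)] edges_in_small[of "{z}"] by (simp add: D_def)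
    then show False using z by (simp add: N_def)
  qed
  define M where "M = N \<inter> D"
  have MV: "M \<subseteq> V" "M \<subseteq> D" using NV by (auto simp: M_def)
  have Mbig: "edges_in Q + 1 \<le> card Q" if "Q \<subseteq> M" "Q \<noteq> {}" for Q
  proof (rule cubic_set_edges)
    show "Q \<subseteq> V" "Q \<noteq> {}" using that MV by auto
    have "R \<subseteq> V - Q" using that RV by (auto simp: M_def D_def)
    then have "card R \<le> card (V - Q)" using finite_V by (intro card_mono) auto
    then show "2 \<le> card (V - Q)" using R by simp
    show "card (nbr u) = 3" if "u \<in> Q" for u using that \<open>Q \<subseteq> M\<close> by (auto simp: M_def N_def)
  qed
  have "M \<noteq> {}" using exists_cubic_outside[OF R(1)] D2 by (auto simp: M_def N_def D_def)
  \<comment> \<open>A leaf or an isolated vertex of the forest spanned by the cubic vertices outside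
    R.\<close>
  then obtain u where u: "u \<in> M" "card (nbr u \<inter> M) \<le> 1"
    using low_degree_vertex[OF MV(1)] Mbig[of M] by blast
  have uV: "u \<in> V" "u \<notin> R" "card (nbr u) = 3" using u by (auto simp: M_def N_def D_def)
  \<comment> \<open>With two neighbours in R, u could be added to R against maximality; with three,
    \<open>tight_full_nbr\<close> would leave u as the only vertex outside R.\<close>
  have uR: "card (nbr u \<inter> R) \<le> 1"
  proof (rule ccontr)
    assume a: "\<not> card (nbr u \<inter> R) \<le> 1"
    have "card (nbr u \<inter> R) \<le> 3" using uV card_mono[of "nbr u" "nbr u \<inter> R"] by simp
    then consider "card (nbr u \<inter> R) = 2" | "card (nbr u \<inter> R) = 3" using a by linarith
    then show False
    proof cases
      case 1
      have "z \<noteq> u" using u z by (auto simp: M_def)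
      then have zz: "z \<in> V - insert u R" using z by auto
      then have "insert u R \<noteq> V" by blast
      then have "tight (insert u R)" using 1 R uV by (intro tight_insert) auto
      then have "insert u R \<in> F" using zz z R uV RV by (auto simp: F_def)
      then show False using Rmax[of "insert u R"] uV RV by simp
    next
      case 2
      then have "nbr u \<inter> R = nbr u" using uV by (intro card_seteq) auto
      then have "insert u R = V" using R uV RV unfolding tight_def by (intro tight_full_nbr) auto
      then have "D \<subseteq> {u}" by (auto simp: D_def)
      then have "card D \<le> card {u}" by (intro card_mono) auto
      then show False using D2 by simp
    qed
  qed
  have uR': "e = e'" if "e \<in> nbr u \<inter> R" "e' \<in> nbr u \<inter> R" for e e'
    using uR that by (metis One_nat_def card_le_Suc0_iff_eq finite_Int finite_nbr)
  have uM': "e = e'" if "e \<in> nbr u \<inter> M" "e' \<in> nbr u \<inter> M" for e e'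
    using u(2) that by (metis One_nat_def card_le_Suc0_iff_eq finite_Int finite_nbr)
  \<comment> \<open>The union of Y and R is tight and larger than R, so its complement Q is cubic.
    Either Q is u alone, and then e lies in R; or the exact edge count of Q forces a neighbour of u
    inside Q, and e is the only neighbour outside Y.\<close>
  have big: "(e \<in> R \<and> Y \<union> R = V - {u}) \<or> e \<in> M"
    if e: "e \<in> nbr u" and Y: "critical u e Y" and YR: "2 \<le> card (Y \<inter> R)" for e Y
  proof -
    have Yt: "tight Y" "u \<notin> Y" "e \<notin> Y" "nbr u - {e} \<subseteq> Y" using Y unfolding critical_def by auto
    have YV: "Y \<subseteq> V" "finite Y" using Yt finite_sub unfolding tight_def by auto
    have ne: "Y \<union> R \<noteq> V" using uV Yt by blast
    have t: "tight (Y \<union> R)" using tight_union(1)[OF Yt(1) R(1) YR ne] .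
    have "\<not> Y \<subseteq> R"
    proof
      assume "Y \<subseteq> R"
      then have "card (nbr u - {e}) \<le> card (nbr u \<inter> R)" using Yt by (intro card_mono) auto
      then show False using uR uV e by simp
    qed
    then have "R \<subset> Y \<union> R" by blast
    then have lt: "card R < card (Y \<union> R)" using YV RV by (intro psubset_card_mono) auto
    then have notF: "Y \<union> R \<notin> F" using Rmax[of "Y \<union> R"] by auto
    define Q where "Q = V - (Y \<union> R)"
    have QN: "Q \<subseteq> M" using notF t lt R by (auto simp: F_def Q_def M_def D_def)
    have uQ: "u \<in> Q" using uV Yt by (simp add: Q_def)
    have fQ: "finite Q" using finite_V by (simp add: Q_def)
    show ?thesis
    proof (cases "Q = {u}")
      case True
      then have "Y \<union> R = V - {u}" using YV RV by (auto simp: Q_def)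
      moreover have "e \<in> V - {u}" using e nbr_subset by blast
      ultimately show ?thesis using Yt by blast
    next
      case False
      then have ne: "Q - {u} \<noteq> {}" using uQ by auto
      have deg: "card (nbr v) = 3" if "v \<in> Q" for v using that QN by (auto simp: M_def N_def)
      then have "(\<Sum>v\<in>Q. card (nbr v)) = 3 * card Q" by simp
      then have "edges_in Q + 1 = card Q" using complement_tight[OF t] by (simp add: Q_def)
      moreover have "edges_in (Q - {u}) + 1 \<le> card (Q - {u})" using Mbig[of "Q - {u}"] QN ne by blast
      moreover have "edges_in Q = edges_in (Q - {u}) + card (nbr u \<inter> Q)" using edges_in_remove[OF uQ] .
      moreover have "card Q \<ge> 1" using uQ fQ by (metis One_nat_def Suc_leI card_gt_0_iff empty_iff)
      ultimately have "card (nbr u \<inter> Q) \<ge> 1" using uQ fQ by simp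
      then have "nbr u \<inter> Q \<noteq> {}" by auto
      then obtain f where f: "f \<in> nbr u" "f \<in> Q" by blast
      then have "f = e" using Yt by (auto simp: Q_def)
      then show ?thesis using f QN by auto
    qed
  qed
  define X where "X e = (SOME Y. critical u e Y)" for e
  have Xc: "critical u e (X e)" if "e \<in> nbr u" for e
    unfolding X_def using crit[OF uV(1,3) that] by (rule someI_ex)
  have Xt: "tight (X e)" "u \<notin> X e" "e \<notin> X e" "nbr u - {e} \<subseteq> X e" "X e \<subseteq> V" "finite (X e)" if "e \<in> nbr u" for e
    using Xc[OF that] finite_sub unfolding critical_def tight_def by auto
  \<comment> \<open>Here e lies in R, \<open>X e\<close> contains everything except u and e, and
    \<open>X e'\<close> meets R in e only. An edge from e into \<open>X e'\<close> would cross
    between \<open>X e\<close> and R, so e would be isolated in the tight set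
    \<open>X e'\<close>.\<close>
  have main: False
    if e: "e \<in> nbr u" "e' \<in> nbr u" "e \<noteq> e'" "e \<notin> M" "e' \<notin> M" and XX: "2 \<le> card (X e \<inter> X e')"
      and XR: "2 \<le> card (X e \<inter> R)" for e e'
  proof -
    have eR: "e \<in> R" "X e \<union> R = V - {u}" using big[OF e(1) Xc[OF e(1)] XR] e by auto
    have "e' \<notin> R" using eR uR' e by blast
    then have "\<not> 2 \<le> card (X e' \<inter> R)" using big[OF e(2) Xc[OF e(2)]] e by auto
    moreover have eX': "e \<in> X e'" using Xt[OF e(2)] e by blast
    ultimately have X'R: "X e' \<inter> R = {e}"
      using eR RV card_le_Suc0_iff_eq[of "X e' \<inter> R"] by force
    have un: "X e \<union> X e' = V - {u}"
    proof -
      have ne: "X e \<union> X e' \<noteq> V" using Xt e uV by blast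
      have t: "tight (X e \<union> X e')" using tight_union(1)[OF Xt(1)[OF e(1)] Xt(1)[OF e(2)] XX ne] .
      have "nbr u \<subseteq> X e \<union> X e'" using Xt(4) e by blast
      then have "insert u (X e \<union> X e') = V"
        using t uV Xt(2) e unfolding tight_def by (intro tight_full_nbr) auto
      then show ?thesis using Xt(2) e by blast
    qed
    then have Xe: "V - {u, e} \<subseteq> X e"
      using X'R eR by blast
    have ncross: "f \<subseteq> X e \<or> f \<subseteq> R" if "f \<in> E" "f \<subseteq> X e \<union> R" for f
      using tight_union(2)[OF Xt(1)[OF e(1)] R(1) XR _ that] eR uV by blast
    have "nbr e \<inter> X e' = {}"
    proof (rule ccontr)
      assume "nbr e \<inter> X e' \<noteq> {}"
      then obtain f where f: "f \<in> nbr e" "f \<in> X e'" by blast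
      then have fe: "{f, e} \<in> E" "f \<noteq> e" by (auto simp: neighbors_def)
      have "f \<noteq> u" using f Xt(2) e by blast
      then have "{f, e} \<subseteq> V - {u}" using edge[OF fe(1)] e nbr_subset by blast
      then have "{f, e} \<subseteq> X e \<union> R" using eR by simp
      then have "{f, e} \<subseteq> R" using ncross[OF fe(1)] Xt(3) e by blast
      then show False using f X'R fe by blast
    qed
    then show False using tight_degree(1)[OF Xt(1)[OF e(2)] eX'] by simp
  qed
  \<comment> \<open>The two sets cover R, which has at least three vertices, so one of them meets R
    in two.\<close>
  have main': False
    if e: "e \<in> nbr u" "e' \<in> nbr u" "e \<noteq> e'" "e \<notin> M" "e' \<notin> M" and XX: "2 \<le> card (X e \<inter> X e')" for e e'
  proof -
    have ne: "X e \<union> X e' \<noteq> V" using Xt e uV by blast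
    have t: "tight (X e \<union> X e')" using tight_union(1)[OF Xt(1)[OF e(1)] Xt(1)[OF e(2)] XX ne] .
    have "nbr u \<subseteq> X e \<union> X e'" using Xt(4) e by blast
    then have "insert u (X e \<union> X e') = V"
      using t uV Xt(2) e unfolding tight_def by (intro tight_full_nbr) auto
    then have "R = (X e \<inter> R) \<union> (X e' \<inter> R)" using RV uV by blast
    then have "card R \<le> card (X e \<inter> R) + card (X e' \<inter> R)" by (metis card_Un_le)
    then consider "2 \<le> card (X e \<inter> R)" | "2 \<le> card (X e' \<inter> R)" using R by linarith
    then show False
    proof cases
      case 1 then show False using main e XX by blast
    next
      case 2
      have "2 \<le> card (X e' \<inter> X e)" using XX by (simp add: Int_commute)
      then show False using main[of e' e] 2 e by blast
    qed
  qed
  \<comment> \<open>If u has no neighbour in M, the three critical sets meet pairwise in at most one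
    vertex and \<open>independent_tight_triangle\<close> applies. Otherwise u has a single neighbour
    f in M, and the critical sets of the other two neighbours meet in f only.\<close>
  show False
  proof (cases "nbr u \<inter> M = {}")
    case True
    obtain e1 e2 e3 where es: "nbr u = {e1, e2, e3}" "e1 \<noteq> e2" "e1 \<noteq> e3" "e2 \<noteq> e3"
      using uV(3) by (metis card_3_iff)
    have i: "e1 \<in> nbr u" "e2 \<in> nbr u" "e3 \<in> nbr u" using es by auto
    have "e1 \<notin> M" "e2 \<notin> M" "e3 \<notin> M" using True i by auto
    then have "card (X e1 \<inter> X e2) < 2" "card (X e1 \<inter> X e3) < 2" "card (X e2 \<inter> X e3) < 2"
      using main' i es by (meson not_le)+
    moreover have "e2 \<in> X e1" "e3 \<in> X e1" "e1 \<in> X e2" "e3 \<in> X e2" "e1 \<in> X e3" "e2 \<in> X e3"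
      using Xt(4)[OF i(1)] Xt(4)[OF i(2)] Xt(4)[OF i(3)] i es(2-4) by blast+
    ultimately show False
      using independent_tight_triangle[OF conn n uV(1) es Xt(1-3)[OF i(1)] _ _ Xt(1-3)[OF i(2)] _ _ Xt(1-3)[OF i(3)]]
      by simp
  next
    case False
    then obtain f where f: "f \<in> nbr u" "f \<in> M" by blast
    obtain e1 e3 where es: "nbr u = {f, e1, e3}" "e1 \<noteq> f" "e3 \<noteq> f" "e1 \<noteq> e3"
    proof -
      have "card (nbr u - {f}) = 2" using f uV by simp
      then obtain a b where "nbr u - {f} = {a, b}" "a \<noteq> b" by (auto simp: card_2_iff)
      then show ?thesis using that[of a b] f by blast
    qed
    have i: "e1 \<in> nbr u" "e3 \<in> nbr u" using es by auto
    have nM: "e1 \<notin> M" "e3 \<notin> M" using uM' f i es by blast+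
    have lt: "card (X e1 \<inter> X e3) < 2" using main'[OF i es(4) nM] by (meson not_le)
    have fX: "f \<in> X e1" "f \<in> X e3" using Xt(4) i f es by blast+
    have inj: "x = f" if "x \<in> X e1" "x \<in> X e3" for x
    proof -
      have "finite (X e1 \<inter> X e3)" using Xt(6) i by blast
      then show ?thesis using lt that fX card_le_Suc0_iff_eq[of "X e1 \<inter> X e3"] by auto
    qed
    have f3: "card (nbr f) = 3" "f \<in> V" using f by (auto simp: M_def N_def)
    have uf: "u \<in> nbr f" using f nbr_sym by blast
    \<comment> \<open>Were \<open>X e\<close> larger than a pair, the cubic f would have both
      neighbours other than u in it; but f also has a neighbour in the other set, which would then
      be a second common vertex.\<close>
    have lone: "3 > card (X e)" if e: "e \<in> {e1, e3}" for e
    proof (rule ccontr)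
      assume "\<not> 3 > card (X e)"
      then have e3: "3 \<le> card (X e)" by simp
      define e' where "e' = (if e = e1 then e3 else e1)"
      have e': "e' \<in> {e1, e3}" "e' \<noteq> e" "{e, e'} = {e1, e3}" using e es by (auto simp: e'_def)
      have ie: "e \<in> nbr u" "e' \<in> nbr u" using e e' i by auto
      have fXe: "f \<in> X e" "f \<in> X e'" using fX e e' by auto
      have "2 \<le> card (nbr f \<inter> X e)" using tight_degree(2)[OF Xt(1)[OF ie(1)] fXe(1) e3] .
      moreover have "nbr f \<inter> X e \<subseteq> nbr f - {u}" using Xt(2) ie by blast
      moreover have "card (nbr f - {u}) = 2" using f3 uf by simp
      ultimately have eq: "nbr f \<inter> X e = nbr f - {u}" by (intro card_seteq) auto
      have "nbr f \<inter> X e' \<noteq> {}" using tight_degree(1)[OF Xt(1)[OF ie(2)] fXe(2)] by auto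
      then obtain g where g: "g \<in> nbr f" "g \<in> X e'" by blast
      then have "g \<in> X e" using eq Xt(2) ie by blast
      then have "g = f" using inj g e e' by auto
      then show False using g nbr_subset by blast
    qed
    have two: "X e = {f, g}" if "e \<in> nbr u" "card (X e) < 3" "f \<in> X e" "g \<in> X e" "g \<noteq> f" for e g
    proof -
      have "{f, g} \<subseteq> X e" "card {f, g} = 2" using that by auto
      then show ?thesis using that Xt(6)[OF that(1)] card_seteq[of "X e" "{f, g}"] by auto
    qed
    have X1: "X e1 = {f, e3}" using two[OF i(1) lone fX(1)] Xt(4)[OF i(1)] i es by blast
    have X3: "X e3 = {f, e1}" using two[OF i(2) lone fX(2)] Xt(4)[OF i(2)] i es by blast
    have adj: "g \<in> nbr f" if "e \<in> nbr u" "X e = {f, g}" for e g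
    proof -
      have "nbr f \<inter> X e \<noteq> {}" using tight_degree(1)[OF Xt(1)[OF that(1)], of f] that(2) by force
      then show ?thesis using that nbr_subset by blast
    qed
    have "e3 \<in> nbr f" "e1 \<in> nbr f" using adj X1 X3 i by blast+
    moreover have ue: "u \<noteq> e1" "u \<noteq> e3" "u \<noteq> f" using es nbr_subset by blast+
    ultimately have nf: "nbr f = {u, e1, e3}"
      using f3 uf es card_seteq[of "nbr f" "{u, e1, e3}"] by auto
    \<comment> \<open>Besides each other, u and f have the same two neighbours \<open>e1\<close> and
      \<open>e3\<close>, which therefore separate them from the remaining vertices.\<close>
    let ?Q = "V - {u, f, e1, e3}"
    have "card {u, f, e1, e3} \<le> 4" using card_length[of "[u, f, e1, e3]"] by simp
    then have "card {u, f, e1, e3} < card V" using n by simp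
    then have "?Q \<noteq> {}" using card_mono[of "{u, f, e1, e3}" V] by auto
    moreover have "V - ({u, f} \<union> ?Q) \<subseteq> {e1, e3}" by auto
    then have "card (V - ({u, f} \<union> ?Q)) \<le> card {e1, e3}" by (intro card_mono) auto
    then have "card (V - ({u, f} \<union> ?Q)) \<le> 2" using es by simp
    ultimately obtain p q where pq: "p \<in> {u, f}" "q \<in> ?Q" "{p, q} \<in> E"
      using three_connectedD[OF conn, of "{u, f}" ?Q] uV f3 by blast
    then have "q \<in> nbr p" by (auto simp: neighbors_def insert_commute)
    then show False using pq es nf by auto
  qed
qed

text \<open>Three edges go and one comes, so the total stays right. A proper subset that becomes
  overfull contains a and b and was tight before: without c it is critical, and with c it already
  gives all of V once v is added.\<close>

lemma admissible_circuit:
  assumes v: "v \<in> V" "nbr v = {a, b, c}" and dist: "a \<noteq> b" "a \<noteq> c" "b \<noteq> c"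
    and adm: "\<not> (\<exists>X. critical v c X)"
  shows "{a, b} \<notin> E" and "circuit (V - {v}) (insert {a, b} {f \<in> E. v \<notin> f})"
proof -
  have inV: "a \<in> V" "b \<in> V" "c \<in> V" "a \<noteq> v" "b \<noteq> v" "c \<noteq> v" using v nbr_subset by blast+
  have nov: "v \<notin> {a, b}" "nbr v - {c} \<subseteq> {a, b}" "c \<notin> {a, b}" using inV v dist by auto
  show abE: "{a, b} \<notin> E"
  proof
    assume "{a, b} \<in> E"
    then have "{{a, b}} \<subseteq> induced E {a, b}" by (auto simp: induced_def)
    then have "card {{a, b}} \<le> edges_in {a, b}" by (intro card_mono finite_induced)
    moreover have "{a, b} \<noteq> V" using v inV by blast
    ultimately have "tight {a, b}" using inV dist by (intro tightI) auto
    then show False using adm nov unfolding critical_def by blast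
  qed
  let ?E0 = "{f \<in> E. v \<notin> f}" and ?E' = "insert {a, b} {f \<in> E. v \<notin> f}"
  have E0: "?E0 = induced E (V - {v})" using edge by (auto simp: induced_def)
  have "nbr v \<inter> V = {a, b, c}" using v inV by auto
  then have "edges_in (V - {v}) + 5 = 2 * card V"
    using edges_in_remove[OF v(1)] edges_in_V dist by simp
  then have c1: "card ?E' + 4 = 2 * card V"
  proof -
    have "{a, b} \<notin> ?E0" using abE by simp
    then have "card ?E' = edges_in (V - {v}) + 1" using finite_E E0 by simp
    then show ?thesis using \<open>edges_in (V - {v}) + 5 = 2 * card V\<close> by simp
  qed
  have c2: "card (V - {v}) = card V - 1" using v finite_V by simp
  show "circuit (V - {v}) ?E'"
  proof
    show "finite (V - {v})" using finite_V by simp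
    show "e \<subseteq> V - {v} \<and> card e = 2" if "e \<in> ?E'" for e
      using that edge inV dist by auto
    show "card ?E' + 2 = 2 * card (V - {v})" using c1 c2 card_V4 by simp
    show "2 \<le> card (V - {v})" using c2 card_V4 by simp
    fix S assume S: "S \<subseteq> V - {v}" "S \<noteq> V - {v}" "2 \<le> card S"
    have S': "S \<subseteq> V" "v \<notin> S" "S \<noteq> V" "finite S" using S v finite_sub[of S] by blast+
    show "card (induced ?E' S) + 3 \<le> 2 * card S"
    proof (cases "{a, b} \<subseteq> S")
      case False
      then have "induced ?E' S \<subseteq> induced E S" by (auto simp: induced_def)
      then have "card (induced ?E' S) \<le> edges_in S" by (intro card_mono finite_induced)
      then show ?thesis using sparse[OF S'(1,3) S(3)] by simp
    next
      case True
      have "induced ?E' S \<subseteq> insert {a, b} (induced E S)" by (auto simp: induced_def)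
      then have "card (induced ?E' S) \<le> card (insert {a, b} (induced E S))" by (intro card_mono) auto
      also have "\<dots> \<le> edges_in S + 1" by (simp add: card_insert_if)
      finally have le: "card (induced ?E' S) \<le> edges_in S + 1" .
      have "edges_in S + 4 \<le> 2 * card S"
      proof (rule ccontr)
        assume "\<not> edges_in S + 4 \<le> 2 * card S"
        then have t: "tight S" using S S' by (intro tightI) auto
        show False
        proof (cases "c \<in> S")
          case False
          then show False using adm t True v S' unfolding critical_def by blast
        next
          case True
          then have "insert v S = V"
            using t v S' \<open>{a, b} \<subseteq> S\<close> unfolding tight_def by (intro tight_full_nbr) auto
          then show False using S by blast
        qed
      qed
      then show ?thesis using le by simp
    qed
  qed
qed

text \<open>The new edge brings A to the circuit count. A proper S in A containing x and y has no
  edge in common with B, and its union with B is still proper; the sparse bound there leaves S one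
  edge below its own bound, room for the new edge.\<close>

lemma tight_part_circuit:
  assumes A: "tight A" and B: "tight B" and AB: "A \<union> B = V" "A \<inter> B = {x, y}" and xy: "x \<noteq> y" "{x, y} \<notin> E"
  shows "circuit A (insert {x, y} (induced E A))"
proof
  have At: "A \<subseteq> V" "2 \<le> card A" "edges_in A + 3 = 2 * card A" "finite A"
    and Bt: "B \<subseteq> V" "2 \<le> card B" "edges_in B + 3 = 2 * card B" "finite B"
    using A B finite_sub[of A] finite_sub[of B] unfolding tight_def by auto
  have xyA: "{x, y} \<subseteq> A" "{x, y} \<subseteq> B" using AB by auto
  show "finite A" by fact
  show "e \<subseteq> A \<and> card e = 2" if "e \<in> insert {x, y} (induced E A)" for e
    using that edge xy xyA by (auto simp: induced_def)
  show "card (insert {x, y} (induced E A)) + 2 = 2 * card A"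
    using At xy by (simp add: induced_def[of _ A] card_insert_if finite_E)
  show "2 \<le> card A" by fact
  fix S assume S: "S \<subseteq> A" "S \<noteq> A" "2 \<le> card S"
  have fS: "finite S" using S At finite_subset by blast
  let ?E' = "insert {x, y} (induced E A)"
  show "card (induced ?E' S) + 3 \<le> 2 * card S"
  proof (cases "{x, y} \<subseteq> S")
    case False
    then have "induced ?E' S \<subseteq> induced E S" by (auto simp: induced_def)
    then have "card (induced ?E' S) \<le> edges_in S" by (intro card_mono finite_induced)
    moreover have "S \<subseteq> V" "S \<noteq> V" using S At by blast+
    ultimately show ?thesis using sparse[of S] S by simp
  next
    case True
    have "induced ?E' S \<subseteq> insert {x, y} (induced E S)" by (auto simp: induced_def)
    then have "card (induced ?E' S) \<le> card (insert {x, y} (induced E S))" by (intro card_mono) auto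
    also have "\<dots> \<le> edges_in S + 1" by (simp add: card_insert_if)
    finally have le: "card (induced ?E' S) \<le> edges_in S + 1" .
    have SB: "S \<inter> B = {x, y}" using True S AB by auto
    obtain z where z: "z \<in> A" "z \<notin> S" using S by blast
    then have "z \<notin> B" using AB True by blast
    then have ne: "S \<union> B \<noteq> V" using z At by blast
    have "e \<notin> induced E {x, y}" for e
    proof
      assume "e \<in> induced E {x, y}"
      then have "e \<in> E" "e \<subseteq> {x, y}" by (auto simp: induced_def)
      then have "e = {x, y}" using edge[of e] xy card_seteq[of "{x, y}" e] by auto
      then show False using xy \<open>e \<in> E\<close> by simp
    qed
    then have "induced E {x, y} = {}" by blast
    then have "edges_in S + edges_in B \<le> edges_in (S \<union> B)"
      using edges_in_supermodular[of S B] SB by simp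
    moreover have "card (S \<union> B) + 2 = card S + card B" using card_Un_Int[OF fS Bt(4)] SB xy by simp
    moreover have "edges_in (S \<union> B) + 3 \<le> 2 * card (S \<union> B)"
    proof (rule sparse)
      show "S \<union> B \<subseteq> V" "S \<union> B \<noteq> V" using S At Bt ne by auto
      show "2 \<le> card (S \<union> B)" using Bt fS card_mono[of "S \<union> B" B] by simp
    qed
    ultimately show ?thesis using le Bt by linarith
  qed
qed

section \<open>2-separations and the reduction of 3-connected circuits\<close>

definition separates :: "'a set \<Rightarrow> 'a set \<Rightarrow> bool" where
  "separates P Q \<longleftrightarrow> P \<noteq> {} \<and> Q \<noteq> {} \<and> P \<inter> Q = {} \<and> P \<union> Q \<subseteq> V \<and> card (V - (P \<union> Q)) \<le> 2 \<and>
     (\<forall>p\<in>P. \<forall>q\<in>Q. {p, q} \<notin> E)"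

lemma not_three_connected: "\<not> three_connected V E \<Longrightarrow> \<exists>P Q. separates P Q"
  unfolding three_connected_def separates_def by (simp only: not_all not_imp Bex_def Ball_def not_ex de_Morgan_conj) metis

lemma separates_sym: "separates P Q \<Longrightarrow> separates Q P"
  unfolding separates_def by (metis Un_commute Int_commute insert_commute)

lemma separates_edge:
  assumes "separates P Q" "{x, y} \<in> E"
  shows "{x, y} \<inter> Q = {} \<or> {x, y} \<inter> P = {}"
proof (rule ccontr)
  assume "\<not> ?thesis"
  then obtain p q where pq: "p \<in> P" "q \<in> Q" "p \<in> {x, y}" "q \<in> {x, y}" by blast
  moreover have "P \<inter> Q = {}" using assms(1) unfolding separates_def by simp
  ultimately have "{p, q} = {x, y}" by auto
  then show False using assms pq unfolding separates_def by metis
qed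

text \<open>Each side together with the separator S is a proper subset, so
  \<open>card E + edges_in S\<close> is at most 2 n + 2 s - 6 with s the size of S (a one-vertex
  side contributes no edge at all). As \<open>card E\<close> is 2 n - 2 and s at most two, S is a
  nonadjacent pair and both sides are tight.\<close>

lemma two_separation:
  assumes PQ: "separates P Q"
  obtains x y where "x \<noteq> y" "V - (P \<union> Q) = {x, y}" "{x, y} \<notin> E"
    "tight (P \<union> {x, y})" "tight (Q \<union> {x, y})"
    "circuit (P \<union> {x, y}) (insert {x, y} (induced E (P \<union> {x, y})))"
    "circuit (Q \<union> {x, y}) (insert {x, y} (induced E (Q \<union> {x, y})))"
proof -
  define S where "S = V - (P \<union> Q)"
  have PQ': "P \<noteq> {}" "Q \<noteq> {}" "P \<inter> Q = {}" "P \<subseteq> V" "Q \<subseteq> V" "card S \<le> 2" "\<And>p q. p \<in> P \<Longrightarrow> q \<in> Q \<Longrightarrow> {p, q} \<notin> E"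
    using PQ unfolding separates_def S_def by auto
  have fin: "finite P" "finite Q" "finite S" using PQ' finite_sub finite_V by (auto simp: S_def)
  have SV: "S \<subseteq> V" "S \<inter> P = {}" "S \<inter> Q = {}" "V = P \<union> Q \<union> S" using PQ' by (auto simp: S_def)
  let ?A = "P \<union> S" and ?B = "Q \<union> S"
  have cov: "E \<subseteq> induced E ?A \<union> induced E ?B"
  proof
    fix e assume e: "e \<in> E"
    then obtain p q where pq: "e = {p, q}" using edge[OF e] by (auto simp: card_2_iff)
    have "\<not> (p \<in> P \<and> q \<in> Q)" "\<not> (q \<in> P \<and> p \<in> Q)"
      using PQ'(7)[of p q] PQ'(7)[of q p] e pq insert_commute[of p q "{}"] by metis+
    moreover have "p \<in> V" "q \<in> V" using pq edge[OF e] by auto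
    ultimately have "e \<subseteq> ?A \<or> e \<subseteq> ?B" using pq SV(4) by blast
    then show "e \<in> induced E ?A \<union> induced E ?B" using e unfolding induced_def by blast
  qed
  have cardA: "card ?A = card P + card S" and cardB: "card ?B = card Q + card S"
    using fin SV by (auto intro!: card_Un_disjoint)
  have cardV: "card V = card P + card Q + card S"
  proof -
    have "card (P \<union> Q) = card P + card Q" using fin PQ'(3) by (simp add: card_Un_disjoint)
    moreover have "(P \<union> Q) \<inter> S = {}" using SV by auto
    ultimately show ?thesis using SV(4) fin card_Un_disjoint[of "P \<union> Q" S] by simp
  qed
  have PQ1: "1 \<le> card P" "1 \<le> card Q" using PQ' fin by (simp_all add: Suc_leI card_gt_0_iff)
  have "card E \<le> card (induced E ?A \<union> induced E ?B)" using cov by (intro card_mono) auto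
  moreover have "card (induced E ?A \<union> induced E ?B) + card (induced E ?A \<inter> induced E ?B) = edges_in ?A + edges_in ?B"
    using card_Un_Int[of "induced E ?A" "induced E ?B"] by simp
  moreover have "induced E ?A \<inter> induced E ?B = induced E S" using PQ' by (auto simp: induced_def)
  ultimately have tot: "card E + edges_in S \<le> edges_in ?A + edges_in ?B" by simp
  have bound: "edges_in X + 3 \<le> 2 * card X \<or> (card X = 1 \<and> edges_in X = 0)"
    if "X \<subseteq> V" "X \<noteq> V" "1 \<le> card X" for X
    using that sparse[of X] edges_in_small[of X] finite_sub[of X] by (cases "card X = 1") auto
  have ne: "?A \<noteq> V" "?B \<noteq> V" using PQ'(1-3) SV by blast+
  have bA: "edges_in ?A + 3 \<le> 2 * card ?A \<or> (card ?A = 1 \<and> edges_in ?A = 0)"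
    using ne PQ'(4) SV(1) cardA PQ1 by (intro bound) auto
  have bB: "edges_in ?B + 3 \<le> 2 * card ?B \<or> (card ?B = 1 \<and> edges_in ?B = 0)"
    using ne PQ'(5) SV(1) cardB PQ1 by (intro bound) auto
  have S2: "card S = 2" "edges_in S = 0" "edges_in ?A + 3 = 2 * card ?A" "edges_in ?B + 3 = 2 * card ?B"
    using bA bB tot card_E cardA cardB cardV PQ1 PQ'(6) card_V4 by linarith+
  then obtain x y where xy: "S = {x, y}" "x \<noteq> y" by (auto simp: card_2_iff)
  have tights: "tight ?A" "tight ?B"
    using S2 ne PQ'(4,5) SV(1) cardA cardB unfolding tight_def by auto
  have notE: "{x, y} \<notin> E"
  proof
    assume "{x, y} \<in> E"
    then have "{x, y} \<in> induced E S" using xy by (simp add: induced_def)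
    then show False using S2(2) by (metis card_0_eq empty_iff finite_induced)
  qed
  have AB: "?A \<union> ?B = V" "?A \<inter> ?B = {x, y}" "?B \<union> ?A = V" "?B \<inter> ?A = {x, y}" using SV PQ'(3) xy by auto
  show thesis
    using that[OF xy(2) _ notE] tights xy
      tight_part_circuit[OF tights AB(1,2) xy(2) notE] tight_part_circuit[OF tights(2,1) AB(3,4) xy(2) notE]
    by (simp add: S_def)
qed

lemma complete_four:
  assumes "card V = 4"
  shows "E = {e. e \<subseteq> V \<and> card e = 2}"
proof (rule card_seteq)
  show "finite {e. e \<subseteq> V \<and> card e = 2}" using finite_V by simp
  show "E \<subseteq> {e. e \<subseteq> V \<and> card e = 2}" using edge by auto
  have "card {e. e \<subseteq> V \<and> card e = 2} = 6"
    using finite_V assms by (simp add: n_subsets choose_two)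
  then show "card {e. e \<subseteq> V \<and> card e = 2} \<le> card E" using card_E assms by simp
qed

text \<open>A triangle also has 2 k - 3 edges, so it can stand in for the tight B in all edge
  counts. A separation of the new graph cannot split the triangle; one side avoids it, and the
  interior of B can be joined to the other.\<close>

lemma triangle_replacement:
  assumes conn: "three_connected V E" and B: "tight B" and xyc: "{x, y, c} \<subseteq> B" "x \<noteq> y" "x \<noteq> c" "y \<noteq> c"
    and att: "\<And>e. e \<in> E \<Longrightarrow> e \<subseteq> B \<or> e \<subseteq> (V - B) \<union> {x, y, c}"
  defines "V0 \<equiv> (V - B) \<union> {x, y, c}"
    and "E0 \<equiv> (E - induced E B) \<union> {{x, y}, {x, c}, {y, c}}"
  shows "circuit V0 E0" and "three_connected V0 E0"
proof -
  have Bt: "B \<subseteq> V" "B \<noteq> V" "2 \<le> card B" "edges_in B + 3 = 2 * card B" "finite B"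
    using B finite_sub[of B] unfolding tight_def by auto
  define O' where "O' = E - induced E B"
  define T where "T = {{x, y}, {x, c}, {y, c}}"
  have E0: "E0 = O' \<union> T" by (simp add: E0_def O'_def T_def)
  have c3: "card {x, y, c} = 3" using xyc by simp
  have V0: "V0 \<subseteq> V" "V0 \<inter> B = {x, y, c}" "V - B \<subseteq> V0" "V0 \<union> B = V" "finite V0"
    using Bt xyc finite_sub by (auto simp: V0_def)
  have inV0: "x \<in> V0" "y \<in> V0" "c \<in> V0" by (auto simp: V0_def)
  have cV0: "card V0 + card B = card V + 3"
    using card_Un_Int[OF V0(5) Bt(5)] V0 c3 by simp
  have OV0: "e \<subseteq> V0" if "e \<in> O'" for e
    using that att[of e] by (auto simp: O'_def induced_def V0_def)
  have OB: "\<not> e \<subseteq> B" if "e \<in> O'" for e using that by (auto simp: O'_def induced_def)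
  have OT: "O' \<inter> T = {}" using OB xyc(1) by (auto simp: T_def)
  have fO: "finite O'" using finite_E by (simp add: O'_def)
  have cO: "card O' + edges_in B = card E"
    using finite_E card_mono[of E "induced E B"] by (simp add: O'_def card_Diff_subset induced_def)
  have dist: "{x, y} \<noteq> {x, c}" "{x, y} \<noteq> {y, c}" "{x, c} \<noteq> {y, c}" using xyc by (auto simp: doubleton_eq_iff)
  have cT: "card T = 3" using dist by (simp add: T_def)
  \<comment> \<open>Otherwise the other two attachment vertices would separate z and the interior of
    B from the outside.\<close>
  have attached: "\<exists>f\<in>O'. z \<in> f" if z: "z \<in> {x, y, c}" for z
  proof -
    have VB: "V - B \<noteq> {}" using Bt by blast
    let ?Q = "insert z (B - {x, y, c})"
    have "V - ((V - B) \<union> ?Q) = {x, y, c} - {z}" using Bt xyc z by blast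
    then have "card (V - ((V - B) \<union> ?Q)) = 2" using c3 z by (simp add: card_Diff_singleton)
    moreover have "(V - B) \<inter> ?Q = {}" "(V - B) \<union> ?Q \<subseteq> V" using Bt xyc z by blast+
    ultimately obtain p q where pq: "p \<in> V - B" "q \<in> ?Q" "{p, q} \<in> E"
      using three_connectedD[OF conn VB insert_not_empty] by (metis order_refl)
    then have "{p, q} \<in> O'" by (auto simp: O'_def induced_def)
    moreover from OV0[OF this] have "q = z" using pq V0(2) by blast
    ultimately show ?thesis by blast
  qed
  show "circuit V0 E0"
  proof
    show "finite V0" by fact
    show "e \<subseteq> V0 \<and> card e = 2" if "e \<in> E0" for e
    proof (cases "e \<in> O'")
      case True then show ?thesis using OV0 edge by (auto simp: O'_def)
    next
      case False then show ?thesis using that inV0 xyc by (auto simp: E0 T_def)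
    qed
    have "card E0 = card O' + 3" unfolding E0 using fO OT cT card_Un_disjoint[of O' T] by (simp add: T_def)
    then show "card E0 + 2 = 2 * card V0" using cO Bt card_E cV0 by linarith
    show "2 \<le> card V0" using card_mono[OF V0(5), of "{x, y, c}"] c3 inV0 by simp
    fix S assume S: "S \<subseteq> V0" "S \<noteq> V0" "2 \<le> card S"
    define k where "k = card (S \<inter> {x, y, c})"
    have fS: "finite S" using S V0 finite_subset by blast
    have SB: "S \<inter> B = S \<inter> {x, y, c}" using S V0 xyc by blast
    have cSB: "card (S \<union> B) + k = card S + card B" using card_Un_Int[OF fS Bt(5)] SB by (simp add: k_def)
    have SV: "S \<subseteq> V" "S \<noteq> V" using S V0 by blast+
    define m where "m = card {e \<in> O'. e \<subseteq> S}"
    define t where "t = card {e \<in> T. e \<subseteq> S}"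
    have "induced E0 S = {e \<in> O'. e \<subseteq> S} \<union> {e \<in> T. e \<subseteq> S}" by (auto simp: induced_def E0)
    then have le: "card (induced E0 S) \<le> m + t" by (simp add: m_def t_def card_Un_le)
    have k3: "k \<le> 3" using card_mono[of "{x, y, c}" "S \<inter> {x, y, c}"] c3 by (simp add: k_def)
    have t_le: "t \<le> (if k \<le> 1 then 0 else if k = 2 then 1 else 3)"
    proof -
      have "{e \<in> T. e \<subseteq> S} = (if x \<in> S \<and> y \<in> S then {{x, y}} else {}) \<union>
          (if x \<in> S \<and> c \<in> S then {{x, c}} else {}) \<union> (if y \<in> S \<and> c \<in> S then {{y, c}} else {})"
        by (auto simp: T_def)
      moreover have "S \<inter> {x, y, c} = (if x \<in> S then {x} else {}) \<union> (if y \<in> S then {y} else {}) \<union> (if c \<in> S then {c} else {})"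
        by auto
      ultimately have "t = card ((if x \<in> S \<and> y \<in> S then {{x, y}} else {}) \<union>
          (if x \<in> S \<and> c \<in> S then {{x, c}} else {}) \<union> (if y \<in> S \<and> c \<in> S then {{y, c}} else {}))"
        "k = card ((if x \<in> S then {x} else {}) \<union> (if y \<in> S then {y} else {}) \<union> (if c \<in> S then {c} else {}))"
        by (simp_all only: t_def k_def)
      then show ?thesis
        using xyc(2-4) dist by (cases "x \<in> S"; cases "y \<in> S"; cases "c \<in> S") auto
    qed
    have union: "card ({e \<in> O'. e \<subseteq> S} \<union> induced E B) = m + edges_in B"
    proof -
      have "{e \<in> O'. e \<subseteq> S} \<inter> induced E B = {}" using OB by (auto simp: induced_def)
      then show ?thesis unfolding m_def using fO by (intro card_Un_disjoint) auto
    qed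
    show "card (induced E0 S) + 3 \<le> 2 * card S"
    proof (cases "k \<le> 1")
      case True
      have "m \<le> edges_in S" unfolding m_def
        by (intro card_mono finite_induced) (auto simp: induced_def O'_def)
      then show ?thesis using le t_le True sparse[OF SV S(3)] by simp
    next
      case False
      show ?thesis
      proof (cases "S \<union> B = V")
        case False
        have "{e \<in> O'. e \<subseteq> S} \<union> induced E B \<subseteq> induced E (S \<union> B)" by (auto simp: induced_def O'_def)
        then have "m + edges_in B \<le> edges_in (S \<union> B)"
          unfolding union[symmetric] by (intro card_mono finite_induced)
        moreover have "edges_in (S \<union> B) + 3 \<le> 2 * card (S \<union> B)"
          using SV Bt False fS card_mono[of "S \<union> B" B] by (intro sparse) auto
        ultimately have "m + 2 * k \<le> 2 * card S" using Bt cSB by linarith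
        then show ?thesis using le t_le \<open>\<not> k \<le> 1\<close> k3 by (auto split: if_splits)
      next
        case True
        then have "V - B \<subseteq> S" by blast
        then obtain z where z: "z \<in> {x, y, c}" "z \<notin> S" using S by (auto simp: V0_def)
        have "S \<inter> {x, y, c} \<subset> {x, y, c}" using z by blast
        then have "k < 3" using psubset_card_mono[of "{x, y, c}"] c3 by (simp add: k_def)
        then have k2: "k = 2" using \<open>\<not> k \<le> 1\<close> by simp
        \<comment> \<open>S misses only this attachment vertex, and an edge leaving B at z is in
          neither count; it saves the one edge that the bound needs.\<close>
        obtain f where f: "f \<in> O'" "z \<in> f" using attached z by blast
        then have fnot: "f \<notin> {e \<in> O'. e \<subseteq> S} \<union> induced E B" using z OB by (auto simp: induced_def)
        have "insert f ({e \<in> O'. e \<subseteq> S} \<union> induced E B) \<subseteq> E" using f by (auto simp: induced_def O'_def)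
        then have "card (insert f ({e \<in> O'. e \<subseteq> S} \<union> induced E B)) \<le> card E"
          using finite_E by (intro card_mono)
        then have "m + edges_in B + 1 \<le> card E" using union fnot fO by simp
        then have "m + 4 \<le> 2 * card S" using card_E Bt cSB k2 True by simp
        then show ?thesis using le t_le k2 by simp
      qed
    qed
  qed
  have key: False
    if P: "P \<noteq> {}" "Q \<noteq> {}" "P \<inter> Q = {}" "P \<union> Q \<subseteq> V0" "card (V0 - (P \<union> Q)) \<le> 2"
      and ne: "\<And>p q. p \<in> P \<Longrightarrow> q \<in> Q \<Longrightarrow> {p, q} \<notin> E0" and QT: "Q \<inter> {x, y, c} = {}" for P Q
  proof -
    let ?P = "P \<union> (B - {x, y, c})"
    have QB: "Q \<inter> B = {}" using P QT V0(2) by blast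
    have "V - (B - {x, y, c}) = V0" using Bt(1) xyc(1) by (auto simp: V0_def)
    then have eq: "V - (?P \<union> Q) = V0 - (P \<union> Q)" by blast
    have "?P \<noteq> {}" using P(1) by blast
    moreover have "?P \<inter> Q = {}" using P(3) QB by blast
    moreover have "?P \<union> Q \<subseteq> V" using P(4) V0(1) Bt(1) by blast
    moreover have "card (V - (?P \<union> Q)) \<le> 2" using P(5) eq by simp
    ultimately obtain p q where pq: "p \<in> ?P" "q \<in> Q" "{p, q} \<in> E"
      by (rule three_connectedD[OF conn _ P(2)])
    have "{p, q} \<in> O'" using pq QB by (auto simp: O'_def induced_def)
    moreover from OV0[OF this] have "p \<in> P" using pq V0(2) by blast
    ultimately show False using ne pq by (auto simp: E0)
  qed
  show "three_connected V0 E0"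
    unfolding three_connected_def
  proof (intro allI impI, rule ccontr)
    fix P Q assume PQ: "P \<noteq> {} \<and> Q \<noteq> {} \<and> P \<inter> Q = {} \<and> P \<union> Q \<subseteq> V0 \<and> card (V0 - (P \<union> Q)) \<le> 2"
      and "\<not> (\<exists>p\<in>P. \<exists>q\<in>Q. {p, q} \<in> E0)"
    then have ne: "{p, q} \<notin> E0" if "p \<in> P" "q \<in> Q" for p q using that by blast
    have ne': "{p, q} \<notin> E0" if "p \<in> Q" "q \<in> P" for p q using ne[OF that(2,1)] by (simp add: insert_commute)
    have tri: "{p, q} \<in> E0" if "p \<in> {x, y, c}" "q \<in> {x, y, c}" "p \<noteq> q" for p q
      using that by (auto simp: E0 T_def insert_commute)
    consider "Q \<inter> {x, y, c} = {}" | "P \<inter> {x, y, c} = {}"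
      using tri ne PQ by (metis disjoint_iff)
    then show False
    proof cases
      case 1 then show False using key[of P Q] PQ ne by blast
    next
      case 2
      have "P \<union> Q = Q \<union> P" "P \<inter> Q = Q \<inter> P" by auto
      then show False using key[of Q P] PQ ne' 2 by auto
    qed
  qed
qed

text \<open>Delete an admissible v. If the reduced circuit is not 3-connected, take a separation
  with a smallest side Q avoiding a and b. Adding v to the other side must not separate the original
  graph, so c lies in Q, and Q with its two cut vertices x, y is a tight part attached at x, y, c
  only. Minimality makes it 3-connected once x and y are joined.\<close>

lemma three_connected_reduction:
  assumes conn: "three_connected V E" and n: "5 \<le> card V"
  obtains
    (extension) v a b c where "v \<in> V" "nbr v = {a, b, c}" "a \<noteq> b" "a \<noteq> c" "b \<noteq> c"
      "circuit (V - {v}) (insert {a, b} {f \<in> E. v \<notin> f})"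
      "three_connected (V - {v}) (insert {a, b} {f \<in> E. v \<notin> f})" "{a, b} \<notin> E"
  | (triangle) B x y c where "{x, y, c} \<subseteq> B" "x \<noteq> y" "x \<noteq> c" "y \<noteq> c" "{x, y} \<notin> E" "B \<subset> V"
      "circuit B (insert {x, y} (induced E B))" "three_connected B (insert {x, y} (induced E B))"
      "circuit ((V - B) \<union> {x, y, c}) ((E - induced E B) \<union> {{x, y}, {x, c}, {y, c}})"
      "three_connected ((V - B) \<union> {x, y, c}) ((E - induced E B) \<union> {{x, y}, {x, c}, {y, c}})"
      "card ((V - B) \<union> {x, y, c}) < card V"
proof -
  obtain v c where vc: "v \<in> V" "c \<in> nbr v" "card (nbr v) = 3" "\<not> (\<exists>X. critical v c X)"
    using exists_admissible[OF assms] by blast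
  then have "card (nbr v - {c}) = 2" by simp
  then obtain a b where ab: "nbr v - {c} = {a, b}" "a \<noteq> b" by (auto simp: card_2_iff)
  then have nv: "nbr v = {a, b, c}" "a \<noteq> c" "b \<noteq> c" using vc by blast+
  define V' where "V' = V - {v}"
  define E' where "E' = insert {a, b} {f \<in> E. v \<notin> f}"
  have abE: "{a, b} \<notin> E" and cV': "circuit V' E'"
    using admissible_circuit[OF vc(1) nv(1) ab(2) nv(2,3) vc(4)] unfolding V'_def E'_def by blast+
  show thesis
  proof (cases "three_connected V' E'")
    case True
    then show thesis using extension[OF vc(1) nv(1) ab(2) nv(2,3)] cV' abE unfolding V'_def E'_def by blast
  next
    case False
    interpret G: circuit V' E' by fact
    have abE': "{a, b} \<in> E'" by (simp add: E'_def)
    define F where "F = {Q. \<exists>P. G.separates P Q \<and> {a, b} \<inter> Q = {}}"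
    obtain P0 Q0 where "G.separates P0 Q0" using G.not_three_connected[OF False] by blast
    moreover have "{a, b} \<inter> Q0 = {} \<or> {a, b} \<inter> P0 = {}"
      using G.separates_edge[OF \<open>G.separates P0 Q0\<close> abE'] .
    ultimately have "F \<noteq> {}" using G.separates_sym unfolding F_def by blast
    then obtain Q where QF: "Q \<in> F" and Qmin: "\<forall>Q'\<in>F. card Q \<le> card Q'"
      using ex_min_card[of F] by metis
    then obtain P where PQ: "G.separates P Q" and abQ: "{a, b} \<inter> Q = {}" unfolding F_def by blast
    have PQ': "P \<noteq> {}" "Q \<noteq> {}" "P \<inter> Q = {}" "P \<subseteq> V'" "Q \<subseteq> V'" "card (V' - (P \<union> Q)) \<le> 2"
      and PQE: "\<And>p q. p \<in> P \<Longrightarrow> q \<in> Q \<Longrightarrow> {p, q} \<notin> E'"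
      using PQ unfolding G.separates_def by auto
    have QV: "v \<notin> Q" "v \<notin> P" using PQ' by (auto simp: V'_def)
    obtain x y where xy: "x \<noteq> y" "V' - (P \<union> Q) = {x, y}" "{x, y} \<notin> E'" "G.tight (Q \<union> {x, y})"
      "circuit (Q \<union> {x, y}) (insert {x, y} (induced E' (Q \<union> {x, y})))"
      using G.two_separation[OF PQ] by metis
    have cQ: "c \<in> Q"
    proof (rule ccontr)
      assume "c \<notin> Q"
      have "V - (insert v P \<union> Q) = V' - (P \<union> Q)" by (auto simp: V'_def)
      moreover have "insert v P \<inter> Q = {}" "insert v P \<union> Q \<subseteq> V" using PQ' QV vc by (auto simp: V'_def)
      ultimately obtain p q where pq: "p \<in> insert v P" "q \<in> Q" "{p, q} \<in> E"
        using three_connectedD[OF conn insert_not_empty PQ'(2)] PQ'(6) by metis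
      show False
      proof (cases "p = v")
        case True
        then have "q \<in> nbr v" using pq QV by (auto simp: neighbors_def insert_commute)
        then show False using nv abQ pq \<open>c \<notin> Q\<close> by blast
      next
        case False
        then have "{p, q} \<in> E'" using pq QV by (auto simp: E'_def)
        then show False using PQE pq False by blast
      qed
    qed
    define B where "B = Q \<union> {x, y}"
    have xyV': "x \<in> V'" "y \<in> V'" "x \<notin> P" "y \<notin> P" "x \<notin> Q" "y \<notin> Q" using xy(2) by blast+
    have vB: "v \<notin> B" using QV xyV' by (auto simp: B_def V'_def)
    have BV: "B \<subseteq> V" "B \<subseteq> V'" using PQ' xyV' by (auto simp: B_def V'_def)
    have "\<not> {a, b} \<subseteq> B"
    proof
      assume "{a, b} \<subseteq> B"
      then have "{a, b} = {x, y}" using abQ ab(2) by (auto simp: B_def)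
      then show False using xy abE' by simp
    qed
    then have ind: "induced E' B = induced E B" using vB by (auto simp: induced_def E'_def)
    have xyE: "{x, y} \<notin> E" using xy(3) xyV' by (auto simp: E'_def V'_def)
    define EB where "EB = insert {x, y} (induced E B)"
    have cB: "circuit B EB" using xy(5) ind by (simp add: B_def EB_def)
    have tB: "tight B"
    proof (rule tightI)
      show "B \<subseteq> V" "B \<noteq> V" using BV vB vc by auto
      show "2 \<le> card B" "2 * card B \<le> edges_in B + 3" using xy(4) ind unfolding G.tight_def B_def by auto
    qed
    interpret B: circuit B EB by fact
    \<comment> \<open>A separation of B has a side \<open>Q2\<close> away from x and y. That side is
      then cut off in the whole reduced graph as well, and it is smaller than Q.\<close>
    have connB: "three_connected B EB"
    proof (rule ccontr)
      assume "\<not> three_connected B EB"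
      then obtain P1 Q1 where s: "B.separates P1 Q1" using B.not_three_connected by blast
      have xyEB: "{x, y} \<in> EB" by (simp add: EB_def)
      have "{x, y} \<inter> Q1 = {} \<or> {x, y} \<inter> P1 = {}"
        using B.separates_edge[OF s xyEB] .
      then obtain P2 Q2 where s2: "B.separates P2 Q2" "{x, y} \<inter> Q2 = {}" using s B.separates_sym by blast
      then obtain S2 where S2: "S2 = B - (P2 \<union> Q2)" "card S2 = 2"
        using B.two_separation[OF s2(1)] by (metis card_2_iff)
      have s2': "P2 \<noteq> {}" "Q2 \<noteq> {}" "P2 \<inter> Q2 = {}" "P2 \<subseteq> B" "Q2 \<subseteq> B"
        and s2E: "\<And>p q. p \<in> P2 \<Longrightarrow> q \<in> Q2 \<Longrightarrow> {p, q} \<notin> EB"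
        using s2(1) unfolding B.separates_def by auto
      have Q2Q: "Q2 \<subseteq> Q" using s2' s2(2) by (auto simp: B_def)
      have fin: "finite P2" "finite Q2" "finite S2" "finite Q"
        using s2' S2 B.finite_V finite_subset PQ' G.finite_V by (blast, blast, simp, blast)
      have Beq: "B = P2 \<union> Q2 \<union> S2" "S2 \<inter> (P2 \<union> Q2) = {}" using s2' S2 by auto
      have "card B = card P2 + card Q2 + 2"
        using Beq fin s2'(3) S2(2) card_Un_disjoint[of "P2 \<union> Q2" S2] card_Un_disjoint[of P2 Q2]
        by (simp add: Int_commute)
      moreover have "card B = card Q + 2"
        using fin xyV' xy(1) by (simp add: B_def)
      moreover have "card P2 > 0" using s2' fin by (simp add: card_gt_0_iff)
      ultimately have lt: "card Q2 < card Q" by simp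
      define P' where "P' = V' - Q2 - S2"
      have "P2 \<subseteq> P'" using Beq s2' BV by (auto simp: P'_def)
      have "G.separates P' Q2"
        unfolding G.separates_def
      proof (intro conjI ballI)
        show "P' \<noteq> {}" using \<open>P2 \<subseteq> P'\<close> s2' by blast
        show "Q2 \<noteq> {}" "P' \<inter> Q2 = {}" "P' \<union> Q2 \<subseteq> V'" using s2' BV by (auto simp: P'_def)
        have "V' - (P' \<union> Q2) \<subseteq> S2" by (auto simp: P'_def)
        then show "card (V' - (P' \<union> Q2)) \<le> 2" using S2(2) fin card_mono by metis
        fix p q assume p: "p \<in> P'" and q: "q \<in> Q2"
        show "{p, q} \<notin> E'"
        proof
          assume e: "{p, q} \<in> E'"
          then have "p \<notin> P" using PQE q Q2Q by blast
          then have "p \<in> B" using p xy(2) by (auto simp: P'_def B_def)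
          then have "p \<in> P2" using p Beq by (auto simp: P'_def)
          moreover have "{p, q} \<in> EB"
            using e \<open>p \<in> B\<close> q s2' ind by (auto simp: EB_def induced_def)
          ultimately show False using s2E q by blast
        qed
      qed
      moreover have "{a, b} \<inter> Q2 = {}" using abQ Q2Q by blast
      ultimately have "Q2 \<in> F" unfolding F_def by blast
      then show False using Qmin lt by (meson not_le)
    qed
    have att: "e \<subseteq> B \<or> e \<subseteq> (V - B) \<union> {x, y, c}" if e: "e \<in> E" for e
    proof (rule ccontr)
      assume n: "\<not> (e \<subseteq> B \<or> e \<subseteq> (V - B) \<union> {x, y, c})"
      obtain q where q: "q \<in> e" "q \<in> Q" "q \<noteq> c" using n edge[OF e] by (auto simp: B_def)
      then obtain p where p: "e = {p, q}" "p \<in> nbr q" using edge_pair[OF e] by metis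
      have "p \<noteq> v"
      proof
        assume "p = v"
        then have "q \<in> nbr v" using p nbr_sym by blast
        then show False using nv abQ q by blast
      qed
      then have e': "{p, q} \<in> E'" using p q e QV by (auto simp: E'_def)
      have "p \<in> V'" using p nbr_subset \<open>p \<noteq> v\<close> by (auto simp: V'_def)
      moreover have "p \<notin> P" using PQE q e' by blast
      ultimately have "p \<in> B" using xy(2) by (auto simp: B_def)
      then show False using n p q by (auto simp: B_def)
    qed
    have sub: "{x, y, c} \<subseteq> B" "x \<noteq> c" "y \<noteq> c" using cQ xyV' by (auto simp: B_def)
    have c4: "4 \<le> card B" by (rule B.card_V4)
    have "card ((V - B) \<union> {x, y, c}) \<le> card (V - B) + 3"
      using card_Un_le[of "V - B" "{x, y, c}"] sub xy(1) by simp
    moreover have "card (V - B) + card B = card V"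
      using BV finite_V finite_sub by (simp add: card_Diff_subset card_sub)
    ultimately have small: "card ((V - B) \<union> {x, y, c}) < card V" using c4 by linarith
    have psub: "B \<subset> V" using BV vB vc by blast
    show thesis
      using triangle[OF sub(1) xy(1) sub(2,3) xyE psub _ _ _ _ small] cB connB
        triangle_replacement[OF conn tB sub(1) xy(1) sub(2,3) att] unfolding EB_def by blast
  qed
qed

end

section \<open>Sparse graphs\<close>

context finite_graph
begin

text \<open>Below a smallest set that violates the sparse bound all subsets obey it, so any
  selection of exactly the circuit number of edges on that set is a circuit.\<close>

lemma dense_has_circuit:
  assumes "S \<subseteq> V" "2 \<le> card S" "2 * card S \<le> edges_in S + 2"
  shows "\<exists>V0 E0. V0 \<subseteq> V \<and> E0 \<subseteq> E \<and> circuit V0 E0"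
proof -
  define F where "F = {S. S \<subseteq> V \<and> 2 \<le> card S \<and> 2 * card S \<le> edges_in S + 2}"
  have "F \<noteq> {}" using assms by (auto simp: F_def)
  then obtain T where T: "T \<in> F" and Tmin: "\<forall>T'\<in>F. card T \<le> card T'"
    using ex_min_card[of F] by metis
  have TV: "T \<subseteq> V" "2 \<le> card T" "2 * card T \<le> edges_in T + 2" "finite T"
    using T finite_V finite_subset by (auto simp: F_def)
  obtain E0 where E0: "E0 \<subseteq> induced E T" "card E0 = 2 * card T - 2" "finite E0"
  proof -
    have "2 * card T - 2 \<le> edges_in T" using TV by simp
    then show thesis using that by (rule obtain_subset_with_card_n)
  qed
  have "circuit T E0"
  proof
    show "finite T" by fact
    show "e \<subseteq> T \<and> card e = 2" if "e \<in> E0" for e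
      using that E0 edge by (auto simp: induced_def)
    show "card E0 + 2 = 2 * card T" "2 \<le> card T" using E0 TV by auto
    fix S assume S: "S \<subseteq> T" "S \<noteq> T" "2 \<le> card S"
    have "card S < card T" using S TV by (simp add: psubset_card_mono psubset_eq)
    then have "S \<notin> F" using Tmin by auto
    then have "edges_in S + 3 \<le> 2 * card S" using S TV by (auto simp: F_def)
    moreover have "card (induced E0 S) \<le> edges_in S"
      using E0 by (intro card_mono finite_induced) (auto simp: induced_def)
    ultimately show "card (induced E0 S) + 3 \<le> 2 * card S" by simp
  qed
  then show ?thesis using TV E0 by (auto simp: induced_def)
qed

lemma sparse_low_degree:
  assumes "V \<noteq> {}" "card E \<le> 2 * card V"
    and strict: "2 \<le> card V \<Longrightarrow> card E < 2 * card V"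
  shows "\<exists>v\<in>V. card (nbr v) \<le> 3"
proof (rule ccontr)
  assume "\<not> ?thesis"
  then have *: "4 \<le> card (nbr v)" if "v \<in> V" for v using that by force
  then have "(\<Sum>v\<in>V. 4) \<le> (\<Sum>v\<in>V. card (nbr v))" by (intro sum_mono)
  also have "\<dots> = 2 * card E" using degree_sum[of V] induced_V edges_in_small[of "{}"] by simp
  finally have le: "4 * card V \<le> 2 * card E" by simp
  obtain v where v: "v \<in> V" using assms by blast
  have "card (nbr v) \<le> card (V - {v})" using nbr_subset finite_V by (intro card_mono) auto
  then have "2 \<le> card V" using *[OF v] v finite_V by simp
  then show False using strict le by simp
qed

text \<open>Some two of the three neighbours lie in no set at the sparse bound that avoids v.
  Otherwise three such sets would combine into one containing all neighbours, two of them if they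
  overlap in two vertices and all three through \<open>triangle_union\<close> if not; adding v would
  then break the bound.\<close>

lemma sparse_extension:
  assumes sparse: "\<And>S. S \<subseteq> V \<Longrightarrow> 2 \<le> card S \<Longrightarrow> edges_in S + 3 \<le> 2 * card S"
    and v: "v \<in> V" "card (nbr v) = 3"
  obtains a b c where "nbr v = {a, b, c}" "a \<noteq> b" "a \<noteq> c" "b \<noteq> c" "{a, b} \<notin> E"
    "\<And>S. S \<subseteq> V - {v} \<Longrightarrow> 2 \<le> card S \<Longrightarrow> card (induced (insert {a, b} {f \<in> E. v \<notin> f}) S) + 3 \<le> 2 * card S"
proof -
  have fin: "finite S" if "S \<subseteq> V" for S using that finite_V finite_subset by blast
  define dense where "dense X \<longleftrightarrow> X \<subseteq> V - {v} \<and> 2 \<le> card X \<and> edges_in X + 3 = 2 * card X" for X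
  have not_all: "\<not> nbr v \<subseteq> X" if "X \<subseteq> V - {v}" "2 \<le> card X" "2 * card X \<le> edges_in X + 3" for X
  proof
    assume n: "nbr v \<subseteq> X"
    have vX: "v \<notin> X" and fX: "finite X" using that fin[of X] by auto
    have "nbr v \<inter> X = nbr v" using n by auto
    then have "edges_in (insert v X) = edges_in X + 3" using edges_in_insert[OF vX] v by simp
    moreover have "edges_in (insert v X) + 3 \<le> 2 * card (insert v X)"
      using that v vX fX by (intro sparse) auto
    ultimately show False using that vX fX by simp
  qed
  have "\<exists>c\<in>nbr v. \<not> (\<exists>X. dense X \<and> nbr v - {c} \<subseteq> X)"
  proof (rule ccontr)
    assume a: "\<not> ?thesis"
    obtain e1 e2 e3 where es: "nbr v = {e1, e2, e3}" "e1 \<noteq> e2" "e1 \<noteq> e3" "e2 \<noteq> e3"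
      using v(2) by (metis card_3_iff)
    obtain X1 where "dense X1" "nbr v - {e1} \<subseteq> X1" using a es by blast
    then have X1: "X1 \<subseteq> V - {v}" "2 \<le> card X1" "edges_in X1 + 3 = 2 * card X1" "e2 \<in> X1" "e3 \<in> X1" "finite X1"
      using es fin[of X1] unfolding dense_def by auto
    obtain X2 where "dense X2" "nbr v - {e2} \<subseteq> X2" using a es by blast
    then have X2: "X2 \<subseteq> V - {v}" "2 \<le> card X2" "edges_in X2 + 3 = 2 * card X2" "e1 \<in> X2" "e3 \<in> X2" "finite X2"
      using es fin[of X2] unfolding dense_def by auto
    obtain X3 where "dense X3" "nbr v - {e3} \<subseteq> X3" using a es by blast
    then have X3: "X3 \<subseteq> V - {v}" "2 \<le> card X3" "edges_in X3 + 3 = 2 * card X3" "e1 \<in> X3" "e2 \<in> X3" "finite X3"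
      using es fin[of X3] unfolding dense_def by auto
    have small: "card (X \<inter> Y) < 2"
      if X: "X \<subseteq> V - {v}" "edges_in X + 3 = 2 * card X" "finite X"
        and Y: "Y \<subseteq> V - {v}" "edges_in Y + 3 = 2 * card Y" "finite Y" and n: "nbr v \<subseteq> X \<union> Y" for X Y
    proof (rule ccontr)
      assume "\<not> card (X \<inter> Y) < 2"
      then have c2: "2 \<le> card (X \<inter> Y)" by simp
      then have c2': "2 \<le> card (X \<union> Y)"
        using card_mono[of "X \<union> Y" "X \<inter> Y"] X Y by (meson Int_lower1 Un_upper1 finite_UnI le_trans subset_trans)
      have "edges_in (X \<inter> Y) + 3 \<le> 2 * card (X \<inter> Y)" using c2 X by (intro sparse) auto
      moreover have "card (X \<union> Y) + card (X \<inter> Y) = card X + card Y" using card_Un_Int[of X Y] X Y by simp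
      ultimately have "2 * card (X \<union> Y) \<le> edges_in (X \<union> Y) + 3"
        using edges_in_supermodular[of X Y] X(2) Y(2) by linarith
      then show False using not_all[of "X \<union> Y"] c2' X Y n by auto
    qed
    have single: "A = {x}" if "card A < 2" "finite A" "x \<in> A" for A and x :: 'a
      using that card_le_Suc0_iff_eq[of A] by auto
    have c: "card (X1 \<inter> X2) < 2" "card (X1 \<inter> X3) < 2" "card (X2 \<inter> X3) < 2"
      using small[of X1 X2] small[of X1 X3] small[of X2 X3] X1 X2 X3 es by auto
    have I: "X1 \<inter> X2 = {e3}" "X1 \<inter> X3 = {e2}" "X2 \<inter> X3 = {e1}"
      using single[OF c(1)] single[OF c(2)] single[OF c(3)] X1 X2 X3 by blast+
    let ?U = "X1 \<union> X2 \<union> X3"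
    let ?I = "induced E X1 \<union> induced E X2 \<union> induced E X3"
    have cardU: "card ?U + 3 = card X1 + card X2 + card X3"
      and cI: "card ?I = edges_in X1 + edges_in X2 + edges_in X3"
      using triangle_union[OF X1(6) X2(6) X3(6) I es(2)] by auto
    have "?I \<subseteq> induced E ?U" by (auto simp: induced_def)
    then have "card ?I \<le> edges_in ?U" by (intro card_mono finite_induced)
    then have "2 * card ?U \<le> edges_in ?U + 3" using cardU cI X1(3) X2(3) X3(3) by linarith
    moreover have "card X1 \<le> card ?U" using X1(6) X2(6) X3(6) by (intro card_mono) auto
    then have "2 \<le> card ?U" using X1(2) by linarith
    moreover have "?U \<subseteq> V - {v}" using X1(1) X2(1) X3(1) by blast
    ultimately show False using not_all[of ?U] X1 X2 es by auto
  qed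
  then obtain c where c: "c \<in> nbr v" "\<not> (\<exists>X. dense X \<and> nbr v - {c} \<subseteq> X)" by blast
  then have "card (nbr v - {c}) = 2" using v by simp
  then obtain a b where ab: "nbr v - {c} = {a, b}" "a \<noteq> b" by (auto simp: card_2_iff)
  then have nv: "nbr v = {a, b, c}" "a \<noteq> c" "b \<noteq> c" using c by blast+
  have abV: "{a, b} \<subseteq> V - {v}" using ab nbr_subset by blast
  have bound: "edges_in S + 4 \<le> 2 * card S" if "{a, b} \<subseteq> S" "S \<subseteq> V - {v}" "2 \<le> card S" for S
  proof -
    have "edges_in S + 3 \<le> 2 * card S" using that by (intro sparse) auto
    moreover have "\<not> dense S" using c that ab by auto
    ultimately show ?thesis using that unfolding dense_def by auto
  qed
  have abE: "{a, b} \<notin> E"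
  proof
    assume "{a, b} \<in> E"
    then have "{{a, b}} \<subseteq> induced E {a, b}" by (auto simp: induced_def)
    then have "card {{a, b}} \<le> edges_in {a, b}" by (intro card_mono finite_induced)
    then show False using bound[of "{a, b}"] abV ab(2) by simp
  qed
  have "card (induced (insert {a, b} {f \<in> E. v \<notin> f}) S) + 3 \<le> 2 * card S"
    if S: "S \<subseteq> V - {v}" "2 \<le> card S" for S
  proof (cases "{a, b} \<subseteq> S")
    case False
    then have "induced (insert {a, b} {f \<in> E. v \<notin> f}) S \<subseteq> induced E S" by (auto simp: induced_def)
    then have "card (induced (insert {a, b} {f \<in> E. v \<notin> f}) S) \<le> edges_in S"
      by (intro card_mono finite_induced)
    moreover have "edges_in S + 3 \<le> 2 * card S" using S by (intro sparse) auto
    ultimately show ?thesis by simp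
  next
    case True
    have "induced (insert {a, b} {f \<in> E. v \<notin> f}) S \<subseteq> insert {a, b} (induced E S)" by (auto simp: induced_def)
    then have "card (induced (insert {a, b} {f \<in> E. v \<notin> f}) S) \<le> card (insert {a, b} (induced E S))"
      by (intro card_mono) auto
    also have "\<dots> \<le> edges_in S + 1" by (simp add: card_insert_if)
    finally show ?thesis using bound[OF True S] by simp
  qed
  then show thesis using that[OF nv(1) ab(2) nv(2,3) abE] by blast
qed

end

section \<open>Linear systems and rows in general position\<close>

lemma homogeneous_system:
  fixes A :: "'i \<Rightarrow> 'j \<Rightarrow> real"
  assumes "finite I" "finite J" "card J < card I"
  shows "\<exists>c. (\<exists>i\<in>I. c i \<noteq> 0) \<and> (\<forall>j\<in>J. (\<Sum>i\<in>I. c i * A i j) = 0)"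
  using assms(2,1,3)
proof (induction J arbitrary: I A rule: finite_induct)
  case empty
  then have "I \<noteq> {}" by auto
  then show ?case by (intro exI[of _ "\<lambda>_. 1"]) auto
next
  case (insert j J)
  show ?case
  proof (cases "\<forall>i\<in>I. A i j = 0")
    case True
    obtain c where "\<exists>i\<in>I. c i \<noteq> 0" "\<forall>j\<in>J. (\<Sum>i\<in>I. c i * A i j) = 0"
      using insert.IH[of I A] insert.prems insert.hyps by auto
    then show ?thesis using True by (intro exI[of _ c]) auto
  next
    case False
    then obtain k where k: "k \<in> I" "A k j \<noteq> 0" by blast
    let ?A = "\<lambda>i l. A i l - A i j / A k j * A k l"
    have "card J < card (I - {k})" using insert.prems insert.hyps k by simp
    then obtain c where c: "\<exists>i\<in>I - {k}. c i \<noteq> 0" "\<forall>l\<in>J. (\<Sum>i\<in>I - {k}. c i * ?A i l) = 0"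
      using insert.IH[of "I - {k}" ?A] insert.prems by auto
    define d where "d i = (if i = k then - (\<Sum>i\<in>I - {k}. c i * A i j) / A k j else c i)" for i
    have split: "(\<Sum>i\<in>I. d i * A i l) = d k * A k l + (\<Sum>i\<in>I - {k}. c i * A i l)" for l
      using k insert.prems(1) by (subst sum.remove[of I k]) (auto simp: d_def)
    have "(\<Sum>i\<in>I. d i * A i l) = 0" if "l \<in> J" for l
    proof -
      have "(\<Sum>i\<in>I - {k}. c i * ?A i l)
          = (\<Sum>i\<in>I - {k}. c i * A i l) - (\<Sum>i\<in>I - {k}. c i * A i j) / A k j * A k l"
        by (simp add: algebra_simps sum_subtractf sum_distrib_left sum_distrib_right sum_divide_distrib)
      then show ?thesis using c(2) that split[of l] by (simp add: d_def)
    qed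
    moreover have "(\<Sum>i\<in>I. d i * A i j) = 0" using split[of j] k by (simp add: d_def)
    moreover have "\<exists>i\<in>I. d i \<noteq> 0" using c(1) by (auto simp: d_def)
    ultimately show ?thesis by (intro exI[of _ d]) auto
  qed
qed

text \<open>In finite dimension injectivity at A gives a lower bound e, half of which survives when
  \<open>A'\<close> is so close that the difference costs at most e / 2. The uniform m is what later
  bounds the change of a stress under perturbation.\<close>

lemma bilinear_injective_open:
  fixes prod :: "'a::euclidean_space \<Rightarrow> 'b::real_normed_vector \<Rightarrow> 'c::euclidean_space"
  assumes bl: "bounded_bilinear prod" and S: "subspace S" and inj: "\<And>x. x \<in> S \<Longrightarrow> prod x A = 0 \<Longrightarrow> x = 0"
  obtains d m where "d > 0" "m > 0" "\<forall>A' x. dist A' A < d \<longrightarrow> x \<in> S \<longrightarrow> m * norm x \<le> norm (prod x A')"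
proof -
  interpret bounded_bilinear prod by fact
  obtain e where e: "e > 0" "\<And>x. x \<in> S \<Longrightarrow> e * norm x \<le> norm (prod x A)"
    using injective_imp_isometric[OF closed_subspace[OF S] S bounded_linear_left[of A]] inj
    by (metis mult.commute)
  obtain K where K: "K > 0" "\<And>a b. norm (prod a b) \<le> norm a * norm b * K" using pos_bounded by blast
  have main: "e / 2 * norm x \<le> norm (prod x A')" if d: "dist A' A < e / (2 * K)" and x: "x \<in> S" for A' x
  proof -
    have "norm (prod x (A' - A)) \<le> norm x * (norm (A' - A) * K)" using K(2)[of x "A' - A"] by (simp add: mult.assoc)
    also have "\<dots> \<le> norm x * (e / 2)"
      using d K(1) by (intro mult_left_mono) (auto simp: dist_norm field_simps)
    finally have "norm (prod x (A' - A)) \<le> e / 2 * norm x" by (simp add: mult.commute)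
    moreover have "prod x A' = prod x A + prod x (A' - A)" by (simp add: diff_right)
    then have "norm (prod x A) - norm (prod x (A' - A)) \<le> norm (prod x A')"
      by (metis norm_diff_ineq)
    ultimately show ?thesis using e(2)[OF x] by (simp add: field_simps)
  qed
  have "e / (2 * K) > 0" "e / 2 > 0" using e K by auto
  then show thesis using main that by blast
qed

definition row_update :: "'n \<Rightarrow> 'a \<Rightarrow> 'a^'n \<Rightarrow> 'a^'n" where
  "row_update v z X = (\<chi> i. if i = v then z else X $ i)"

lemma row_update_nth [simp]: "row_update v z X $ i = (if i = v then z else X $ i)"
  by (simp add: row_update_def)

lemma dist_row_update: "dist (row_update v z X) X = dist z (X $ v)"
  for X :: "'a::real_normed_vector^'n::finite"
proof -
  have "(\<lambda>i. dist (row_update v z X $ i) (X $ i)) = (\<lambda>i. if i = v then dist z (X $ v) else 0)" by auto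
  then show ?thesis by (simp add: dist_vec_def L2_set_def if_distrib[of "\<lambda>x. x^2"] cong: if_cong)
qed

text \<open>Independence of the family and not of the set of rows, so that equal rows count as
  dependent.\<close>

definition indep_rows :: "'n::finite set \<Rightarrow> (real^3)^'n \<Rightarrow> bool" where
  "indep_rows U X \<longleftrightarrow> (\<forall>c. (\<Sum>u\<in>U. c u *\<^sub>R X $ u) = 0 \<longrightarrow> (\<forall>u\<in>U. c u = 0))"

lemma indep_rowsD: "indep_rows U X \<Longrightarrow> (\<Sum>u\<in>U. c u *\<^sub>R X $ u) = 0 \<Longrightarrow> u \<in> U \<Longrightarrow> c u = 0"
  unfolding indep_rows_def by blast

lemma indep_rows_cong: "(\<And>u. u \<in> U \<Longrightarrow> X $ u = X' $ u) \<Longrightarrow> indep_rows U X \<longleftrightarrow> indep_rows U X'"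
  unfolding indep_rows_def by (metis (no_types, lifting) sum.cong)

lemma indep_rows_open:
  fixes X :: "(real^3)^'n::finite"
  assumes "indep_rows U X"
  shows "\<exists>d>0. \<forall>X'. dist X' X < d \<longrightarrow> indep_rows U X'"
proof -
  let ?S = "{c::real^'n. \<forall>i. i \<notin> U \<longrightarrow> c $ i = 0}"
  let ?p = "\<lambda>(c::real^'n) (X::(real^3)^'n). \<Sum>i\<in>UNIV. c $ i *\<^sub>R X $ i"
  have S: "subspace ?S" by (auto simp: subspace_def)
  have "bilinear ?p"
    by (auto simp: bilinear_def linear_iff sum.distrib algebra_simps scaleR_sum_right)
  then have bl: "bounded_bilinear ?p" using bilinear_conv_bounded_bilinear by blast
  have eq: "?p c Y = (\<Sum>u\<in>U. c $ u *\<^sub>R Y $ u)" if "c \<in> ?S" for c Y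
    using that by (intro sum.mono_neutral_right) auto
  have inj: "c = 0" if "c \<in> ?S" "?p c X = 0" for c
  proof -
    have "(\<Sum>u\<in>U. c $ u *\<^sub>R X $ u) = 0" using eq[OF that(1), of X] that(2) by metis
    then have "\<And>u. u \<in> U \<Longrightarrow> c $ u = 0" using indep_rowsD[OF assms, of "\<lambda>u. c $ u"] by blast
    then show ?thesis using that(1) by (auto simp: vec_eq_iff)
  qed
  obtain d m where dm: "d > 0" "m > 0"
    and dm': "\<forall>A' x. dist A' X < d \<longrightarrow> x \<in> ?S \<longrightarrow> m * norm x \<le> norm (?p x A')"
    by (rule bilinear_injective_open[OF bl S inj])
  have "indep_rows U X'" if "dist X' X < d" for X'
    unfolding indep_rows_def
  proof (intro allI impI ballI)
    fix c u assume c: "(\<Sum>u\<in>U. c u *\<^sub>R X' $ u) = 0" and u: "u \<in> U"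
    define x where "x = (\<chi> i. if i \<in> U then c i else 0)"
    have x: "x \<in> ?S" by (simp add: x_def)
    have "?p x X' = 0" unfolding eq[OF x] using c by (simp add: x_def)
    moreover have "m * norm x \<le> norm (?p x X')" using dm' that x by blast
    ultimately have "m * norm x \<le> 0" by simp
    then have "x = 0" using dm(2) by (simp add: mult_le_0_iff)
    then have "x $ u = 0" by simp
    then show "c u = 0" using u by (simp add: x_def)
  qed
  then show ?thesis using dm(1) by blast
qed

lemma indep_rows_insert:
  assumes F: "indep_rows F X" "finite F" "u \<notin> F" and z: "X $ u \<notin> span (($) X ` F)"
  shows "indep_rows (insert u F) X"
  unfolding indep_rows_def
proof (intro allI impI)
  fix c assume c: "(\<Sum>u\<in>insert u F. c u *\<^sub>R X $ u) = 0"
  then have e: "c u *\<^sub>R X $ u + (\<Sum>u\<in>F. c u *\<^sub>R X $ u) = 0" using F by simp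
  have "c u = 0"
  proof (rule ccontr)
    assume "c u \<noteq> 0"
    then have "X $ u = (- 1 / c u) *\<^sub>R (\<Sum>u\<in>F. c u *\<^sub>R X $ u)"
      using e by (metis (no_types, lifting) add_eq_0_iff2 divide_inverse mult_minus_left mult_1 scaleR_minus_left scaleR_minus_right vector_fraction_eq_iff scaleR_one divideR_right real_vector.scale_left_imp_eq real_vector_eq_affinity scaleR_scaleR left_inverse)
    moreover have "(- 1 / c u) *\<^sub>R (\<Sum>u\<in>F. c u *\<^sub>R X $ u) \<in> span (($) X ` F)"
      by (intro span_mul span_sum) (auto intro: span_base)
    ultimately show False using z by simp
  qed
  then show "\<forall>x\<in>insert u F. c x = 0" using e F(1) unfolding indep_rows_def by auto
qed

lemma near_outside_span:
  fixes z :: "real^3"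
  assumes "finite B" "card B < 3" "0 < e"
  obtains z' where "dist z' z < e" "z' \<notin> span B"
proof -
  have "dim (span B) \<le> card B" using assms by (simp add: dim_le_card')
  then have "interior (span B) = {}" using assms by (intro empty_interior_lowdim) auto
  then have "\<not> ball z e \<subseteq> span B"
    using assms(3) by (metis centre_in_ball empty_iff interior_maximal open_ball subset_iff)
  then obtain z' where "z' \<in> ball z e" "z' \<notin> span B" by blast
  then show thesis using that[of z'] by (simp add: dist_commute)
qed

lemma indep_rows_perturb:
  fixes X :: "(real^3)^'n::finite"
  assumes "finite U" "card U \<le> 3" "0 < e"
  shows "\<exists>X'. dist X' X < e \<and> indep_rows U X'"
  using assms
proof (induction U arbitrary: e rule: finite_induct)
  case empty
  then show ?case by (intro exI[of _ X]) (auto simp: indep_rows_def)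
next
  case (insert u F)
  then obtain X1 where X1: "dist X1 X < e / 2" "indep_rows F X1" by (metis card_insert_disjoint half_gt_zero Suc_leD)
  have "card (($) X1 ` F) < 3" using insert.hyps insert.prems card_image_le[of F "($) X1"] by simp
  then obtain z where z: "dist z (X1 $ u) < e / 2" "z \<notin> span (($) X1 ` F)"
    using near_outside_span[of "($) X1 ` F" "e / 2" "X1 $ u"] insert.hyps insert.prems by auto
  let ?X = "row_update u z X1"
  have "dist ?X X \<le> dist ?X X1 + dist X1 X" by (rule dist_triangle)
  then have "dist ?X X < e" using X1 z by (simp add: dist_row_update)
  moreover have im: "($) ?X ` F = ($) X1 ` F" using insert.hyps by (intro image_cong) auto
  have "indep_rows F ?X" using X1(2) insert.hyps indep_rows_cong[of F ?X X1] by (metis row_update_nth)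
  then have "indep_rows (insert u F) ?X"
    using insert.hyps z im by (intro indep_rows_insert) auto
  ultimately show ?case by blast
qed

lemma indep_rows_independent:
  assumes "indep_rows U X" "finite U"
  shows "inj_on (($) X) U" and "independent (($) X ` U)"
proof -
  show inj: "inj_on (($) X) U"
  proof (rule inj_onI, rule ccontr)
    fix u v assume uv: "u \<in> U" "v \<in> U" "X $ u = X $ v" "u \<noteq> v"
    let ?c = "\<lambda>i. if i = u then 1 else if i = v then - 1 else (0::real)"
    have "(\<Sum>i\<in>U. ?c i *\<^sub>R X $ i) = (\<Sum>i\<in>{u, v}. ?c i *\<^sub>R X $ i)"
      using uv assms by (intro sum.mono_neutral_right) auto
    also have "\<dots> = 0" using uv by simp
    finally show False using indep_rowsD[OF assms(1), of ?c u] uv by simp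
  qed
  show "independent (($) X ` U)"
  proof
    assume "dependent (($) X ` U)"
    then obtain k where k: "\<exists>v\<in>($) X ` U. k v \<noteq> 0" "(\<Sum>v\<in>($) X ` U. k v *\<^sub>R v) = 0"
      using assms by (auto simp: dependent_finite)
    then have "(\<Sum>u\<in>U. k (X $ u) *\<^sub>R X $ u) = 0" using inj by (simp add: sum.reindex)
    then show False using indep_rowsD[OF assms(1), of "\<lambda>u. k (X $ u)"] k(1) by blast
  qed
qed

lemma indep_triple_span:
  assumes "indep_rows U X" "finite U" "card U = 3"
  shows "span (($) X ` U) = UNIV"
proof -
  have "card (($) X ` U) = 3" using indep_rows_independent(1)[OF assms(1,2)] assms by (simp add: card_image)
  then show ?thesis
    using card_ge_dim_independent[OF subset_UNIV indep_rows_independent(2)[OF assms(1,2)]] by auto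
qed

lemma indep_functional:
  fixes g :: "'n::finite \<Rightarrow> 'b::real_vector"
  assumes "indep_rows U X" "finite U"
  obtains f :: "real^3 \<Rightarrow> 'b" where "linear f" "\<And>u. u \<in> U \<Longrightarrow> f (X $ u) = g u"
proof -
  have "\<exists>f::real^3 \<Rightarrow> 'b. linear f \<and> (\<forall>x\<in>($) X ` U. f x = g (inv_into U (($) X) x))"
    by (rule linear_independent_extend[OF indep_rows_independent(2)[OF assms]])
  then obtain f :: "real^3 \<Rightarrow> 'b" where f: "linear f \<and> (\<forall>x\<in>($) X ` U. f x = g (inv_into U (($) X) x))" ..
  then show thesis using that[of f] indep_rows_independent(1)[OF assms] by simp
qed

lemma linear_eq_triple:
  assumes "indep_rows U X" "finite U" "card U = 3" "linear f" "linear g" "\<And>u. u \<in> U \<Longrightarrow> f (X $ u) = g (X $ u)"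
  shows "f = g"
proof
  fix x
  have "x \<in> span (($) X ` U)" using indep_triple_span[OF assms(1-3)] by simp
  then show "f x = g x" using linear_eq_on[OF assms(4,5), of x "($) X ` U"] assms(6) by blast
qed

section \<open>Equilibrium stresses\<close>

definition stress_space :: "'n::finite set \<Rightarrow> 'n set set \<Rightarrow> (real^'n^'n) set" where
  "stress_space V E = {w. transpose w = w \<and> (\<forall>i j. w $ i $ j \<noteq> 0 \<longrightarrow> i \<in> V \<and> j \<in> V \<and> (i = j \<or> {i, j} \<in> E))}"

definition stresses :: "'n::finite set \<Rightarrow> 'n set set \<Rightarrow> (real^'k)^'n \<Rightarrow> (real^'n^'n) set" where
  "stresses V E X = {w \<in> stress_space V E. w ** X = 0}"

definition quadratic :: "real^'n^'n::finite \<Rightarrow> real^'n \<Rightarrow> real" where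
  "quadratic w y = y \<bullet> (w *v y)"

lemma matrix_mult_row: "(w ** X) $ i = (\<Sum>j\<in>UNIV. w $ i $ j *\<^sub>R X $ j)"
  for w :: "real^'n^'m" and X :: "real^'k^'n"
  by (simp add: matrix_matrix_mult_def vec_eq_iff)

lemma symmetric_nth: "transpose w = w \<Longrightarrow> w $ i $ j = w $ j $ i"
  by (metis transpose_def vec_lambda_beta)

lemma subspace_stress_space: "subspace (stress_space V E)"
  unfolding subspace_def stress_space_def
  by (auto simp: transpose_def vec_eq_iff) (metis add.right_neutral add_0)+

lemma bounded_bilinear_matrix_mult: "bounded_bilinear (\<lambda>(w::real^'n^'n) (X::real^'k^'n). w ** X)"
proof -
  have "bilinear (\<lambda>(w::real^'n^'n) (X::real^'k^'n). w ** X)"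
    by (auto simp: bilinear_def linear_iff matrix_matrix_mult_def vec_eq_iff sum.distrib
        algebra_simps sum_distrib_left)
  then show ?thesis using bilinear_conv_bounded_bilinear by blast
qed

lemma quadratic_sum: "quadratic w y = (\<Sum>i\<in>UNIV. \<Sum>j\<in>UNIV. w $ i $ j * y $ i * y $ j)"
  by (simp add: quadratic_def inner_vec_def matrix_vector_mult_def sum_distrib_left algebra_simps)

lemma quadratic_add: "quadratic (w + w') y = quadratic w y + quadratic w' y"
  by (simp add: quadratic_def matrix_vector_mult_add_rdistrib inner_add_right)

lemma quadratic_scaleR: "quadratic (c *\<^sub>R w) y = c * quadratic w y"
  by (simp add: quadratic_sum sum_distrib_left algebra_simps)

lemma quadratic_cong:
  assumes "\<And>i j. w $ i $ j \<noteq> 0 \<Longrightarrow> i \<in> V \<and> j \<in> V" "\<And>i. i \<in> V \<Longrightarrow> y $ i = y' $ i"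
  shows "quadratic w y = quadratic w y'"
  unfolding quadratic_sum
proof (intro sum.cong refl)
  fix i j
  show "w $ i $ j * y $ i * y $ j = w $ i $ j * y' $ i * y' $ j"
    using assms by (cases "w $ i $ j = 0") auto
qed

lemma quadratic_shift:
  assumes "transpose w = w" "w *v k = 0"
  shows "quadratic w (y + k) = quadratic w y"
proof -
  have "k \<bullet> (w *v y) = (w *v k) \<bullet> y" using assms(1) by (metis dot_lmul_matrix inner_commute transpose_matrix_vector)
  then show ?thesis using assms by (simp add: quadratic_def matrix_vector_right_distrib inner_add_left)
qed

lemma kernel_linear_image:
  fixes X :: "(real^'k)^'n::finite" and f :: "real^'k \<Rightarrow> real"
  assumes "w ** X = 0" "linear f"
  shows "w *v (\<chi> i. f (X $ i)) = 0"
proof -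
  have "(w *v (\<chi> i. f (X $ i))) $ i = f ((w ** X) $ i)" for i
    using assms(2) by (simp add: matrix_vector_mult_def matrix_mult_row linear_sum linear_scale)
  then show ?thesis using assms linear_0 by (simp add: vec_eq_iff)
qed

text \<open>With loads only at U, both sides are the symmetric form of w at the two vectors of
  values of \<open>f i\<close> and \<open>f k\<close> on the rows. The nine coordinates of the loads
  at three vertices thus amount to six conditions.\<close>

lemma stress_load_symmetric:
  fixes X :: "(real^3)^'n::finite"
  assumes w: "transpose w = w" and U: "\<And>i. i \<notin> U \<Longrightarrow> (w ** X) $ i = 0"
    and f: "\<And>u. u \<in> U \<Longrightarrow> linear (f u)" "\<And>u v. u \<in> U \<Longrightarrow> v \<in> U \<Longrightarrow> f u (X $ v) = (if u = v then 1 else (0::real))"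
    and ik: "i \<in> U" "k \<in> U"
  shows "f k ((w ** X) $ i) = f i ((w ** X) $ k)"
proof -
  have *: "f k ((w ** X) $ i) = (\<Sum>a\<in>UNIV. \<Sum>b\<in>UNIV. w $ a $ b * f i (X $ a) * f k (X $ b))"
    if "i \<in> U" "k \<in> U" for i k
  proof -
    have "(\<Sum>a\<in>UNIV. f i (X $ a) * f k ((w ** X) $ a)) = (\<Sum>a\<in>{i}. f i (X $ a) * f k ((w ** X) $ a))"
    proof (rule sum.mono_neutral_right)
      show "\<forall>a\<in>UNIV - {i}. f i (X $ a) * f k ((w ** X) $ a) = 0"
      proof
        fix a assume "a \<in> UNIV - {i}"
        then show "f i (X $ a) * f k ((w ** X) $ a) = 0"
          using U[of a] f[of i] f[of k] that linear_0[of "f k"] by (cases "a \<in> U") auto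
      qed
    qed auto
    also have "\<dots> = f k ((w ** X) $ i)" using f that by simp
    also have "(\<Sum>a\<in>UNIV. f i (X $ a) * f k ((w ** X) $ a)) =
        (\<Sum>a\<in>UNIV. \<Sum>b\<in>UNIV. w $ a $ b * f i (X $ a) * f k (X $ b))"
      using f(1)[OF that(2)] by (simp add: matrix_mult_row linear_sum linear_scale sum_distrib_left algebra_simps)
    finally show ?thesis by simp
  qed
  show ?thesis unfolding *[OF ik] *[OF ik(2,1)]
    using symmetric_nth[OF w] by (subst sum.swap) (simp add: mult.commute mult.left_commute mult.assoc)
qed

lemma dual_functionals:
  fixes X :: "(real^3)^'n::finite"
  assumes "indep_rows U X" "card U = 3"
  obtains f :: "'n \<Rightarrow> real^3 \<Rightarrow> real" where "\<And>u. linear (f u)"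
    "\<And>u v. v \<in> U \<Longrightarrow> f u (X $ v) = (if u = v then 1 else 0)"
    "\<And>z. z = (\<Sum>u\<in>U. f u z *\<^sub>R X $ u)"
proof -
  have "\<exists>g::real^3 \<Rightarrow> real. linear g \<and> (\<forall>v\<in>U. g (X $ v) = (if u = v then 1 else 0))" for u
    by (rule indep_functional[OF assms(1) finite, of "\<lambda>v. if u = v then 1 else 0"]) auto
  then obtain f :: "'n \<Rightarrow> real^3 \<Rightarrow> real"
    where f: "\<And>u. linear (f u)" "\<And>u v. v \<in> U \<Longrightarrow> f u (X $ v) = (if u = v then 1 else 0)" by metis
  have "(\<lambda>z. z) = (\<lambda>z. \<Sum>u\<in>U. f u z *\<^sub>R X $ u)"
  proof (rule linear_eq_triple[OF assms(1) finite assms(2)])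
    show "linear (\<lambda>z. \<Sum>u\<in>U. f u z *\<^sub>R X $ u)"
      using f(1) by (auto intro!: linear_compose_sum linear_scaleR_left simp: linear_iff algebra_simps sum.distrib scaleR_sum_right)
    fix v assume v: "v \<in> U"
    have "(\<Sum>u\<in>U. f u (X $ v) *\<^sub>R X $ u) = (\<Sum>u\<in>{v}. f u (X $ v) *\<^sub>R X $ u)"
      using v f(2) by (intro sum.mono_neutral_right) auto
    then show "X $ v = (\<Sum>u\<in>U. f u (X $ v) *\<^sub>R X $ u)" using f(2)[OF v] by simp
  qed (auto simp: linear_iff)
  then show thesis using that[of f] f by metis
qed

text \<open>Expanded in the basis of the rows at U, the loads form a symmetric 3 by 3 matrix; N is
  its negative.\<close>

lemma load_resolution:
  fixes X :: "(real^3)^'n::finite"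
  assumes U: "indep_rows U X" "card U = 3" and w: "transpose w = w" "\<And>i. i \<notin> U \<Longrightarrow> (w ** X) $ i = 0"
  obtains N where "transpose N = N" "\<And>i j. N $ i $ j \<noteq> 0 \<Longrightarrow> i \<in> U \<and> j \<in> U" "(w + N) ** X = 0"
proof -
  obtain f :: "'n \<Rightarrow> real^3 \<Rightarrow> real" where f: "\<And>u. linear (f u)"
    "\<And>u v. v \<in> U \<Longrightarrow> f u (X $ v) = (if u = v then 1 else 0)"
    "\<And>z. z = (\<Sum>u\<in>U. f u z *\<^sub>R X $ u)"
    using dual_functionals[OF U] by metis
  define N :: "real^'n^'n" where "N = (\<chi> i j. if i \<in> U \<and> j \<in> U then - f j ((w ** X) $ i) else 0)"
  have "transpose N = N"
    using stress_load_symmetric[OF w f(1,2)] by (auto simp: transpose_def N_def vec_eq_iff)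
  moreover have "N $ i $ j \<noteq> 0 \<Longrightarrow> i \<in> U \<and> j \<in> U" for i j by (auto simp: N_def split: if_splits)
  moreover have "((w + N) ** X) $ i = 0" for i
  proof -
    have "(N ** X) $ i = - (w ** X) $ i"
    proof (cases "i \<in> U")
      case True
      have "(N ** X) $ i = (\<Sum>j\<in>U. N $ i $ j *\<^sub>R X $ j)"
        unfolding matrix_mult_row by (intro sum.mono_neutral_right) (auto simp: N_def)
      also have "\<dots> = - (\<Sum>j\<in>U. f j ((w ** X) $ i) *\<^sub>R X $ j)" using True by (simp add: N_def sum_negf)
      finally show ?thesis using f(3) by metis
    next
      case False
      then show ?thesis using w(2) by (simp add: matrix_mult_row N_def)
    qed
    then show ?thesis by (simp add: bounded_bilinear.add_left[OF bounded_bilinear_matrix_mult])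
  qed
  ultimately show thesis using that by (simp add: vec_eq_iff)
qed


lemmas matrix_mult_bilinear =
  bounded_bilinear.add_left[OF bounded_bilinear_matrix_mult] bounded_bilinear.add_right[OF bounded_bilinear_matrix_mult]
  bounded_bilinear.diff_left[OF bounded_bilinear_matrix_mult] bounded_bilinear.diff_right[OF bounded_bilinear_matrix_mult]
  bounded_bilinear.scaleR_left[OF bounded_bilinear_matrix_mult] bounded_bilinear.scaleR_right[OF bounded_bilinear_matrix_mult]
  bounded_bilinear.zero_left[OF bounded_bilinear_matrix_mult]

lemma subspace_stresses: "subspace (stresses V E X)"
  using subspace_stress_space[of V E] unfolding subspace_def stresses_def
  by (auto simp: matrix_mult_bilinear)

lemma stress_spaceD:
  assumes "w \<in> stress_space V E"
  shows "transpose w = w" "w $ i $ j = w $ j $ i" "w $ i $ j \<noteq> 0 \<Longrightarrow> i \<in> V \<and> j \<in> V"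
    "w $ i $ j \<noteq> 0 \<Longrightarrow> i \<noteq> j \<Longrightarrow> {i, j} \<in> E"
  using assms symmetric_nth unfolding stress_space_def by blast+

lemma stressesD: "w \<in> stresses V E X \<Longrightarrow> w \<in> stress_space V E" "w \<in> stresses V E X \<Longrightarrow> w ** X = 0"
  unfolding stresses_def by auto

lemma stress_row: "w \<in> stresses V E X \<Longrightarrow> (\<Sum>j\<in>UNIV. w $ i $ j *\<^sub>R X $ j) = 0"
  using stressesD(2)[of w V E X] matrix_mult_row[of w X i] by simp

lemma stress_space_mono: "V \<subseteq> V' \<Longrightarrow> E \<subseteq> E' \<Longrightarrow> stress_space V E \<subseteq> stress_space V' E'"
  unfolding stress_space_def by blast

lemma stress_spaceI:
  assumes "\<And>i j. w $ i $ j = w $ j $ i" "\<And>i j. w $ i $ j \<noteq> 0 \<Longrightarrow> i \<in> V \<and> j \<in> V \<and> (i = j \<or> {i, j} \<in> E)"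
  shows "w \<in> stress_space V E"
  using assms unfolding stress_space_def by (auto simp: transpose_def vec_eq_iff)

text \<open>Values of a linear function on the rows are in the kernel of every stress of X; on V
  nothing else may be. In rigidity theory this is the rank condition of super stable
  frameworks.\<close>

definition super_psd :: "'n::finite set \<Rightarrow> (real^3)^'n \<Rightarrow> real^'n^'n \<Rightarrow> bool" where
  "super_psd V X w \<longleftrightarrow> (\<forall>y. 0 \<le> quadratic w y) \<and>
     (\<forall>y. quadratic w y = 0 \<longrightarrow> (\<exists>f. linear f \<and> (\<forall>i\<in>V. y $ i = f (X $ i))))"

definition pos_def_on :: "'n::finite set \<Rightarrow> real^'n^'n \<Rightarrow> bool" where
  "pos_def_on W w \<longleftrightarrow> (\<forall>y. (\<forall>i. i \<notin> W \<longrightarrow> y $ i = 0) \<longrightarrow> y \<noteq> 0 \<longrightarrow> 0 < quadratic w y)"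

text \<open>Subtracting a linear function of the rows makes any vector vanish on U without changing
  the form. A condition on a kernel that moves with X thereby becomes positive definiteness on a
  fixed coordinate subspace, which is open.\<close>

lemma super_psd_iff:
  fixes w :: "real^'n^'n::finite"
  assumes U: "indep_rows U X" "card U = 3" "U \<subseteq> V" and w: "w \<in> stresses V E X"
  shows "super_psd V X w \<longleftrightarrow> pos_def_on (V - U) w"
proof
  assume pd: "pos_def_on (V - U) w"
  have *: "0 \<le> quadratic w y \<and> (quadratic w y = 0 \<longrightarrow> (\<exists>f. linear f \<and> (\<forall>i\<in>V. y $ i = f (X $ i))))" for y
  proof -
    obtain f :: "real^3 \<Rightarrow> real" where f: "linear f" "\<And>u. u \<in> U \<Longrightarrow> f (X $ u) = y $ u"
      using indep_functional[OF U(1) finite, of "\<lambda>u. y $ u"] by blast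
    define F where "F = (\<chi> i. f (X $ i))"
    define y' where "y' = (\<chi> i. if i \<in> V then y $ i - f (X $ i) else 0)"
    have "quadratic w (y - F + F) = quadratic w (y - F)"
      using kernel_linear_image[OF stressesD(2)[OF w] f(1)] stress_spaceD(1)[OF stressesD(1)[OF w]]
      unfolding F_def by (intro quadratic_shift)
    also have "\<dots> = quadratic w y'"
      using stress_spaceD(3)[OF stressesD(1)[OF w]]
      by (intro quadratic_cong[where V = V]) (auto simp: F_def y'_def)
    finally have eq: "quadratic w y = quadratic w y'" by simp
    have supp: "\<forall>i. i \<notin> V - U \<longrightarrow> y' $ i = 0" using f(2) by (auto simp: y'_def)
    show ?thesis
    proof (cases "y' = 0")
      case True
      have "y $ i = f (X $ i)" if "i \<in> V" for i
      proof -
        have "y' $ i = 0" using True by simp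
        then show ?thesis using that by (simp add: y'_def)
      qed
      then show ?thesis using eq True f(1) by (auto simp: quadratic_def)
    next
      case False
      then show ?thesis using pd supp eq unfolding pos_def_on_def by (metis less_eq_real_def less_irrefl)
    qed
  qed
  show "super_psd V X w" unfolding super_psd_def using * by blast
next
  assume sp: "super_psd V X w"
  show "pos_def_on (V - U) w"
    unfolding pos_def_on_def
  proof (intro allI impI)
    fix y :: "real^'n" assume supp: "\<forall>i. i \<notin> V - U \<longrightarrow> y $ i = 0" and "y \<noteq> 0"
    show "0 < quadratic w y"
    proof (rule ccontr)
      assume "\<not> 0 < quadratic w y"
      then have "quadratic w y = 0" using sp unfolding super_psd_def by (meson antisym not_le_imp_less)
      then obtain f where f: "linear f" "\<forall>i\<in>V. y $ i = f (X $ i)" using sp unfolding super_psd_def by blast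
      have "f = (\<lambda>_. 0)"
      proof (rule linear_eq_triple[OF U(1) finite U(2) f(1)])
        fix u assume "u \<in> U"
        then have "y $ u = f (X $ u)" "y $ u = 0" using f(2) U(3) supp by blast+
        then show "f (X $ u) = 0" by simp
      qed (simp add: linear_iff)
      then have "y $ i = 0" for i using f(2) supp by (cases "i \<in> V") auto
      then show False using \<open>y \<noteq> 0\<close> by (simp add: vec_eq_iff)
    qed
  qed
qed

lemma pos_def_on_open:
  fixes w :: "real^'n^'n::finite"
  assumes "pos_def_on W w"
  obtains d where "d > 0" "\<forall>w'. dist w' w < d \<longrightarrow> pos_def_on W w'"
proof -
  define S where "S = {y::real^'n. \<forall>i. i \<notin> W \<longrightarrow> y $ i = 0}"
  have sS: "subspace S" by (auto simp: S_def subspace_def)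
  have cS: "compact (S \<inter> sphere 0 1)" using closed_subspace[OF sS] by (simp add: closed_Int_compact)
  have qc: "continuous_on (S \<inter> sphere 0 1) (quadratic w)"
    unfolding quadratic_def by (intro continuous_intros linear_continuous_on matrix_vector_mul_linear
        linear_conv_bounded_linear[THEN iffD1])
  have "\<exists>m>0. \<forall>y\<in>S \<inter> sphere 0 1. m \<le> quadratic w y"
  proof (cases "S \<inter> sphere 0 1 = {}")
    case True then show ?thesis by (intro exI[of _ 1]) auto
  next
    case False
    then obtain y0 where y0: "y0 \<in> S \<inter> sphere 0 1" "\<forall>y\<in>S \<inter> sphere 0 1. quadratic w y0 \<le> quadratic w y"
      using continuous_attains_inf[OF cS _ qc] by blast
    have "0 < quadratic w y0" using y0(1) assms unfolding pos_def_on_def S_def by auto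
    then show ?thesis using y0(2) by blast
  qed
  then obtain m where m: "m > 0" "\<And>y. y \<in> S \<Longrightarrow> norm y = 1 \<Longrightarrow> m \<le> quadratic w y" by auto
  have "bilinear (\<lambda>(w::real^'n^'n) (y::real^'n). w *v y)"
    by (auto simp: bilinear_def linear_iff matrix_vector_mult_def vec_eq_iff sum.distrib algebra_simps sum_distrib_left)
  then have bb: "bounded_bilinear (\<lambda>(w::real^'n^'n) (y::real^'n). w *v y)"
    using bilinear_conv_bounded_bilinear by blast
  then obtain K where K: "K > 0" "\<And>(w::real^'n^'n) (y::real^'n). norm (w *v y) \<le> norm w * norm y * K"
    using bounded_bilinear.pos_bounded[OF bb] by blast
  have "pos_def_on W w'" if d: "dist w' w < m / K" for w'
    unfolding pos_def_on_def
  proof (intro allI impI)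
    fix y :: "real^'n" assume y: "\<forall>i. i \<notin> W \<longrightarrow> y $ i = 0" "y \<noteq> 0"
    define z where "z = (1 / norm y) *\<^sub>R y"
    have z: "z \<in> S" "norm z = 1" using y by (auto simp: z_def S_def)
    have "\<bar>quadratic (w' - w) z\<bar> \<le> norm z * norm ((w' - w) *v z)"
      unfolding quadratic_def by (rule Cauchy_Schwarz_ineq2)
    also have "\<dots> \<le> norm (w' - w) * K" using K(2)[of "w' - w" z] z by simp
    also have "\<dots> < m" using d K(1) by (simp add: dist_norm field_simps)
    finally have "\<bar>quadratic (w' - w) z\<bar> < m" .
    moreover have "quadratic w' z = quadratic w z + quadratic (w' - w) z"
      using quadratic_add[of w "w' - w" z] by simp
    ultimately have "0 < quadratic w' z" using m(2)[OF z] by linarith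
    moreover have "y = norm y *\<^sub>R z" using y by (simp add: z_def)
    then have "quadratic w' y = (norm y)\<^sup>2 * quadratic w' z"
      unfolding quadratic_def by (metis (no_types, lifting) inner_scaleR_left inner_scaleR_right
          matrix_vector_mult_scaleR mult.assoc power2_eq_square)
    ultimately show "0 < quadratic w' y" using y by simp
  qed
  then show thesis using that[of "m / K"] m(1) K(1) by simp
qed

definition framework_graph :: "'n::finite set \<Rightarrow> 'n set set \<Rightarrow> bool" where
  "framework_graph V E \<longleftrightarrow> (\<forall>e\<in>E. e \<subseteq> V \<and> card e = 2) \<and> 2 * card V \<le> card E + 2"

lemma sum_delta_real: "(\<Sum>e\<in>I. (if a = e then c e else 0) :: real) = (if a \<in> I then c a else 0)" if "finite I"
  using that by (simp add: sum.delta)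

text \<open>Counting: \<open>card E + card V\<close> unknowns face three equations at each vertex
  off U and, as the loads at U are symmetric, only six at U. That is 3 n - 3 equations, while
  \<open>framework_graph\<close> provides at least 3 n - 2 unknowns.\<close>

lemma stress_exists:
  fixes X :: "(real^3)^'n::finite"
  assumes G: "framework_graph V E" and U: "indep_rows U X" "card U = 3" "U \<subseteq> V"
  obtains w where "w \<in> stresses V E X" "w \<noteq> 0"
proof -
  obtain f :: "'n \<Rightarrow> real^3 \<Rightarrow> real" where f: "\<And>u. linear (f u)"
    "\<And>u v. v \<in> U \<Longrightarrow> f u (X $ v) = (if u = v then 1 else 0)"
    "\<And>z. z = (\<Sum>u\<in>U. f u z *\<^sub>R X $ u)"
    using dual_functionals[OF U(1,2)] by metis
  obtain a b c where abc: "U = {a, b, c}" "a \<noteq> b" "a \<noteq> c" "b \<noteq> c" using U(2) by (metis card_3_iff)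
  \<comment> \<open>A singleton stands for a diagonal position, a pair for the two symmetric
    positions of an edge.\<close>
  define I where "I = E \<union> (\<lambda>i. {i}) ` V"
  define P where "P = {(a, a), (a, b), (a, c), (b, b), (b, c), (c, c)}"
  define J :: "('n \<times> 3 + 'n \<times> 'n) set" where "J = Inl ` ((V - U) \<times> UNIV) \<union> Inr ` P"
  define B where "B e i = (\<Sum>j\<in>UNIV. (if {i, j} = e then 1 else 0) *\<^sub>R X $ j)" for e i
  define A where "A e j = (case j of Inl (i, k) \<Rightarrow> B e i $ k | Inr (u, v) \<Rightarrow> f v (B e u))" for e j
  have E2: "e \<subseteq> V" "card e = 2" if "e \<in> E" for e using G that unfolding framework_graph_def by auto
  have "E \<inter> (\<lambda>i. {i}) ` V = {}" using E2 by fastforce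
  then have cI: "card I = card E + card V"
    unfolding I_def by (subst card_Un_disjoint) (auto simp: card_image)
  have "card P \<le> 6" unfolding P_def
    using card_length[of "[(a, a), (a, b), (a, c), (b, b), (b, c), (c, c)]"] by simp
  moreover have "card J \<le> card (Inl ` ((V - U) \<times> (UNIV::3 set)) :: ('n \<times> 3 + 'n \<times> 'n) set) + card (Inr ` P :: ('n \<times> 3 + 'n \<times> 'n) set)"
    unfolding J_def by (rule card_Un_le)
  moreover have "card (Inl ` ((V - U) \<times> (UNIV::3 set)) :: ('n \<times> 3 + 'n \<times> 'n) set) = 3 * (card V - 3)"
    using U by (simp add: card_image card_cartesian_product card_Diff_subset)
  moreover have "card (Inr ` P :: ('n \<times> 3 + 'n \<times> 'n) set) \<le> card P" by (rule card_image_le) simp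
  moreover have "3 \<le> card V" using U card_mono[of V U] by simp
  ultimately have "card J < card I" using cI G unfolding framework_graph_def by linarith
  then obtain k where k: "\<exists>e\<in>I. k e \<noteq> 0" "\<forall>j\<in>J. (\<Sum>e\<in>I. k e * A e j) = 0"
    using homogeneous_system[of I J A] by auto
  define w :: "real^'n^'n" where "w = (\<chi> i j. if {i, j} \<in> I then k {i, j} else 0)"
  have I_V: "i \<in> V \<and> j \<in> V \<and> (i = j \<or> {i, j} \<in> E)" if "{i, j} \<in> I" for i j
    using that E2 by (auto simp: I_def doubleton_eq_iff)
  have ws: "w \<in> stress_space V E"
    using I_V by (intro stress_spaceI) (auto simp: w_def insert_commute split: if_splits)
  have row: "(w ** X) $ i = (\<Sum>e\<in>I. k e *\<^sub>R B e i)" for i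
  proof -
    have "(\<Sum>e\<in>I. k e *\<^sub>R B e i) = (\<Sum>j\<in>UNIV. \<Sum>e\<in>I. (if {i, j} = e then k e else 0) *\<^sub>R X $ j)"
      unfolding B_def scaleR_sum_right by (subst sum.swap) (auto intro!: sum.cong)
    also have "\<dots> = (\<Sum>j\<in>UNIV. (\<Sum>e\<in>I. if {i, j} = e then k e else 0) *\<^sub>R X $ j)"
      unfolding scaleR_sum_left ..
    also have "\<dots> = (\<Sum>j\<in>UNIV. w $ i $ j *\<^sub>R X $ j)"
      by (simp add: sum_delta_real w_def)
    finally show ?thesis by (simp add: matrix_mult_row)
  qed
  have lin: "f v ((w ** X) $ i) = (\<Sum>e\<in>I. k e * f v (B e i))" for v i
    unfolding row using f(1)[of v] by (simp add: linear_sum linear_scale)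
  have out: "(w ** X) $ i = 0" if "i \<notin> U" for i
  proof (cases "i \<in> V")
    case True
    have "(w ** X) $ i $ l = 0" for l
    proof -
      have "Inl (i, l) \<in> J" using True that by (simp add: J_def)
      then have "(\<Sum>e\<in>I. k e * A e (Inl (i, l))) = 0" using k(2) by blast
      then show ?thesis unfolding row by (simp add: A_def)
    qed
    then show ?thesis by (simp add: vec_eq_iff)
  next
    case False
    then have "w $ i $ j = 0" for j using stress_spaceD(3)[OF ws] by blast
    then show ?thesis by (simp add: matrix_mult_row)
  qed
  have P0: "f v ((w ** X) $ u) = 0" if "(u, v) \<in> P" for u v
  proof -
    have "Inr (u, v) \<in> J" using that by (simp add: J_def)
    then have "(\<Sum>e\<in>I. k e * A e (Inr (u, v))) = 0" using k(2) by blast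
    then show ?thesis unfolding lin by (simp add: A_def)
  qed
  have "f v ((w ** X) $ u) = 0" if uv: "u \<in> U" "v \<in> U" for u v
  proof -
    have "(u, v) \<in> P \<or> (v, u) \<in> P" using uv abc by (auto simp: P_def)
    then show ?thesis
      using P0 stress_load_symmetric[OF stress_spaceD(1)[OF ws] out f(1,2), where i = u and k = v] uv by metis
  qed
  then have "(w ** X) $ u = 0" if "u \<in> U" for u
    using f(3)[of "(w ** X) $ u"] that by simp
  then have "w ** X = 0" using out by (metis vec_eq_iff zero_index)
  then have "w \<in> stresses V E X" using ws by (simp add: stresses_def)
  moreover obtain e where e: "e \<in> I" "k e \<noteq> 0" using k(1) by blast
  have "e \<in> E \<or> (\<exists>i. e = {i, i})" using e(1) by (auto simp: I_def)
  then have "\<exists>i j. e = {i, j}" using E2(2)[of e] unfolding card_2_iff by blast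
  then obtain i j where "e = {i, j}" by blast
  then have "w $ i $ j \<noteq> 0" using e by (simp add: w_def)
  then have "w \<noteq> 0" by (metis zero_index)
  ultimately show thesis using that by blast
qed

definition rigid_stress :: "'n::finite set \<Rightarrow> 'n set set \<Rightarrow> (real^3)^'n \<Rightarrow> real^'n^'n \<Rightarrow> bool" where
  "rigid_stress V E X w \<longleftrightarrow> w \<in> stresses V E X \<and> super_psd V X w \<and> (\<forall>w'\<in>stresses V E X. \<exists>c. w' = c *\<^sub>R w)"

lemma entries_open:
  fixes w :: "real^'n^'n::finite"
  obtains e where "e > 0" "\<forall>w'. dist w' w < e \<longrightarrow> (\<forall>i j. w $ i $ j \<noteq> 0 \<longrightarrow> 0 < w' $ i $ j * w $ i $ j)"
proof -
  define A where "A = insert 1 ((\<lambda>(i, j). \<bar>w $ i $ j\<bar>) ` {(i, j). w $ i $ j \<noteq> 0})"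
  have fin: "finite A" "A \<noteq> {}" by (auto simp: A_def)
  have pos: "Min A > 0" using fin by (subst Min_gr_iff) (auto simp: A_def)
  have "0 < w' $ i $ j * w $ i $ j" if "dist w' w < Min A" "w $ i $ j \<noteq> 0" for w' i j
  proof -
    have "\<bar>(w' - w) $ i $ j\<bar> \<le> norm ((w' - w) $ i)" by (rule component_le_norm_cart)
    also have "\<dots> \<le> norm (w' - w)" by (rule Finite_Cartesian_Product.norm_nth_le)
    also have "\<dots> < Min A" using that by (simp add: dist_norm)
    also have "Min A \<le> \<bar>w $ i $ j\<bar>" using that fin by (intro Min_le) (auto simp: A_def)
    finally have "\<bar>w' $ i $ j - w $ i $ j\<bar> < \<bar>w $ i $ j\<bar>" by simp
    then have "w' $ i $ j > 0 \<and> w $ i $ j > 0 \<or> w' $ i $ j < 0 \<and> w $ i $ j < 0" by linarith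
    then show ?thesis by (auto intro: mult_pos_pos mult_neg_neg)
  qed
  then show thesis using that pos by blast
qed

lemma stress_space_remove:
  assumes "w \<in> stress_space V E" "w $ p $ q = 0"
  shows "w \<in> stress_space V (E - {{p, q}})"
proof (rule stress_spaceI)
  note w = stress_spaceD[OF assms(1)]
  show "w $ i $ j = w $ j $ i" for i j using w(2) .
  have "w $ q $ p = 0" using assms(2) w(2)[of q p] by simp
  then show "i \<in> V \<and> j \<in> V \<and> (i = j \<or> {i, j} \<in> E - {{p, q}})" if "w $ i $ j \<noteq> 0" for i j
    using w(3)[OF that] w(4)[OF that] assms(2) that by (auto simp: doubleton_eq_iff)
qed

text \<open>Without the edge p, q the stress equations at X are injective, since all stresses are
  multiples of w; this persists nearby with a uniform bound. Counting still provides a stress,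
  necessarily nonzero at p, q. Scaled to agree with w there, it differs from w by a matrix to which
  the uniform bound applies.\<close>

lemma rigid_stress_open:
  fixes X :: "(real^3)^'n::finite"
  assumes G: "framework_graph V E" and rs: "rigid_stress V E X w"
    and U: "indep_rows U X" "card U = 3" "U \<subseteq> V" and pq: "{p, q} \<in> E" "w $ p $ q \<noteq> 0" and eps: "eps > 0"
  obtains d where "d > 0"
    "\<forall>X'. dist X' X < d \<longrightarrow> indep_rows U X' \<and> (\<exists>w'. rigid_stress V E X' w' \<and> dist w' w < eps)"
proof -
  define S where "S = stress_space V (E - {{p, q}})"
  have sS: "subspace S" unfolding S_def by (rule subspace_stress_space)
  have ws: "w \<in> stresses V E X" "super_psd V X w" and uniq: "\<And>w'. w' \<in> stresses V E X \<Longrightarrow> \<exists>c. w' = c *\<^sub>R w"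
    using rs unfolding rigid_stress_def by auto
  have SE: "S \<subseteq> stress_space V E" unfolding S_def by (rule stress_space_mono) auto
  have Spq: "x $ p $ q = 0" if "x \<in> S" for x
  proof (rule ccontr)
    assume "x $ p $ q \<noteq> 0"
    moreover have "p \<noteq> q" using G pq(1) unfolding framework_graph_def by fastforce
    ultimately have "{p, q} \<in> E - {{p, q}}" using stress_spaceD(4)[of x V "E - {{p, q}}" p q] that unfolding S_def by blast
    then show False by blast
  qed
  have inj: "x = 0" if "x \<in> S" "x ** X = 0" for x
  proof -
    have "x \<in> stresses V E X" using that SE by (auto simp: stresses_def)
    then obtain c where c: "x = c *\<^sub>R w" using uniq by blast
    then have "c * w $ p $ q = 0" using Spq[OF that(1)] by simp
    then show ?thesis using c pq by simp
  qed
  obtain d1 m where d1: "d1 > 0" "m > 0" "\<forall>A' x. dist A' X < d1 \<longrightarrow> x \<in> S \<longrightarrow> m * norm x \<le> norm (x ** A')"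
    by (rule bilinear_injective_open[OF bounded_bilinear_matrix_mult sS inj])
  obtain d2 where d2: "d2 > 0" "\<forall>X'. dist X' X < d2 \<longrightarrow> indep_rows U X'" using indep_rows_open[OF U(1)] by blast
  have "pos_def_on (V - U) w" using super_psd_iff[OF U ws(1)] ws(2) by blast
  then obtain d3 where d3: "d3 > 0" "\<forall>w'. dist w' w < d3 \<longrightarrow> pos_def_on (V - U) w'" by (rule pos_def_on_open)
  obtain K where K: "K > 0" "\<And>(w::real^'n^'n) (X::(real^3)^'n). norm (w ** X) \<le> norm w * norm X * K"
    using bounded_bilinear.pos_bounded[OF bounded_bilinear_matrix_mult] by blast
  define e where "e = min eps d3"
  \<comment> \<open>The last bound makes \<open>w ** (X' - X)\<close>, which controls
    \<open>w' - w\<close>, smaller than \<open>m * e\<close>.\<close>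
  define d where "d = min d1 (min d2 (m * e / (K * (norm w + 1))))"
  have e0: "e > 0" using eps d3 by (simp add: e_def)
  have nw: "norm w + 1 > 0" by (smt (verit) norm_ge_zero)
  have "d > 0" using d1 d2 e0 K nw by (simp add: d_def)
  moreover have "indep_rows U X' \<and> (\<exists>w'. rigid_stress V E X' w' \<and> dist w' w < eps)" if X': "dist X' X < d" for X'
  proof -
    have iU: "indep_rows U X'" using X' d2 by (simp add: d_def)
    have bd: "m * norm x \<le> norm (x ** X')" if "x \<in> S" for x using d1 X' that by (simp add: d_def)
    then have inj': "x = 0" if "x \<in> S" "x ** X' = 0" for x
      using that d1(2) by (metis mult_le_cancel_left_pos mult_zero_right norm_le_zero_iff norm_zero)
    obtain w1 where w1: "w1 \<in> stresses V E X'" "w1 \<noteq> 0" using stress_exists[OF G iU U(2,3)] by blast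
    have w1pq: "w1 $ p $ q \<noteq> 0"
    proof
      assume "w1 $ p $ q = 0"
      then have "w1 \<in> S" using stress_space_remove stressesD(1)[OF w1(1)] unfolding S_def by blast
      then show False using inj' w1 stressesD(2) by blast
    qed
    define w' where "w' = (w $ p $ q / w1 $ p $ q) *\<^sub>R w1"
    have w': "w' \<in> stresses V E X'" using w1(1) subspace_stresses subspace_scale unfolding w'_def by blast
    have w'pq: "w' $ p $ q = w $ p $ q" using w1pq by (simp add: w'_def)
    have diffS: "w' - w \<in> S" unfolding S_def
    proof (rule stress_space_remove)
      show "w' - w \<in> stress_space V E"
        using subspace_diff[OF subspace_stress_space] stressesD(1)[OF w'] stressesD(1)[OF ws(1)] by blast
    qed (simp add: w'pq)
    have "(w' - w) ** X' = - (w ** (X' - X))"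
      using stressesD(2)[OF w'] stressesD(2)[OF ws(1)] by (simp add: matrix_mult_bilinear)
    then have "m * norm (w' - w) \<le> norm (w ** (X' - X))" using bd[OF diffS] by simp
    also have "\<dots> \<le> norm w * norm (X' - X) * K" by (rule K(2))
    also have "\<dots> \<le> (norm w + 1) * norm (X' - X) * K" using K by (intro mult_right_mono) auto
    also have "\<dots> < m * e"
    proof -
      have "norm (X' - X) < m * e / (K * (norm w + 1))" using X' by (simp add: d_def dist_norm)
      then show ?thesis using K(1) nw by (simp add: pos_less_divide_eq mult_ac)
    qed
    finally have lt: "dist w' w < e" using d1(2) by (simp add: dist_norm)
    then have "pos_def_on (V - U) w'" using d3 by (simp add: e_def)
    then have sp: "super_psd V X' w'" using super_psd_iff[OF iU U(2,3) w'] by blast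
    have "\<exists>c. w'' = c *\<^sub>R w'" if w'': "w'' \<in> stresses V E X'" for w''
    proof -
      define z where "z = w'' - (w'' $ p $ q / w' $ p $ q) *\<^sub>R w'"
      have "z \<in> stresses V E X'" unfolding z_def
        using w'' w' subspace_stresses by (intro subspace_diff subspace_scale) auto
      moreover have "z $ p $ q = 0" using w'pq pq by (simp add: z_def)
      ultimately have "z = 0" using inj' stress_space_remove stressesD unfolding S_def by blast
      then show ?thesis unfolding z_def by auto
    qed
    then have "rigid_stress V E X' w'" using w' sp unfolding rigid_stress_def by blast
    then show ?thesis using iU lt by (auto simp: e_def)
  qed
  ultimately show thesis using that by blast
qed

definition good_at :: "'n::finite set \<Rightarrow> 'n set set \<Rightarrow> (real^3)^'n \<Rightarrow> real^'n^'n \<Rightarrow> bool" where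
  "good_at V E X w \<longleftrightarrow> rigid_stress V E X w \<and> (\<exists>U. U \<subseteq> V \<and> card U = 3 \<and> indep_rows U X) \<and>
     (\<forall>i j. {i, j} \<in> E \<longrightarrow> w $ i $ j \<noteq> 0)"

lemma good_at_nearby:
  assumes G: "framework_graph V E" "E \<noteq> {}" and good: "good_at V E X w"
  obtains d where "d > 0" "\<forall>X'. dist X' X < d \<longrightarrow>
    (\<exists>w'. good_at V E X' w' \<and> (\<forall>i j. w $ i $ j \<noteq> 0 \<longrightarrow> 0 < w' $ i $ j * w $ i $ j))"
proof -
  have g: "rigid_stress V E X w" "\<And>i j. {i, j} \<in> E \<Longrightarrow> w $ i $ j \<noteq> 0" using good unfolding good_at_def by auto
  obtain U where U: "indep_rows U X" "card U = 3" "U \<subseteq> V" using good unfolding good_at_def by blast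
  obtain e0 where "e0 \<in> E" using G(2) by blast
  then obtain p q where pq: "{p, q} \<in> E" using G(1) unfolding framework_graph_def card_2_iff by metis
  obtain e where e: "e > 0" "\<forall>w'. dist w' w < e \<longrightarrow> (\<forall>i j. w $ i $ j \<noteq> 0 \<longrightarrow> 0 < w' $ i $ j * w $ i $ j)"
    by (rule entries_open)
  obtain d where d: "d > 0"
    "\<forall>X'. dist X' X < d \<longrightarrow> indep_rows U X' \<and> (\<exists>w'. rigid_stress V E X' w' \<and> dist w' w < e)"
    by (rule rigid_stress_open[OF G(1) g(1) U pq g(2)[OF pq] e(1)])
  have "\<exists>w'. good_at V E X' w' \<and> (\<forall>i j. w $ i $ j \<noteq> 0 \<longrightarrow> 0 < w' $ i $ j * w $ i $ j)" if near: "dist X' X < d" for X'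
  proof -
    obtain w' where w': "rigid_stress V E X' w'" "dist w' w < e" "indep_rows U X'" using d(2) near by blast
    have s: "\<forall>i j. w $ i $ j \<noteq> 0 \<longrightarrow> 0 < w' $ i $ j * w $ i $ j" using e w' by blast
    have "w' $ i $ j \<noteq> 0" if "{i, j} \<in> E" for i j
    proof -
      have "0 < w' $ i $ j * w $ i $ j" using s g(2)[OF that] by blast
      then show ?thesis by auto
    qed
    then have "good_at V E X' w'" using w' U unfolding good_at_def by blast
    then show ?thesis using s by blast
  qed
  then show thesis using that d(1) by blast
qed

text \<open>Extension and gluing need independent rows at prescribed vertices: goodness is open, and
  independence of at most three rows is dense.\<close>

lemma good_at_perturb:
  assumes G: "framework_graph V E" "E \<noteq> {}" and good: "good_at V E X w" and U: "card U \<le> 3"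
  obtains X' w' where "good_at V E X' w'" "indep_rows U X'"
proof -
  obtain d where d: "d > 0" "\<forall>X'. dist X' X < d \<longrightarrow>
    (\<exists>w'. good_at V E X' w' \<and> (\<forall>i j. w $ i $ j \<noteq> 0 \<longrightarrow> 0 < w' $ i $ j * w $ i $ j))"
    by (rule good_at_nearby[OF G good])
  obtain X' where "dist X' X < d" "indep_rows U X'" using indep_rows_perturb[OF finite U d(1)] by blast
  then show thesis using d that by blast
qed

section \<open>Rank-one stresses, the complete graph on four vertices and 1-extensions\<close>

definition rank_one :: "('n \<Rightarrow> real) \<Rightarrow> real^'n^'n::finite" where
  "rank_one u = (\<chi> i j. u i * u j)"

lemma rank_one_nth [simp]: "rank_one u $ i $ j = u i * u j"
  by (simp add: rank_one_def)

lemma transpose_rank_one [simp]: "transpose (rank_one u) = rank_one u"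
  by (simp add: rank_one_def transpose_def vec_eq_iff mult.commute)

lemma quadratic_rank_one: "quadratic (rank_one u) y = (\<Sum>i\<in>UNIV. u i * y $ i)\<^sup>2"
proof -
  have "quadratic (rank_one u) y = (\<Sum>i\<in>UNIV. \<Sum>j\<in>UNIV. (u i * y $ i) * (u j * y $ j))"
    by (simp add: quadratic_sum algebra_simps)
  then show ?thesis by (simp add: power2_eq_square sum_product)
qed

lemma rank_one_mult: "(rank_one u ** X) $ i = u i *\<^sub>R (\<Sum>j\<in>UNIV. u j *\<^sub>R X $ j)"
  for X :: "real^'k^'n::finite"
  by (simp add: matrix_mult_row scaleR_sum_right)

lemma matrix_mult_cong:
  fixes w :: "real^'n^'n::finite" and X X' :: "real^'k^'n"
  assumes "\<And>i j. w $ i $ j \<noteq> 0 \<Longrightarrow> j \<in> V" "\<And>j. j \<in> V \<Longrightarrow> X $ j = X' $ j"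
  shows "w ** X = w ** X'"
proof -
  have "(w ** X) $ i = (w ** X') $ i" for i
    unfolding matrix_mult_row
  proof (intro sum.cong refl)
    fix j show "w $ i $ j *\<^sub>R X $ j = w $ i $ j *\<^sub>R X' $ j" using assms by (cases "w $ i $ j = 0") auto
  qed
  then show ?thesis by (simp add: vec_eq_iff)
qed

lemma stresses_cong:
  assumes "\<And>j. j \<in> V \<Longrightarrow> X $ j = X' $ j"
  shows "stresses V E X = stresses V E X'"
proof -
  have "w ** X = w ** X'" if "w \<in> stress_space V E" for w
    using stress_spaceD(3)[OF that] assms by (intro matrix_mult_cong[where V = V]) auto
  then show ?thesis unfolding stresses_def by auto
qed

lemma super_psd_cong:
  assumes "\<And>j. j \<in> V \<Longrightarrow> X $ j = X' $ j"
  shows "super_psd V X w \<longleftrightarrow> super_psd V X' w"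
  unfolding super_psd_def using assms by (metis (no_types, lifting))

lemma sum_three:
  fixes f :: "'n::finite \<Rightarrow> 'a::comm_monoid_add"
  assumes "a \<noteq> b" "a \<noteq> c" "b \<noteq> c" "\<And>i. i \<notin> {a, b, c} \<Longrightarrow> f i = 0"
  shows "(\<Sum>i\<in>UNIV. f i) = f a + f b + f c"
proof -
  have "(\<Sum>i\<in>UNIV. f i) = (\<Sum>i\<in>{a, b, c}. f i)" using assms by (intro sum.mono_neutral_right) auto
  then show ?thesis using assms by (simp add: add.assoc)
qed

lemma sum_four:
  fixes f :: "'n::finite \<Rightarrow> 'a::comm_monoid_add"
  assumes "v \<notin> {a, b, c}" "a \<noteq> b" "a \<noteq> c" "b \<noteq> c" "\<And>i. i \<notin> {v, a, b, c} \<Longrightarrow> f i = 0"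
  shows "(\<Sum>i\<in>UNIV. f i) = f v + f a + f b + f c"
proof -
  have "(\<Sum>i\<in>UNIV. f i) = (\<Sum>i\<in>{v, a, b, c}. f i)" using assms by (intro sum.mono_neutral_right) auto
  then show ?thesis using assms by (simp add: add.assoc)
qed

lemma indep_triple_coeffs:
  assumes "indep_rows {a, b, c} X" "a \<noteq> b" "a \<noteq> c" "b \<noteq> c"
    and "\<alpha> *\<^sub>R X $ a + \<beta> *\<^sub>R X $ b + \<gamma> *\<^sub>R X $ c = 0"
  shows "\<alpha> = 0" "\<beta> = 0" "\<gamma> = 0"
proof -
  let ?k = "\<lambda>i. if i = a then \<alpha> else if i = b then \<beta> else \<gamma>"
  have "(\<Sum>i\<in>{a, b, c}. ?k i *\<^sub>R X $ i) = 0" using assms by (simp add: add.assoc)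
  then have "?k a = 0" "?k b = 0" "?k c = 0" using indep_rowsD[OF assms(1), of ?k] by blast+
  then show "\<alpha> = 0" "\<beta> = 0" "\<gamma> = 0" using assms by auto
qed

definition split_vector :: "'n \<Rightarrow> 'n \<Rightarrow> 'n \<Rightarrow> real \<Rightarrow> 'n \<Rightarrow> real" where
  "split_vector v a b \<beta> i = (if i = v then 1 else if i = a then - 1 else if i = b then - \<beta> else 0)"

lemma split_vector_kernel:
  fixes X :: "(real^3)^'n::finite"
  assumes "v \<noteq> a" "v \<noteq> b" "a \<noteq> b" "X $ v = X $ a + \<beta> *\<^sub>R X $ b"
  shows "(\<Sum>j\<in>UNIV. split_vector v a b \<beta> j *\<^sub>R X $ j) = 0"
  by (subst sum_three[of v a b]) (use assms in \<open>auto simp: split_vector_def\<close>)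

text \<open>The equation at v, written in the independent rows of a, b, c, determines row v of w up
  to the factor \<open>w $ v $ v\<close>: it is a multiple of the split vector, with entry zero at
  c. Subtracting the rank-one stress clears row v, so stresses of the extended graph come from those
  of the smaller one.\<close>

lemma split_vertex_reduce:
  fixes X :: "(real^3)^'n::finite"
  assumes v: "v \<notin> {a, b, c}" "a \<noteq> b" "a \<noteq> c" "b \<noteq> c" and ind: "indep_rows {a, b, c} X"
    and Xv: "X $ v = X $ a + \<beta> *\<^sub>R X $ b"
    and w: "transpose w = w" "w ** X = 0" "\<And>j. w $ v $ j \<noteq> 0 \<Longrightarrow> j \<in> {v, a, b, c}"
  defines "z \<equiv> w - w $ v $ v *\<^sub>R rank_one (split_vector v a b \<beta>)"
  shows "z $ v $ j = 0" and "z ** X = 0" and "transpose z = z"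
proof -
  have "(\<Sum>j\<in>UNIV. w $ v $ j *\<^sub>R X $ j) = 0" using w(2) matrix_mult_row[of w X v] by simp
  then have "w $ v $ v *\<^sub>R X $ v + w $ v $ a *\<^sub>R X $ a + w $ v $ b *\<^sub>R X $ b + w $ v $ c *\<^sub>R X $ c = 0"
    using w(3) v by (subst (asm) sum_four[of v a b c]) auto
  then have "(w $ v $ v + w $ v $ a) *\<^sub>R X $ a + (w $ v $ v * \<beta> + w $ v $ b) *\<^sub>R X $ b + w $ v $ c *\<^sub>R X $ c = 0"
    unfolding Xv by (simp add: algebra_simps)
  from indep_triple_coeffs[OF ind v(2-4) this]
  have "w $ v $ a = - w $ v $ v" "w $ v $ b = - \<beta> * w $ v $ v" "w $ v $ c = 0" by (auto simp: algebra_simps)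
  then show "z $ v $ j = 0"
    using w(3)[of j] v by (auto simp: z_def split_vector_def)
  show "z ** X = 0"
    using w(2) split_vector_kernel[OF _ _ v(2) Xv] v
    by (auto simp: z_def matrix_mult_bilinear vec_eq_iff rank_one_mult)
  show "transpose z = z" using w(1)
    by (simp add: z_def transpose_def vec_eq_iff rank_one_def mult.commute)
qed

text \<open>Four vectors in space, three of them independent, satisfy one linear relation up to
  scaling; with the fourth row minus the sum of the others its coefficients are all one. The
  rank-one matrix of this relation is the only stress up to scaling.\<close>

lemma complete_four_good:
  fixes V :: "'n::finite set"
  assumes "card V = 4" and E: "E = {e. e \<subseteq> V \<and> card e = 2}"
  shows "\<exists>X w. good_at V E X w"
proof -
  obtain d where d: "d \<in> V" using assms by (metis card.empty ex_in_conv zero_neq_numeral)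
  then have "card (V - {d}) = 3" using assms by simp
  then obtain a b c where abc: "V - {d} = {a, b, c}" "a \<noteq> b" "a \<noteq> c" "b \<noteq> c" by (metis card_3_iff)
  have V: "V = {d, a, b, c}" "d \<notin> {a, b, c}" using abc d by auto
  obtain X0 :: "(real^3)^'n" where X0: "indep_rows {a, b, c} X0"
    using indep_rows_perturb[of "{a, b, c}" 1 0] abc by auto
  define X where "X = row_update d (- (X0 $ a + X0 $ b + X0 $ c)) X0"
  have ind: "indep_rows {a, b, c} X"
    using X0 V(2) by (subst indep_rows_cong[of _ X X0]) (auto simp: X_def)
  define u :: "'n \<Rightarrow> real" where "u i = (if i \<in> V then 1 else 0)" for i
  have "(\<Sum>j\<in>UNIV. u j *\<^sub>R X $ j) = 0"
    using V abc(2-4) by (subst sum_four[of d a b c]) (auto simp: u_def X_def)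
  then have ker: "rank_one u ** X = 0" by (simp add: vec_eq_iff rank_one_mult)
  have ws: "rank_one u \<in> stresses V E X"
    unfolding stresses_def using ker by (auto intro!: stress_spaceI simp: u_def E split: if_splits)
  have sp: "super_psd V X (rank_one u)"
    unfolding super_psd_def quadratic_rank_one
  proof (intro conjI allI impI)
    fix y :: "real^'n" assume "(\<Sum>i\<in>UNIV. u i * y $ i)\<^sup>2 = 0"
    then have "(\<Sum>i\<in>UNIV. u i * y $ i) = 0" by simp
    then have y: "y $ d + y $ a + y $ b + y $ c = 0"
      using V abc(2-4) by (subst (asm) sum_four[of d a b c]) (auto simp: u_def)
    obtain f :: "real^3 \<Rightarrow> real" where f: "linear f" "\<And>i. i \<in> {a, b, c} \<Longrightarrow> f (X $ i) = y $ i"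
      using indep_functional[OF ind finite, of "\<lambda>i. y $ i"] by blast
    have "X $ d = - (X $ a + X $ b + X $ c)" using V(2) by (auto simp: X_def)
    then have "f (X $ d) = - (f (X $ a) + f (X $ b) + f (X $ c))"
      by (simp only: linear_neg[OF f(1)] linear_add[OF f(1)])
    then have "f (X $ d) = y $ d" using f(2) y by simp
    then show "\<exists>f. linear f \<and> (\<forall>i\<in>V. y $ i = f (X $ i))" using f V by auto
  qed simp
  have "\<exists>k. w' = k *\<^sub>R rank_one u" if w': "w' \<in> stresses V E X" for w'
  proof -
    note s = stress_spaceD[OF stressesD(1)[OF w']]
    have row: "w' $ i $ j = w' $ i $ d" if "j \<in> V" for i j
    proof -
      have "(\<Sum>j\<in>UNIV. w' $ i $ j *\<^sub>R X $ j) = 0" using stress_row[OF w'] .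
      then have "w' $ i $ d *\<^sub>R X $ d + w' $ i $ a *\<^sub>R X $ a + w' $ i $ b *\<^sub>R X $ b + w' $ i $ c *\<^sub>R X $ c = 0"
        using s(3)[of i] V abc(2-4) by (subst (asm) sum_four[of d a b c]) auto
      moreover have "X $ d = - (X $ a + X $ b + X $ c)" using V(2) by (auto simp: X_def)
      ultimately have "(w' $ i $ a - w' $ i $ d) *\<^sub>R X $ a + (w' $ i $ b - w' $ i $ d) *\<^sub>R X $ b +
          (w' $ i $ c - w' $ i $ d) *\<^sub>R X $ c = 0"
        by (simp add: algebra_simps)
      from indep_triple_coeffs[OF ind abc(2-4) this] show ?thesis using that V by auto
    qed
    define k where "k = w' $ d $ d"
    have "w' $ i $ j = k * (u i * u j)" for i j
    proof (cases "i \<in> V \<and> j \<in> V")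
      case True
      then have "w' $ i $ j = w' $ d $ i" using row s(2) by metis
      also have "\<dots> = k" using row True unfolding k_def by blast
      finally show ?thesis using True by (simp add: u_def)
    next
      case False
      then show ?thesis using s(3)[of i j] by (auto simp: u_def)
    qed
    then have "w' = k *\<^sub>R rank_one u" by (simp add: vec_eq_iff)
    then show ?thesis by blast
  qed
  then have "rigid_stress V E X (rank_one u)" using ws sp unfolding rigid_stress_def by blast
  moreover have "{a, b, c} \<subseteq> V" "card {a, b, c} = 3" using V abc by auto
  moreover have "rank_one u $ i $ j \<noteq> 0" if "{i, j} \<in> E" for i j using that E by (auto simp: u_def)
  ultimately show ?thesis using ind unfolding good_at_def by blast
qed

text \<open>
  The new vertex is placed on the line through \<open>a\<close> and \<open>b\<close>; the stress of the smaller graph is changed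
  by the rank one stress of the collinear triple so that the entry at \<open>{a, b}\<close> vanishes, and a
  perturbation makes the remaining entries nonzero.
\<close>

lemma good_extension:
  fixes V' :: "'n::finite set"
  assumes G': "framework_graph V' E'" and good: "good_at V' E' X0 w0"
    and ab: "{a, b} \<in> E'" and abc: "c \<in> V'" "a \<noteq> b" "a \<noteq> c" "b \<noteq> c" and v: "v \<notin> V'"
    and V: "V = insert v V'" and E: "E = (E' - {{a, b}}) \<union> {{v, a}, {v, b}, {v, c}}" and G: "framework_graph V E"
  shows "\<exists>X w. good_at V E X w"
proof -
  have E'V: "e \<subseteq> V'" if "e \<in> E'" for e using G' that unfolding framework_graph_def by auto
  have inV: "a \<in> V'" "b \<in> V'" using E'V[OF ab] by auto
  have va: "v \<notin> {a, b, c}" "v \<noteq> a" "v \<noteq> b" "v \<noteq> c" using v inV abc by auto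
  obtain X1 w1 where 1: "good_at V' E' X1 w1" "indep_rows {a, b, c} X1"
    using good_at_perturb[OF G' _ good, of "{a, b, c}"] ab abc by (metis card_3_iff empty_iff order_refl)
  have g1: "w1 \<in> stresses V' E' X1" "super_psd V' X1 w1" "\<And>w'. w' \<in> stresses V' E' X1 \<Longrightarrow> \<exists>k. w' = k *\<^sub>R w1"
    "\<And>i j. {i, j} \<in> E' \<Longrightarrow> w1 $ i $ j \<noteq> 0"
    using 1(1) unfolding good_at_def rigid_stress_def by auto
  note s1 = stress_spaceD[OF stressesD(1)[OF g1(1)]]
  define p where "p = w1 $ a $ b"
  have p0: "p \<noteq> 0" using g1(4)[OF ab] by (simp add: p_def)
  \<comment> \<open>The rank-one stress has the entry \<beta> at a, b; with sign opposite to p, a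
    positive factor t cancels p.\<close>
  define \<beta> where "\<beta> = - sgn p"
  define t where "t = \<bar>p\<bar>"
  have t\<beta>: "t > 0" "\<beta> \<noteq> 0" "p + t * \<beta> = 0" using p0 by (auto simp: t_def \<beta>_def sgn_if)
  define X2 where "X2 = row_update v (X1 $ a + \<beta> *\<^sub>R X1 $ b) X1"
  have X2v: "X2 $ v = X2 $ a + \<beta> *\<^sub>R X2 $ b" using va by (simp add: X2_def)
  have X2V: "X2 $ j = X1 $ j" if "j \<in> V'" for j using that v by (auto simp: X2_def)
  define u where "u = split_vector v a b \<beta>"
  define w2 where "w2 = w1 + t *\<^sub>R rank_one u"
  have uker: "(\<Sum>j\<in>UNIV. u j *\<^sub>R X2 $ j) = 0"
    unfolding u_def using split_vector_kernel[OF va(2,3) abc(2) X2v] .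
  have st': "stresses V' E' X2 = stresses V' E' X1" using X2V by (rule stresses_cong)
  have ind2: "indep_rows {a, b, c} X2"
    using 1(2) X2V inV abc by (subst indep_rows_cong[of _ X2 X1]) auto
  have w2ker: "w2 ** X2 = 0"
    using stressesD(2)[of w1 V' E' X2] g1(1) st' uker
    by (simp add: w2_def matrix_mult_bilinear vec_eq_iff rank_one_mult)
  have w2e: "w2 $ i $ j = w1 $ i $ j + t * (u i * u j)" for i j by (simp add: w2_def)
  have usupp: "u i \<noteq> 0 \<Longrightarrow> i \<in> {v, a, b}" for i by (auto simp: u_def split_vector_def split: if_splits)
  have uv: "u v = 1" "u a = - 1" "u b = - \<beta>" using va abc by (auto simp: u_def split_vector_def)
  have w2s: "w2 \<in> stresses V E X2"
    unfolding stresses_def mem_Collect_eq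
  proof (rule conjI[OF stress_spaceI w2ker])
    fix i j show "w2 $ i $ j = w2 $ j $ i" using s1(2)[of i j] by (simp add: w2e mult.commute)
    assume nz: "w2 $ i $ j \<noteq> 0"
    then have "w1 $ i $ j \<noteq> 0 \<or> (u i \<noteq> 0 \<and> u j \<noteq> 0)" by (auto simp: w2e)
    then have inV': "i \<in> V \<and> j \<in> V" using s1(3) usupp inV V by blast
    moreover have "i = j \<or> {i, j} \<in> E"
    proof (cases "i = j \<or> {i, j} = {a, b}")
      case True
      then show ?thesis
      proof
        assume "{i, j} = {a, b}"
        then have "(i = a \<and> j = b) \<or> (i = b \<and> j = a)" by (auto simp: doubleton_eq_iff)
        then have "w2 $ i $ j = p + t * \<beta>"
          using uv s1(2)[of b a] by (auto simp: w2e p_def)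
        then show ?thesis using t\<beta>(3) nz by simp
      qed simp
    next
      case False
      show ?thesis
      proof (cases "w1 $ i $ j = 0")
        case True
        then have "u i \<noteq> 0" "u j \<noteq> 0" using nz by (auto simp: w2e)
        then have "i \<in> {v, a, b}" "j \<in> {v, a, b}" using usupp by blast+
        then show ?thesis using False by (auto simp: E insert_commute)
      next
        case nz1: False
        then have "{i, j} \<in> E'" using s1(4) False by blast
        then show ?thesis using False by (auto simp: E)
      qed
    qed
    ultimately show "i \<in> V \<and> j \<in> V \<and> (i = j \<or> {i, j} \<in> E)" by blast
  qed
  have w2p: "super_psd V X2 w2"
    unfolding super_psd_def
  proof (intro conjI allI impI)
    fix y :: "real^'n"
    have q: "quadratic w2 y = quadratic w1 y + t * (\<Sum>i\<in>UNIV. u i * y $ i)\<^sup>2"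
      by (simp add: w2_def quadratic_add quadratic_scaleR quadratic_rank_one)
    have q1: "0 \<le> quadratic w1 y" using g1(2) unfolding super_psd_def by blast
    show "0 \<le> quadratic w2 y" using q q1 t\<beta>(1) by simp
    assume "quadratic w2 y = 0"
    moreover have "0 \<le> t * (\<Sum>i\<in>UNIV. u i * y $ i)\<^sup>2" using t\<beta>(1) by simp
    ultimately have z: "quadratic w1 y = 0" "t * (\<Sum>i\<in>UNIV. u i * y $ i)\<^sup>2 = 0" using q q1 by linarith+
    then have "(\<Sum>i\<in>UNIV. u i * y $ i) = 0" using t\<beta>(1) by simp
    then have yv: "y $ v = y $ a + \<beta> * y $ b"
      using usupp va abc uv by (subst (asm) sum_three[of v a b]) auto
    obtain f where f: "linear f" "\<forall>i\<in>V'. y $ i = f (X1 $ i)" using g1(2) z(1) unfolding super_psd_def by blast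
    have "y $ i = f (X2 $ i)" if "i \<in> V" for i
    proof (cases "i = v")
      case True
      have "f (X2 $ v) = f (X2 $ a) + \<beta> * f (X2 $ b)" unfolding X2v using f(1) by (simp add: linear_add linear_scale)
      then show ?thesis using True yv f(2) X2V inV by simp
    next
      case False
      then show ?thesis using that V f(2) X2V by simp
    qed
    then show "\<exists>f. linear f \<and> (\<forall>i\<in>V. y $ i = f (X2 $ i))" using f(1) by blast
  qed
  have w2u: "\<exists>k. w' = k *\<^sub>R w2" if w': "w' \<in> stresses V E X2" for w'
  proof -
    note s' = stress_spaceD[OF stressesD(1)[OF w']]
    have nv: "j \<in> {v, a, b, c}" if "w' $ v $ j \<noteq> 0" for j
    proof (cases "v = j")
      case False
      then have "{v, j} \<in> E" using s'(4)[OF that] by blast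
      moreover have "{v, j} \<notin> E'" using E'V v by blast
      ultimately show ?thesis by (auto simp: E doubleton_eq_iff)
    qed simp
    define z where "z = w' - w' $ v $ v *\<^sub>R rank_one u"
    have z: "\<And>j. z $ v $ j = 0" "z ** X2 = 0" "transpose z = z"
      using split_vertex_reduce[OF va(1) abc(2-4) ind2 X2v s'(1) stressesD(2)[OF w'] nv] unfolding z_def u_def by blast+
    have ze: "z $ i $ j = w' $ i $ j - w' $ v $ v * (u i * u j)" for i j by (simp add: z_def)
    have "z \<in> stresses V' E' X2"
      unfolding stresses_def mem_Collect_eq
    proof (rule conjI[OF stress_spaceI z(2)])
      fix i j show sym: "z $ i $ j = z $ j $ i" using symmetric_nth[OF z(3)] .
      assume nz: "z $ i $ j \<noteq> 0"
      then have ne: "i \<noteq> v" "j \<noteq> v" using z(1) symmetric_nth[OF z(3)] by auto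
      have "w' $ i $ j \<noteq> 0 \<or> (u i \<noteq> 0 \<and> u j \<noteq> 0)" using nz by (auto simp: ze)
      then have "i \<in> V \<and> j \<in> V" using s'(3) usupp inV V by blast
      then have iV: "i \<in> V'" "j \<in> V'" using ne V by auto
      moreover have "i = j \<or> {i, j} \<in> E'"
      proof (cases "w' $ i $ j = 0")
        case True
        then have "u i \<noteq> 0 \<and> u j \<noteq> 0" using nz by (auto simp: ze)
        then have "i \<in> {a, b}" "j \<in> {a, b}" using usupp ne by blast+
        then show ?thesis using ab by (auto simp: insert_commute)
      next
        case False
        then have "i = j \<or> {i, j} \<in> E" using s'(4) by blast
        then show ?thesis using ne by (auto simp: E doubleton_eq_iff)
      qed
      ultimately show "i \<in> V' \<and> j \<in> V' \<and> (i = j \<or> {i, j} \<in> E')" by blast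
    qed
    then obtain k where k: "z = k *\<^sub>R w1" using g1(3) st' by blast
    have "{a, b} \<notin> E" using va by (auto simp: E doubleton_eq_iff)
    then have "w' $ a $ b = 0" using s'(4)[of a b] abc(2) by blast
    \<comment> \<open>The edge a, b is gone, so the entry of \<open>w'\<close> there is zero; this
      ties the multiples of \<open>w1\<close> and of the rank-one stress together in the ratio used
      for \<open>w2\<close>.\<close>
    then have "- (w' $ v $ v * \<beta>) = k * p" using ze[of a b] uv k by (simp add: p_def)
    also have "\<dots> = - (k * t * \<beta>)"
    proof -
      have "p = - (t * \<beta>)" using t\<beta>(3) by linarith
      then show ?thesis by simp
    qed
    finally have "w' $ v $ v = k * t" using t\<beta>(2) by simp
    then have "w' = k *\<^sub>R w1 + (k * t) *\<^sub>R rank_one u" using k by (simp add: z_def algebra_simps)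
    also have "\<dots> = k *\<^sub>R w2" by (simp add: w2_def algebra_simps)
    finally show ?thesis by blast
  qed
  have rs2: "rigid_stress V E X2 w2" using w2s w2p w2u unfolding rigid_stress_def by blast
  have U: "{a, b, c} \<subseteq> V" "card {a, b, c} = 3" using inV abc V by auto
  have w2va: "w2 $ v $ a \<noteq> 0"
  proof -
    have "w1 $ v $ a = 0" using s1(3)[of v a] v by blast
    then show ?thesis using uv t\<beta> by (simp add: w2e)
  qed
  have vaE: "{v, a} \<in> E" by (simp add: E)
  obtain e where e: "e > 0" "\<forall>w'. dist w' w2 < e \<longrightarrow> (\<forall>i j. w2 $ i $ j \<noteq> 0 \<longrightarrow> 0 < w' $ i $ j * w2 $ i $ j)"
    by (rule entries_open)
  obtain d where d: "d > 0"
    "\<forall>X'. dist X' X2 < d \<longrightarrow> indep_rows {a, b, c} X' \<and> (\<exists>w'. rigid_stress V E X' w' \<and> dist w' w2 < e)"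
    by (rule rigid_stress_open[OF G rs2 ind2 U(2,1) vaE w2va e(1)])
  \<comment> \<open>For v on the line through a and b the entry at v, c is zero. Moving v by
    \<gamma> times the row of c turns it into \<open>- w3 $ v $ v * \<gamma>\<close>; the
    denominator keeps the move below d.\<close>
  define \<gamma> where "\<gamma> = d / (2 * (norm (X2 $ c) + 1))"
  have \<gamma>: "\<gamma> > 0" "norm (\<gamma> *\<^sub>R X2 $ c) < d"
  proof -
    have n: "norm (X2 $ c) + 1 > 0" by (smt (verit) norm_ge_zero)
    then show g: "\<gamma> > 0" using d(1) by (simp add: \<gamma>_def)
    have "norm (\<gamma> *\<^sub>R X2 $ c) \<le> \<gamma> * (norm (X2 $ c) + 1)" using g by simp
    also have "\<dots> = d / 2" using n by (simp add: \<gamma>_def field_simps)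
    finally show "norm (\<gamma> *\<^sub>R X2 $ c) < d" using d(1) by simp
  qed
  define X3 where "X3 = row_update v (X2 $ v + \<gamma> *\<^sub>R X2 $ c) X2"
  have "dist X3 X2 < d" using \<gamma>(2) unfolding X3_def dist_row_update by (simp add: dist_norm)
  then obtain w3 where w3: "rigid_stress V E X3 w3" "dist w3 w2 < e" and ind3: "indep_rows {a, b, c} X3"
    using d(2) by blast
  have same: "w3 $ i $ j \<noteq> 0" if "w2 $ i $ j \<noteq> 0" for i j
  proof -
    have "0 < w3 $ i $ j * w2 $ i $ j" using e(2) w3(2) that by blast
    then show ?thesis by auto
  qed
  have w3s: "w3 \<in> stresses V E X3" using w3(1) unfolding rigid_stress_def by blast
  note s3 = stress_spaceD[OF stressesD(1)[OF w3s]]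
  have w3vc: "w3 $ v $ c \<noteq> 0"
  proof -
    have nv: "j \<in> {v, a, b, c}" if "w3 $ v $ j \<noteq> 0" for j
    proof (cases "v = j")
      case False
      then have "{v, j} \<in> E" using s3(4)[OF that] by blast
      moreover have "{v, j} \<notin> E'" using E'V v by blast
      ultimately show ?thesis by (auto simp: E doubleton_eq_iff)
    qed simp
    have "(\<Sum>j\<in>UNIV. w3 $ v $ j *\<^sub>R X3 $ j) = 0" using stress_row[OF w3s] .
    then have "w3 $ v $ v *\<^sub>R X3 $ v + w3 $ v $ a *\<^sub>R X3 $ a + w3 $ v $ b *\<^sub>R X3 $ b + w3 $ v $ c *\<^sub>R X3 $ c = 0"
      using nv va abc by (subst (asm) sum_four[of v a b c]) auto
    moreover have "X3 $ v = X3 $ a + \<beta> *\<^sub>R X3 $ b + \<gamma> *\<^sub>R X3 $ c" using va X2v by (simp add: X3_def)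
    ultimately have "(w3 $ v $ v + w3 $ v $ a) *\<^sub>R X3 $ a + (w3 $ v $ v * \<beta> + w3 $ v $ b) *\<^sub>R X3 $ b +
        (w3 $ v $ v * \<gamma> + w3 $ v $ c) *\<^sub>R X3 $ c = 0" by (simp add: algebra_simps)
    from indep_triple_coeffs(3)[OF ind3 abc(2-4) this] have "w3 $ v $ c = - w3 $ v $ v * \<gamma>" by simp
    moreover have "w1 $ v $ v = 0" using s1(3)[of v v] v by blast
    then have "w2 $ v $ v \<noteq> 0" using uv t\<beta>(1) by (simp add: w2e)
    ultimately show ?thesis using same \<gamma>(1) by simp
  qed
  have "w3 $ i $ j \<noteq> 0" if ij: "{i, j} \<in> E" for i j
  proof (cases "{i, j} \<in> E'")
    case True
    then have "i \<noteq> j" using G' unfolding framework_graph_def by fastforce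
    have "i \<noteq> v" "j \<noteq> v" using E'V[OF True] v by auto
    then have "{i, j} \<noteq> {a, b}" using ij va by (auto simp: E doubleton_eq_iff)
    then have "u i * u j = 0" using usupp[of i] usupp[of j] \<open>i \<noteq> v\<close> \<open>j \<noteq> v\<close> \<open>i \<noteq> j\<close> by auto
    then have "w2 $ i $ j \<noteq> 0" using g1(4)[OF True] by (auto simp: w2e)
    then show ?thesis by (rule same)
  next
    case False
    have "w1 $ v $ b = 0" using s1(3)[of v b] v by blast
    then have "w2 $ v $ b \<noteq> 0" using uv t\<beta> by (simp add: w2e)
    then have nz: "w3 $ v $ a \<noteq> 0" "w3 $ v $ b \<noteq> 0" "w3 $ v $ c \<noteq> 0" using same w2va w3vc by blast+
    have "{i, j} \<in> {{v, a}, {v, b}, {v, c}}" using ij False by (auto simp: E)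
    then show ?thesis using nz s3(2) by (auto simp: doubleton_eq_iff)
  qed
  then have "good_at V E X3 w3" using w3(1) ind3 U unfolding good_at_def by blast
  then show ?thesis by blast
qed

section \<open>Row scalings and linear changes of coordinates\<close>

definition scale_rows :: "('n \<Rightarrow> real) \<Rightarrow> (real^3)^'n \<Rightarrow> (real^3)^'n::finite" where
  "scale_rows d X = (\<chi> i. d i *\<^sub>R X $ i)"

text \<open>Congruence by the inverse of the diagonal matrix of d. It compensates the scaling of the
  rows and, for nonzero factors, preserves semidefiniteness; the points given by the rows in
  projective space stay the same.\<close>

definition scale_stress :: "('n \<Rightarrow> real) \<Rightarrow> real^'n^'n \<Rightarrow> real^'n^'n::finite" where
  "scale_stress d w = (\<chi> i j. w $ i $ j / (d i * d j))"

lemma scale_stress_nth [simp]: "scale_stress d w $ i $ j = w $ i $ j / (d i * d j)"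
  by (simp add: scale_stress_def)

lemma scale_rows_nth [simp]: "scale_rows d X $ i = d i *\<^sub>R X $ i"
  by (simp add: scale_rows_def)

lemma scale_stress_stresses:
  assumes "w \<in> stresses V E X" "\<And>i. d i \<noteq> 0"
  shows "scale_stress d w \<in> stresses V E (scale_rows d X)"
proof -
  note s = stress_spaceD[OF stressesD(1)[OF assms(1)]]
  have "(scale_stress d w ** scale_rows d X) $ i = (1 / d i) *\<^sub>R (w ** X) $ i" for i
    using assms(2) by (simp add: matrix_mult_row scaleR_sum_right field_simps)
  then have "scale_stress d w ** scale_rows d X = 0"
    using stressesD(2)[OF assms(1)] by (simp add: vec_eq_iff)
  moreover have "scale_stress d w \<in> stress_space V E"
  proof (rule stress_spaceI)
    show "scale_stress d w $ i $ j = scale_stress d w $ j $ i" for i j using s(2)[of i j] by (simp add: mult.commute)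
    show "i \<in> V \<and> j \<in> V \<and> (i = j \<or> {i, j} \<in> E)" if "scale_stress d w $ i $ j \<noteq> 0" for i j
    proof -
      have "w $ i $ j \<noteq> 0" using that by auto
      then show ?thesis using s(3,4) by blast
    qed
  qed
  ultimately show ?thesis unfolding stresses_def by blast
qed

lemma scale_inverse:
  assumes "\<And>i. d i \<noteq> 0"
  shows "scale_rows (\<lambda>i. 1 / d i) (scale_rows d X) = X" "scale_stress d (scale_stress (\<lambda>i. 1 / d i) w) = w"
  using assms by (simp_all add: vec_eq_iff)

lemma quadratic_scale: "quadratic (scale_stress d w) y = quadratic w (\<chi> i. y $ i / d i)"
  by (simp add: quadratic_sum algebra_simps)

lemma super_psd_scale:
  fixes w :: "real^'n^'n::finite"
  assumes "super_psd V X w" "\<And>i. d i \<noteq> 0"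
  shows "super_psd V (scale_rows d X) (scale_stress d w)"
  unfolding super_psd_def quadratic_scale
proof (intro conjI allI impI)
  fix y :: "real^'n"
  show "0 \<le> quadratic w (\<chi> i. y $ i / d i)" using assms(1) unfolding super_psd_def by blast
  assume "quadratic w (\<chi> i. y $ i / d i) = 0"
  then obtain f where f: "linear f" "\<forall>i\<in>V. (\<chi> i. y $ i / d i) $ i = f (X $ i)"
    using assms(1) unfolding super_psd_def by blast
  have "y $ i = f (scale_rows d X $ i)" if "i \<in> V" for i
  proof -
    have "y $ i / d i = f (X $ i)" using f(2) that by simp
    then have "y $ i = d i * f (X $ i)" using assms(2)[of i] by (simp add: field_simps)
    then show ?thesis using f(1) by (simp add: linear_scale)
  qed
  then show "\<exists>f. linear f \<and> (\<forall>i\<in>V. y $ i = f (scale_rows d X $ i))" using f(1) by blast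
qed

lemma rigid_stress_scale:
  assumes "rigid_stress V E X w" "\<And>i. d i \<noteq> 0"
  shows "rigid_stress V E (scale_rows d X) (scale_stress d w)"
  unfolding rigid_stress_def
proof (intro conjI ballI)
  have r: "w \<in> stresses V E X" "super_psd V X w" "\<And>w'. w' \<in> stresses V E X \<Longrightarrow> \<exists>c. w' = c *\<^sub>R w"
    using assms(1) unfolding rigid_stress_def by auto
  show "scale_stress d w \<in> stresses V E (scale_rows d X)" using scale_stress_stresses[OF r(1) assms(2)] .
  show "super_psd V (scale_rows d X) (scale_stress d w)" using super_psd_scale[OF r(2) assms(2)] .
  fix w' assume "w' \<in> stresses V E (scale_rows d X)"
  then have "scale_stress (\<lambda>i. 1 / d i) w' \<in> stresses V E X"
    using scale_stress_stresses[of w' V E "scale_rows d X" "\<lambda>i. 1 / d i"] assms(2) scale_inverse(1)[of d X] by simp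
  then obtain c where "scale_stress (\<lambda>i. 1 / d i) w' = c *\<^sub>R w" using r(3) by blast
  then have "scale_stress d (scale_stress (\<lambda>i. 1 / d i) w') = scale_stress d (c *\<^sub>R w)" by simp
  moreover have "scale_stress d (scale_stress (\<lambda>i. 1 / d i) w') = w'" by (rule scale_inverse(2)[OF assms(2)])
  moreover have "scale_stress d (c *\<^sub>R w) = c *\<^sub>R scale_stress d w" by (simp add: vec_eq_iff)
  ultimately show "\<exists>c. w' = c *\<^sub>R scale_stress d w" by metis
qed

lemma indep_rows_scale:
  assumes "indep_rows U X" "\<And>i. d i \<noteq> 0"
  shows "indep_rows U (scale_rows d X)"
  unfolding indep_rows_def
proof (intro allI impI ballI)
  fix c u assume c: "(\<Sum>u\<in>U. c u *\<^sub>R scale_rows d X $ u) = 0" and u: "u \<in> U"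
  then have "(\<Sum>u\<in>U. (c u * d u) *\<^sub>R X $ u) = 0" by simp
  then have "c u * d u = 0" using indep_rowsD[OF assms(1), of "\<lambda>u. c u * d u"] u by blast
  then show "c u = 0" using assms(2) by simp
qed

definition map_rows :: "(real^3 \<Rightarrow> real^3) \<Rightarrow> (real^3)^'n \<Rightarrow> (real^3)^'n::finite" where
  "map_rows T X = (\<chi> i. T (X $ i))"

lemma map_rows_nth [simp]: "map_rows T X $ i = T (X $ i)"
  by (simp add: map_rows_def)

lemma stresses_map_rows:
  fixes X :: "(real^3)^'n::finite"
  assumes T: "linear T" "linear S" "\<And>z. S (T z) = z"
  shows "stresses V E (map_rows T X) = stresses V E X"
proof -
  have "(w ** map_rows T X) $ i = T ((w ** X) $ i)" for w :: "real^'n^'n" and i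
    using T(1) by (simp add: matrix_mult_row linear_sum linear_scale)
  moreover have "T z = 0 \<longleftrightarrow> z = 0" for z using T by (metis linear_0)
  ultimately have "w ** map_rows T X = 0 \<longleftrightarrow> w ** X = 0" for w :: "real^'n^'n" by (simp add: vec_eq_iff[of "w ** _"])
  then show ?thesis unfolding stresses_def by simp
qed

lemma super_psd_map_rows:
  fixes X :: "(real^3)^'n::finite"
  assumes "super_psd V X w" and T: "linear T" "linear S" "\<And>z. S (T z) = z"
  shows "super_psd V (map_rows T X) w"
proof -
  have "\<exists>g. linear g \<and> (\<forall>i\<in>V. y $ i = g (map_rows T X $ i))"
    if f: "linear f" "\<forall>i\<in>V. y $ i = f (X $ i)" for f :: "real^3 \<Rightarrow> real" and y :: "real^'n"
  proof (intro exI conjI)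
    show "linear (f \<circ> S)" using f T by (intro linear_compose)
    show "\<forall>i\<in>V. y $ i = (f \<circ> S) (map_rows T X $ i)" using f(2) T(3) by simp
  qed
  then show ?thesis using assms(1) unfolding super_psd_def by blast
qed

lemma align_triples:
  fixes X Y :: "(real^3)^'n::finite"
  assumes "indep_rows U X" "indep_rows U Y" "card U = 3"
  obtains T S :: "real^3 \<Rightarrow> real^3" where "linear T" "linear S" "\<And>z. S (T z) = z" "\<And>z. T (S z) = z"
    "\<And>u. u \<in> U \<Longrightarrow> T (X $ u) = Y $ u"
proof -
  obtain T :: "real^3 \<Rightarrow> real^3" where T: "linear T" "\<And>u. u \<in> U \<Longrightarrow> T (X $ u) = Y $ u"
    using indep_functional[OF assms(1) finite, of "\<lambda>u. Y $ u"] by blast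
  obtain S :: "real^3 \<Rightarrow> real^3" where S: "linear S" "\<And>u. u \<in> U \<Longrightarrow> S (Y $ u) = X $ u"
    using indep_functional[OF assms(2) finite, of "\<lambda>u. X $ u"] by blast
  have "S \<circ> T = id"
    by (rule linear_eq_triple[OF assms(1) finite assms(3)]) (auto intro: linear_compose T S linear_id simp: T(2) S(2))
  moreover have "T \<circ> S = id"
    by (rule linear_eq_triple[OF assms(2) finite assms(3)]) (auto intro: linear_compose T S linear_id simp: T(2) S(2))
  ultimately show thesis using that[of T S] T S by (metis comp_apply id_apply)
qed

lemma stresses_mono: "E \<subseteq> E' \<Longrightarrow> stresses V E X \<subseteq> stresses V E' X"
  using stress_space_mono[of V V E E'] unfolding stresses_def by blast

text \<open>Exchanging one edge keeps the count, so a stress exists. With entry zero at the new edge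
  it would be a stress of E vanishing at x, y, hence a zero multiple of w. Normalized to one at z,
  c, it can cancel an unwanted entry there without touching x, y; if z, c is an edge anyway, the
  correction is zero.\<close>

lemma replacement_stress:
  fixes V :: "'n::finite set"
  assumes G: "framework_graph V E" and rs: "rigid_stress V E X w"
    and U: "indep_rows U X" "card U = 3" "U \<subseteq> V" and xy: "{x, y} \<in> E" "w $ x $ y \<noteq> 0"
    and zc: "z \<in> V" "c \<in> V" "z \<noteq> c" "{z, c} \<noteq> {x, y}"
  obtains \<omega> where "\<omega> \<in> stresses V (E - {{x, y}} \<union> {{z, c}}) X"
    "{z, c} \<notin> E \<Longrightarrow> \<omega> $ z $ c = 1" "{z, c} \<in> E \<Longrightarrow> \<omega> = 0" "\<omega> $ x $ y = 0"
proof (cases "{z, c} \<in> E")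
  case True
  have "0 \<in> stresses V (E - {{x, y}} \<union> {{z, c}}) X" using subspace_0[OF subspace_stresses] .
  then show thesis using that[of 0] True by simp
next
  case False
  let ?E = "E - {{x, y}} \<union> {{z, c}}"
  have fE: "finite E" by simp
  have "card (E - {{x, y}}) = card E - 1" "card E \<ge> 1" using xy(1) fE
    by (auto simp: Suc_le_eq card_gt_0_iff)
  then have "card ?E = card E" using False fE by simp
  then have G': "framework_graph V ?E" using G zc unfolding framework_graph_def by auto
  obtain \<omega> where \<omega>: "\<omega> \<in> stresses V ?E X" "\<omega> \<noteq> 0" using stress_exists[OF G' U] by blast
  note s = stress_spaceD[OF stressesD(1)[OF \<omega>(1)]]
  have "x \<noteq> y" using G xy(1) unfolding framework_graph_def by fastforce
  then have xy0: "\<omega> $ x $ y = 0" using s(4)[of x y] zc(4) by blast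
  have nz: "\<omega> $ z $ c \<noteq> 0"
  proof
    assume "\<omega> $ z $ c = 0"
    then have "\<omega> \<in> stress_space V (?E - {{z, c}})" using stress_space_remove[OF stressesD(1)[OF \<omega>(1)]] by blast
    moreover have "stress_space V (?E - {{z, c}}) \<subseteq> stress_space V E" by (rule stress_space_mono) auto
    ultimately have "\<omega> \<in> stresses V E X" using stressesD(2)[OF \<omega>(1)] unfolding stresses_def by blast
    then obtain k where "\<omega> = k *\<^sub>R w" using rs unfolding rigid_stress_def by blast
    then show False using xy0 xy(2) \<omega>(2) by simp
  qed
  have "(1 / \<omega> $ z $ c) *\<^sub>R \<omega> \<in> stresses V ?E X" using \<omega>(1) subspace_stresses subspace_scale by blast
  then show thesis using that[of "(1 / \<omega> $ z $ c) *\<^sub>R \<omega>"] False nz xy0 by simp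
qed

text \<open>
  The second framework is made to agree with the first one on \<open>x, y, c\<close> by a linear map, after
  scaling the row of \<open>c\<close> in the first one by a large factor and choosing the sign of the row of \<open>x\<close>,
  so that the positive semidefinite stress of the second framework dominates the corrections
  needed to cancel the entries of the triangle.
\<close>

lemma good_triangle_glue:
  fixes V1 V2 :: "'n::finite set"
  assumes G1: "framework_graph V1 E1" and good1: "good_at V1 E1 X10 w10"
    and G2: "framework_graph V2 E2" and good2: "good_at V2 E2 X20 w20"
    and V12: "V1 \<inter> V2 = {x, y, c}" and dist: "x \<noteq> y" "x \<noteq> c" "y \<noteq> c"
    and tri: "{x, y} \<in> E1" "{x, c} \<in> E1" "{y, c} \<in> E1" and xyE2: "{x, y} \<in> E2"
    and V: "V = V1 \<union> V2" and E: "E = (E1 - {{x, y}, {x, c}, {y, c}}) \<union> (E2 - {{x, y}})"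
  shows "\<exists>X w. good_at V E X w"
proof -
  let ?U = "{x, y, c}"
  have U3: "card ?U = 3" using dist by simp
  have UV: "?U \<subseteq> V1" "?U \<subseteq> V2" using V12 by auto
  obtain X1 w1 where 1: "good_at V1 E1 X1 w1" "indep_rows ?U X1"
    using good_at_perturb[OF G1 _ good1, of ?U] tri U3 by (metis empty_iff order_refl)
  obtain X2 w2 where 2: "good_at V2 E2 X2 w2" "indep_rows ?U X2"
    using good_at_perturb[OF G2 _ good2, of ?U] xyE2 U3 by (metis empty_iff order_refl)
  have rs1: "rigid_stress V1 E1 X1 w1" and nz1: "\<And>i j. {i, j} \<in> E1 \<Longrightarrow> w1 $ i $ j \<noteq> 0"
    using 1(1) unfolding good_at_def by auto
  have rs2: "rigid_stress V2 E2 X2 w2" and nz2: "\<And>i j. {i, j} \<in> E2 \<Longrightarrow> w2 $ i $ j \<noteq> 0"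
    using 2(1) unfolding good_at_def by auto
  have st2: "w2 \<in> stresses V2 E2 X2" "super_psd V2 X2 w2" "\<And>w'. w' \<in> stresses V2 E2 X2 \<Longrightarrow> \<exists>k. w' = k *\<^sub>R w2"
    using rs2 unfolding rigid_stress_def by auto
  note s2 = stress_spaceD[OF stressesD(1)[OF st2(1)]]
  have E1V: "e \<subseteq> V1" "card e = 2" if "e \<in> E1" for e using G1 that unfolding framework_graph_def by auto
  have E2V: "e \<subseteq> V2" "card e = 2" if "e \<in> E2" for e using G2 that unfolding framework_graph_def by auto
  have xy2: "w2 $ x $ y \<noteq> 0" using nz2[OF xyE2] .
  have pairs: "{x, c} \<noteq> {x, y}" "{y, c} \<noteq> {x, y}" "{x, c} \<noteq> {y, c}" using dist by (auto simp: doubleton_eq_iff)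
  obtain \<omega>x where \<omega>x: "\<omega>x \<in> stresses V2 (E2 - {{x, y}} \<union> {{x, c}}) X2"
    "{x, c} \<notin> E2 \<Longrightarrow> \<omega>x $ x $ c = 1" "{x, c} \<in> E2 \<Longrightarrow> \<omega>x = 0" "\<omega>x $ x $ y = 0"
    using replacement_stress[OF G2 rs2 2(2) U3 UV(2) xyE2 xy2 _ _ dist(2) pairs(1)] UV by auto
  obtain \<omega>y where \<omega>y: "\<omega>y \<in> stresses V2 (E2 - {{x, y}} \<union> {{y, c}}) X2"
    "{y, c} \<notin> E2 \<Longrightarrow> \<omega>y $ y $ c = 1" "{y, c} \<in> E2 \<Longrightarrow> \<omega>y = 0" "\<omega>y $ x $ y = 0"
    using replacement_stress[OF G2 rs2 2(2) U3 UV(2) xyE2 xy2 _ _ dist(3) pairs(2)] UV by auto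
  note sx = stress_spaceD[OF stressesD(1)[OF \<omega>x(1)]] and sy = stress_spaceD[OF stressesD(1)[OF \<omega>y(1)]]
  define p where "p = w1 $ x $ y"
  define q where "q = w1 $ x $ c"
  define r where "r = w1 $ y $ c"
  have p0: "p \<noteq> 0" using nz1 tri by (simp add: p_def)
  \<comment> \<open>Flipping row x by \<sigma> makes the entry of the first stress at x, y opposite
    in sign to that of \<open>w2\<close>; \<kappa> is the positive factor that then cancels
    it.\<close>
  define \<sigma> where "\<sigma> = - sgn (p * w2 $ x $ y)"
  have \<sigma>: "\<sigma> \<noteq> 0" "\<sigma> * \<sigma> = 1" using p0 xy2 by (auto simp: \<sigma>_def sgn_if)
  define \<kappa> where "\<kappa> = - \<sigma> * p / w2 $ x $ y"
  have \<kappa>: "\<kappa> > 0" using p0 xy2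
    by (auto simp: \<kappa>_def \<sigma>_def sgn_if zero_less_divide_iff zero_less_mult_iff divide_less_0_iff not_less)
  \<comment> \<open>\<open>M1\<close> collects the corrections at x, c and y, c; \<open>M2\<close>
    records the entries of the first stress at these positions. Both will be multiplied by
    h.\<close>
  define M1 where "M1 = (\<sigma> * q) *\<^sub>R \<omega>x + r *\<^sub>R \<omega>y"
  define M2 :: "real^'n^'n" where "M2 = (\<chi> i j. if {i, j} = {x, c} then \<sigma> * q else if {i, j} = {y, c} then r else 0)"
  define E2' where "E2' = E2 \<union> {{x, c}, {y, c}}"
  have sub2: "stresses V2 (E2 - {{x, y}} \<union> {{x, c}}) X2 \<subseteq> stresses V2 E2' X2"
    "stresses V2 (E2 - {{x, y}} \<union> {{y, c}}) X2 \<subseteq> stresses V2 E2' X2" "stresses V2 E2 X2 \<subseteq> stresses V2 E2' X2"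
    by (rule stresses_mono, (auto simp: E2'_def)[1])+
  have \<kappa>w2: "\<kappa> *\<^sub>R w2 \<in> stresses V2 E2' X2"
    using subspace_scale[OF subspace_stresses] st2(1) sub2(3) by blast
  have M1s: "M1 \<in> stresses V2 E2' X2"
    unfolding M1_def using subspace_stresses \<omega>x(1) \<omega>y(1) sub2 by (intro subspace_add subspace_scale) auto
  have "pos_def_on (V2 - ?U) w2" using super_psd_iff[OF 2(2) U3 UV(2) st2(1)] st2(2) by blast
  then have "pos_def_on (V2 - ?U) (\<kappa> *\<^sub>R w2)" using \<kappa> unfolding pos_def_on_def by (simp add: quadratic_scaleR)
  then obtain d1 where d1: "d1 > 0" "\<forall>w'. dist w' (\<kappa> *\<^sub>R w2) < d1 \<longrightarrow> pos_def_on (V2 - ?U) w'"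
    by (rule pos_def_on_open)
  obtain d2 where d2: "d2 > 0" "\<forall>w'. dist w' (\<kappa> *\<^sub>R w2) < d2 \<longrightarrow>
      (\<forall>i j. (\<kappa> *\<^sub>R w2) $ i $ j \<noteq> 0 \<longrightarrow> 0 < w' $ i $ j * (\<kappa> *\<^sub>R w2) $ i $ j)"
    by (rule entries_open)
  \<comment> \<open>So small that \<open>\<kappa> *\<^sub>R w2 - h *\<^sub>R M1\<close> stays
    positive definite off the triangle and that the final entries at edges of \<open>E2\<close>
    other than x, y keep the signs of \<open>w2\<close>.\<close>
  define h where "h = min (d1 / (2 * (norm M1 + 1))) (d2 / (2 * (norm (M2 - M1) + 1)))"
  have n0: "norm M1 + 1 > 0" "norm (M2 - M1) + 1 > 0" by (smt (verit) norm_ge_zero)+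
  have h0: "h > 0" using d1(1) d2(1) n0 by (simp add: h_def)
  have hM1: "norm (h *\<^sub>R M1) < d1"
  proof -
    have "norm (h *\<^sub>R M1) \<le> h * (norm M1 + 1)" using h0 by simp
    also have "\<dots> \<le> d1 / (2 * (norm M1 + 1)) * (norm M1 + 1)" using n0 by (intro mult_right_mono) (auto simp: h_def)
    also have "\<dots> = d1 / 2" using n0 by (simp add: field_simps)
    finally show ?thesis using d1(1) by simp
  qed
  have hM2: "norm (h *\<^sub>R (M2 - M1)) < d2"
  proof -
    have "norm (h *\<^sub>R (M2 - M1)) \<le> h * (norm (M2 - M1) + 1)" using h0 by simp
    also have "\<dots> \<le> d2 / (2 * (norm (M2 - M1) + 1)) * (norm (M2 - M1) + 1)"
      using n0 by (intro mult_right_mono) (auto simp: h_def)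
    also have "\<dots> = d2 / 2" using n0 by (simp add: field_simps)
    finally show ?thesis using d2(1) by simp
  qed
  define \<Psi> where "\<Psi> = \<kappa> *\<^sub>R w2 - h *\<^sub>R M1"
  have \<Psi>s: "\<Psi> \<in> stresses V2 E2' X2"
    unfolding \<Psi>_def by (rule subspace_diff[OF subspace_stresses \<kappa>w2 subspace_scale[OF subspace_stresses M1s]])
  note s\<Psi> = stress_spaceD[OF stressesD(1)[OF \<Psi>s]]
  have "pos_def_on (V2 - ?U) \<Psi>" using d1(2) hM1 by (simp add: \<Psi>_def dist_norm)
  then have \<Psi>p: "super_psd V2 X2 \<Psi>" using super_psd_iff[OF 2(2) U3 UV(2) \<Psi>s] by blast
  have signs: "0 < (\<Psi> $ i $ j + h * M2 $ i $ j) * (\<kappa> * w2 $ i $ j)" if "w2 $ i $ j \<noteq> 0" for i j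
  proof -
    have "dist (\<kappa> *\<^sub>R w2 + h *\<^sub>R (M2 - M1)) (\<kappa> *\<^sub>R w2) < d2" using hM2 by (simp add: dist_norm)
    then have "0 < (\<kappa> *\<^sub>R w2 + h *\<^sub>R (M2 - M1)) $ i $ j * (\<kappa> *\<^sub>R w2) $ i $ j"
      using d2(2)[rule_format, of "\<kappa> *\<^sub>R w2 + h *\<^sub>R (M2 - M1)" i j] that \<kappa> by simp
    moreover have "(\<kappa> *\<^sub>R w2 + h *\<^sub>R (M2 - M1)) $ i $ j = \<Psi> $ i $ j + h * M2 $ i $ j"
      by (simp add: \<Psi>_def algebra_simps)
    ultimately show ?thesis by simp
  qed
  \<comment> \<open>Multiplying row c by 1 / h multiplies the entries of the first stress at x, c
    and y, c by h; this is how the required corrections become small.\<close>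
  define d where "d i = (if i = x then \<sigma> else if i = c then 1 / h else 1)" for i
  have d0: "d i \<noteq> 0" for i using \<sigma> h0 by (simp add: d_def)
  define Y where "Y = scale_rows d X1"
  define wY where "wY = scale_stress d w1"
  have rsY: "rigid_stress V1 E1 Y wY" unfolding Y_def wY_def using rigid_stress_scale[OF rs1 d0] .
  have stY: "wY \<in> stresses V1 E1 Y" "super_psd V1 Y wY" "\<And>w'. w' \<in> stresses V1 E1 Y \<Longrightarrow> \<exists>k. w' = k *\<^sub>R wY"
    using rsY unfolding rigid_stress_def by auto
  note sY = stress_spaceD[OF stressesD(1)[OF stY(1)]]
  have indY: "indep_rows ?U Y" unfolding Y_def using indep_rows_scale[OF 1(2) d0] .
  have wYxy: "wY $ x $ y = \<sigma> * p" "wY $ x $ c = h * (\<sigma> * q)" "wY $ y $ c = h * r"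
    using \<sigma> dist h0 by (auto simp: wY_def d_def p_def q_def r_def field_simps)
  have wYnz: "wY $ i $ j \<noteq> 0" if "{i, j} \<in> E1" for i j using nz1[OF that] d0 by (simp add: wY_def)
  obtain T S :: "real^3 \<Rightarrow> real^3" where T: "linear T" "linear S" "\<And>z. S (T z) = z" "\<And>z. T (S z) = z"
    "\<And>u. u \<in> ?U \<Longrightarrow> T (X2 $ u) = Y $ u"
    by (rule align_triples[OF 2(2) indY U3]) blast
  define X where "X = (\<chi> i. if i \<in> V1 then Y $ i else T (X2 $ i))"
  have XV1: "X $ i = Y $ i" if "i \<in> V1" for i using that by (simp add: X_def)
  have XV2: "X $ i = map_rows T X2 $ i" if "i \<in> V2" for i
  proof (cases "i \<in> V1")
    case True
    then have "i \<in> ?U" using that V12 by blast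
    then show ?thesis using T(5) True by (simp add: X_def)
  qed (simp add: X_def)
  have stX1: "stresses V1 F X = stresses V1 F Y" for F using XV1 by (rule stresses_cong)
  have stX2: "stresses V2 F X = stresses V2 F X2" for F
    using stresses_cong[of V2 X "map_rows T X2" F] XV2 stresses_map_rows[OF T(1-3)] by metis
  have spX1: "super_psd V1 X wY" using super_psd_cong[of V1 X Y wY] XV1 stY(2) by blast
  have spX2: "super_psd V2 X \<Psi>"
    using super_psd_cong[of V2 X "map_rows T X2" \<Psi>] XV2 super_psd_map_rows[OF \<Psi>p T(1-3)] by blast
  have indX: "indep_rows ?U X" using indY XV1 UV by (subst indep_rows_cong[of _ X Y]) auto
  have kerY: "wY ** X = 0" "\<Psi> ** X = 0"
    using stressesD(2)[of wY V1 E1 X] stressesD(2)[of \<Psi> V2 E2' X] stY(1) stX1 \<Psi>s stX2 by auto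
  define w where "w = wY + \<Psi>"
  have wxy: "w $ x $ y = 0"
    using xy2 \<omega>x(4) \<omega>y(4) wYxy by (simp add: w_def \<Psi>_def M1_def \<kappa>_def)
  have wxc: "w $ x $ c = 0" if "{x, c} \<notin> E2"
  proof -
    have "w2 $ x $ c = 0" using s2(4)[of x c] that dist by blast
    moreover have "\<omega>y $ x $ c = 0" using sy(4)[of x c] that dist pairs by blast
    ultimately show ?thesis using \<omega>x(2)[OF that] wYxy by (simp add: w_def \<Psi>_def M1_def)
  qed
  have wyc: "w $ y $ c = 0" if "{y, c} \<notin> E2"
  proof -
    have "w2 $ y $ c = 0" using s2(4)[of y c] that dist by blast
    moreover have "\<omega>x $ y $ c = 0" using sx(4)[of y c] that dist pairs by blast
    ultimately show ?thesis using \<omega>y(2)[OF that] wYxy by (simp add: w_def \<Psi>_def M1_def)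
  qed
  have wsym: "w $ i $ j = w $ j $ i" for i j using sY(2)[of i j] s\<Psi>(2)[of i j] by (simp add: w_def)
  have xyE: "{x, y} \<notin> E" by (auto simp: E)
  have ws: "w \<in> stresses V E X"
    unfolding stresses_def mem_Collect_eq
  proof (rule conjI[OF stress_spaceI[OF wsym]])
    show "w ** X = 0" using kerY by (simp add: w_def matrix_mult_bilinear)
    fix i j assume nz: "w $ i $ j \<noteq> 0"
    then have "wY $ i $ j \<noteq> 0 \<or> \<Psi> $ i $ j \<noteq> 0" by (auto simp: w_def)
    then have "i \<in> V \<and> j \<in> V" using sY(3)[of i j] s\<Psi>(3)[of i j] V by blast
    moreover have "i = j \<or> {i, j} \<in> E"
    proof (rule ccontr)
      assume n: "\<not> (i = j \<or> {i, j} \<in> E)"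
      then have "{i, j} \<in> E1 \<or> {i, j} \<in> E2'"
        using sY(4)[of i j] s\<Psi>(4)[of i j] \<open>wY $ i $ j \<noteq> 0 \<or> \<Psi> $ i $ j \<noteq> 0\<close> by blast
      then have tri3: "{i, j} \<in> {{x, y}, {x, c}, {y, c}}" using n unfolding E E2'_def by blast
      have nE2: "{i, j} \<notin> E2 - {{x, y}}" using n unfolding E by blast
      have pw: "w $ i $ j = w $ k $ l" if "{i, j} = {k, l}" for k l
        using that wsym by (auto simp: doubleton_eq_iff)
      from tri3 consider "{i, j} = {x, y}" | "{i, j} = {x, c}" | "{i, j} = {y, c}" by blast
      then show False
      proof cases
        case 1
        then show False using pw[OF 1] wxy nz by simp
      next
        case 2
        then have "{x, c} \<notin> E2" using nE2 pairs by auto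
        then show False using pw[OF 2] wxc nz by simp
      next
        case 3
        then have "{y, c} \<notin> E2" using nE2 pairs by auto
        then show False using pw[OF 3] wyc nz by simp
      qed
    qed
    ultimately show "i \<in> V \<and> j \<in> V \<and> (i = j \<or> {i, j} \<in> E)" by blast
  qed
  have sp: "super_psd V X w"
    unfolding super_psd_def
  proof (intro conjI allI impI)
    fix y' :: "real^'n"
    have qq: "quadratic w y' = quadratic wY y' + quadratic \<Psi> y'" by (simp add: w_def quadratic_add)
    have q0: "0 \<le> quadratic wY y'" "0 \<le> quadratic \<Psi> y'" using spX1 spX2 unfolding super_psd_def by blast+
    show "0 \<le> quadratic w y'" using qq q0 by simp
    assume "quadratic w y' = 0"
    then have "quadratic wY y' = 0" "quadratic \<Psi> y' = 0" using qq q0 by linarith+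
    then obtain f g where f: "linear f" "\<forall>i\<in>V1. y' $ i = f (X $ i)" and g: "linear g" "\<forall>i\<in>V2. y' $ i = g (X $ i)"
      using spX1 spX2 unfolding super_psd_def by blast
    have "f = g"
    proof (rule linear_eq_triple[OF indX finite U3 f(1) g(1)])
      fix u assume "u \<in> ?U"
      then show "f (X $ u) = g (X $ u)" using f(2) g(2) UV by (metis subsetD)
    qed
    then show "\<exists>f. linear f \<and> (\<forall>i\<in>V. y' $ i = f (X $ i))" using f g V by blast
  qed
  have uniq: "\<exists>k. w' = k *\<^sub>R w" if w': "w' \<in> stresses V E X" for w'
  proof -
    note s' = stress_spaceD[OF stressesD(1)[OF w']]
    \<comment> \<open>\<tau> is the part of \<open>w'\<close> inside \<open>V2\<close> without the
      positions of the triangle. Its loads sit on the triangle and are resolved there by N, which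
      splits \<open>w'\<close> into a stress \<rho> of the first graph and a part inside
      \<open>V2\<close>.\<close>
    define \<tau> :: "real^'n^'n" where "\<tau> = (\<chi> i j. if i \<in> V2 \<and> j \<in> V2 \<and> \<not> (i \<in> ?U \<and> j \<in> ?U) then w' $ i $ j else 0)"
    have \<tau>sym: "transpose \<tau> = \<tau>" using s'(2) by (auto simp: \<tau>_def transpose_def vec_eq_iff)
    have V1only: "j \<in> V2" if "i \<in> V2" "i \<notin> ?U" "w' $ i $ j \<noteq> 0" for i j
    proof (cases "i = j")
      case False
      then have "{i, j} \<in> E" using s'(4) that by blast
      moreover have "i \<notin> V1" using that V12 by blast
      then have "{i, j} \<notin> E1" using E1V by blast
      ultimately have "{i, j} \<in> E2" by (auto simp: E)
      then show ?thesis using E2V by blast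
    qed (use that in simp)
    have \<tau>0: "(\<tau> ** X) $ i = 0" if "i \<notin> ?U" for i
    proof (cases "i \<in> V2")
      case True
      have "\<tau> $ i $ j = w' $ i $ j" for j using True that V1only by (auto simp: \<tau>_def)
      then show ?thesis using stress_row[OF w'] by (simp add: matrix_mult_row)
    next
      case False
      then show ?thesis by (simp add: \<tau>_def matrix_mult_row)
    qed
    obtain N where N: "transpose N = N" "\<And>i j. N $ i $ j \<noteq> 0 \<Longrightarrow> i \<in> ?U \<and> j \<in> ?U" "(\<tau> + N) ** X = 0"
      by (rule load_resolution[OF indX U3 \<tau>sym \<tau>0]) (assumption, rule that, assumption, blast, assumption)
    define \<rho> where "\<rho> = w' - (\<tau> + N)"
    have \<rho>e: "\<rho> $ i $ j = w' $ i $ j - \<tau> $ i $ j - N $ i $ j" for i j by (simp add: \<rho>_def)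
    have Utri: "i = j \<or> {i, j} \<in> E1" if "i \<in> ?U" "j \<in> ?U" for i j
      using that tri by (auto simp: insert_commute)
    have "\<rho> \<in> stresses V1 E1 X"
      unfolding stresses_def mem_Collect_eq
    proof (rule conjI[OF stress_spaceI])
      show "\<rho> ** X = 0" using N(3) stressesD(2)[OF w'] by (simp add: \<rho>_def matrix_mult_bilinear)
      fix i j
      show "\<rho> $ i $ j = \<rho> $ j $ i"
        using s'(2)[of i j] symmetric_nth[OF \<tau>sym, of i j] symmetric_nth[OF N(1), of i j] by (simp add: \<rho>e)
      assume nz: "\<rho> $ i $ j \<noteq> 0"
      show "i \<in> V1 \<and> j \<in> V1 \<and> (i = j \<or> {i, j} \<in> E1)"
      proof (cases "i \<in> ?U \<and> j \<in> ?U")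
        case True
        then show ?thesis using Utri UV by blast
      next
        case False
        then have N0: "N $ i $ j = 0" using N(2) by blast
        then have w'nz: "w' $ i $ j \<noteq> 0" and nV2: "\<not> (i \<in> V2 \<and> j \<in> V2)" using nz False by (auto simp: \<rho>e \<tau>_def split: if_splits)
        have "i = j \<or> {i, j} \<in> E" using s'(4) w'nz by blast
        moreover have "{i, j} \<notin> E2" using E2V nV2 by blast
        ultimately have a: "i = j \<or> {i, j} \<in> E1" by (auto simp: E)
        moreover have "i \<in> V \<and> j \<in> V" using s'(3) w'nz by blast
        ultimately show ?thesis using E1V[of "{i, j}"] nV2 V by blast
      qed
    qed
    then obtain k where k: "\<rho> = k *\<^sub>R wY" using stY(3) stX1 by blast
    \<comment> \<open>What remains is a stress of the second graph that vanishes at x, y, where the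
      glued graph has no edge; as a multiple of \<open>w2\<close> it is zero.\<close>
    define \<delta> where "\<delta> = w' - k *\<^sub>R w"
    have \<delta>eq: "\<delta> = \<tau> + N - k *\<^sub>R \<Psi>" using k by (simp add: \<delta>_def \<rho>_def w_def algebra_simps)
    have \<delta>V2: "i \<in> V2 \<and> j \<in> V2" if "\<delta> $ i $ j \<noteq> 0" for i j
    proof -
      have "\<tau> $ i $ j \<noteq> 0 \<or> N $ i $ j \<noteq> 0 \<or> \<Psi> $ i $ j \<noteq> 0" using that by (auto simp: \<delta>eq)
      then show ?thesis using N(2)[of i j] s\<Psi>(3)[of i j] UV by (auto simp: \<tau>_def split: if_splits)
    qed
    have \<delta>s: "\<delta> \<in> stresses V E X"
      unfolding \<delta>_def using w' ws subspace_stresses by (intro subspace_diff subspace_scale) auto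
    note sd = stress_spaceD[OF stressesD(1)[OF \<delta>s]]
    have "\<delta> \<in> stress_space V2 (E2 - {{x, y}})"
    proof (rule stress_spaceI)
      show "\<delta> $ i $ j = \<delta> $ j $ i" for i j by (rule sd(2))
      fix i j assume nz: "\<delta> $ i $ j \<noteq> 0"
      have "{i, j} \<notin> E1 - {{x, y}, {x, c}, {y, c}}" if "i \<noteq> j"
      proof
        assume e: "{i, j} \<in> E1 - {{x, y}, {x, c}, {y, c}}"
        then have "i \<in> ?U" "j \<in> ?U" using E1V(1)[of "{i, j}"] \<delta>V2[OF nz] V12 by blast+
        then show False using e that by (auto simp: insert_commute)
      qed
      then have "i = j \<or> {i, j} \<in> E2 - {{x, y}}" using sd(4)[OF nz] by (auto simp: E)
      then show "i \<in> V2 \<and> j \<in> V2 \<and> (i = j \<or> {i, j} \<in> E2 - {{x, y}})" using \<delta>V2[OF nz] by blast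
    qed
    moreover have "stress_space V2 (E2 - {{x, y}}) \<subseteq> stress_space V2 E2" by (rule stress_space_mono) auto
    ultimately have "\<delta> \<in> stresses V2 E2 X" using stressesD(2)[OF \<delta>s] unfolding stresses_def by blast
    then obtain l where l: "\<delta> = l *\<^sub>R w2" using st2(3) stX2 by blast
    have "\<delta> $ x $ y = 0" using sd(4)[of x y] dist(1) xyE by blast
    then have "l = 0" using l xy2 by simp
    then have "w' = k *\<^sub>R w" using l by (simp add: \<delta>_def)
    then show ?thesis by blast
  qed
  have nzE: "w $ i $ j \<noteq> 0" if ij: "{i, j} \<in> E" for i j
  proof (cases "{i, j} \<in> E2 - {{x, y}}")
    case True
    then have e: "{i, j} \<in> E2" "{i, j} \<noteq> {x, y}" by auto
    have ne: "i \<noteq> j" using E2V(2)[OF e(1)] by fastforce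
    have "wY $ i $ j = h * M2 $ i $ j"
    proof (cases "{i, j} = {x, c} \<or> {i, j} = {y, c}")
      case True
      then show ?thesis
      proof
        assume "{i, j} = {x, c}"
        then have "i = x \<and> j = c \<or> i = c \<and> j = x" by (auto simp: doubleton_eq_iff)
        then show ?thesis using wYxy sY(2)[of c x] \<open>{i, j} = {x, c}\<close> by (auto simp: M2_def)
      next
        assume a: "{i, j} = {y, c}"
        then have "i = y \<and> j = c \<or> i = c \<and> j = y" by (auto simp: doubleton_eq_iff)
        then show ?thesis using wYxy sY(2)[of c y] a pairs by (auto simp: M2_def)
      qed
    next
      case False
      have "wY $ i $ j = 0"
      proof (rule ccontr)
        assume "wY $ i $ j \<noteq> 0"
        then have "i \<in> ?U" "j \<in> ?U" using sY(3)[of i j] E2V(1)[OF e(1)] V12 by blast+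
        then show False using False e ne by (auto simp: insert_commute)
      qed
      then show ?thesis using False by (simp add: M2_def)
    qed
    then have "w $ i $ j = \<Psi> $ i $ j + h * M2 $ i $ j" by (simp add: w_def)
    then show ?thesis using signs[OF nz2[OF e(1)]] by auto
  next
    case False
    then have e: "{i, j} \<in> E1" "{i, j} \<notin> {{x, y}, {x, c}, {y, c}}" using ij by (auto simp: E)
    have ne: "i \<noteq> j" using E1V(2)[OF e(1)] by fastforce
    have "\<Psi> $ i $ j = 0"
    proof (rule ccontr)
      assume "\<Psi> $ i $ j \<noteq> 0"
      then have "i \<in> ?U" "j \<in> ?U" using s\<Psi>(3)[of i j] E1V(1)[OF e(1)] V12 by blast+
      then show False using e ne by (auto simp: insert_commute)
    qed
    then show ?thesis using wYnz[OF e(1)] by (simp add: w_def)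
  qed
  have "rigid_stress V E X w" using ws sp uniq unfolding rigid_stress_def by blast
  moreover have "?U \<subseteq> V" using UV V by blast
  ultimately have "good_at V E X w" using indX U3 nzE unfolding good_at_def by blast
  then show ?thesis by blast
qed

theorem three_connected_circuit_good:
  fixes V :: "'n::finite set"
  assumes "circuit V E" "three_connected V E"
  shows "\<exists>X w. good_at V E X w"
  using assms
proof (induction "card V" arbitrary: V E rule: less_induct)
  case less
  interpret circuit V E by fact
  have fw: "framework_graph V' E'" if "circuit V' E'" for V' :: "'n set" and E'
  proof -
    interpret c: circuit V' E' by fact
    show ?thesis unfolding framework_graph_def using c.edge c.card_E by auto
  qed
  show ?case
  proof (cases "card V = 4")
    case True
    then show ?thesis using complete_four_good complete_four by blast
  next
    case False
    then have n: "5 \<le> card V" using card_V4 by simp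
    show ?thesis
    proof (rule three_connected_reduction[OF less.prems(2) n])
      fix v a b c assume v: "v \<in> V" "neighbors E v = {a, b, c}" "a \<noteq> b" "a \<noteq> c" "b \<noteq> c"
        and c': "circuit (V - {v}) (insert {a, b} {f \<in> E. v \<notin> f})"
        "three_connected (V - {v}) (insert {a, b} {f \<in> E. v \<notin> f})" and ab: "{a, b} \<notin> E"
      have "card (V - {v}) < card V" using v(1) finite_V by (intro psubset_card_mono) auto
      then obtain X w where g: "good_at (V - {v}) (insert {a, b} {f \<in> E. v \<notin> f}) X w"
        using less.hyps[OF _ c'] by blast
      have cV: "c \<in> V - {v}" using nbr_subset[of v] v(2) by blast
      have Eeq: "E = (insert {a, b} {f \<in> E. v \<notin> f} - {{a, b}}) \<union> {{v, a}, {v, b}, {v, c}}"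
      proof -
        have "{v, u} \<in> E" if "u \<in> {a, b, c}" for u
          using that v(2) unfolding neighbors_def by (metis (mono_tags, lifting) insert_commute mem_Collect_eq)
        moreover have "f \<in> {{v, a}, {v, b}, {v, c}}" if f: "f \<in> E" "v \<in> f" for f
        proof -
          obtain u where "f = {u, v}" "u \<in> {a, b, c}" using edge_pair[OF f] v(2) by metis
          then show ?thesis by (auto simp: insert_commute)
        qed
        ultimately show ?thesis using ab by blast
      qed
      have "V = insert v (V - {v})" "v \<notin> V - {v}" using v(1) by auto
      then show ?thesis
        by (rule good_extension[OF fw[OF c'(1)] g insertI1 cV v(3-5) _ _ Eeq fw[OF less.prems(1)], rotated])
    next
      fix B x y c assume B: "{x, y, c} \<subseteq> B" "x \<noteq> y" "x \<noteq> c" "y \<noteq> c" "{x, y} \<notin> E" "B \<subset> V"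
        and cB: "circuit B (insert {x, y} (induced E B))" "three_connected B (insert {x, y} (induced E B))"
        and c0: "circuit ((V - B) \<union> {x, y, c}) ((E - induced E B) \<union> {{x, y}, {x, c}, {y, c}})"
        "three_connected ((V - B) \<union> {x, y, c}) ((E - induced E B) \<union> {{x, y}, {x, c}, {y, c}})"
        and small: "card ((V - B) \<union> {x, y, c}) < card V"
      have "card B < card V" using B(6) finite_V by (rule psubset_card_mono[rotated])
      then obtain XB wB where gB: "good_at B (insert {x, y} (induced E B)) XB wB" using less.hyps[OF _ cB] by blast
      obtain X0 w0 where g0: "good_at ((V - B) \<union> {x, y, c}) ((E - induced E B) \<union> {{x, y}, {x, c}, {y, c}}) X0 w0"
        using less.hyps[OF small c0] by blast
      have Veq: "V = ((V - B) \<union> {x, y, c}) \<union> B" using B by blast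
      have I: "((V - B) \<union> {x, y, c}) \<inter> B = {x, y, c}" using B by blast
      have "{x, c} \<notin> E - induced E B" "{y, c} \<notin> E - induced E B" "{x, y} \<notin> induced E B"
        using B by (auto simp: induced_def)
      then have Eeq: "E = ((E - induced E B) \<union> {{x, y}, {x, c}, {y, c}} - {{x, y}, {x, c}, {y, c}}) \<union>
          (insert {x, y} (induced E B) - {{x, y}})"
        using B(5) by (auto simp: induced_def)
      show ?thesis
        by (rule good_triangle_glue[OF fw[OF c0(1)] g0 fw[OF cB(1)] gB I B(2-4) _ _ _ _ Veq Eeq]) auto
    qed
  qed
qed

text \<open>
  Gluing along an edge needs the two entries at this edge to cancel for all nearby configurations,
  so the sign pattern of the stress, that of \<open>w0\<close>, has to be locally constant.
\<close>

definition robust_psd :: "'n::finite set \<Rightarrow> 'n set set \<Rightarrow> bool" where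
  "robust_psd V E \<longleftrightarrow> (\<exists>(X::(real^3)^'n) w0 d. d > 0 \<and> (\<forall>X'. dist X' X < d \<longrightarrow>
     (\<exists>w\<in>stresses V E X'. (\<forall>y. 0 \<le> quadratic w y) \<and> (\<forall>i j. {i, j} \<in> E \<longrightarrow> 0 < w $ i $ j * w0 $ i $ j))))"

lemma good_imp_robust_psd:
  assumes "framework_graph V E" "E \<noteq> {}" "good_at V E X w"
  shows "robust_psd V E"
proof -
  obtain d where d: "d > 0" "\<forall>X'. dist X' X < d \<longrightarrow>
    (\<exists>w'. good_at V E X' w' \<and> (\<forall>i j. w $ i $ j \<noteq> 0 \<longrightarrow> 0 < w' $ i $ j * w $ i $ j))"
    by (rule good_at_nearby[OF assms])
  have nz: "w $ i $ j \<noteq> 0" if "{i, j} \<in> E" for i j using assms(3) that unfolding good_at_def by blast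
  have "\<exists>w'\<in>stresses V E X'. (\<forall>y. 0 \<le> quadratic w' y) \<and> (\<forall>i j. {i, j} \<in> E \<longrightarrow> 0 < w' $ i $ j * w $ i $ j)"
    if X': "dist X' X < d" for X'
  proof -
    obtain w' where "good_at V E X' w'" "\<forall>i j. w $ i $ j \<noteq> 0 \<longrightarrow> 0 < w' $ i $ j * w $ i $ j" using d X' by blast
    then show ?thesis using nz unfolding good_at_def rigid_stress_def super_psd_def by blast
  qed
  then show ?thesis using d(1) unfolding robust_psd_def by blast
qed

lemma row_le_dist:
  fixes X X' :: "(real^3)^'n::finite"
  assumes "\<And>i. norm (Y' $ i - Y $ i) \<le> B * norm (X' $ i - X $ i)" "B \<ge> 0"
  shows "dist Y' Y \<le> B * dist X' X"
proof -
  have "norm (Y' - Y) \<le> norm (B *\<^sub>R (X' - X))"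
  proof (rule norm_le_componentwise_cart)
    show "norm ((Y' - Y) $ i) \<le> norm ((B *\<^sub>R (X' - X)) $ i)" for i
      using assms by simp
  qed
  then show ?thesis using assms(2) by (simp add: dist_norm)
qed

text \<open>After a perturbation the rows of x and y are independent in both configurations and can
  be matched by an invertible linear map. A configuration near the glued one restricts to
  \<open>V1\<close> and \<open>V2\<close> close to the given ones, which yields two positive
  semidefinite stresses. With row x reversed in the second if necessary, their entries at x, y have
  opposite signs, and a positive combination cancels them.\<close>

lemma robust_psd_two_sum:
  fixes V1 V2 :: "'n::finite set"
  assumes r1: "robust_psd V1 E1" and r2: "robust_psd V2 E2"
    and E1: "\<And>e. e \<in> E1 \<Longrightarrow> e \<subseteq> V1 \<and> card e = 2" and E2: "\<And>e. e \<in> E2 \<Longrightarrow> e \<subseteq> V2 \<and> card e = 2"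
    and V12: "V1 \<inter> V2 = {x, y}" and xy: "x \<noteq> y" "{x, y} \<in> E1" "{x, y} \<in> E2"
  shows "robust_psd (V1 \<union> V2) ((E1 \<union> E2) - {{x, y}})"
proof -
  obtain X10 :: "(real^3)^'n" and w1 d10 where 10: "d10 > 0" "\<forall>X'. dist X' X10 < d10 \<longrightarrow>
     (\<exists>w\<in>stresses V1 E1 X'. (\<forall>y. 0 \<le> quadratic w y) \<and> (\<forall>i j. {i, j} \<in> E1 \<longrightarrow> 0 < w $ i $ j * w1 $ i $ j))"
    using r1 unfolding robust_psd_def by metis
  obtain X20 :: "(real^3)^'n" and w2 d20 where 20: "d20 > 0" "\<forall>X'. dist X' X20 < d20 \<longrightarrow>
     (\<exists>w\<in>stresses V2 E2 X'. (\<forall>y. 0 \<le> quadratic w y) \<and> (\<forall>i j. {i, j} \<in> E2 \<longrightarrow> 0 < w $ i $ j * w2 $ i $ j))"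
    using r2 unfolding robust_psd_def by metis
  have c3: "card {x, y} \<le> 3" using xy by simp
  have cy: "finite {x, y}" by simp
  obtain X1 where X1: "dist X1 X10 < d10 / 2" "indep_rows {x, y} X1"
    using indep_rows_perturb[OF cy c3, of "d10 / 2" X10] 10(1) by auto
  obtain X2 where X2: "dist X2 X20 < d20 / 2" "indep_rows {x, y} X2"
    using indep_rows_perturb[OF cy c3, of "d20 / 2" X20] 20(1) by auto
  define d1 where "d1 = d10 / 2"
  define d2 where "d2 = d20 / 2"
  have dpos: "d1 > 0" "d2 > 0" using 10(1) 20(1) by (auto simp: d1_def d2_def)
  have near1: "\<exists>w\<in>stresses V1 E1 X'. (\<forall>y. 0 \<le> quadratic w y) \<and> (\<forall>i j. {i, j} \<in> E1 \<longrightarrow> 0 < w $ i $ j * w1 $ i $ j)"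
    if "dist X' X1 < d1" for X'
  proof -
    have "dist X' X10 \<le> dist X' X1 + dist X1 X10" by (rule dist_triangle)
    then have "dist X' X10 < d10" using that X1(1) by (simp add: d1_def)
    then show ?thesis using 10(2) by blast
  qed
  have near2: "\<exists>w\<in>stresses V2 E2 X'. (\<forall>y. 0 \<le> quadratic w y) \<and> (\<forall>i j. {i, j} \<in> E2 \<longrightarrow> 0 < w $ i $ j * w2 $ i $ j)"
    if "dist X' X2 < d2" for X'
  proof -
    have "dist X' X20 \<le> dist X' X2 + dist X2 X20" by (rule dist_triangle)
    then have "dist X' X20 < d20" using that X2(1) by (simp add: d2_def)
    then show ?thesis using 20(2) by blast
  qed
  define \<sigma> where "\<sigma> = - sgn (w1 $ x $ y * w2 $ x $ y)"
  have w1xy: "w1 $ x $ y \<noteq> 0"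
  proof -
    obtain w where "\<forall>i j. {i, j} \<in> E1 \<longrightarrow> 0 < w $ i $ j * w1 $ i $ j" using near1[of X1] dpos by auto
    then have "0 < w $ x $ y * w1 $ x $ y" using xy by blast
    then show ?thesis by auto
  qed
  have w2xy: "w2 $ x $ y \<noteq> 0"
  proof -
    obtain w where "\<forall>i j. {i, j} \<in> E2 \<longrightarrow> 0 < w $ i $ j * w2 $ i $ j" using near2[of X2] dpos by auto
    then have "0 < w $ x $ y * w2 $ x $ y" using xy by blast
    then show ?thesis by auto
  qed
  have \<sigma>: "\<sigma> \<noteq> 0" "\<sigma> * \<sigma> = 1" "\<bar>\<sigma>\<bar> = 1" using w1xy w2xy by (auto simp: \<sigma>_def sgn_if)
  define e where "e i = (if i = x then \<sigma> else 1)" for i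
  have e: "e i \<noteq> 0" "e i * e i = 1" "\<bar>e i\<bar> = 1" for i using \<sigma> by (auto simp: e_def)
  
  define Y1 where "Y1 = scale_rows e X1"
  have Y1: "indep_rows {x, y} Y1" unfolding Y1_def using indep_rows_scale[OF X1(2) e(1)] .
  \<comment> \<open>Only two rows are prescribed; the vectors \<open>z2\<close> and
    \<open>z1\<close> outside the spans complete them to bases and make the map invertible.\<close>
  obtain T S :: "real^3 \<Rightarrow> real^3" where T: "linear T" "linear S" "\<And>z. S (T z) = z" "\<And>z. T (S z) = z"
    "T (X2 $ x) = Y1 $ x" "T (X2 $ y) = Y1 $ y"
  proof -
    note i2 = indep_rows_independent[OF X2(2) finite] and i1 = indep_rows_independent[OF Y1 finite]
    obtain h :: "real^3 \<Rightarrow> real^3" where h: "linear h" "h (X2 $ x) = Y1 $ x" "h (X2 $ y) = Y1 $ y"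
      "inj_on h (span (($) X2 ` {x, y}))"
    proof -
      obtain h :: "real^3 \<Rightarrow> real^3" where h: "linear h" "\<And>u. u \<in> {x, y} \<Longrightarrow> h (X2 $ u) = Y1 $ u"
        using indep_functional[OF X2(2) finite, of "\<lambda>u. Y1 $ u"] by blast
      obtain k :: "real^3 \<Rightarrow> real^3" where k: "linear k" "\<And>u. u \<in> {x, y} \<Longrightarrow> k (Y1 $ u) = X2 $ u"
        using indep_functional[OF Y1 finite, of "\<lambda>u. X2 $ u"] by blast
      have "k (h v) = v" if "v \<in> span (($) X2 ` {x, y})" for v
      proof -
        have "(k \<circ> h) v = id v"
          by (rule linear_eq_on[OF linear_compose[OF h(1) k(1)] linear_id that]) (use h k in auto)
        then show ?thesis by simp
      qed
      then have "inj_on h (span (($) X2 ` {x, y}))" by (metis inj_onI)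
      then show thesis using that[OF h(1)] h(2) by blast
    qed
    have fin: "finite (($) X2 ` {x, y})" "finite (($) Y1 ` {x, y})" by auto
    have card2: "card (($) X2 ` {x, y}) = 2" "card (($) Y1 ` {x, y}) = 2"
      using card_image[OF i2(1)] card_image[OF i1(1)] xy by simp_all
    obtain z2 where z2: "z2 \<notin> span (($) X2 ` {x, y})"
      using near_outside_span[OF fin(1) _ zero_less_one, of 0] card2 by auto
    obtain z1 where z1: "z1 \<notin> span (($) Y1 ` {x, y})"
      using near_outside_span[OF fin(2) _ zero_less_one, of 0] card2 by auto
    have ind2: "independent (insert z2 (($) X2 ` {x, y}))" using z2 i2(2) by (rule independent_insertI)
    have ind1: "independent (insert z1 (($) Y1 ` {x, y}))" using z1 i1(2) by (rule independent_insertI)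
    have span2: "span (insert z2 (($) X2 ` {x, y})) = UNIV"
    proof -
      have "card (insert z2 (($) X2 ` {x, y})) = 3" using card2 fin z2 span_base[of z2] by (subst card_insert_disjoint) auto
      then show ?thesis using card_ge_dim_independent[OF subset_UNIV ind2] by auto
    qed
    have span1: "span (insert z1 (($) Y1 ` {x, y})) = UNIV"
    proof -
      have "card (insert z1 (($) Y1 ` {x, y})) = 3" using card2 fin z1 span_base[of z1] by (subst card_insert_disjoint) auto
      then show ?thesis using card_ge_dim_independent[OF subset_UNIV ind1] by auto
    qed
    have ne2: "z2 \<noteq> X2 $ x" "z2 \<noteq> X2 $ y" using z2 by (auto intro: span_base)
    have ne1: "z1 \<noteq> Y1 $ x" "z1 \<noteq> Y1 $ y" using z1 by (auto intro: span_base)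
    have nex: "X2 $ x \<noteq> X2 $ y" "Y1 $ x \<noteq> Y1 $ y" using i2(1) i1(1) xy unfolding inj_on_def by blast+
    have "\<exists>T. linear T \<and> (\<forall>v\<in>insert z2 (($) X2 ` {x, y}). T v = (if v = z2 then z1 else if v = X2 $ x then Y1 $ x else Y1 $ y))"
      by (rule linear_independent_extend[OF ind2])
    then obtain T where T0: "linear T" "\<forall>v\<in>insert z2 (($) X2 ` {x, y}). T v = (if v = z2 then z1 else if v = X2 $ x then Y1 $ x else Y1 $ y)" by auto
    have "\<exists>S. linear S \<and> (\<forall>v\<in>insert z1 (($) Y1 ` {x, y}). S v = (if v = z1 then z2 else if v = Y1 $ x then X2 $ x else X2 $ y))"
      by (rule linear_independent_extend[OF ind1])
    then obtain S where S0: "linear S" "\<forall>v\<in>insert z1 (($) Y1 ` {x, y}). S v = (if v = z1 then z2 else if v = Y1 $ x then X2 $ x else X2 $ y)" by auto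
    have Tv: "T z2 = z1" "T (X2 $ x) = Y1 $ x" "T (X2 $ y) = Y1 $ y" using T0(2) ne2 nex by auto
    have Sv: "S z1 = z2" "S (Y1 $ x) = X2 $ x" "S (Y1 $ y) = X2 $ y" using S0(2) ne1 nex by auto
    have "S (T v) = v" for v
    proof -
      have "(S \<circ> T) v = id v"
        by (rule linear_eq_on[OF linear_compose[OF T0(1) S0(1)] linear_id, of v "insert z2 (($) X2 ` {x, y})"])
          (use span2 Tv Sv in auto)
      then show ?thesis by simp
    qed
    moreover have "T (S v) = v" for v
    proof -
      have "(T \<circ> S) v = id v"
        by (rule linear_eq_on[OF linear_compose[OF S0(1) T0(1)] linear_id, of v "insert z1 (($) Y1 ` {x, y})"])
          (use span1 Tv Sv in auto)
      then show ?thesis by simp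
    qed
    ultimately show thesis using that[OF T0(1) S0(1)] Tv by blast
  qed
  define X where "X = (\<chi> i. if i \<in> V1 then X1 $ i else T (X2 $ i))"
  obtain B where B: "B > 0" "\<And>v. norm (S v) \<le> B * norm v"
    using linear_bounded_pos[OF T(2)] by blast
  define d where "d = min d1 (d2 / B)"
  \<comment> \<open>The common sign pattern; on the second part the reversal of row x has to be
    taken into account.\<close>
  define w0 :: "real^'n^'n" where "w0 = (\<chi> i j. if {i, j} \<in> E1 then w1 $ i $ j else w2 $ i $ j * (e i * e j))"
  have main: "\<exists>w\<in>stresses (V1 \<union> V2) ((E1 \<union> E2) - {{x, y}}) X'. (\<forall>y. 0 \<le> quadratic w y) \<and>
      (\<forall>i j. {i, j} \<in> (E1 \<union> E2) - {{x, y}} \<longrightarrow> 0 < w $ i $ j * w0 $ i $ j)"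
    if X': "dist X' X < d" for X'
  proof -
    \<comment> \<open>Robustness speaks of whole configurations. Rows outside \<open>V1\<close> are
      copied from \<open>X1\<close>, where they add no distance; stresses on \<open>V1\<close> do
      not see them.\<close>
    define A1 where "A1 = (\<chi> i. if i \<in> V1 then X' $ i else X1 $ i)"
    have "dist A1 X1 \<le> 1 * dist X' X"
      by (rule row_le_dist) (auto simp: A1_def X_def)
    then have "dist A1 X1 < d1" using X' by (simp add: d_def)
    then obtain wa where wa: "wa \<in> stresses V1 E1 A1" "\<forall>y. 0 \<le> quadratic wa y"
      "\<forall>i j. {i, j} \<in> E1 \<longrightarrow> 0 < wa $ i $ j * w1 $ i $ j" using near1 by blast
    have wa1: "wa \<in> stresses V1 E1 X'" using wa(1) stresses_cong[of V1 A1 X' E1] by (simp add: A1_def)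
    define A2 where "A2 = (\<chi> i. if i \<in> V2 then e i *\<^sub>R S (X' $ i) else X2 $ i)"
    have SX: "e i *\<^sub>R S (X $ i) = X2 $ i" if "i \<in> V2" for i
    proof (cases "i \<in> V1")
      case True
      then have ixy: "i = x \<or> i = y" using that V12 by auto
      have "X2 $ i = S (Y1 $ i)" using ixy T(3)[of "X2 $ i"] T(5,6) by auto
      also have "\<dots> = e i *\<^sub>R S (X1 $ i)" using T(2) by (simp add: Y1_def linear_scale)
      finally show ?thesis using True by (simp add: X_def)
    next
      case False
      then have "i \<noteq> x" using V12 by auto
      then show ?thesis using False T(3) by (simp add: X_def e_def)
    qed
    have "dist A2 X2 \<le> B * dist X' X"
    proof (rule row_le_dist)
      show "norm (A2 $ i - X2 $ i) \<le> B * norm (X' $ i - X $ i)" for i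
      proof (cases "i \<in> V2")
        case True
        have "A2 $ i - X2 $ i = e i *\<^sub>R S (X' $ i - X $ i)"
          using SX[OF True, symmetric] True T(2) by (simp add: A2_def linear_diff scaleR_diff_right)
        then show ?thesis using B(2) e(3) by simp
      next
        case False
        then show ?thesis using B(1) by (simp add: A2_def)
      qed
    qed (use B in simp)
    also have "\<dots> < d2" using X' B(1) by (simp add: d_def field_simps)
    finally obtain wb where wb: "wb \<in> stresses V2 E2 A2" "\<forall>y. 0 \<le> quadratic wb y"
      "\<forall>i j. {i, j} \<in> E2 \<longrightarrow> 0 < wb $ i $ j * w2 $ i $ j" using near2 by blast
    define wc where "wc = scale_stress e wb"
    have "wc \<in> stresses V2 E2 (scale_rows e A2)" unfolding wc_def by (rule scale_stress_stresses[OF wb(1) e(1)])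
    moreover have "stresses V2 E2 (scale_rows e A2) = stresses V2 E2 (map_rows S X')"
      using e(2) by (intro stresses_cong) (simp add: A2_def)
    ultimately have wc1: "wc \<in> stresses V2 E2 X'" using stresses_map_rows[OF T(2,1,4)] by metis
    have wcp: "0 \<le> quadratic wc y" for y using wb(2) unfolding wc_def quadratic_scale by blast
    have ee: "e i * e j * (e i * e j) = 1" for i j using e(2)[of i] e(2)[of j] by (metis mult.assoc mult.left_commute mult_1)
    have wce: "wc $ i $ j = wb $ i $ j * (e i * e j)" for i j
      using ee[of i j] e(1)[of i] e(1)[of j] by (simp add: wc_def field_simps)
    have exy: "e x * e y = \<sigma>" using xy by (simp add: e_def)
    define k where "k = - wa $ x $ y / wc $ x $ y"
    have pos: "0 < wa $ x $ y * w1 $ x $ y" "0 < wb $ x $ y * w2 $ x $ y" using wa(3) wb(3) xy by blast+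
    have wcxy: "wc $ x $ y = \<sigma> * wb $ x $ y" using wce[of x y] exy by simp
    have nzc: "wc $ x $ y \<noteq> 0" using wcxy pos(2) \<sigma>(1) by auto
    have k: "k > 0"
    proof -
      have "0 < (wa $ x $ y * w1 $ x $ y) * (wb $ x $ y * w2 $ x $ y)" using pos by simp
      then have "0 < (wa $ x $ y * wb $ x $ y) * (w1 $ x $ y * w2 $ x $ y)" by (simp add: mult_ac)
      then have "\<sigma> * (wa $ x $ y * wb $ x $ y) < 0"
        unfolding \<sigma>_def by (auto simp: sgn_if zero_less_mult_iff mult_less_0_iff not_less split: if_splits)
      then have "wa $ x $ y * wc $ x $ y < 0" by (simp add: wcxy mult_ac)
      then show ?thesis unfolding k_def by (auto simp: zero_less_divide_iff mult_less_0_iff divide_less_0_iff)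
    qed
    define w where "w = wa + k *\<^sub>R wc"
    note sa = stress_spaceD[OF stressesD(1)[OF wa1]] and sc = stress_spaceD[OF stressesD(1)[OF wc1]]
    have wxy: "w $ x $ y = 0" using nzc by (simp add: w_def k_def)
    have wsym: "w $ i $ j = w $ j $ i" for i j using sa(2)[of i j] sc(2)[of i j] by (simp add: w_def)
    have ws: "w \<in> stresses (V1 \<union> V2) ((E1 \<union> E2) - {{x, y}}) X'"
      unfolding stresses_def mem_Collect_eq
    proof (rule conjI[OF stress_spaceI[OF wsym]])
      show "w ** X' = 0" using stressesD(2)[OF wa1] stressesD(2)[OF wc1] by (simp add: w_def matrix_mult_bilinear)
      fix i j assume nz: "w $ i $ j \<noteq> 0"
      then have o: "wa $ i $ j \<noteq> 0 \<or> wc $ i $ j \<noteq> 0" by (auto simp: w_def)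
      then have 1: "i \<in> V1 \<union> V2 \<and> j \<in> V1 \<union> V2" using sa(3)[of i j] sc(3)[of i j] by blast
      have 2: "i = j \<or> {i, j} \<in> E1 \<union> E2" using o sa(4)[of i j] sc(4)[of i j] by blast
      have "{i, j} \<noteq> {x, y}"
      proof
        assume "{i, j} = {x, y}"
        then have "w $ i $ j = w $ x $ y" using wsym by (auto simp: doubleton_eq_iff)
        then show False using nz wxy by simp
      qed
      then show "i \<in> V1 \<union> V2 \<and> j \<in> V1 \<union> V2 \<and> (i = j \<or> {i, j} \<in> (E1 \<union> E2) - {{x, y}})" using 1 2 by blast
    qed
    have "0 \<le> quadratic w y" for y using wa(2) wcp k by (simp add: w_def quadratic_add quadratic_scaleR)
    moreover have "0 < w $ i $ j * w0 $ i $ j" if ij: "{i, j} \<in> (E1 \<union> E2) - {{x, y}}" for i j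
    proof -
      have ne: "i \<noteq> j" using ij E1[of "{i, j}"] E2[of "{i, j}"] by fastforce
      have notboth: False if "{i, j} \<subseteq> V1" "{i, j} \<subseteq> V2"
      proof -
        have "i \<in> {x, y}" "j \<in> {x, y}" using that V12 by blast+
        then show False using ij ne by (auto simp: insert_commute)
      qed
      show ?thesis
      proof (cases "{i, j} \<in> E1")
        case True
        then have "wc $ i $ j = 0" using sc(3)[of i j] E1[OF True] notboth by blast
        then show ?thesis using True wa(3) by (simp add: w_def w0_def)
      next
        case False
        then have ij2: "{i, j} \<in> E2" using ij by blast
        then have "wa $ i $ j = 0" using sa(3)[of i j] E2[OF ij2] notboth by blast
        then have "w $ i $ j * w0 $ i $ j = k * (wb $ i $ j * w2 $ i $ j) * (e i * e j * (e i * e j))"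
          using False by (simp add: w_def w0_def wce mult_ac)
        then show ?thesis using k wb(3) ij2 ee[of i j] by simp
      qed
    qed
    ultimately show ?thesis using ws by blast
  qed
  moreover have "d > 0" using dpos B by (simp add: d_def)
  ultimately show ?thesis unfolding robust_psd_def by blast
qed

theorem circuit_robust_psd:
  fixes V :: "'n::finite set"
  assumes "circuit V E"
  shows "robust_psd V E"
  using assms
proof (induction "card V" arbitrary: V E rule: less_induct)
  case less
  interpret circuit V E by fact
  show ?case
  proof (cases "three_connected V E")
    case True
    then obtain X w where g: "good_at V E X w" using three_connected_circuit_good[OF less.prems] by blast
    have "framework_graph V E" unfolding framework_graph_def using edge card_E by auto
    moreover have "E \<noteq> {}" using card_E card_V4 by auto
    ultimately show ?thesis using good_imp_robust_psd g by blast
  next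
    case False
    then obtain P Q where PQ: "separates P Q" using not_three_connected by blast
    have PQ': "P \<noteq> {}" "Q \<noteq> {}" "P \<inter> Q = {}" "P \<subseteq> V" "Q \<subseteq> V"
      and PQE: "\<And>p q. p \<in> P \<Longrightarrow> q \<in> Q \<Longrightarrow> {p, q} \<notin> E" using PQ unfolding separates_def by auto
    obtain x y where xy: "x \<noteq> y" "V - (P \<union> Q) = {x, y}" "{x, y} \<notin> E"
      "circuit (P \<union> {x, y}) (insert {x, y} (induced E (P \<union> {x, y})))"
      "circuit (Q \<union> {x, y}) (insert {x, y} (induced E (Q \<union> {x, y})))"
      by (rule two_separation[OF PQ]) (rule that, assumption+)
    let ?A = "P \<union> {x, y}" and ?B = "Q \<union> {x, y}"
    let ?EA = "insert {x, y} (induced E ?A)" and ?EB = "insert {x, y} (induced E ?B)"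
    interpret A: circuit ?A ?EA by fact
    interpret B: circuit ?B ?EB by fact
    have xyn: "x \<notin> P" "y \<notin> P" "x \<notin> Q" "y \<notin> Q" "x \<in> V" "y \<in> V" using xy(2) by blast+
    have Veq: "V = ?A \<union> ?B" using xy(2) PQ' by blast
    have "?A \<subset> V" "?B \<subset> V" using Veq PQ' xyn by blast+
    then have small: "card ?A < card V" "card ?B < card V" using finite_V by (auto intro: psubset_card_mono)
    have I: "?A \<inter> ?B = {x, y}" using PQ' xyn by auto
    have "robust_psd (?A \<union> ?B) ((?EA \<union> ?EB) - {{x, y}})"
      using less.hyps[OF small(1) xy(4)] less.hyps[OF small(2) xy(5)] A.edge B.edge I xy(1)
      by (rule robust_psd_two_sum) auto
    moreover have "(?EA \<union> ?EB) - {{x, y}} = E"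
    proof -
      have "e \<in> induced E ?A \<union> induced E ?B" if e: "e \<in> E" for e
      proof -
        obtain p q where pq: "e = {p, q}" using edge[OF e] by (auto simp: card_2_iff)
        have "\<not> (p \<in> P \<and> q \<in> Q)" "\<not> (q \<in> P \<and> p \<in> Q)"
          using PQE[of p q] PQE[of q p] e pq insert_commute[of p q "{}"] by metis+
        moreover have "p \<in> V" "q \<in> V" using pq edge[OF e] by auto
        ultimately have "e \<subseteq> ?A \<or> e \<subseteq> ?B" using pq Veq by blast
        then show ?thesis using e unfolding induced_def by blast
      qed
      then show ?thesis using xy(3) by (auto simp: induced_def)
    qed
    ultimately show ?thesis using Veq by simp
  qed
qed

section \<open>Sparse graphs have stress-free configurations\<close>

lemma stress_free_open:
  fixes X :: "(real^3)^'n::finite"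
  assumes "\<And>w. w \<in> stresses V E X \<Longrightarrow> w = 0"
  obtains d where "d > 0" "\<forall>X'. dist X' X < d \<longrightarrow> (\<forall>w\<in>stresses V E X'. w = 0)"
proof -
  have inj: "x = 0" if "x \<in> stress_space V E" "x ** X = 0" for x using assms that by (simp add: stresses_def)
  obtain d m where d: "d > 0" "m > 0" "\<forall>A' x. dist A' X < d \<longrightarrow> x \<in> stress_space V E \<longrightarrow> m * norm x \<le> norm (x ** A')"
    by (rule bilinear_injective_open[OF bounded_bilinear_matrix_mult subspace_stress_space inj])
  have "w = 0" if "dist X' X < d" "w \<in> stresses V E X'" for X' w
  proof -
    have "m * norm w \<le> norm (w ** X')" using d(3) that stressesD(1) by blast
    then have "m * norm w \<le> 0" using stressesD(2)[OF that(2)] by simp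
    then show ?thesis using d(2) by (simp add: mult_le_0_iff)
  qed
  then show thesis using that d(1) by blast
qed

lemma stress_free_perturb:
  fixes X :: "(real^3)^'n::finite"
  assumes "\<And>w. w \<in> stresses V E X \<Longrightarrow> w = 0" "card U \<le> 3"
  obtains X' where "indep_rows U X'" "\<And>w. w \<in> stresses V E X' \<Longrightarrow> w = 0"
proof -
  obtain d where d: "d > 0" "\<forall>X'. dist X' X < d \<longrightarrow> (\<forall>w\<in>stresses V E X'. w = 0)"
    by (rule stress_free_open[OF assms(1)])
  obtain X' where "dist X' X < d" "indep_rows U X'" using indep_rows_perturb[OF finite assms(2) d(1)] by blast
  then show thesis using that d(2) by blast
qed

text \<open>Some vertex v has degree at most three. With at most two neighbours, v is placed so that
  its row and theirs are independent, and row v of every stress vanishes. With three,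
  \<open>split_vertex_reduce\<close> leaves a stress of the smaller sparse graph with the extra edge
  a, b, which is zero by induction; as a, b is no edge of the original graph, the multiple of the
  rank-one stress is zero too.\<close>

theorem sparse_stress_free:
  fixes V :: "'n::finite set"
  assumes "finite_graph V E" "\<And>S. S \<subseteq> V \<Longrightarrow> 2 \<le> card S \<Longrightarrow> card (induced E S) + 3 \<le> 2 * card S"
  shows "\<exists>X::(real^3)^'n. \<forall>w\<in>stresses V E X. w = 0"
  using assms
proof (induction "card V" arbitrary: V E rule: less_induct)
  case less
  interpret finite_graph V E by fact
  note sparse = less.prems(2)
  show ?case
  proof (cases "V = {}")
    case True
    have "w = 0" if "w \<in> stresses V E 0" for w
      using stress_spaceD(3)[OF stressesD(1)[OF that]] True by (auto simp: vec_eq_iff)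
    then show ?thesis by blast
  next
    case False
    have "card E < 2 * card V" if "2 \<le> card V" using sparse[of V] induced_V that by simp
    moreover have "card E \<le> 2 * card V"
      using sparse[of V] induced_V edges_in_small[of V] finite_V by (cases "2 \<le> card V") auto
    ultimately obtain v where v: "v \<in> V" "card (nbr v) \<le> 3" using sparse_low_degree[OF False] by blast
    define V' where "V' = V - {v}"
    define E0 where "E0 = {f \<in> E. v \<notin> f}"
    have small: "card V' < card V" unfolding V'_def using v finite_V by (intro psubset_card_mono) auto
    have nv: "w $ v $ j = 0" if "w \<in> stresses V E X" "j \<noteq> v" "j \<notin> nbr v" for w X j
    proof (rule ccontr)
      assume "w $ v $ j \<noteq> 0"
      then have "{v, j} \<in> E" using stress_spaceD(4)[OF stressesD(1)[OF that(1)]] that(2) by blast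
      then show False using that by (auto simp: neighbors_def insert_commute)
    qed
    show ?thesis
    proof (cases "card (nbr v) = 3")
      case False
      then have c2: "card (nbr v) \<le> 2" using v by simp
      have fg: "finite_graph V' E0" using edge finite_V by unfold_locales (auto simp: V'_def E0_def)
      have sp: "card (induced E0 S) + 3 \<le> 2 * card S" if "S \<subseteq> V'" "2 \<le> card S" for S
      proof -
        have "card (induced E0 S) \<le> edges_in S" by (intro card_mono finite_induced) (auto simp: induced_def E0_def)
        moreover have "S \<subseteq> V" using that(1) by (auto simp: V'_def)
        ultimately show ?thesis using sparse[of S] that(2) by simp
      qed
      obtain X0 :: "(real^3)^'n" where X0: "\<forall>w\<in>stresses V' E0 X0. w = 0" using less.hyps[OF small fg sp] by blast
      obtain X1 where X1: "indep_rows (nbr v) X1" "\<And>w. w \<in> stresses V' E0 X1 \<Longrightarrow> w = 0"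
        using stress_free_perturb[of V' E0 X0 "nbr v"] X0 c2 by auto
      have "card (($) X1 ` nbr v) < 3" using card_image_le[of "nbr v" "($) X1"] c2 by simp
      then obtain z where z: "z \<notin> span (($) X1 ` nbr v)"
        using near_outside_span[of "($) X1 ` nbr v" 1 0] by auto
      define X where "X = row_update v z X1"
      have vn: "v \<notin> nbr v" using nbr_subset by blast
      have XX1: "X $ j = X1 $ j" if "j \<noteq> v" for j using that by (simp add: X_def)
      have ind: "indep_rows (insert v (nbr v)) X"
      proof (rule indep_rows_insert)
        show "indep_rows (nbr v) X" using X1(1) indep_rows_cong[of "nbr v" X X1] XX1 vn by metis
        have "($) X ` nbr v = ($) X1 ` nbr v" by (intro image_cong refl) (metis XX1 vn)
        then show "X $ v \<notin> span (($) X ` nbr v)" using z by (simp add: X_def)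
      qed (use vn in auto)
      have "w = 0" if w: "w \<in> stresses V E X" for w
      proof -
        note s = stress_spaceD[OF stressesD(1)[OF w]]
        have "(\<Sum>j\<in>insert v (nbr v). w $ v $ j *\<^sub>R X $ j) = (\<Sum>j\<in>UNIV. w $ v $ j *\<^sub>R X $ j)"
          using nv[OF w] by (intro sum.mono_neutral_left) auto
        also have "\<dots> = 0" by (rule stress_row[OF w])
        finally have "w $ v $ j = 0" if "j \<in> insert v (nbr v)" for j
          using indep_rowsD[OF ind, of "\<lambda>j. w $ v $ j" j] that by blast
        then have row: "w $ v $ j = 0" for j using nv[OF w, of j] by (cases "j \<in> insert v (nbr v)") auto
        have nz: "i \<noteq> v \<and> j \<noteq> v" if "w $ i $ j \<noteq> 0" for i j using that row s(2)[of i j] by auto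
        have "w \<in> stress_space V' E0"
        proof (rule stress_spaceI[OF s(2)])
          fix i j assume "w $ i $ j \<noteq> 0"
          then show "i \<in> V' \<and> j \<in> V' \<and> (i = j \<or> {i, j} \<in> E0)"
            using s(3)[of i j] s(4)[of i j] nz[of i j] by (auto simp: V'_def E0_def)
        qed
        then have "w \<in> stresses V' E0 X" using stressesD(2)[OF w] by (simp add: stresses_def)
        moreover have "stresses V' E0 X = stresses V' E0 X1" using XX1 by (intro stresses_cong) (auto simp: V'_def)
        ultimately show "w = 0" using X1(2) by blast
      qed
      then show ?thesis by blast
    next
      case True
      obtain a b c where abc: "nbr v = {a, b, c}" "a \<noteq> b" "a \<noteq> c" "b \<noteq> c" "{a, b} \<notin> E"
        and sp: "\<And>S. S \<subseteq> V - {v} \<Longrightarrow> 2 \<le> card S \<Longrightarrow> card (induced (insert {a, b} {f \<in> E. v \<notin> f}) S) + 3 \<le> 2 * card S"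
        by (rule sparse_extension[OF sparse v(1) True]) (assumption, assumption, rule that, assumption+)
      define E1 where "E1 = insert {a, b} E0"
      have nbrs: "a \<in> V'" "b \<in> V'" "c \<in> V'" using abc(1) nbr_subset[of v] by (auto simp: V'_def)
      have fg: "finite_graph V' E1"
        using edge finite_V nbrs abc(2) by unfold_locales (auto simp: V'_def E0_def E1_def)
      have sp': "card (induced E1 S) + 3 \<le> 2 * card S" if "S \<subseteq> V'" "2 \<le> card S" for S
        using sp[of S] that by (simp add: V'_def E1_def E0_def)
      obtain X0 :: "(real^3)^'n" where X0: "\<forall>w\<in>stresses V' E1 X0. w = 0" using less.hyps[OF small fg sp'] by blast
      have "card {a, b, c} \<le> 3" using abc by simp
      then obtain X1 where X1: "indep_rows {a, b, c} X1" "\<And>w. w \<in> stresses V' E1 X1 \<Longrightarrow> w = 0"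
        using stress_free_perturb[of V' E1 X0 "{a, b, c}"] X0 by auto
      define X where "X = row_update v (X1 $ a + 1 *\<^sub>R X1 $ b) X1"
      have va: "v \<notin> {a, b, c}" using nbrs by (auto simp: V'_def)
      have XX1: "X $ j = X1 $ j" if "j \<noteq> v" for j using that by (simp add: X_def)
      have Xv: "X $ v = X $ a + 1 *\<^sub>R X $ b" using va by (auto simp: X_def)
      have ind: "indep_rows {a, b, c} X" using X1(1) indep_rows_cong[of "{a, b, c}" X X1] XX1 va by metis
      have "w = 0" if w: "w \<in> stresses V E X" for w
      proof -
        note s = stress_spaceD[OF stressesD(1)[OF w]]
        define u where "u = split_vector v a b 1"
        define z where "z = w - w $ v $ v *\<^sub>R rank_one u"
        have "j \<in> {v, a, b, c}" if "w $ v $ j \<noteq> 0" for j using nv[OF w, of j] that abc(1) by blast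
        from split_vertex_reduce[OF va abc(2-4) ind Xv s(1) stressesD(2)[OF w] this]
        have z: "\<And>j. z $ v $ j = 0" "z ** X = 0" "transpose z = z" unfolding z_def u_def by blast+
        have ze: "z $ i $ j = w $ i $ j - w $ v $ v * (u i * u j)" for i j by (simp add: z_def)
        have usupp: "u i \<noteq> 0 \<Longrightarrow> i \<in> {v, a, b}" for i by (auto simp: u_def split_vector_def split: if_splits)
        have "z \<in> stress_space V' E1"
        proof (rule stress_spaceI)
          fix i j show "z $ i $ j = z $ j $ i" using symmetric_nth[OF z(3)] .
          assume nz: "z $ i $ j \<noteq> 0"
          then have ne: "i \<noteq> v" "j \<noteq> v" using z(1) symmetric_nth[OF z(3)] by auto
          show "i \<in> V' \<and> j \<in> V' \<and> (i = j \<or> {i, j} \<in> E1)"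
          proof (cases "w $ i $ j = 0")
            case True
            then have "u i \<noteq> 0" "u j \<noteq> 0" using nz by (auto simp: ze)
            then have "i \<in> {a, b}" "j \<in> {a, b}" using usupp ne by blast+
            then show ?thesis using nbrs by (auto simp: E1_def insert_commute)
          next
            case False
            then show ?thesis using s(3)[of i j] s(4)[of i j] ne by (auto simp: V'_def E1_def E0_def)
          qed
        qed
        then have "z \<in> stresses V' E1 X" using z(2) by (simp add: stresses_def)
        moreover have "stresses V' E1 X = stresses V' E1 X1" using XX1 by (intro stresses_cong) (auto simp: V'_def)
        ultimately have z0: "z = 0" using X1(2) by blast
        have "w $ a $ b = 0" using s(4)[of a b] abc(2,5) by blast
        moreover have "u a * u b = 1" using va abc(2) by (auto simp: u_def split_vector_def)
        ultimately have "w $ v $ v = 0" using ze[of a b] z0 by simp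
        then show "w = 0" using z0 by (simp add: z_def)
      qed
      then show ?thesis by blast
    qed
  qed
qed

section \<open>Existence of the maximum likelihood estimate\<close>

definition psd :: "real^'n^'n::finite \<Rightarrow> bool" where
  "psd w \<longleftrightarrow> transpose w = w \<and> (\<forall>y. 0 \<le> quadratic w y)"

lemma positive_definite_iff: "positive_definite K \<longleftrightarrow> transpose K = K \<and> (\<forall>x. x \<noteq> 0 \<longrightarrow> 0 < quadratic K x)"
  by (simp add: positive_definite_def symmetric_matrix_def quadratic_def)

lemma positive_definite_psd: "positive_definite K \<Longrightarrow> psd K"
  unfolding positive_definite_iff psd_def
proof (intro conjI allI)
  fix y assume K: "transpose K = K \<and> (\<forall>x. x \<noteq> 0 \<longrightarrow> 0 < quadratic K x)"
  show "0 \<le> quadratic K y"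
    by (cases "y = 0") (use K in \<open>auto simp: quadratic_def intro: less_imp_le\<close>)
qed simp

lemma symmetric_inner:
  fixes w :: "real^'n^'n::finite"
  shows "transpose w = w \<Longrightarrow> x \<bullet> (w *v y) = (w *v x) \<bullet> y"
  using dot_lmul_matrix[of x w y] transpose_matrix_vector[of w x] by simp

lemma quadratic_line:
  assumes "transpose w = w"
  shows "quadratic w (x + t *\<^sub>R y) = quadratic w x + 2 * t * (y \<bullet> (w *v x)) + t\<^sup>2 * quadratic w y"
proof -
  have "x \<bullet> (w *v y) = y \<bullet> (w *v x)" using symmetric_inner[OF assms, of x y] by (simp add: inner_commute)
  then show ?thesis
    by (simp add: quadratic_def matrix_vector_right_distrib matrix_vector_mult_scaleR inner_add_left inner_add_right
        algebra_simps power2_eq_square)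
qed

text \<open>A zero of a nonnegative form is a minimum. A step of length t from x against y changes
  the form by - 2 t b + t^2 c, which is negative for small t unless b is zero; t = b / (c + 1) works
  for c = 0 as well.\<close>

lemma psd_kernel:
  assumes "psd w" "quadratic w x = 0"
  shows "w *v x = 0"
proof -
  define y where "y = w *v x"
  define b where "b = y \<bullet> y"
  define c where "c = quadratic w y"
  have c: "c \<ge> 0" using assms by (simp add: psd_def c_def)
  define t where "t = b / (c + 1)"
  have b: "b = t * (c + 1)" using c by (simp add: t_def)
  have "0 \<le> quadratic w (x + (- t) *\<^sub>R y)" using assms by (simp add: psd_def)
  also have "\<dots> = - (t\<^sup>2 * (c + 2))"
    using quadratic_line[of w x "- t" y] assms b
    by (simp add: psd_def b_def[symmetric] c_def[symmetric] y_def[symmetric] power2_eq_square algebra_simps)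
  finally have "t\<^sup>2 * (c + 2) \<le> 0" by simp
  then have "t = 0" using c by (simp add: mult_le_0_iff)
  then have "b = 0" using b by simp
  then show ?thesis by (simp add: b_def y_def)
qed

lemma continuous_on_det: "continuous_on S (det :: real^'n^'n::finite \<Rightarrow> real)"
  unfolding det_def[abs_def] by (intro continuous_intros)

lemma continuous_on_quadratic: "continuous_on S (\<lambda>w::real^'n^'n::finite. quadratic w y)"
  unfolding quadratic_sum by (intro continuous_intros)

lemma positive_definite_invertible:
  assumes "positive_definite K"
  shows "invertible K"
proof -
  have "x = 0" if "K *v x = 0" for x
  proof (rule ccontr)
    assume "x \<noteq> 0"
    then have "0 < quadratic K x" using assms unfolding positive_definite_iff by blast
    then show False using that by (simp add: quadratic_def)
  qed
  then show ?thesis using matrix_left_invertible_ker invertible_left_inverse by blast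
qed

lemma positive_definite_det_nonzero: "positive_definite K \<Longrightarrow> det K \<noteq> 0"
  using positive_definite_invertible invertible_det_nz by blast

lemma positive_definite_mat: "positive_definite (mat 1 :: real^'n^'n::finite)"
  by (simp add: positive_definite_def symmetric_matrix_def transpose_mat)

lemma positive_definite_add:
  assumes "positive_definite K" "psd w"
  shows "positive_definite (K + w)"
proof -
  have "transpose (K + w) = K + w"
    using assms by (simp add: positive_definite_iff psd_def transpose_def vec_eq_iff)
  then show ?thesis using assms unfolding positive_definite_iff psd_def
    by (simp add: quadratic_add add_pos_nonneg)
qed

lemma psd_scaleR: "psd w \<Longrightarrow> 0 \<le> c \<Longrightarrow> psd (c *\<^sub>R w)"
  unfolding psd_def by (auto simp: quadratic_scaleR transpose_def vec_eq_iff)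

lemma positive_definite_scaleR: "positive_definite w \<Longrightarrow> 0 < c \<Longrightarrow> positive_definite (c *\<^sub>R w)"
  unfolding positive_definite_iff by (auto simp: quadratic_scaleR transpose_def vec_eq_iff)

text \<open>All matrices on the segment from K to the identity are positive definite, so the
  determinant has no zero there and ends at one.\<close>

lemma positive_definite_det_pos:
  fixes K :: "real^'n^'n::finite"
  assumes K: "positive_definite K"
  shows "0 < det K"
proof (rule ccontr)
  assume "\<not> 0 < det K"
  define g where "g t = det (t *\<^sub>R (mat 1 :: real^'n^'n) + (1 - t) *\<^sub>R K)" for t :: real
  have "continuous_on {0..1} g"
    unfolding g_def by (intro continuous_on_compose2[OF continuous_on_det[of UNIV]] continuous_intros) auto
  moreover have "g 0 \<le> 0" "0 \<le> g 1" using \<open>\<not> 0 < det K\<close> by (auto simp: g_def)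
  ultimately obtain t where t: "0 \<le> t" "t \<le> 1" "g t = 0" using IVT'[of g 0 0 1] by auto
  have "positive_definite (t *\<^sub>R (mat 1 :: real^'n^'n) + (1 - t) *\<^sub>R K)"
  proof (cases "t = 1")
    case True then show ?thesis using positive_definite_mat by simp
  next
    case False
    have "positive_definite ((1 - t) *\<^sub>R K + t *\<^sub>R (mat 1 :: real^'n^'n))"
      using False t K positive_definite_mat
      by (intro positive_definite_add positive_definite_scaleR psd_scaleR positive_definite_psd) auto
    then show ?thesis by (simp add: add.commute)
  qed
  then show False using positive_definite_det_nonzero t(3) by (auto simp: g_def)
qed

section \<open>Strict monotonicity of the determinant\<close>

definition outer :: "real^'n \<Rightarrow> real^'n^'n::finite" where
  "outer u = (\<chi> i j. u $ i * u $ j)"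

lemma outer_nth [simp]: "outer u $ i $ j = u $ i * u $ j"
  by (simp add: outer_def)

lemma outer_mult: "outer u *v x = (u \<bullet> x) *\<^sub>R u"
  by (simp add: matrix_vector_mult_def vec_eq_iff inner_vec_def sum_distrib_left mult_ac)

lemma quadratic_outer: "quadratic (outer u) x = (u \<bullet> x)\<^sup>2"
  by (simp add: quadratic_def outer_mult power2_eq_square inner_commute)

lemma psd_outer: "psd (outer u)"
  by (simp add: psd_def quadratic_outer transpose_def vec_eq_iff mult.commute)

lemma det_add_diagonal:
  fixes K :: "real^'n^'n::finite"
  shows "det (K + c *\<^sub>R outer (axis k 1)) = det K + c * det (\<chi> i. if i = k then axis k 1 else K $ i)"
proof -
  have "K + c *\<^sub>R outer (axis k 1) = (\<chi> i. if i = k then K $ i + c *s axis k 1 else K $ i)"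
    by (auto simp: vec_eq_iff axis_def)
  then have "det (K + c *\<^sub>R outer (axis k 1)) =
      det (\<chi> i. if i = k then K $ i else K $ i) + det (\<chi> i. if i = k then c *s axis k 1 else K $ i)"
    by (simp only: det_row_add[of k "\<lambda>i. K $ i" "\<lambda>i. c *s axis k 1" "\<lambda>i. K $ i"])
  also have "det (\<chi> i. if i = k then c *s axis k 1 else K $ i) = c * det (\<chi> i. if i = k then axis k 1 else K $ i)"
    by (rule det_row_mul)
  also have "(\<chi> i. if i = k then K $ i else K $ i) = K" by (simp add: vec_eq_iff)
  finally show ?thesis .
qed

text \<open>The determinant is affine in c with slope M. It stays positive for all nonnegative c, so
  M is not negative; it is zero for some negative c, so M is not zero.\<close>

lemma det_add_axis:
  fixes K :: "real^'n^'n::finite"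
  assumes K: "positive_definite K" and c: "c > 0"
  shows "det K < det (K + c *\<^sub>R outer (axis k 1))"
proof -
  define M where "M = det (\<chi> i. if i = k then axis k 1 else K $ i)"
  have D: "det (K + t *\<^sub>R outer (axis k 1)) = det K + t * M" for t
    unfolding M_def by (rule det_add_diagonal)
  have dK: "det K > 0" by (rule positive_definite_det_pos[OF K])
  have pos: "0 < det K + t * M" if "t \<ge> 0" for t
    using positive_definite_det_pos[OF positive_definite_add[OF K psd_scaleR[OF psd_outer that]], of "axis k 1"] D by simp
  have "M \<ge> 0"
  proof (rule ccontr)
    assume "\<not> M \<ge> 0"
    then show False using pos[of "- det K / M"] dK by (simp add: divide_nonpos_neg field_simps)
  qed
  moreover have "M \<noteq> 0"
  proof
    assume "M = 0"
    obtain K' where K': "K ** K' = mat 1" using positive_definite_invertible[OF K] invertible_def by metis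
    \<comment> \<open>This preimage of the k-th unit vector becomes a kernel vector when
      \<open>1 / x $ k\<close> is subtracted at the diagonal position k; \<open>x $ k\<close> is the
      value of the form of K at x, hence positive.\<close>
    define x where "x = K' *v axis k 1"
    have x: "K *v x = axis k 1" using K' by (simp add: x_def matrix_vector_mul_assoc)
    then have "x \<noteq> 0" by auto
    then have "0 < x $ k" using K x unfolding positive_definite_iff quadratic_def
      by (metis inner_axis inner_real_def mult.right_neutral)
    moreover have "(K + (- 1 / x $ k) *\<^sub>R outer (axis k 1)) *v x = K *v x + (- 1 / x $ k) *\<^sub>R (outer (axis k 1) *v x)"
      unfolding scaleR_matrix_vector_assoc by (rule matrix_vector_mult_add_rdistrib)
    ultimately have "(K + (- 1 / x $ k) *\<^sub>R outer (axis k 1)) *v x = 0"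
      using x by (simp add: outer_mult inner_axis')
    then have "\<not> invertible (K + (- 1 / x $ k) *\<^sub>R outer (axis k 1))"
      using \<open>x \<noteq> 0\<close> matrix_left_invertible_ker invertible_left_inverse by blast
    then have "det (K + (- 1 / x $ k) *\<^sub>R outer (axis k 1)) = 0" using invertible_det_nz by blast
    then show False using D[of "- 1 / x $ k"] \<open>M = 0\<close> dK by simp
  qed
  ultimately show ?thesis using D[of c] c by simp
qed

lemma det_add_outer:
  fixes K :: "real^'n^'n::finite"
  assumes K: "positive_definite K" and u: "u \<noteq> 0"
  shows "det K < det (K + outer u)"
proof -
  fix k :: 'n
  have "norm u = norm (norm u *\<^sub>R axis k (1::real))" by (simp add: norm_axis_1)
  then obtain f where f: "orthogonal_transformation f" "f u = norm u *\<^sub>R axis k (1::real)"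
    using orthogonal_transformation_exists by metis
  define Q where "Q = matrix f"
  have lf: "linear f" using f(1) orthogonal_transformation_linear by blast
  have Qv: "Q *v x = f x" for x unfolding Q_def by (rule fun_cong[OF matrix_vector_mul(2)[OF lf]])
  have oQ: "orthogonal_matrix Q" using f(1) orthogonal_transformation_matrix unfolding Q_def by blast
  have dQ: "det Q * det Q = 1" using det_orthogonal_matrix[OF oQ] by auto
  have dd: "det (Q ** A ** transpose Q) = det A" for A
    using dQ by (simp add: det_mul det_transpose mult_ac)
  have "transpose (Q ** K ** transpose Q) = Q ** K ** transpose Q"
    using K unfolding positive_definite_iff by (simp add: matrix_transpose_mul matrix_mul_assoc)
  moreover have "0 < quadratic (Q ** K ** transpose Q) x" if "x \<noteq> 0" for x
  proof -
    have "transpose Q *v x \<noteq> 0"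
    proof
      assume "transpose Q *v x = 0"
      then have "Q *v (transpose Q *v x) = 0" by simp
      then show False using oQ that by (metis matrix_vector_mul_assoc matrix_vector_mul_lid orthogonal_matrix_def)
    qed
    moreover have "quadratic (Q ** K ** transpose Q) x = quadratic K (transpose Q *v x)"
      by (simp add: quadratic_def matrix_vector_mul_assoc[symmetric] dot_lmul_matrix[symmetric] transpose_matrix_vector)
    ultimately show ?thesis using K unfolding positive_definite_iff by metis
  qed
  ultimately have K': "positive_definite (Q ** K ** transpose Q)" unfolding positive_definite_iff by blast
  have "Q ** outer u ** transpose Q = outer (Q *v u)"
    by (auto simp: vec_eq_iff matrix_matrix_mult_def matrix_vector_mult_def transpose_def sum_product sum_distrib_left sum_distrib_right
        algebra_simps intro!: sum.cong)
  also have "\<dots> = (norm u)\<^sup>2 *\<^sub>R outer (axis k 1)" unfolding Qv f(2) by (simp add: vec_eq_iff power2_eq_square mult_ac)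
  finally have "Q ** (K + outer u) ** transpose Q = Q ** K ** transpose Q + (norm u)\<^sup>2 *\<^sub>R outer (axis k 1)"
    by (simp add: matrix_add_ldistrib matrix_mult_bilinear)
  then have "det (K + outer u) = det (Q ** K ** transpose Q + (norm u)\<^sup>2 *\<^sub>R outer (axis k 1))" using dd by metis
  also have "\<dots> > det (Q ** K ** transpose Q)" using u by (intro det_add_axis K') simp
  finally show ?thesis using dd by metis
qed

lemma psd_axis: "quadratic w (axis i 1) = w $ i $ i"
  by (simp add: quadratic_def inner_axis' matrix_vector_mul_component inner_axis)

lemma axis_column: "(w *v axis i (1::real)) $ j = w $ j $ i"
  by (simp add: matrix_vector_mul_component inner_axis)

lemma psd_zero_diagonal:
  assumes "psd w" "w $ i $ i = 0"
  shows "w $ i $ j = 0"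
proof -
  have "w *v axis i 1 = 0" using psd_kernel[OF assms(1)] psd_axis assms(2) by metis
  then have "w $ j $ i = 0" by (metis axis_column zero_index)
  then show ?thesis using assms(1) symmetric_nth[of w] unfolding psd_def by metis
qed

text \<open>A step of the Cholesky decomposition: subtracting the square of the normalized i-th
  column leaves a Schur complement, whose form at y is the minimum of the form of w over the line
  through y in direction i.\<close>

lemma psd_peel:
  assumes w: "psd w" and i: "w $ i $ i > 0"
  obtains u where "u \<noteq> 0" "psd (w - outer u)" "(w - outer u) $ i $ i = 0"
    "\<And>j. w $ j $ j = 0 \<Longrightarrow> (w - outer u) $ j $ j = 0"
proof -
  define c where "c = w $ i $ i"
  define a where "a = w *v axis i 1"
  define u where "u = (1 / sqrt c) *\<^sub>R a"
  have sym: "transpose w = w" using w by (simp add: psd_def)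
  have c: "c > 0" "sqrt c * sqrt c = c" using i by (auto simp: c_def)
  have ai: "a $ j = w $ j $ i" for j by (simp add: a_def axis_column)
  have ue: "u $ j * u $ k = w $ j $ i * w $ k $ i / c" for j k
    using c by (simp add: u_def ai field_simps)
  have "psd (w - outer u)"
    unfolding psd_def
  proof (intro conjI allI)
    show "transpose (w - outer u) = w - outer u"
      using symmetric_nth[OF sym] by (simp add: transpose_def vec_eq_iff mult.commute)
    fix y
    define t where "t = - (y \<bullet> a) / c"
    have "0 \<le> quadratic w (y + t *\<^sub>R axis i 1)" using w by (simp add: psd_def)
    also have "\<dots> = quadratic w y + 2 * t * (axis i 1 \<bullet> (w *v y)) + t\<^sup>2 * c"
      unfolding quadratic_line[OF sym] psd_axis c_def ..
    also have "axis i 1 \<bullet> (w *v y) = y \<bullet> a"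
      unfolding a_def using symmetric_inner[OF sym, of "axis i 1" y] by (simp add: inner_commute)
    also have "quadratic w y + 2 * t * (y \<bullet> a) + t\<^sup>2 * c = quadratic w y - (y \<bullet> a)\<^sup>2 / c"
      using c by (simp add: t_def field_simps power2_eq_square)
    also have "(y \<bullet> a)\<^sup>2 / c = (u \<bullet> y)\<^sup>2"
      using c by (simp add: u_def inner_commute power_divide)
    also have "quadratic w y - (u \<bullet> y)\<^sup>2 = quadratic (w - outer u) y"
      using quadratic_add[of "w - outer u" "outer u" y] by (simp add: quadratic_outer)
    finally show "0 \<le> quadratic (w - outer u) y" .
  qed
  moreover have "(w - outer u) $ i $ i = 0" using ue[of i i] c by (simp add: c_def)
  moreover have "(w - outer u) $ j $ j = 0" if "w $ j $ j = 0" for j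
    using ue[of j j] psd_zero_diagonal[OF w that, of i] that by simp
  moreover have "u \<noteq> 0"
  proof
    assume "u = 0"
    then show False using ue[of i i] c by (simp add: c_def)
  qed
  ultimately show thesis using that by blast
qed

text \<open>Each square peeled off raises the determinant strictly and clears a diagonal entry
  without filling others, so the number of nonzero diagonal entries decreases.\<close>

lemma det_add_psd:
  fixes K :: "real^'n^'n::finite"
  assumes "positive_definite K" "psd w" "w \<noteq> 0"
  shows "det K < det (K + w)"
  using assms
proof (induction "card {i. w $ i $ i \<noteq> 0}" arbitrary: w K rule: less_induct)
  case less
  have "\<exists>i. w $ i $ i \<noteq> 0"
    using psd_zero_diagonal[OF less.prems(2)] less.prems(3) by (auto simp: vec_eq_iff)
  then obtain i where i: "w $ i $ i \<noteq> 0" by blast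
  moreover have "0 \<le> w $ i $ i" using less.prems(2) psd_axis[of w i] unfolding psd_def by metis
  ultimately have "w $ i $ i > 0" by simp
  then obtain u where u: "u \<noteq> 0" "psd (w - outer u)" "(w - outer u) $ i $ i = 0"
    "\<And>j. w $ j $ j = 0 \<Longrightarrow> (w - outer u) $ j $ j = 0"
    using psd_peel[OF less.prems(2)] by metis
  have 1: "det K < det (K + outer u)" using det_add_outer[OF less.prems(1) u(1)] .
  show ?case
  proof (cases "w - outer u = 0")
    case True then show ?thesis using 1 by simp
  next
    case False
    have "{j. (w - outer u) $ j $ j \<noteq> 0} \<subset> {j. w $ j $ j \<noteq> 0}" using u(3,4) i by blast
    then have "card {j. (w - outer u) $ j $ j \<noteq> 0} < card {j. w $ j $ j \<noteq> 0}" by (intro psubset_card_mono) auto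
    then have "det (K + outer u) < det (K + outer u + (w - outer u))"
      using less.hyps[OF _ positive_definite_add[OF less.prems(1) psd_outer] u(2) False] by blast
    then show ?thesis using 1 by simp
  qed
qed

section \<open>The likelihood function\<close>

lemma trace_sample_covariance:
  "trace (sample_covariance N X ** K) = (1 / real N) * (\<Sum>k=1..N. quadratic K (X k))"
proof -
  have "trace (sample_covariance N X ** K) = (\<Sum>i\<in>UNIV. \<Sum>j\<in>UNIV. (1 / real N) * (\<Sum>k=1..N. X k $ i * X k $ j) * K $ j $ i)"
    by (simp add: trace_def matrix_matrix_mult_def sample_covariance_def)
  also have "\<dots> = (\<Sum>i\<in>UNIV. \<Sum>j\<in>UNIV. \<Sum>k=1..N. (1 / real N) * (K $ j $ i * X k $ j * X k $ i))"
    by (simp add: sum_distrib_left sum_distrib_right mult_ac)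
  also have "\<dots> = (\<Sum>k=1..N. \<Sum>j\<in>UNIV. \<Sum>i\<in>UNIV. (1 / real N) * (K $ j $ i * X k $ j * X k $ i))"
    by (subst sum.swap[of _ _ UNIV], subst (2) sum.swap, subst sum.swap) (intro refl)
  also have "\<dots> = (1 / real N) * (\<Sum>k=1..N. quadratic K (X k))"
    by (simp add: quadratic_sum sum_distrib_left)
  finally show ?thesis .
qed

lemma concentration_matrices_iff:
  "K \<in> concentration_matrices E \<longleftrightarrow> K \<in> stress_space UNIV E \<and> positive_definite K"
  unfolding concentration_matrices_def stress_space_def by (auto simp: positive_definite_iff)

text \<open>Adding w to a candidate K leaves the trace term unchanged, because w kills all samples,
  and strictly raises the determinant.\<close>

lemma not_mle_exists:
  assumes w: "w \<in> stress_space UNIV E" "psd w" "w \<noteq> 0" "\<And>k. k \<in> {1..N} \<Longrightarrow> w *v X k = 0"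
  shows "\<not> mle_exists E N X"
proof
  assume "mle_exists E N X"
  then obtain K where K: "K \<in> concentration_matrices E"
    and opt: "\<And>K'. K' \<in> concentration_matrices E \<Longrightarrow>
      neg_log_likelihood (sample_covariance N X) K \<le> neg_log_likelihood (sample_covariance N X) K'"
    unfolding mle_exists_def by blast
  have pd: "positive_definite K" and KS: "K \<in> stress_space UNIV E" using K by (auto simp: concentration_matrices_iff)
  have pd': "positive_definite (K + w)" by (rule positive_definite_add[OF pd w(2)])
  have "K + w \<in> concentration_matrices E"
    using subspace_add[OF subspace_stress_space KS w(1)] pd' by (simp add: concentration_matrices_iff)
  from opt[OF this] have "ln (det (K + w)) \<le> ln (det K)"
    using w(4) by (simp add: neg_log_likelihood_def trace_sample_covariance quadratic_add quadratic_def[of w])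
  then have "det (K + w) \<le> det K"
    using positive_definite_det_pos[OF pd] positive_definite_det_pos[OF pd'] by simp
  then show False using det_add_psd[OF pd w(2,3)] by simp
qed

lemma closed_psd: "closed {w::real^'n^'n::finite. psd w}"
proof -
  have "{w::real^'n^'n. psd w} = (\<Inter>i. \<Inter>j. {w. w $ i $ j = w $ j $ i}) \<inter> (\<Inter>y. {w. 0 \<le> quadratic w y})"
    by (auto simp: psd_def transpose_def vec_eq_iff)
  moreover have "closed \<dots>"
    by (intro closed_Int closed_INT ballI closed_Collect_eq closed_Collect_le continuous_intros continuous_on_quadratic)
  ultimately show ?thesis by simp
qed

lemma abs_det_le:
  fixes K :: "real^'n^'n::finite"
  shows "\<bar>det K\<bar> \<le> fact CARD('n) * norm K ^ CARD('n)"
proof -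
  have entry: "\<bar>K $ i $ j\<bar> \<le> norm K" for i j
    by (rule order_trans[OF component_le_norm_cart Finite_Cartesian_Product.norm_nth_le])
  have "\<bar>det K\<bar> \<le> (\<Sum>p\<in>{p. p permutes (UNIV :: 'n set)}. \<bar>of_int (sign p) * (\<Prod>i\<in>UNIV. K $ i $ p i)\<bar>)"
    unfolding det_def by (rule sum_abs)
  also have "\<dots> \<le> (\<Sum>p\<in>{p. p permutes (UNIV :: 'n set)}. norm K ^ CARD('n))"
  proof (rule sum_mono)
    fix p
    have "\<bar>of_int (sign p) * (\<Prod>i\<in>UNIV. K $ i $ p i)\<bar> = (\<Prod>i\<in>UNIV. \<bar>K $ i $ p i\<bar>)"
      by (simp add: abs_mult abs_prod sign_def)
    also have "\<dots> \<le> (\<Prod>i\<in>(UNIV::'n set). norm K)" using entry by (intro prod_mono) auto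
    finally show "\<bar>of_int (sign p) * (\<Prod>i\<in>UNIV. K $ i $ p i)\<bar> \<le> norm K ^ CARD('n)" by simp
  qed
  also have "\<dots> = fact CARD('n) * norm K ^ CARD('n)" by (simp add: card_permutations)
  finally show ?thesis .
qed

text \<open>By compactness the trace term is at least m times the norm on positive semidefinite
  matrices supported on the graph, while \<open>ln (det K)\<close> grows at most logarithmically.
  Candidates no worse than the identity lie in a compact set on which the determinant is bounded
  away from zero; a minimizer there is positive definite.\<close>

lemma mle_existsI:
  fixes E :: "'n::finite set set"
  assumes N: "1 \<le> N"
    and free: "\<And>w. w \<in> stress_space UNIV E \<Longrightarrow> psd w \<Longrightarrow> (\<And>k. k \<in> {1..N} \<Longrightarrow> w *v X k = 0) \<Longrightarrow> w = 0"
  shows "mle_exists E N X"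
proof -
  let ?S = "stress_space UNIV E"
  define f where "f = neg_log_likelihood (sample_covariance N X)"
  define \<tau> where "\<tau> K = (1 / real N) * (\<Sum>k=1..N. quadratic K (X k))" for K
  have f: "f K = \<tau> K - ln (det K)" for K by (simp add: f_def neg_log_likelihood_def trace_sample_covariance \<tau>_def)
  have cont: "continuous_on T \<tau>" for T unfolding \<tau>_def by (intro continuous_intros continuous_on_quadratic)
  define C where "C = ?S \<inter> {w. psd w} \<inter> sphere 0 1"
  have "compact C" unfolding C_def
    using closed_subspace[OF subspace_stress_space] closed_psd by (intro closed_Int_compact closed_Int) auto
  have \<tau>0: "0 \<le> \<tau> K" if "psd K" for K using that by (simp add: \<tau>_def psd_def sum_nonneg)
  have \<tau>pos: "0 < \<tau> w" if "w \<in> C" for w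
  proof (rule ccontr)
    assume "\<not> 0 < \<tau> w"
    then have "\<tau> w = 0" using \<tau>0[of w] that by (simp add: C_def)
    then have "(\<Sum>k=1..N. quadratic w (X k)) = 0" using N by (simp add: \<tau>_def)
    moreover have "0 \<le> quadratic w (X k)" for k using \<open>w \<in> C\<close> by (simp add: C_def psd_def)
    ultimately have zero: "quadratic w (X k) = 0" if "k \<in> {1..N}" for k
      using sum_nonneg_0[of "{1..N}" "\<lambda>k. quadratic w (X k)" k] that by blast
    have wS: "w \<in> ?S" "psd w" using \<open>w \<in> C\<close> by (auto simp: C_def)
    have "w = 0" by (rule free[OF wS psd_kernel[OF wS(2) zero]])
    then show False using that by (simp add: C_def)
  qed
  have "\<exists>m>0. \<forall>w\<in>C. m \<le> \<tau> w"
  proof (cases "C = {}")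
    case True then show ?thesis by (intro exI[of _ 1]) auto
  next
    case False
    then obtain w where "w \<in> C" "\<forall>w'\<in>C. \<tau> w \<le> \<tau> w'"
      using continuous_attains_inf[OF \<open>compact C\<close> _ cont] by blast
    then show ?thesis using \<tau>pos by blast
  qed
  then obtain m where m: "m > 0" "\<And>w. w \<in> C \<Longrightarrow> m \<le> \<tau> w" by blast
  have \<tau>scale: "\<tau> (c *\<^sub>R K) = c * \<tau> K" for c K by (simp add: \<tau>_def quadratic_scaleR sum_distrib_left algebra_simps)
  have coercive: "m * norm K \<le> \<tau> K" if "K \<in> ?S" "psd K" for K
  proof (cases "K = 0")
    case True then show ?thesis using \<tau>0[OF that(2)] by simp
  next
    case False
    have "(1 / norm K) *\<^sub>R K \<in> C"
      using subspace_scale[OF subspace_stress_space that(1), of "1 / norm K"] psd_scaleR[OF that(2), of "1 / norm K"] False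
      by (simp add: C_def)
    from m(2)[OF this] show ?thesis using False by (simp add: \<tau>scale field_simps)
  qed
  define n where "n = real CARD('n)"
  have n: "n > 0" by (simp add: n_def)
  \<comment> \<open>With this slope the bound of \<open>ln\<close> by its tangent, taken at
    \<open>a * norm K\<close>, charges half of the growth \<open>m * norm K\<close> to the
    logarithm; the other half gives R.\<close>
  define a where "a = m / (2 * n)"
  have a: "a > 0" using m n by (simp add: a_def)
  define c0 where "c0 = f (mat 1)"
  define R where "R = 2 * (c0 + ln (fact CARD('n)) - n - n * ln a) / m"
  define Q where "Q = ?S \<inter> {w. psd w} \<inter> cball 0 R \<inter> {K. exp (- c0) \<le> det K}"
  have "compact (?S \<inter> {w. psd w} \<inter> cball 0 R)"
    using closed_subspace[OF subspace_stress_space] closed_psd by (intro closed_Int_compact closed_Int) auto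
  moreover have "closed {K::real^'n^'n. exp (- c0) \<le> det K}"
    by (intro closed_Collect_le continuous_intros continuous_on_det)
  ultimately have cQ: "compact Q" unfolding Q_def by (rule compact_Int_closed)
  have sub: "K \<in> Q" if K: "K \<in> concentration_matrices E" "f K \<le> c0" for K
  proof -
    have KS: "K \<in> ?S" "positive_definite K" "psd K"
      using K positive_definite_psd by (auto simp: concentration_matrices_iff)
    have d: "det K > 0" by (rule positive_definite_det_pos[OF KS(2)])
    have K0: "norm K > 0" using KS(2) by (auto simp: positive_definite_iff quadratic_def dest: spec[of _ "axis undefined 1"])
    have "- c0 \<le> ln (det K)" using K(2) \<tau>0[OF KS(3)] by (simp add: f)
    then have "exp (- c0) \<le> det K" using d by (metis exp_le_cancel_iff exp_ln)
    moreover have "norm K \<le> R"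
    proof -
      have "det K \<le> fact CARD('n) * norm K ^ CARD('n)" using abs_det_le[of K] by linarith
      then have "ln (det K) \<le> ln (fact CARD('n) * norm K ^ CARD('n))" using d K0 by simp
      also have "\<dots> = ln (fact CARD('n)) + n * ln (norm K)"
        using K0 by (simp add: ln_mult ln_realpow n_def)
      finally have 1: "ln (det K) \<le> ln (fact CARD('n)) + n * ln (norm K)" .
      have "ln (a * norm K) \<le> a * norm K - 1" using a K0 by (intro ln_le_minus_one) simp
      then have "ln (norm K) \<le> a * norm K - 1 - ln a" using a K0 by (simp add: ln_mult)
      then have "n * ln (norm K) \<le> n * (a * norm K - 1 - ln a)" using n by (intro mult_left_mono) auto
      also have "\<dots> = m / 2 * norm K - n - n * ln a" using n by (simp add: a_def algebra_simps)
      finally have "m * norm K \<le> c0 + ln (fact CARD('n)) + (m / 2 * norm K - n - n * ln a)"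
        using 1 coercive[OF KS(1,3)] K(2) by (simp add: f)
      then show ?thesis using m(1) by (simp add: R_def field_simps)
    qed
    ultimately show ?thesis using KS by (simp add: Q_def)
  qed
  have I: "mat 1 \<in> concentration_matrices E"
    using positive_definite_mat by (auto simp: concentration_matrices_iff mat_def intro!: stress_spaceI split: if_splits)
  then have IQ: "mat 1 \<in> Q" using sub by (simp add: c0_def)
  have "continuous_on Q f"
    unfolding f[abs_def]
  proof (intro continuous_on_diff cont continuous_on_ln continuous_on_det ballI)
    fix K assume "K \<in> Q"
    then have "exp (- c0) \<le> det K" by (simp add: Q_def)
    then show "det K \<noteq> 0" by (smt (verit) exp_gt_zero)
  qed
  then obtain K where K: "K \<in> Q" "\<And>K'. K' \<in> Q \<Longrightarrow> f K \<le> f K'"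
    using continuous_attains_inf[OF cQ] IQ by blast
  have "det K \<noteq> 0" using K(1) by (simp add: Q_def) (smt (verit) exp_gt_zero)
  then have inv: "invertible K" using invertible_det_nz by blast
  have "0 < quadratic K x" if "x \<noteq> 0" for x
  proof (rule ccontr)
    assume "\<not> 0 < quadratic K x"
    moreover have "0 \<le> quadratic K x" using K(1) by (simp add: Q_def psd_def)
    ultimately have "K *v x = 0" using K(1) by (intro psd_kernel) (auto simp: Q_def)
    then show False using inv that matrix_left_invertible_ker invertible_left_inverse by blast
  qed
  then have Kc: "K \<in> concentration_matrices E"
    using K(1) by (simp add: Q_def psd_def concentration_matrices_iff positive_definite_iff)
  have "f K \<le> f K'" if "K' \<in> concentration_matrices E" for K'
  proof (cases "f K' \<le> c0")
    case True then show ?thesis using K(2) sub that by blast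
  next
    case False then show ?thesis using K(2)[OF IQ] by (simp add: c0_def)
  qed
  then show ?thesis using Kc unfolding mle_exists_def f_def by blast
qed

section \<open>Polynomial functions\<close>

text \<open>Polynomial functions as the algebra generated by G. The generators are coordinates of a
  Euclidean space, coordinates of several samples, or another given family; induction over the
  generation replaces work with coefficients.\<close>

inductive_set function_algebra :: "('a \<Rightarrow> real) set \<Rightarrow> ('a \<Rightarrow> real) set" for G where
  const: "(\<lambda>_. c) \<in> function_algebra G"
| gen: "g \<in> G \<Longrightarrow> g \<in> function_algebra G"
| add: "f \<in> function_algebra G \<Longrightarrow> g \<in> function_algebra G \<Longrightarrow> (\<lambda>x. f x + g x) \<in> function_algebra G"
| mult: "f \<in> function_algebra G \<Longrightarrow> g \<in> function_algebra G \<Longrightarrow> (\<lambda>x. f x * g x) \<in> function_algebra G"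

lemma function_algebra_sum:
  assumes "\<And>i. i \<in> I \<Longrightarrow> f i \<in> function_algebra G"
  shows "(\<lambda>x. \<Sum>i\<in>I. f i x) \<in> function_algebra G"
  using assms
proof (induction I rule: infinite_finite_induct)
  case (insert i I)
  then have "(\<lambda>x. f i x + (\<Sum>i\<in>I. f i x)) \<in> function_algebra G" by (intro function_algebra.add) auto
  then show ?case using insert by simp
qed (simp_all add: function_algebra.const)

lemma function_algebra_prod:
  assumes "\<And>i. i \<in> I \<Longrightarrow> f i \<in> function_algebra G"
  shows "(\<lambda>x. \<Prod>i\<in>I. f i x) \<in> function_algebra G"
  using assms
proof (induction I rule: infinite_finite_induct)
  case (insert i I)
  then have "(\<lambda>x. f i x * (\<Prod>i\<in>I. f i x)) \<in> function_algebra G" by (intro function_algebra.mult) auto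
  then show ?case using insert by simp
qed (simp_all add: function_algebra.const)

lemma function_algebra_power:
  assumes "f \<in> function_algebra G"
  shows "(\<lambda>x. f x ^ n) \<in> function_algebra G"
proof (induction n)
  case (Suc n)
  then show ?case using function_algebra.mult[OF assms Suc] by simp
qed (simp add: function_algebra.const)

lemma function_algebra_compose:
  assumes "f \<in> function_algebra G" "\<And>g. g \<in> G \<Longrightarrow> (\<lambda>x. g (\<phi> x)) \<in> function_algebra H"
  shows "(\<lambda>x. f (\<phi> x)) \<in> function_algebra H"
  using assms(1)
  by induction (auto intro: function_algebra.const function_algebra.add function_algebra.mult assms(2))

lemma function_algebra_poly:
  assumes "f \<in> function_algebra G" "\<And>g. g \<in> G \<Longrightarrow> \<exists>p. \<forall>s. g (\<phi> s) = poly p s"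
  shows "\<exists>p. \<forall>s. f (\<phi> s) = poly p s"
  using assms(1)
proof induction
  case (const c)
  show ?case by (intro exI[of _ "[:c:]"]) simp
next
  case (add f g)
  then obtain p q where "\<forall>s. f (\<phi> s) = poly p s" "\<forall>s. g (\<phi> s) = poly q s" by blast
  then show ?case by (intro exI[of _ "p + q"]) simp
next
  case (mult f g)
  then obtain p q where "\<forall>s. f (\<phi> s) = poly p s" "\<forall>s. g (\<phi> s) = poly q s" by blast
  then show ?case by (intro exI[of _ "p * q"]) simp
qed (rule assms(2))

abbreviation coordinate_functions :: "('a::euclidean_space \<Rightarrow> real) set" where
  "coordinate_functions \<equiv> (\<lambda>b x. x \<bullet> b) ` Basis"

lemma polynomial_on_line:
  assumes "f \<in> function_algebra (coordinate_functions :: ('a::euclidean_space \<Rightarrow> real) set)"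
  shows "\<exists>p. \<forall>s. f (x + s *\<^sub>R (y - x)) = poly p s"
proof (rule function_algebra_poly[OF assms])
  fix g :: "'a \<Rightarrow> real" assume "g \<in> coordinate_functions"
  then obtain b where "g = (\<lambda>x. x \<bullet> b)" by blast
  then show "\<exists>p. \<forall>s. g (x + s *\<^sub>R (y - x)) = poly p s"
    by (intro exI[of _ "[:x \<bullet> b, (y - x) \<bullet> b:]"]) (simp add: inner_add_left)
qed

text \<open>On the line from a point where the earlier functions are nonzero to one where the new
  function is, their product and the new function are nonzero polynomials in one variable, so only
  finitely many parameters are bad.\<close>

lemma polynomial_common_nonzero:
  fixes h :: "'j \<Rightarrow> 'a::euclidean_space \<Rightarrow> real"
  assumes "finite J" "\<And>j. j \<in> J \<Longrightarrow> h j \<in> function_algebra coordinate_functions" "\<And>j. j \<in> J \<Longrightarrow> \<exists>x. h j x \<noteq> 0"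
  shows "\<exists>x. \<forall>j\<in>J. h j x \<noteq> 0"
  using assms
proof (induction J rule: finite_induct)
  case (insert i J)
  then obtain x where x: "\<forall>j\<in>J. h j x \<noteq> 0" by auto
  obtain y where y: "h i y \<noteq> 0" using insert.prems by blast
  define H where "H = (\<lambda>x. \<Prod>j\<in>J. h j x)"
  have "H \<in> function_algebra coordinate_functions" unfolding H_def using insert.prems by (intro function_algebra_prod) auto
  then obtain p where p: "\<And>s. H (x + s *\<^sub>R (y - x)) = poly p s" using polynomial_on_line by blast
  obtain q where q: "\<And>s. h i (x + s *\<^sub>R (y - x)) = poly q s" using polynomial_on_line insert.prems by blast
  have "poly p 0 \<noteq> 0" using p[of 0] x insert.hyps(1) by (auto simp: H_def dest: sym)
  moreover have "poly q 1 \<noteq> 0" using q[of 1] y by simp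
  ultimately have "p * q \<noteq> 0" by auto
  then have "finite {s. poly (p * q) s = 0}" by (rule poly_roots_finite)
  then obtain s where "poly (p * q) s \<noteq> 0"
    using infinite_UNIV_char_0[where 'a = real] by (metis (mono_tags, lifting) UNIV_eq_I mem_Collect_eq)
  then have "H (x + s *\<^sub>R (y - x)) \<noteq> 0" "h i (x + s *\<^sub>R (y - x)) \<noteq> 0" using p q by auto
  then have "\<forall>j\<in>insert i J. h j (x + s *\<^sub>R (y - x)) \<noteq> 0" using insert.hyps by (auto simp: H_def)
  then show ?case by blast
qed simp

text \<open>The bound is on the exponent of each variable separately, so the monomials form a box
  that is easy to count.\<close>

inductive_set bounded_degree :: "nat \<Rightarrow> ('a::euclidean_space \<Rightarrow> real) set" for N where
  zero: "(\<lambda>_. 0) \<in> bounded_degree N"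
| monomial: "m \<in> Basis \<rightarrow> {..N} \<Longrightarrow> (\<lambda>x. c * (\<Prod>b\<in>Basis. (x \<bullet> b) ^ m b)) \<in> bounded_degree N"
| add: "f \<in> bounded_degree N \<Longrightarrow> g \<in> bounded_degree N \<Longrightarrow> (\<lambda>x. f x + g x) \<in> bounded_degree N"

lemma bounded_degree_mono:
  assumes "f \<in> bounded_degree N" "N \<le> N'"
  shows "f \<in> bounded_degree N'"
  using assms(1)
proof induction
  case (monomial m c)
  have "m b \<le> N'" if "b \<in> Basis" for b using monomial that assms(2) by (auto intro: order_trans)
  then show ?case by (intro bounded_degree.monomial) auto
qed (auto intro: bounded_degree.intros)

lemma bounded_degree_mult:
  assumes f: "f \<in> bounded_degree N" and g: "g \<in> bounded_degree N'"
  shows "(\<lambda>x. f x * g x) \<in> bounded_degree (N + N')"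
  using f
proof induction
  case (monomial m c)
  show ?case
    using g
  proof induction
    case (monomial m' c')
    have "(\<lambda>x. c * c' * (\<Prod>b\<in>Basis. (x \<bullet> b) ^ (m b + m' b))) \<in> bounded_degree (N + N')"
      using monomial \<open>m \<in> Basis \<rightarrow> {..N}\<close> by (intro bounded_degree.monomial) (fastforce intro: add_mono)
    then show ?case by (simp add: power_add prod.distrib mult_ac)
  next
    case (add g1 g2)
    then show ?case using bounded_degree.add[OF add.IH] by (simp add: distrib_left)
  qed (simp add: bounded_degree.zero)
next
  case (add f1 f2)
  then show ?case using bounded_degree.add[OF add.IH] by (simp add: distrib_right)
qed (simp add: bounded_degree.zero)

lemma bounded_degree_const: "(\<lambda>_. c) \<in> bounded_degree N"
  using bounded_degree.monomial[of "\<lambda>_. 0" N c] by simp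

lemma bounded_degree_exists:
  assumes "f \<in> function_algebra coordinate_functions"
  shows "\<exists>N. f \<in> bounded_degree N"
  using assms
proof induction
  case (const c) then show ?case using bounded_degree_const by blast
next
  case (gen g)
  then obtain b where b: "b \<in> Basis" "g = (\<lambda>x. x \<bullet> b)" by blast
  have "(\<lambda>x. 1 * (\<Prod>b'\<in>Basis. (x \<bullet> b') ^ (if b' = b then 1 else 0))) \<in> bounded_degree 1"
    by (intro bounded_degree.monomial) auto
  moreover have "(\<Prod>b'\<in>Basis. (x \<bullet> b') ^ (if b' = b then 1 else 0)) = x \<bullet> b" for x
    using b(1) by (simp add: if_distrib[of "\<lambda>n. _ ^ n"] prod.If_cases cong: if_cong)
  ultimately show ?case using b(2) by auto
next
  case (add f g)
  then obtain N N' where "f \<in> bounded_degree N" "g \<in> bounded_degree N'" by blast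
  then have "f \<in> bounded_degree (max N N')" "g \<in> bounded_degree (max N N')" by (auto intro: bounded_degree_mono)
  then show ?case using bounded_degree.add by blast
next
  case (mult f g)
  then show ?case using bounded_degree_mult by blast
qed

lemma bounded_degree_power:
  assumes "f \<in> bounded_degree N"
  shows "(\<lambda>x. f x ^ n) \<in> bounded_degree (n * N)"
proof (induction n)
  case (Suc n)
  then show ?case using bounded_degree_mult[OF assms Suc] by simp
qed (use bounded_degree_const[of 1] in simp)

lemma bounded_degree_prod:
  assumes "finite I" "\<And>i. i \<in> I \<Longrightarrow> f i \<in> bounded_degree N"
  shows "(\<lambda>x. \<Prod>i\<in>I. f i x) \<in> bounded_degree (card I * N)"
  using assms
proof (induction I rule: finite_induct)
  case (insert i I)
  then have "(\<lambda>x. f i x * (\<Prod>i\<in>I. f i x)) \<in> bounded_degree (N + card I * N)"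
    by (intro bounded_degree_mult) auto
  then show ?case using insert by simp
qed (use bounded_degree_const[of 1] in simp)

lemma bounded_degree_coefficients:
  assumes "f \<in> bounded_degree N"
  shows "\<exists>c. \<forall>x::'a::euclidean_space. f x = (\<Sum>m\<in>Basis \<rightarrow>\<^sub>E {..N}. c m * (\<Prod>b\<in>Basis. (x \<bullet> b) ^ m b))"
  using assms
proof induction
  case zero
  show ?case by (intro exI[of _ "\<lambda>_. 0"]) simp
next
  case (monomial m c)
  have fin: "finite ((Basis :: 'a set) \<rightarrow>\<^sub>E {..N})" by (intro finite_PiE) auto
  define m' where "m' = restrict m (Basis :: 'a set)"
  have "m' \<in> Basis \<rightarrow>\<^sub>E {..N}" using monomial by (auto simp: m'_def)
  then have "(\<Sum>k\<in>Basis \<rightarrow>\<^sub>E {..N}. (if k = m' then c else 0) * (\<Prod>b\<in>Basis. (x \<bullet> b) ^ k b)) = c * (\<Prod>b\<in>Basis. (x \<bullet> b) ^ m' b)" for x :: 'a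
    using fin by (simp add: if_distrib[of "\<lambda>c. c * _"] cong: if_cong)
  moreover have "(\<Prod>b\<in>Basis. (x \<bullet> b) ^ m' b) = (\<Prod>b\<in>Basis. (x \<bullet> b) ^ m b)" for x :: 'a
    by (intro prod.cong) (auto simp: m'_def)
  ultimately show ?case by (intro exI[of _ "\<lambda>k. if k = m' then c else 0"]) simp
next
  case (add f g)
  then obtain c d where "\<forall>x. f x = (\<Sum>m\<in>Basis \<rightarrow>\<^sub>E {..N}. c m * (\<Prod>b\<in>Basis. (x \<bullet> b) ^ m b))"
    "\<forall>x. g x = (\<Sum>m\<in>Basis \<rightarrow>\<^sub>E {..N}. d m * (\<Prod>b\<in>Basis. (x \<bullet> b) ^ m b))" by blast
  then show ?case by (intro exI[of _ "\<lambda>m. c m + d m"]) (simp add: distrib_right sum.distrib)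
qed

section \<open>Algebraic independence and the Jacobian criterion\<close>

text \<open>Exponents are extensional functions on I, so each monomial is listed once; a relation of
  any degree fits below a large M.\<close>

definition alg_indep :: "'j set \<Rightarrow> ('j \<Rightarrow> 'a \<Rightarrow> real) \<Rightarrow> bool" where
  "alg_indep I g \<longleftrightarrow> (\<forall>M c. (\<forall>x. (\<Sum>e\<in>I \<rightarrow>\<^sub>E {..<M}. c e * (\<Prod>i\<in>I. g i x ^ e i)) = 0) \<longrightarrow> (\<forall>e\<in>I \<rightarrow>\<^sub>E {..<M::nat}. c e = 0))"

text \<open>The \<open>M ^ card I\<close> monomials with exponents below M lie in a space of
  polynomials with \<open>(L + 1) ^ DIM('a)\<close> coefficients, where L is linear in M. With more
  functions than dimensions there are too many monomials for large M, and a linear dependency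
  between them is an algebraic relation.\<close>

lemma alg_indep_card:
  fixes g :: "'j \<Rightarrow> 'a::euclidean_space \<Rightarrow> real"
  assumes "alg_indep I g" "finite I" "\<And>i. i \<in> I \<Longrightarrow> g i \<in> function_algebra coordinate_functions"
  shows "card I \<le> DIM('a)"
proof (rule ccontr)
  assume "\<not> card I \<le> DIM('a)"
  then have K: "DIM('a) < card I" by simp
  have "\<forall>i\<in>I. \<exists>N. g i \<in> bounded_degree N" using bounded_degree_exists assms(3) by blast
  then obtain N where N: "\<And>i. i \<in> I \<Longrightarrow> g i \<in> bounded_degree (N i)" by metis
  define D where "D = Max (insert 0 (N ` I))"
  have gD: "g i \<in> bounded_degree D" if "i \<in> I" for i
    using N[OF that] that assms(2) by (auto simp: D_def intro: bounded_degree_mono)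
  define k where "k = DIM('a)"
  \<comment> \<open>Chosen so that \<open>(card I * D + 1) ^ k < M\<close>: one further power of M
    absorbs the constant of the coefficient count.\<close>
  define M where "M = (card I * D + 1) ^ k + 1"
  define L where "L = card I * (M * D)"
  have mono: "(\<lambda>x. \<Prod>i\<in>I. g i x ^ e i) \<in> bounded_degree L" if "e \<in> I \<rightarrow>\<^sub>E {..<M}" for e
    unfolding L_def
  proof (rule bounded_degree_prod[OF assms(2)])
    fix i assume "i \<in> I"
    then have "e i * D \<le> M * D" using that by (intro mult_right_mono) (auto dest!: PiE_mem)
    then show "(\<lambda>x. g i x ^ e i) \<in> bounded_degree (M * D)"
      using bounded_degree_power[OF gD[OF \<open>i \<in> I\<close>], of "e i"] bounded_degree_mono by blast
  qed
  have "\<forall>e\<in>I \<rightarrow>\<^sub>E {..<M}. \<exists>c. \<forall>x::'a. (\<Prod>i\<in>I. g i x ^ e i) = (\<Sum>m\<in>Basis \<rightarrow>\<^sub>E {..L}. c m * (\<Prod>b\<in>Basis. (x \<bullet> b) ^ m b))"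
    using bounded_degree_coefficients[OF mono] by blast
  from bchoice[OF this] obtain A where A: "\<forall>e\<in>I \<rightarrow>\<^sub>E {..<M}. \<forall>x::'a.
      (\<Prod>i\<in>I. g i x ^ e i) = (\<Sum>m\<in>Basis \<rightarrow>\<^sub>E {..L}. A e m * (\<Prod>b\<in>Basis. (x \<bullet> b) ^ m b))" by blast
  have c1: "card (I \<rightarrow>\<^sub>E {..<M}) = M ^ card I" using assms(2) by (simp add: card_PiE)
  have c2: "card ((Basis :: 'a set) \<rightarrow>\<^sub>E {..L}) = (L + 1) ^ k" by (simp add: card_PiE k_def)
  have "L + 1 \<le> (card I * D + 1) * M" by (simp add: L_def M_def algebra_simps)
  then have "(L + 1) ^ k \<le> ((card I * D + 1) * M) ^ k" by (rule power_mono) simp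
  also have "\<dots> = (card I * D + 1) ^ k * M ^ k" by (rule power_mult_distrib)
  also have "\<dots> < M * M ^ k" by (intro mult_strict_right_mono) (auto simp: M_def)
  also have "\<dots> = M ^ Suc k" by simp
  also have "\<dots> \<le> M ^ card I" using K by (intro power_increasing) (auto simp: k_def M_def)
  finally have lt: "card ((Basis :: 'a set) \<rightarrow>\<^sub>E {..L}) < card (I \<rightarrow>\<^sub>E {..<M})" using c1 c2 by simp
  have fin: "finite (I \<rightarrow>\<^sub>E {..<M})" "finite ((Basis :: 'a set) \<rightarrow>\<^sub>E {..L})" using assms(2) by (auto intro: finite_PiE)
  obtain c where c: "\<exists>e\<in>I \<rightarrow>\<^sub>E {..<M}. c e \<noteq> 0" "\<forall>m\<in>Basis \<rightarrow>\<^sub>E {..L}. (\<Sum>e\<in>I \<rightarrow>\<^sub>E {..<M}. c e * A e m) = 0"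
    using homogeneous_system[OF fin lt] by blast
  have "(\<Sum>e\<in>I \<rightarrow>\<^sub>E {..<M}. c e * (\<Prod>i\<in>I. g i x ^ e i)) = 0" for x
  proof -
    have "(\<Sum>e\<in>I \<rightarrow>\<^sub>E {..<M}. c e * (\<Prod>i\<in>I. g i x ^ e i)) =
        (\<Sum>e\<in>I \<rightarrow>\<^sub>E {..<M}. \<Sum>m\<in>Basis \<rightarrow>\<^sub>E {..L}. c e * A e m * (\<Prod>b\<in>Basis. (x \<bullet> b) ^ m b))"
      using A by (intro sum.cong) (auto simp: sum_distrib_left mult.assoc)
    also have "\<dots> = (\<Sum>m\<in>Basis \<rightarrow>\<^sub>E {..L}. (\<Sum>e\<in>I \<rightarrow>\<^sub>E {..<M}. c e * A e m) * (\<Prod>b\<in>Basis. (x \<bullet> b) ^ m b))"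
      by (subst sum.swap) (simp add: sum_distrib_right)
    also have "\<dots> = 0" using c(2) by simp
    finally show ?thesis .
  qed
  then show False using assms(1) c(1) unfolding alg_indep_def by blast
qed

lemma sum_PiE_insert:
  fixes F :: "('j \<Rightarrow> nat) \<Rightarrow> real"
  assumes "j \<notin> I" "finite I"
  shows "(\<Sum>e\<in>insert j I \<rightarrow>\<^sub>E {..<M}. F e) = (\<Sum>l<M. \<Sum>e\<in>I \<rightarrow>\<^sub>E {..<M}. F (e(j := l)))"
proof -
  have "(\<Sum>e\<in>insert j I \<rightarrow>\<^sub>E {..<M}. F e) = (\<Sum>p\<in>{..<M} \<times> (I \<rightarrow>\<^sub>E {..<M}). F ((snd p)(j := fst p)))"
    unfolding PiE_insert_eq
    by (subst sum.reindex[OF inj_combinator[OF assms(1)]]) (simp add: case_prod_unfold)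
  also have "\<dots> = (\<Sum>l<M. \<Sum>e\<in>I \<rightarrow>\<^sub>E {..<M}. F (e(j := l)))"
    by (simp add: sum.cartesian_product case_prod_unfold)
  finally show ?thesis .
qed

lemma prod_update:
  assumes "j \<notin> I" "finite I"
  shows "(\<Prod>i\<in>insert j I. z i ^ (e(j := l)) i) = (z j :: real) ^ l * (\<Prod>i\<in>I. z i ^ (e i :: nat))"
proof -
  have "(\<Prod>i\<in>I. z i ^ (e(j := l)) i) = (\<Prod>i\<in>I. z i ^ e i)" using assms by (intro prod.cong) auto
  then show ?thesis using assms by simp
qed

text \<open>One variable at a time: with the others fixed, a polynomial vanishes on an interval, so
  its coefficients vanish, and these are polynomials on a box of smaller dimension.\<close>

lemma polynomial_zero_on_box:
  assumes "finite D" "r > 0"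
    and "\<And>z. (\<forall>i\<in>D. \<bar>z i - a i\<bar> < r) \<Longrightarrow> (\<Sum>e\<in>D \<rightarrow>\<^sub>E {..<M}. c e * (\<Prod>i\<in>D. z i ^ e i)) = (0::real)"
  shows "\<forall>e\<in>D \<rightarrow>\<^sub>E {..<M}. c e = 0"
  using assms(1,3)
proof (induction D arbitrary: c rule: finite_induct)
  case empty
  then show ?case by simp
next
  case (insert j D)
  have *: "\<forall>e\<in>D \<rightarrow>\<^sub>E {..<M}. c (e(j := l)) = 0" if l: "l < M" for l
  proof (rule insert.IH)
    fix z assume z: "\<forall>i\<in>D. \<bar>z i - a i\<bar> < r"
    define q where "q l = (\<Sum>e\<in>D \<rightarrow>\<^sub>E {..<M}. c (e(j := l)) * (\<Prod>i\<in>D. z i ^ e i))" for l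
    define p where "p = (\<Sum>l<M. monom (q l) l)"
    have "poly p t = 0" if t: "t \<in> {a j - r<..<a j + r}" for t
    proof -
      have "\<forall>i\<in>insert j D. \<bar>(z(j := t)) i - a i\<bar> < r" using z t by (auto simp: abs_less_iff)
      from insert.prems[OF this]
      have "(\<Sum>l<M. \<Sum>e\<in>D \<rightarrow>\<^sub>E {..<M}. c (e(j := l)) * (t ^ l * (\<Prod>i\<in>D. (z(j := t)) i ^ e i))) = 0"
        unfolding sum_PiE_insert[OF insert.hyps(2,1)] prod_update[OF insert.hyps(2,1)] by simp
      moreover have "(\<Prod>i\<in>D. (z(j := t)) i ^ e i) = (\<Prod>i\<in>D. z i ^ e i)" for e
        using insert.hyps by (intro prod.cong) auto
      ultimately show ?thesis by (simp add: p_def poly_sum poly_monom q_def sum_distrib_left mult_ac)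
    qed
    then have "{a j - r<..<a j + r} \<subseteq> {t. poly p t = 0}" by blast
    moreover have "infinite {a j - r<..<a j + r}" using assms(2) by (intro infinite_Ioo) simp
    ultimately have "p = 0" using poly_roots_finite finite_subset by blast
    then have "coeff p l = 0" by simp
    moreover have "coeff p l = q l" unfolding p_def coeff_sum coeff_monom using l by simp
    ultimately show "(\<Sum>e\<in>D \<rightarrow>\<^sub>E {..<M}. c (e(j := l)) * (\<Prod>i\<in>D. z i ^ e i)) = 0" by (simp add: q_def)
  qed
  show ?case
  proof
    fix e assume e: "e \<in> insert j D \<rightarrow>\<^sub>E {..<M}"
    then obtain l e' where "l < M" "e' \<in> D \<rightarrow>\<^sub>E {..<M}" "e = e'(j := l)" unfolding PiE_insert_eq by auto
    then show "c e = 0" using * by blast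
  qed
qed

lemma alg_indep_if_box:
  assumes "finite D" "r > 0" "\<And>z. (\<forall>i\<in>D. \<bar>z i - a i\<bar> < r) \<Longrightarrow> \<exists>x. \<forall>i\<in>D. f i x = z i"
  shows "alg_indep D f"
  unfolding alg_indep_def
proof (intro allI impI)
  fix M c assume 0: "\<forall>x. (\<Sum>e\<in>D \<rightarrow>\<^sub>E {..<M}. c e * (\<Prod>i\<in>D. f i x ^ e i)) = 0"
  show "\<forall>e\<in>D \<rightarrow>\<^sub>E {..<M}. c e = 0"
  proof (rule polynomial_zero_on_box[OF assms(1,2), of a])
    fix z assume "\<forall>i\<in>D. \<bar>z i - a i\<bar> < r"
    then obtain x where "\<forall>i\<in>D. f i x = z i" using assms(3) by blast
    then have "(\<Prod>i\<in>D. z i ^ e i) = (\<Prod>i\<in>D. f i x ^ e i)" for e by (intro prod.cong) auto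
    then show "(\<Sum>e\<in>D \<rightarrow>\<^sub>E {..<M}. c e * (\<Prod>i\<in>D. z i ^ e i)) = 0" using 0 by simp
  qed
qed

definition line_derivative :: "('a::real_vector \<Rightarrow> real) \<Rightarrow> 'a \<Rightarrow> 'a \<Rightarrow> real \<Rightarrow> bool" where
  "line_derivative f x w d \<longleftrightarrow> ((\<lambda>t. f (x + t *\<^sub>R w)) has_field_derivative d) (at 0)"

lemma line_derivative_zero:
  assumes "h \<in> function_algebra G" "\<And>g. g \<in> G \<Longrightarrow> line_derivative g x w 0"
  shows "line_derivative h x w 0"
  using assms(1)
proof induction
  case (add f g)
  then show ?case unfolding line_derivative_def using DERIV_add[of _ 0 0 UNIV _ 0] by fastforce
next
  case (mult f g)
  then show ?case unfolding line_derivative_def using DERIV_mult[of _ 0 0 UNIV _ 0] by fastforce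
qed (auto simp: line_derivative_def assms(2)[unfolded line_derivative_def])

text \<open>Take a relation of least degree in the coordinate b whose coefficients are polynomials
  in the \<open>g i\<close>. Its formal derivative h in that coordinate is not identically zero, as
  it would be a relation of lower degree. When the relation is differentiated along w, the
  coefficients contribute nothing and \<open>h x * (w \<bullet> b)\<close> remains.\<close>

lemma algebraic_relation_derivative:
  fixes y :: "'a::euclidean_space \<Rightarrow> real"
  assumes dep: "\<not> alg_indep (insert j I) g" and ind: "alg_indep I g" and I: "finite I" "j \<notin> I"
    and alg: "\<And>i. i \<in> I \<Longrightarrow> g i \<in> function_algebra coordinate_functions" and gj: "g j = (\<lambda>x. x \<bullet> b)" "b \<in> Basis"
  obtains h where "h \<in> function_algebra coordinate_functions" "\<exists>x. h x \<noteq> 0"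
    "\<And>x w. (\<And>i. i \<in> I \<Longrightarrow> line_derivative (g i) x w 0) \<Longrightarrow> h x * (w \<bullet> b) = 0"
proof -
  let ?A = "function_algebra (g ` I)"
  define relation where "relation N a \<longleftrightarrow> (\<forall>l. a l \<in> ?A) \<and> (\<forall>x. (\<Sum>l\<le>N. a l x * (x \<bullet> b) ^ l) = 0) \<and> (\<exists>x. a N x \<noteq> 0)"
    for N :: nat and a
  have "\<exists>N a. relation N a"
  proof -
    obtain M c e0 where c: "\<And>x. (\<Sum>e\<in>insert j I \<rightarrow>\<^sub>E {..<M}. c e * (\<Prod>i\<in>insert j I. g i x ^ e i)) = 0"
      and e0: "e0 \<in> insert j I \<rightarrow>\<^sub>E {..<M::nat}" "c e0 \<noteq> 0"
      using dep unfolding alg_indep_def by blast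
    define a where "a l = (\<lambda>x. \<Sum>e\<in>I \<rightarrow>\<^sub>E {..<M}. c (e(j := l)) * (\<Prod>i\<in>I. g i x ^ e i))" for l
    have aA: "a l \<in> ?A" for l unfolding a_def
      by (intro function_algebra_sum function_algebra.mult function_algebra.const function_algebra_prod
          function_algebra_power function_algebra.gen) auto
    have rel: "(\<Sum>l<M. a l x * (x \<bullet> b) ^ l) = 0" for x
      using c[of x] unfolding sum_PiE_insert[OF I(2,1)] prod_update[OF I(2,1)]
      by (simp add: a_def gj sum_distrib_left mult_ac)
    obtain l0 e' where l0: "l0 < M" "e' \<in> I \<rightarrow>\<^sub>E {..<M}" "e0 = e'(j := l0)" using e0(1) unfolding PiE_insert_eq by auto
    have "\<exists>x. a l0 x \<noteq> 0"
    proof (rule ccontr)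
      assume "\<nexists>x. a l0 x \<noteq> 0"
      then have "\<forall>x. (\<Sum>e\<in>I \<rightarrow>\<^sub>E {..<M}. c (e(j := l0)) * (\<Prod>i\<in>I. g i x ^ e i)) = 0" by (simp add: a_def)
      then have "\<forall>e\<in>I \<rightarrow>\<^sub>E {..<M}. c (e(j := l0)) = 0" using ind unfolding alg_indep_def by (elim allE[of _ M] allE[of _ "\<lambda>e. c (e(j := l0))"]) blast
      then show False using l0 e0 by blast
    qed
    \<comment> \<open>Top coefficients may vanish identically; N is the largest index whose
      coefficient does not.\<close>
    define T where "T = {l. l < M \<and> (\<exists>x. a l x \<noteq> 0)}"
    have T: "finite T" "l0 \<in> T" using l0 \<open>\<exists>x. a l0 x \<noteq> 0\<close> by (auto simp: T_def)
    define N where "N = Max T"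
    have N: "N \<in> T" unfolding N_def using T by (intro Max_in) auto
    have "(\<Sum>l\<le>N. a l x * (x \<bullet> b) ^ l) = (\<Sum>l<M. a l x * (x \<bullet> b) ^ l)" for x
    proof (rule sum.mono_neutral_left)
      show "{..N} \<subseteq> {..<M}" using N by (auto simp: T_def)
      show "\<forall>l\<in>{..<M} - {..N}. a l x * (x \<bullet> b) ^ l = 0"
      proof
        fix l assume "l \<in> {..<M} - {..N}"
        then have "l \<notin> T" "l < M" using T(1) Max_ge[of T l] by (auto simp: N_def)
        then show "a l x * (x \<bullet> b) ^ l = 0" by (auto simp: T_def)
      qed
    qed simp
    then have "relation N a" unfolding relation_def using aA rel N by (auto simp: T_def)
    then show ?thesis by blast
  qed
  then have "\<exists>a. relation (LEAST N. \<exists>a. relation N a) a" by (rule LeastI_ex)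
  define N where "N = (LEAST N. \<exists>a. relation N a)"
  obtain a where a: "relation N a" using \<open>\<exists>a. relation (LEAST N. \<exists>a. relation N a) a\<close> unfolding N_def by blast
  have least: "\<not> relation N' a'" if "N' < N" for N' a' using that not_less_Least unfolding N_def by blast
  have aA: "a l \<in> ?A" and rel: "(\<Sum>l\<le>N. a l x * (x \<bullet> b) ^ l) = 0" and aN: "\<exists>x. a N x \<noteq> 0" for l x
    using a unfolding relation_def by auto
  have "N \<noteq> 0"
  proof
    assume "N = 0"
    then show False using rel aN by simp
  qed
  define a' where "a' l = (\<lambda>x. real (Suc l) * a (Suc l) x)" for l
  define h where "h = (\<lambda>x. \<Sum>l\<le>N - 1. a' l x * (x \<bullet> b) ^ l)"
  have a'A: "a' l \<in> ?A" for l unfolding a'_def by (intro function_algebra.mult function_algebra.const aA)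
  have "?A \<subseteq> function_algebra coordinate_functions"
  proof
    fix f assume "f \<in> ?A"
    then show "f \<in> function_algebra coordinate_functions"
      by induction (auto intro: function_algebra.const function_algebra.add function_algebra.mult alg)
  qed
  then have "h \<in> function_algebra coordinate_functions"
    unfolding h_def
    by (intro function_algebra_sum function_algebra.mult function_algebra_power subsetD[OF _ a'A] function_algebra.gen)
      (use gj(2) in auto)
  moreover have "\<exists>x. h x \<noteq> 0"
  proof (rule ccontr)
    assume "\<nexists>x. h x \<noteq> 0"
    then have "\<forall>x. (\<Sum>l\<le>N - 1. a' l x * (x \<bullet> b) ^ l) = 0" by (simp add: h_def)
    moreover have "\<exists>x. a' (N - 1) x \<noteq> 0" using aN \<open>N \<noteq> 0\<close> by (simp add: a'_def)
    ultimately have "relation (N - 1) a'" using a'A unfolding relation_def by blast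
    then show False using least[of "N - 1"] \<open>N \<noteq> 0\<close> by simp
  qed
  moreover have "h x * (w \<bullet> b) = 0" if 0: "\<And>i. i \<in> I \<Longrightarrow> line_derivative (g i) x w 0" for x w
  proof -
    have da: "((\<lambda>t. a l (x + t *\<^sub>R w)) has_field_derivative 0) (at 0)" for l
      using line_derivative_zero[OF aA, of x w] 0 unfolding line_derivative_def by blast
    have dy: "((\<lambda>t. ((x + t *\<^sub>R w) \<bullet> b) ^ l) has_field_derivative real l * (x \<bullet> b) ^ (l - 1) * (w \<bullet> b)) (at 0)" for l
      by (auto intro!: derivative_eq_intros simp: inner_add_left)
    have "((\<lambda>t. \<Sum>l\<le>N. a l (x + t *\<^sub>R w) * ((x + t *\<^sub>R w) \<bullet> b) ^ l) has_field_derivative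
        (\<Sum>l\<le>N. a l x * (real l * (x \<bullet> b) ^ (l - 1) * (w \<bullet> b)))) (at 0)"
    proof (intro DERIV_sum)
      fix l
      show "((\<lambda>t. a l (x + t *\<^sub>R w) * ((x + t *\<^sub>R w) \<bullet> b) ^ l) has_field_derivative
          a l x * (real l * (x \<bullet> b) ^ (l - 1) * (w \<bullet> b))) (at 0)"
        using DERIV_mult[OF da[of l] dy[of l]] by (simp add: mult_ac)
    qed
    then have "((\<lambda>t. 0) has_field_derivative (\<Sum>l\<le>N. a l x * (real l * (x \<bullet> b) ^ (l - 1) * (w \<bullet> b)))) (at 0)"
      unfolding rel .
    from DERIV_unique[OF this DERIV_const]
    have "(\<Sum>l\<le>N. a l x * (real l * (x \<bullet> b) ^ (l - 1) * (w \<bullet> b))) = 0" .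
    also have "{..N} = insert 0 (Suc ` {..N - 1})" using \<open>N \<noteq> 0\<close> atMost_Suc_eq_insert_0[of "N - 1"] by simp
    also have "(\<Sum>l\<in>insert 0 (Suc ` {..N - 1}). a l x * (real l * (x \<bullet> b) ^ (l - 1) * (w \<bullet> b))) = h x * (w \<bullet> b)"
      by (simp add: sum.reindex h_def a'_def sum_distrib_left mult_ac)
    finally show ?thesis .
  qed
  ultimately show thesis using that by blast
qed

text \<open>Enlarge the family by coordinates to a maximal algebraically independent one; it has at
  most \<open>DIM('a)\<close> members. Every other coordinate is algebraic over it, so at a point
  where no h of \<open>algebraic_relation_derivative\<close> vanishes, a direction killed by all
  differentials of the family is zero. A relation among the differentials of f would make one
  condition redundant and leave a nonzero direction.\<close>

theorem jacobian_criterion: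
  fixes f :: "'d \<Rightarrow> 'a::euclidean_space \<Rightarrow> real"
  assumes D: "finite D" and ind: "alg_indep D f"
    and alg: "\<And>e. e \<in> D \<Longrightarrow> f e \<in> function_algebra coordinate_functions"
    and df: "\<And>e x w. e \<in> D \<Longrightarrow> line_derivative (f e) x w (f' e x w)" and lin: "\<And>e x. e \<in> D \<Longrightarrow> linear (f' e x)"
  shows "\<exists>x. \<forall>\<mu>. (\<forall>w. (\<Sum>e\<in>D. \<mu> e * f' e x w) = 0) \<longrightarrow> (\<forall>e\<in>D. \<mu> e = 0)"
proof -
  define g :: "'d + 'a \<Rightarrow> 'a \<Rightarrow> real" where "g = case_sum f (\<lambda>b x. x \<bullet> b)"
  define I where "I J = Inl ` D \<union> Inr ` J" for J :: "'a set"
  have g: "g (Inl e) = f e" "g (Inr b) = (\<lambda>x. x \<bullet> b)" for e b by (auto simp: g_def)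
  have galg: "g i \<in> function_algebra coordinate_functions" if "i \<in> I J" "J \<subseteq> Basis" for i J
  proof -
    consider e where "e \<in> D" "i = Inl e" | b where "b \<in> Basis" "i = Inr b" using \<open>i \<in> I J\<close> \<open>J \<subseteq> Basis\<close> by (auto simp: I_def)
    then show ?thesis by cases (simp_all add: alg g function_algebra.gen)
  qed
  have "alg_indep (I {}) g"
    unfolding alg_indep_def
  proof (intro allI impI ballI)
    fix M c e assume 0: "\<forall>x. (\<Sum>e\<in>I {} \<rightarrow>\<^sub>E {..<M}. c e * (\<Prod>i\<in>I {}. g i x ^ e i)) = 0" and e: "e \<in> I {} \<rightarrow>\<^sub>E {..<M}"
    define \<phi> where "\<phi> e = (\<lambda>i::'d + 'a. if i \<in> I {} then e (projl i) else undefined)" for e :: "'d \<Rightarrow> nat"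
    have inj: "inj_on \<phi> (D \<rightarrow>\<^sub>E {..<M})"
    proof (rule inj_onI)
      fix u v assume u: "u \<in> D \<rightarrow>\<^sub>E {..<M}" "v \<in> D \<rightarrow>\<^sub>E {..<M}" "\<phi> u = \<phi> v"
      have "u i = v i" if "i \<in> D" for i using fun_cong[OF u(3), of "Inl i"] that by (simp add: \<phi>_def I_def)
      then show "u = v" using u by (intro PiE_ext) auto
    qed
    have img: "\<phi> ` (D \<rightarrow>\<^sub>E {..<M}) = I {} \<rightarrow>\<^sub>E {..<M}"
    proof
      show "\<phi> ` (D \<rightarrow>\<^sub>E {..<M}) \<subseteq> I {} \<rightarrow>\<^sub>E {..<M}" by (auto simp: \<phi>_def I_def PiE_iff)
      show "I {} \<rightarrow>\<^sub>E {..<M} \<subseteq> \<phi> ` (D \<rightarrow>\<^sub>E {..<M})"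
      proof
        fix v assume v: "v \<in> I {} \<rightarrow>\<^sub>E {..<M}"
        define u where "u = restrict (\<lambda>i. v (Inl i)) D"
        have "u \<in> D \<rightarrow>\<^sub>E {..<M}" using v by (auto simp: u_def I_def PiE_iff)
        moreover have "\<phi> u = v" using v by (auto simp: \<phi>_def u_def I_def PiE_iff extensional_def fun_eq_iff)
        ultimately show "v \<in> \<phi> ` (D \<rightarrow>\<^sub>E {..<M})" by blast
      qed
    qed
    have "(\<Sum>u\<in>D \<rightarrow>\<^sub>E {..<M}. c (\<phi> u) * (\<Prod>i\<in>D. f i x ^ u i)) = 0" for x
    proof -
      have "(\<Prod>i\<in>I {}. g i x ^ \<phi> u i) = (\<Prod>i\<in>D. f i x ^ u i)" for u
        by (simp add: I_def prod.reindex g \<phi>_def)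
      then have "(\<Sum>u\<in>D \<rightarrow>\<^sub>E {..<M}. c (\<phi> u) * (\<Prod>i\<in>D. f i x ^ u i)) = (\<Sum>e\<in>I {} \<rightarrow>\<^sub>E {..<M}. c e * (\<Prod>i\<in>I {}. g i x ^ e i))"
        unfolding img[symmetric] by (subst sum.reindex[OF inj]) simp
      then show ?thesis using 0 by simp
    qed
    then have "\<forall>u\<in>D \<rightarrow>\<^sub>E {..<M}. c (\<phi> u) = 0"
      using ind unfolding alg_indep_def by (elim allE[of _ M] allE[of _ "\<lambda>u. c (\<phi> u)"]) blast
    then show "c e = 0" using e unfolding img[symmetric] by blast
  qed
  define F where "F = {J. J \<subseteq> (Basis :: 'a set) \<and> alg_indep (I J) g}"
  have F: "finite F" "{} \<in> F" using \<open>alg_indep (I {}) g\<close> by (auto simp: F_def intro: finite_subset[of _ "Pow Basis"])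
  then have "Max (card ` F) \<in> card ` F" by (intro Max_in) auto
  then obtain J where J: "J \<in> F" "card J = Max (card ` F)" by auto
  have Jmax: "card J' \<le> card J" if "J' \<in> F" for J' using that F by (simp add: J(2))
  have JB: "J \<subseteq> Basis" "alg_indep (I J) g" "finite J"
    using J(1) finite_subset[OF _ finite_Basis, of J] by (auto simp: F_def)
  have fI: "finite (I J)" using D JB by (simp add: I_def)
  have cI: "card (I J) = card D + card J"
    unfolding I_def using D JB by (subst card_Un_disjoint) (auto simp: card_image)
  have small: "card D + card J \<le> DIM('a)"
    using alg_indep_card[OF JB(2) fI] galg JB(1) cI by metis
  have "\<forall>b\<in>Basis - J. \<exists>h. h \<in> function_algebra coordinate_functions \<and> (\<exists>x. h x \<noteq> 0) \<and>
      (\<forall>x w. (\<forall>i\<in>I J. line_derivative (g i) x w 0) \<longrightarrow> h x * (w \<bullet> b) = 0)"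
  proof
    fix b :: 'a assume b: "b \<in> Basis - J"
    have "insert b J \<notin> F" using Jmax[of "insert b J"] b JB(3) by auto
    then have dep: "\<not> alg_indep (insert (Inr b) (I J)) g" using b JB(1) by (auto simp: F_def I_def)
    have bI: "Inr b \<notin> I J" using b by (auto simp: I_def)
    obtain h where "h \<in> function_algebra coordinate_functions" "\<exists>x. h x \<noteq> 0"
      "\<And>x w. (\<And>i. i \<in> I J \<Longrightarrow> line_derivative (g i) x w 0) \<Longrightarrow> h x * (w \<bullet> b) = 0"
      by (rule algebraic_relation_derivative[OF dep JB(2) fI bI galg g(2)]) (use b JB(1) in auto)
    then show "\<exists>h. h \<in> function_algebra coordinate_functions \<and> (\<exists>x. h x \<noteq> 0) \<and>
      (\<forall>x w. (\<forall>i\<in>I J. line_derivative (g i) x w 0) \<longrightarrow> h x * (w \<bullet> b) = 0)" by blast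
  qed
  then obtain h where h: "\<And>b. b \<in> Basis - J \<Longrightarrow> h b \<in> function_algebra coordinate_functions"
    "\<And>b. b \<in> Basis - J \<Longrightarrow> \<exists>x. h b x \<noteq> 0"
    "\<And>b x w. b \<in> Basis - J \<Longrightarrow> (\<forall>i\<in>I J. line_derivative (g i) x w 0) \<Longrightarrow> h b x * (w \<bullet> b) = 0" by metis
  obtain x where x: "\<forall>b\<in>Basis - J. h b x \<noteq> 0"
    using polynomial_common_nonzero[of "Basis - J" h] h(1,2) by auto
  show ?thesis
  proof (intro exI[of _ x] allI impI ballI, rule ccontr)
    fix \<mu> e0 assume \<mu>: "\<forall>w. (\<Sum>e\<in>D. \<mu> e * f' e x w) = 0" and e0: "e0 \<in> D" "\<mu> e0 \<noteq> 0"
    \<comment> \<open>The condition of \<open>e0\<close> follows from the others through \<mu> and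
      is left out, so fewer equations than dimensions remain.\<close>
    define EQ :: "('d + 'a) set" where "EQ = Inl ` (D - {e0}) \<union> Inr ` J"
    define A where "A b = case_sum (\<lambda>e. f' e x b) (\<lambda>j. b \<bullet> j)" for b
    have "card EQ = card (D - {e0}) + card J"
      unfolding EQ_def using D JB by (subst card_Un_disjoint) (auto simp: card_image)
    then have "card EQ < DIM('a)" using small e0 D by (simp add: card_Diff_singleton)
        (metis One_nat_def Suc_pred add_Suc card_gt_0_iff empty_iff less_eq_Suc_le)
    then obtain c where c: "\<exists>b\<in>Basis. c b \<noteq> 0" "\<forall>i\<in>EQ. (\<Sum>b\<in>Basis. c b * A b i) = 0"
      using homogeneous_system[of "Basis :: 'a set" EQ A] D JB by (auto simp: EQ_def)
    define w where "w = (\<Sum>b\<in>Basis. c b *\<^sub>R b)"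
    have wb: "w \<bullet> b = c b" if "b \<in> Basis" for b using that by (simp add: w_def inner_sum_left_Basis)
    have fw: "f' e x w = (\<Sum>b\<in>Basis. c b * f' e x b)" if "e \<in> D" for e
      using lin[OF that, of x] by (simp add: w_def linear_sum linear_scale)
    have f0: "f' e x w = 0" if "e \<in> D - {e0}" for e
    proof -
      have "Inl e \<in> EQ" using that by (simp add: EQ_def)
      then show ?thesis using c(2) fw that by (auto simp: A_def)
    qed
    have "\<mu> e0 * f' e0 x w + (\<Sum>e\<in>D - {e0}. \<mu> e * f' e x w) = 0" using \<mu> sum.remove[OF D e0(1)] by metis
    then have "f' e0 x w = 0" using f0 e0(2) by simp
    then have fall: "f' e x w = 0" if "e \<in> D" for e using f0 that by (cases "e = e0") auto
    have wJ: "w \<bullet> j = 0" if "j \<in> J" for j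
    proof -
      have "Inr j \<in> EQ" using that by (simp add: EQ_def)
      then have "(\<Sum>b\<in>Basis. c b * (b \<bullet> j)) = 0" using c(2) by (auto simp: A_def)
      then show ?thesis by (simp add: w_def inner_sum_left)
    qed
    have "\<forall>i\<in>I J. line_derivative (g i) x w 0"
    proof
      fix i assume "i \<in> I J"
      then consider e where "e \<in> D" "i = Inl e" | j where "j \<in> J" "i = Inr j" by (auto simp: I_def)
      then show "line_derivative (g i) x w 0"
      proof cases
        case 1 then show ?thesis using df[of e x w] fall by (simp add: g)
      next
        case 2 then show ?thesis using wJ by (simp add: g line_derivative_def inner_add_left)
      qed
    qed
    then have "w \<bullet> b = 0" if "b \<in> Basis" for b
      using h(3)[of b x w] x wJ that by (cases "b \<in> J") auto
    then show False using c(1) wb by auto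
  qed
qed

section \<open>Nonvanishing of polynomials almost everywhere\<close>

abbreviation product_generators :: "'i set \<Rightarrow> ('b \<Rightarrow> real) set \<Rightarrow> (('i \<Rightarrow> 'b) \<Rightarrow> real) set" where
  "product_generators I H \<equiv> (\<lambda>(i, h) X. h (X i)) ` (I \<times> H)"

lemma function_algebra_measurable:
  assumes "f \<in> function_algebra G" "\<And>g. g \<in> G \<Longrightarrow> g \<in> borel_measurable M"
  shows "f \<in> borel_measurable M"
  using assms(1)
  by induction (auto intro: borel_measurable_add borel_measurable_times assms(2))

lemma product_generators_measurable:
  assumes "g \<in> product_generators I H" "\<And>h. h \<in> H \<Longrightarrow> h \<in> borel_measurable M"
  shows "g \<in> borel_measurable (Pi\<^sub>M I (\<lambda>_. M))"
proof -
  obtain i h where g: "g = (\<lambda>X. h (X i))" "i \<in> I" "h \<in> H" using assms(1) by auto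
  show ?thesis unfolding g(1)
    by (rule measurable_compose[OF measurable_component_singleton[OF g(2)] assms(2)[OF g(3)]])
qed

text \<open>Fubini, one factor at a time: for almost every x in the new factor the restricted
  function is not identically zero, and the induction hypothesis applies to it. With
  \<open>one\<close> as a hypothesis the lemma serves both for coordinates under Lebesgue measure
  and for samples.\<close>

lemma polynomial_AE_product:
  assumes I: "finite I" and M: "sigma_finite_measure M"
    and H: "\<And>h. h \<in> H \<Longrightarrow> h \<in> borel_measurable M"
    and one: "\<And>p. p \<in> function_algebra H \<Longrightarrow> \<exists>x. p x \<noteq> 0 \<Longrightarrow> AE x in M. p x \<noteq> 0"
    and f: "f \<in> function_algebra (product_generators I H)" "\<exists>X. f X \<noteq> 0"
  shows "AE X in Pi\<^sub>M I (\<lambda>_. M). f X \<noteq> 0"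
  using I f
proof (induction I arbitrary: f rule: finite_induct)
  case empty
  from empty(1) have "\<exists>c. f = (\<lambda>_. c)" by induction auto
  then show ?case using empty(2) by auto
next
  case (insert i I)
  interpret product_sigma_finite "\<lambda>_. M" using M by (simp add: product_sigma_finite_def)
  obtain X0 where X0: "f X0 \<noteq> 0" using insert.prems by blast
  have alg1: "(\<lambda>x. f (X0(i := x))) \<in> function_algebra H"
  proof (rule function_algebra_compose[OF insert.prems(1), of "\<lambda>x. X0(i := x)"])
    fix g assume "g \<in> product_generators (insert i I) H"
    then obtain i' h where g: "g = (\<lambda>X. h (X i'))" "h \<in> H" by auto
    show "(\<lambda>x. g (X0(i := x))) \<in> function_algebra H"
      using g by (cases "i' = i") (auto intro: function_algebra.const function_algebra.gen)
  qed
  have alg2: "(\<lambda>X. f (X(i := x))) \<in> function_algebra (product_generators I H)" for x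
  proof (rule function_algebra_compose[OF insert.prems(1), of "\<lambda>X. X(i := x)"])
    fix g assume "g \<in> product_generators (insert i I) H"
    then obtain i' h where g: "g = (\<lambda>X. h (X i'))" "h \<in> H" "i' \<in> insert i I" by auto
    show "(\<lambda>X. g (X(i := x))) \<in> function_algebra (product_generators I H)"
    proof (cases "i' = i")
      case True then show ?thesis using g by (auto intro: function_algebra.const)
    next
      case False
      then have "(\<lambda>X. g (X(i := x))) \<in> product_generators I H" using g by (auto intro!: image_eqI[of _ _ "(i', h)"])
      then show ?thesis by (rule function_algebra.gen)
    qed
  qed
  have "AE x in M. f (X0(i := x)) \<noteq> 0"
    by (rule one[OF alg1]) (use X0 in \<open>auto intro!: exI[of _ "X0 i"]\<close>)
  then have ae: "AE x in M. AE X in Pi\<^sub>M I (\<lambda>_. M). f (X(i := x)) \<noteq> 0"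
    by eventually_elim (rule insert.IH[OF alg2], blast)
  have fm [measurable]: "f \<in> borel_measurable (Pi\<^sub>M (insert i I) (\<lambda>_. M))"
    by (rule function_algebra_measurable[OF insert.prems(1)]) (rule product_generators_measurable[OF _ H])
  define u where "u X = (if f X = 0 then 1 else 0 :: ennreal)" for X
  have um: "u \<in> borel_measurable (Pi\<^sub>M (insert i I) (\<lambda>_. M))" unfolding u_def by measurable
  have "(\<integral>\<^sup>+ X. u X \<partial>Pi\<^sub>M (insert i I) (\<lambda>_. M)) = (\<integral>\<^sup>+ x. \<integral>\<^sup>+ X. u (X(i := x)) \<partial>Pi\<^sub>M I (\<lambda>_. M) \<partial>M)"
    by (rule product_nn_integral_insert_rev[OF insert.hyps um])
  also have "\<dots> = (\<integral>\<^sup>+ x. 0 \<partial>M)"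
  proof (rule nn_integral_cong_AE)
    show "AE x in M. (\<integral>\<^sup>+ X. u (X(i := x)) \<partial>Pi\<^sub>M I (\<lambda>_. M)) = 0"
      using ae
    proof eventually_elim
      case (elim x)
      then have "(\<integral>\<^sup>+ X. u (X(i := x)) \<partial>Pi\<^sub>M I (\<lambda>_. M)) = (\<integral>\<^sup>+ X. 0 \<partial>Pi\<^sub>M I (\<lambda>_. M))"
        by (intro nn_integral_cong_AE) (auto simp: u_def)
      then show ?case by simp
    qed
  qed
  finally have "AE X in Pi\<^sub>M (insert i I) (\<lambda>_. M). u X = 0" using nn_integral_0_iff_AE[OF um] by simp
  then show ?case by eventually_elim (auto simp: u_def split: if_splits)
qed

text \<open>Lebesgue measure is the image of a product of one-dimensional ones, where a nonzero
  polynomial has finitely many roots.\<close>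

lemma polynomial_AE_lborel:
  fixes f :: "'a::euclidean_space \<Rightarrow> real"
  assumes f: "f \<in> function_algebra coordinate_functions" "\<exists>x. f x \<noteq> 0"
  shows "AE x in lborel. f x \<noteq> 0"
proof -
  define \<phi> :: "('a \<Rightarrow> real) \<Rightarrow> 'a" where "\<phi> X = (\<Sum>b\<in>Basis. X b *\<^sub>R b)" for X
  have one: "AE x in lborel. p x \<noteq> 0" if p: "p \<in> function_algebra {\<lambda>x::real. x}" "\<exists>x. p x \<noteq> 0" for p
  proof -
    have "\<exists>q. \<forall>s. p s = poly q s"
      by (rule function_algebra_poly[OF p(1), of "\<lambda>s. s"]) (auto intro!: exI[of _ "[:0, 1:]"])
    then obtain q where q: "\<And>s. p s = poly q s" by blast
    then have "q \<noteq> 0" using p(2) by auto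
    then have "finite {s. poly q s = 0}" by (rule poly_roots_finite)
    then have "{s. poly q s = 0} \<in> null_sets lborel" by (rule finite_imp_null_set_lborel)
    then have "AE s in lborel. s \<notin> {s. poly q s = 0}" by (rule AE_not_in)
    then show ?thesis using q by simp
  qed
  have comp: "(\<lambda>X. f (\<phi> X)) \<in> function_algebra (product_generators Basis {\<lambda>x. x})"
  proof (rule function_algebra_compose[OF f(1), of \<phi>])
    fix g :: "'a \<Rightarrow> real" assume "g \<in> coordinate_functions"
    then obtain b where b: "b \<in> Basis" "g = (\<lambda>x. x \<bullet> b)" by blast
    then have "(\<lambda>X. g (\<phi> X)) = (\<lambda>X. X b)" by (auto simp: \<phi>_def)
    then show "(\<lambda>X. g (\<phi> X)) \<in> function_algebra (product_generators Basis {\<lambda>x. x})"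
      using b(1) by (auto intro!: function_algebra.gen)
  qed
  obtain x0 where "f x0 \<noteq> 0" using f(2) by blast
  then have "f (\<phi> (\<lambda>b. x0 \<bullet> b)) \<noteq> 0" by (simp add: \<phi>_def euclidean_representation)
  then have "\<exists>X. f (\<phi> X) \<noteq> 0" by blast
  then have "AE X in (\<Pi>\<^sub>M b\<in>Basis. lborel). f (\<phi> X) \<noteq> 0"
    by (intro polynomial_AE_product[OF finite_Basis _ _ one comp]) (auto intro: lborel.sigma_finite_measure_axioms)
  moreover have \<phi>m: "\<phi> \<in> measurable (\<Pi>\<^sub>M b\<in>Basis. lborel) borel" unfolding \<phi>_def[abs_def] by measurable
  have [measurable]: "f \<in> borel_measurable borel"
    by (rule function_algebra_measurable[OF f(1)]) auto
  have "{x \<in> space borel. f x \<noteq> 0} \<in> sets borel" by measurable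
  note AE_distr_iff[OF \<phi>m this]
  ultimately have "AE x in distr (\<Pi>\<^sub>M b\<in>Basis. lborel) borel \<phi>. f x \<noteq> 0" by blast
  moreover have eq: "(lborel :: 'a measure) = distr (\<Pi>\<^sub>M b\<in>Basis. lborel) borel \<phi>"
    unfolding \<phi>_def[abs_def] by (rule lborel_eq)
  ultimately show ?thesis by (subst eq)
qed

lemma polynomial_AE_samples:
  fixes f :: "(nat \<Rightarrow> real^'n) \<Rightarrow> real"
  assumes \<mu>: "equiv_lebesgue_distribution \<mu>"
    and f: "f \<in> function_algebra (product_generators {1..N} coordinate_functions)" "\<exists>X. f X \<noteq> 0"
  shows "AE X in (\<Pi>\<^sub>M k\<in>{1..N}. \<mu>). f X \<noteq> 0"
proof (rule polynomial_AE_product[OF finite_atLeastAtMost _ _ _ f])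
  interpret prob_space \<mu> using \<mu> by (simp add: equiv_lebesgue_distribution_def)
  show "sigma_finite_measure \<mu>" by (rule sigma_finite_measure_axioms)
  have sets: "sets \<mu> = sets borel" and ac: "absolutely_continuous lborel \<mu>"
    using \<mu> by (auto simp: equiv_lebesgue_distribution_def)
  show "h \<in> borel_measurable \<mu>" if "h \<in> coordinate_functions" for h :: "real^'n \<Rightarrow> real"
    using that by (subst measurable_cong_sets[OF sets refl]) auto
  show "AE x in \<mu>. p x \<noteq> 0" if "p \<in> function_algebra coordinate_functions" "\<exists>x. p x \<noteq> 0" for p :: "real^'n \<Rightarrow> real"
    by (rule absolutely_continuous_AE[OF _ ac polynomial_AE_lborel[OF that]]) (simp add: sets)
qed

section \<open>Generically stress-free samples\<close>

text \<open>The diagonal position of i is the singleton \<open>{i}\<close>, so one index set covers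
  diagonal and edges; for a simple graph it has m + n elements.\<close>

definition graph_support :: "'n::finite set set \<Rightarrow> 'n set set" where
  "graph_support E = {e. \<exists>i j. e = {i, j} \<and> (i = j \<or> {i, j} \<in> E)}"

lemma graph_support_iff: "{i, j} \<in> graph_support E \<longleftrightarrow> i = j \<or> {i, j} \<in> E"
  by (auto simp: graph_support_def doubleton_eq_iff insert_commute)

definition edge_matrix :: "'n::finite set \<Rightarrow> real^'n^'n" where
  "edge_matrix e = (\<chi> i j. if {i, j} = e then 1 else 0)"

lemma edge_matrix_nth [simp]: "edge_matrix e $ i $ j = (if {i, j} = e then 1 else 0)"
  by (simp add: edge_matrix_def)

lemma edge_combination_nth:
  "(\<Sum>e\<in>graph_support E. c e *\<^sub>R edge_matrix e) $ i $ j = (if {i, j} \<in> graph_support E then c {i, j} else 0)"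
  by (simp add: if_distrib[of "\<lambda>x. c _ * x"] cong: if_cong)

lemma edge_combination_stress_space:
  "(\<Sum>e\<in>graph_support E. c e *\<^sub>R edge_matrix e) \<in> stress_space UNIV E"
proof (rule stress_spaceI)
  fix i j
  show "(\<Sum>e\<in>graph_support E. c e *\<^sub>R edge_matrix e) $ i $ j = (\<Sum>e\<in>graph_support E. c e *\<^sub>R edge_matrix e) $ j $ i"
    unfolding edge_combination_nth by (simp add: insert_commute)
  assume "(\<Sum>e\<in>graph_support E. c e *\<^sub>R edge_matrix e) $ i $ j \<noteq> 0"
  then have "{i, j} \<in> graph_support E" unfolding edge_combination_nth by (auto split: if_splits)
  then show "i \<in> UNIV \<and> j \<in> UNIV \<and> (i = j \<or> {i, j} \<in> E)" by (simp add: graph_support_iff)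
qed

lemma stress_edge_combination:
  fixes w :: "real^'n^'n::finite"
  assumes w: "w \<in> stress_space UNIV E"
  obtains c where "w = (\<Sum>e\<in>graph_support E. c e *\<^sub>R edge_matrix e)"
    "\<And>e. e \<notin> graph_support E \<Longrightarrow> c e = 0"
proof -
  define p where "p e = (SOME p. {fst p, snd p} = e)" for e :: "'n set"
  define c where "c e = (if e \<in> graph_support E then w $ fst (p e) $ snd (p e) else 0)" for e
  have sym: "w $ i $ j = w $ j $ i" for i j by (rule stress_spaceD(2)[OF w])
  have "w $ i $ j = (if {i, j} \<in> graph_support E then c {i, j} else 0)" for i j
  proof -
    have "{fst (p {i, j}), snd (p {i, j})} = {i, j}" unfolding p_def by (rule someI[of _ "(i, j)"]) simp
    then have "w $ fst (p {i, j}) $ snd (p {i, j}) = w $ i $ j" using sym by (auto simp: doubleton_eq_iff)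
    moreover have "w $ i $ j = 0" if "{i, j} \<notin> graph_support E"
      using stress_spaceD(4)[OF w, of i j] that by (auto simp: graph_support_iff)
    ultimately show ?thesis by (auto simp: c_def)
  qed
  then have "w = (\<Sum>e\<in>graph_support E. c e *\<^sub>R edge_matrix e)" unfolding vec_eq_iff edge_combination_nth by blast
  then show thesis by (rule that) (simp add: c_def)
qed

definition stress_free :: "'n::finite set set \<Rightarrow> 'k set \<Rightarrow> ('k \<Rightarrow> real^'n) \<Rightarrow> bool" where
  "stress_free E K X \<longleftrightarrow> (\<forall>w\<in>stress_space UNIV E. (\<forall>k\<in>K. w *v X k = 0) \<longrightarrow> w = 0)"

text \<open>
  The Gram matrix of the linear map \<open>w \<mapsto> (w *v X k)\<^sub>k\<close> on stresses in the basis of edge matrices,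
  padded by an identity block on the sets that are not edges.
\<close>

definition stress_gram :: "'n::finite set set \<Rightarrow> 'k set \<Rightarrow> ('k \<Rightarrow> real^'n) \<Rightarrow> real^('n set)^('n set)" where
  "stress_gram E K X = (\<chi> e e'. if e \<in> graph_support E \<and> e' \<in> graph_support E
     then \<Sum>k\<in>K. (edge_matrix e *v X k) \<bullet> (edge_matrix e' *v X k) else if e = e' then 1 else 0)"

lemma stress_gram_mult:
  fixes X :: "'k \<Rightarrow> real^'n::finite"
  assumes "e \<in> graph_support E" "\<And>e. e \<notin> graph_support E \<Longrightarrow> c $ e = 0"
  shows "(stress_gram E K X *v c) $ e =
    (\<Sum>k\<in>K. (edge_matrix e *v X k) \<bullet> ((\<Sum>e\<in>graph_support E. c $ e *\<^sub>R edge_matrix e) *v X k))"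
proof -
  have lin: "(\<Sum>e\<in>graph_support E. c $ e *\<^sub>R edge_matrix e) *v x = (\<Sum>e\<in>graph_support E. c $ e *\<^sub>R (edge_matrix e *v x))" for x
    by (simp add: matrix_vector_mult_def vec_eq_iff sum_distrib_right sum_distrib_left sum_component mult.assoc) (subst sum.swap, simp)
  have "(stress_gram E K X *v c) $ e = (\<Sum>e'\<in>UNIV. stress_gram E K X $ e $ e' * c $ e')"
    by (simp add: matrix_vector_mult_def)
  also have "\<dots> = (\<Sum>e'\<in>graph_support E. stress_gram E K X $ e $ e' * c $ e')"
    using assms(2) by (intro sum.mono_neutral_right) auto
  also have "\<dots> = (\<Sum>e'\<in>graph_support E. \<Sum>k\<in>K. c $ e' * ((edge_matrix e *v X k) \<bullet> (edge_matrix e' *v X k)))"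
    using assms(1) by (intro sum.cong) (auto simp: stress_gram_def sum_distrib_left mult.commute)
  also have "\<dots> = (\<Sum>k\<in>K. (edge_matrix e *v X k) \<bullet> ((\<Sum>e\<in>graph_support E. c $ e *\<^sub>R edge_matrix e) *v X k))"
    unfolding lin by (subst sum.swap) (simp add: inner_sum_right)
  finally show ?thesis .
qed

text \<open>For c supported on \<open>graph_support E\<close>, pairing the image of c with c gives
  the sum of the squared norms of \<open>w *v X k\<close>, where w is the stress with coefficients
  c; a kernel vector is thus a stress that kills all samples.\<close>

lemma det_stress_gram:
  fixes X :: "'k \<Rightarrow> real^'n::finite"
  assumes K: "finite K"
  shows "det (stress_gram E K X) \<noteq> 0 \<longleftrightarrow> stress_free E K X"
proof
  assume det: "det (stress_gram E K X) \<noteq> 0"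
  show "stress_free E K X"
    unfolding stress_free_def
  proof (intro ballI impI)
    fix w assume w: "w \<in> stress_space UNIV E" "\<forall>k\<in>K. w *v X k = 0"
    obtain c where c: "w = (\<Sum>e\<in>graph_support E. c e *\<^sub>R edge_matrix e)" "\<And>e. e \<notin> graph_support E \<Longrightarrow> c e = 0"
      using stress_edge_combination[OF w(1)] by blast
    have "(stress_gram E K X *v (\<chi> e. c e)) $ e = 0" for e
    proof (cases "e \<in> graph_support E")
      case True
      then show ?thesis using stress_gram_mult[OF True, of "\<chi> e. c e" K X] c w(2) by simp
    next
      case False
      then show ?thesis using c(2) by (simp add: matrix_vector_mult_def stress_gram_def if_distrib[of "\<lambda>x. x * _"] cong: if_cong)
    qed
    then have "stress_gram E K X *v (\<chi> e. c e) = 0" by (simp add: vec_eq_iff)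
    then have "(\<chi> e. c e) = (0 :: real^('n set))"
      using det invertible_det_nz matrix_left_invertible_ker invertible_left_inverse by blast
    then have "c e = 0" for e by (simp add: vec_eq_iff)
    then show "w = 0" using c(1) by simp
  qed
next
  assume free: "stress_free E K X"
  have "c = 0" if 0: "stress_gram E K X *v c = 0" for c
  proof -
    have out: "c $ e = 0" if "e \<notin> graph_support E" for e
    proof -
      have "(stress_gram E K X *v c) $ e = c $ e"
        using that by (simp add: matrix_vector_mult_def stress_gram_def if_distrib[of "\<lambda>x. x * _"] cong: if_cong)
      then show ?thesis using 0 by simp
    qed
    define w where "w = (\<Sum>e\<in>graph_support E. c $ e *\<^sub>R edge_matrix e)"
    have w: "w \<in> stress_space UNIV E" unfolding w_def by (rule edge_combination_stress_space)
    have lin: "w *v x = (\<Sum>e\<in>graph_support E. c $ e *\<^sub>R (edge_matrix e *v x))" for x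
      by (simp add: w_def matrix_vector_mult_def vec_eq_iff sum_distrib_right sum_distrib_left sum_component mult.assoc) (subst sum.swap, simp)
    have "(\<Sum>k\<in>K. (edge_matrix e *v X k) \<bullet> (w *v X k)) = 0" if "e \<in> graph_support E" for e
      using stress_gram_mult[OF that out, of K X] 0 by (simp add: w_def)
    then have "0 = (\<Sum>e\<in>graph_support E. c $ e * (\<Sum>k\<in>K. (edge_matrix e *v X k) \<bullet> (w *v X k)))" by simp
    also have "\<dots> = (\<Sum>k\<in>K. (w *v X k) \<bullet> (w *v X k))"
      unfolding sum_distrib_left by (subst sum.swap) (simp add: lin[of "X _"] inner_sum_left)
    finally have "(\<Sum>k\<in>K. (w *v X k) \<bullet> (w *v X k)) = 0" by simp
    then have "\<forall>k\<in>K. (w *v X k) \<bullet> (w *v X k) = 0" using sum_nonneg_eq_0_iff[OF K, of "\<lambda>k. (w *v X k) \<bullet> (w *v X k)"] by simp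
    then have "\<forall>k\<in>K. w *v X k = 0" by simp
    then have "w = 0" using free w unfolding stress_free_def by blast
    have "c $ e = 0" if supp: "e \<in> graph_support E" for e
    proof -
      obtain i j where e: "e = {i, j}" using supp by (auto simp: graph_support_def)
      have "w $ i $ j = c $ e" using supp unfolding w_def edge_combination_nth e by simp
      then show ?thesis using \<open>w = 0\<close> by simp
    qed
    then show "c = 0" using out unfolding vec_eq_iff by (metis zero_index)
  qed
  then show "det (stress_gram E K X) \<noteq> 0"
    using matrix_left_invertible_ker invertible_left_inverse invertible_det_nz by blast
qed

lemma stress_gram_polynomial:
  fixes E :: "'n::finite set set"
  shows "(\<lambda>X. det (stress_gram E K X)) \<in> function_algebra (product_generators K coordinate_functions)"
    (is "_ \<in> ?A")
proof -
  have coord: "(\<lambda>X. X k $ j) \<in> ?A" if "k \<in> K" for k j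
  proof -
    have "(\<lambda>X::'a \<Rightarrow> real^'n. X k $ j) = (\<lambda>X. X k \<bullet> axis j 1)" by (simp add: inner_axis)
    then show ?thesis using that
      by (auto intro!: function_algebra.gen image_eqI[of _ _ "(k, \<lambda>x. x \<bullet> axis j 1)"] simp: axis_in_Basis_iff)
  qed
  have entry: "(\<lambda>X. stress_gram E K X $ e $ e') \<in> ?A" for e e'
  proof (cases "e \<in> graph_support E \<and> e' \<in> graph_support E")
    case True
    have "(\<lambda>X. \<Sum>k\<in>K. \<Sum>i\<in>UNIV. (\<Sum>j\<in>UNIV. edge_matrix e $ i $ j * X k $ j) * (\<Sum>j\<in>UNIV. edge_matrix e' $ i $ j * X k $ j)) \<in> ?A"
      by (intro function_algebra_sum function_algebra.mult function_algebra.const coord)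
    moreover have "stress_gram E K X $ e $ e' =
      (\<Sum>k\<in>K. \<Sum>i\<in>UNIV. (\<Sum>j\<in>UNIV. edge_matrix e $ i $ j * X k $ j) * (\<Sum>j\<in>UNIV. edge_matrix e' $ i $ j * X k $ j))" for X
      unfolding stress_gram_def inner_vec_def matrix_vector_mult_def using True by simp
    ultimately show ?thesis by simp
  next
    case False
    then have "(\<lambda>X. stress_gram E K X $ e $ e') = (\<lambda>X. if e = e' then 1 else 0)" by (auto simp: stress_gram_def)
    then show ?thesis using function_algebra.const by metis
  qed
  show ?thesis
    unfolding det_def by (intro function_algebra_sum function_algebra.mult function_algebra.const function_algebra_prod entry)
qed

theorem stress_free_mle:
  assumes "1 \<le> N" and free: "stress_free E {1..N} X0" and "equiv_lebesgue_distribution \<mu>"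
  shows "AE X in (\<Pi>\<^sub>M k\<in>{1..N}. \<mu>). mle_exists E N X"
proof -
  have "\<exists>X. det (stress_gram E {1..N} X) \<noteq> 0" using free det_stress_gram[of "{1..N}" E X0] by blast
  with polynomial_AE_samples[OF assms(3) stress_gram_polynomial]
  have "AE X in (\<Pi>\<^sub>M k\<in>{1..N}. \<mu>). det (stress_gram E {1..N} X) \<noteq> 0" by blast
  then show ?thesis
  proof eventually_elim
    case (elim X)
    then have "stress_free E {1..N} X" using det_stress_gram[of "{1..N}"] by blast
    then show ?case unfolding stress_free_def by (intro mle_existsI[OF assms(1)]) blast
  qed
qed

section \<open>Open sets of samples without an estimate\<close>

text \<open>The threshold quantifies over these distributions, so an instance is needed to draw any
  conclusion from it. A strictly positive integrable function, normalized, is a density.\<close>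

lemma equiv_lebesgue_distribution_exists: "\<exists>\<mu> :: (real^'n) measure. equiv_lebesgue_distribution \<mu>"
proof -
  obtain h :: "real^'n \<Rightarrow> ennreal" where h [measurable]: "h \<in> borel_measurable lborel"
    and fin: "integral\<^sup>N lborel h \<noteq> \<infinity>" and pos: "\<And>x. 0 < h x \<and> h x < \<infinity>"
    using sigma_finite_measure.Ex_finite_integrable_function[OF sigma_finite_lborel] by auto
  define c where "c = integral\<^sup>N lborel h"
  have "c \<noteq> 0"
  proof
    assume "c = 0"
    then have "AE x in lborel. h x = 0" using nn_integral_0_iff_AE[OF h] by (simp add: c_def)
    then have "AE x in (lborel :: (real^'n) measure). x \<notin> UNIV" by eventually_elim (use pos in \<open>metis less_irrefl\<close>)
    then have "(UNIV :: (real^'n) set) \<in> null_sets lborel" by (subst AE_iff_null_sets) auto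
    then show False using null_setsD1 by fastforce
  qed
  have "c < \<infinity>" using fin by (simp add: c_def less_top)
  define \<mu> where "\<mu> = density lborel (\<lambda>x. h x / c)"
  have m [measurable]: "(\<lambda>x. h x / c) \<in> borel_measurable lborel" by measurable
  have "emeasure \<mu> (space \<mu>) = (\<integral>\<^sup>+ x. h x / c \<partial>lborel)"
    unfolding \<mu>_def by (subst emeasure_density) auto
  also have "\<dots> = c / c" unfolding c_def by (rule nn_integral_divide) simp
  also have "\<dots> = 1" using \<open>c \<noteq> 0\<close> \<open>c < \<infinity>\<close> by simp
  finally have "prob_space \<mu>" by (rule prob_spaceI)
  moreover have "sets \<mu> = sets borel" by (simp add: \<mu>_def)
  moreover have "absolutely_continuous lborel \<mu>" unfolding \<mu>_def by (rule absolutely_continuousI_density[OF m])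
  moreover have "absolutely_continuous \<mu> lborel"
    unfolding absolutely_continuous_def
  proof
    fix A assume "A \<in> null_sets \<mu>"
    then have A: "A \<in> sets lborel" "AE x in lborel. x \<in> A \<longrightarrow> h x / c = 0"
      unfolding \<mu>_def null_sets_density_iff[OF m] by auto
    have "h x / c \<noteq> 0" for x
      using pos[of x] \<open>c < \<infinity>\<close> by (auto simp: ennreal_divide_eq_0_iff)
    then have "AE x in lborel. x \<notin> A" using A(2) by auto
    then show "A \<in> null_sets lborel" using A(1) AE_iff_null_sets by blast
  qed
  ultimately show ?thesis unfolding equiv_lebesgue_distribution_def by blast
qed

text \<open>A product of nonempty open sets has positive measure under the sample law, so an almost
  sure property holds somewhere in it.\<close>

lemma mle_exists_somewhere:
  fixes U :: "nat \<Rightarrow> (real^'n) set"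
  assumes ae: "\<And>\<mu>. equiv_lebesgue_distribution \<mu> \<Longrightarrow> AE X in (\<Pi>\<^sub>M k\<in>{1..N}. \<mu>). mle_exists E N X"
    and U: "\<And>k. k \<in> {1..N} \<Longrightarrow> open (U k)" "\<And>k. k \<in> {1..N} \<Longrightarrow> U k \<noteq> {}"
  shows "\<exists>X. (\<forall>k\<in>{1..N}. X k \<in> U k) \<and> mle_exists E N X"
proof (rule ccontr)
  assume no: "\<not> ?thesis"
  obtain \<mu> :: "(real^'n) measure" where \<mu>: "equiv_lebesgue_distribution \<mu>" using equiv_lebesgue_distribution_exists by blast
  interpret prob_space \<mu> using \<mu> by (simp add: equiv_lebesgue_distribution_def)
  interpret P: product_sigma_finite "\<lambda>_::nat. \<mu>" by (simp add: product_sigma_finite_def sigma_finite_measure_axioms)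
  have sets: "sets \<mu> = sets borel" and ac: "absolutely_continuous \<mu> lborel"
    using \<mu> by (auto simp: equiv_lebesgue_distribution_def)
  have Us: "U k \<in> sets \<mu>" if "k \<in> {1..N}" for k using U(1)[OF that] by (simp add: sets)
  have pos: "emeasure \<mu> (U k) \<noteq> 0" if k: "k \<in> {1..N}" for k
  proof
    assume "emeasure \<mu> (U k) = 0"
    then have "U k \<in> null_sets \<mu>" using Us[OF k] by auto
    then have "U k \<in> null_sets lborel" using ac by (auto simp: absolutely_continuous_def)
    then have "negligible (U k)" using negligible_iff_null_sets null_sets_completionI by blast
    then show False using open_not_negligible U k by blast
  qed
  have "AE X in (\<Pi>\<^sub>M k\<in>{1..N}. \<mu>). X \<notin> Pi\<^sub>E {1..N} U"
    using ae[OF \<mu>] by eventually_elim (use no in \<open>auto simp: PiE_iff\<close>)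
  moreover have "Pi\<^sub>E {1..N} U \<in> sets (\<Pi>\<^sub>M k\<in>{1..N}. \<mu>)" using Us by (intro sets_PiM_I_finite) auto
  ultimately have "emeasure (\<Pi>\<^sub>M k\<in>{1..N}. \<mu>) (Pi\<^sub>E {1..N} U) = 0"
    using AE_iff_null_sets by (blast dest: null_setsD1)
  then have "(\<Prod>k\<in>{1..N}. emeasure \<mu> (U k)) = 0" using P.emeasure_PiM[of "{1..N}" U] Us by simp
  then show False using pos by (simp add: prod_zero_iff)
qed

lemma psd_add: "psd v \<Longrightarrow> psd w \<Longrightarrow> psd (v + w)"
  unfolding psd_def by (auto simp: quadratic_add transpose_def vec_eq_iff)

lemma outer_stress_space:
  assumes "\<And>i j. u $ i \<noteq> 0 \<Longrightarrow> u $ j \<noteq> 0 \<Longrightarrow> i = j \<or> {i, j} \<in> E"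
  shows "outer u \<in> stress_space UNIV E"
  by (rule stress_spaceI) (use assms in \<open>auto simp: mult.commute\<close>)

text \<open>The square of a vector supported on i and j and orthogonal to x.\<close>

lemma edge_psd_stress:
  fixes x :: "real^'n::finite"
  assumes E: "{i, j} \<in> E" "i \<noteq> j" and x: "x $ j \<noteq> 0"
  obtains w where "w \<in> stress_space UNIV E" "psd w" "w \<noteq> 0" "w *v x = 0"
proof
  define u :: "real^'n" where "u = x $ j *\<^sub>R axis i 1 - x $ i *\<^sub>R axis j 1"
  have u: "u $ k = (if k = i then x $ j else if k = j then - (x $ i) else 0)" for k
    using E(2) by (simp add: u_def axis_def)
  show "outer u \<in> stress_space UNIV E"
    by (rule outer_stress_space) (use E in \<open>auto simp: u insert_commute split: if_splits\<close>)
  show "psd (outer u)" by (rule psd_outer)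
  have "outer u $ i $ i \<noteq> 0" using x by (simp add: u)
  then show "outer u \<noteq> 0" by (metis zero_index)
  have "u \<bullet> x = 0" by (simp add: u_def inner_diff_left inner_axis')
  then show "outer u *v x = 0" by (simp add: outer_mult)
qed

definition det2 :: "real^'n \<Rightarrow> real^'n \<Rightarrow> 'n \<Rightarrow> 'n \<Rightarrow> real" where
  "det2 x y i j = x $ i * y $ j - x $ j * y $ i"

text \<open>Cramer's rule: three vectors in the plane satisfy the linear relation whose coefficients
  are the opposite 2 by 2 minors.\<close>

lemma triangle_stress:
  fixes x y :: "real^'n::finite"
  assumes "a \<noteq> b" "b \<noteq> c" "a \<noteq> c"
  obtains u where "u $ a = det2 x y b c" "u $ b = det2 x y c a" "u $ c = det2 x y a b"
    "\<And>k. k \<notin> {a, b, c} \<Longrightarrow> u $ k = 0" "u \<bullet> x = 0" "u \<bullet> y = 0"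
proof
  define u where "u = det2 x y b c *\<^sub>R axis a 1 + det2 x y c a *\<^sub>R axis b 1 + det2 x y a b *\<^sub>R axis c (1::real)"
  show "u $ a = det2 x y b c" "u $ b = det2 x y c a" "u $ c = det2 x y a b"
    "\<And>k. k \<notin> {a, b, c} \<Longrightarrow> u $ k = 0"
    using assms by (auto simp: u_def axis_def)
  show "u \<bullet> x = 0" "u \<bullet> y = 0"
    by (simp_all add: u_def inner_add_left inner_axis' det2_def algebra_simps)
qed

definition cycle_edges :: "(nat \<Rightarrow> 'n) \<Rightarrow> nat \<Rightarrow> 'n set set" where
  "cycle_edges v m = insert {v 0, v m} ((\<lambda>i. {v i, v (Suc i)}) ` {..<m})"

text \<open>
  The stress is a positive combination of the stresses of the triangles \<open>v 0, v i, v (i + 1)\<close>, scaled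
  so that the entries at the diagonals \<open>{v 0, v i}\<close> cancel.
\<close>

lemma cycle_psd_stress:
  fixes x y :: "real^'n::finite"
  assumes "2 \<le> m" "inj_on v {..m}" "\<And>i j. i < j \<Longrightarrow> j \<le> m \<Longrightarrow> 0 < det2 x y (v i) (v j)"
  shows "\<exists>w\<in>stress_space UNIV (cycle_edges v m). psd w \<and> w *v x = 0 \<and> w *v y = 0 \<and> 0 < w $ v 0 $ v m"
  using assms
proof (induction m rule: dec_induct)
  case base
  have ne: "v 0 \<noteq> v 1" "v 1 \<noteq> v 2" "v 0 \<noteq> v 2" 
    using inj_on_eq_iff[OF base.prems(1), of 0 1] inj_on_eq_iff[OF base.prems(1), of 1 2] inj_on_eq_iff[OF base.prems(1), of 0 2]
    by auto
  obtain u where u: "u $ v 0 = det2 x y (v 1) (v 2)" "u $ v 2 = det2 x y (v 0) (v 1)"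
    "\<And>k. k \<notin> {v 0, v 1, v 2} \<Longrightarrow> u $ k = 0" "u \<bullet> x = 0" "u \<bullet> y = 0"
    using triangle_stress[OF ne] by metis
  have ce: "cycle_edges v 2 = {{v 0, v 2}, {v 0, v 1}, {v 1, v 2}}"
    by (auto simp: cycle_edges_def numeral_2_eq_2 lessThan_Suc)
  have "outer u \<in> stress_space UNIV (cycle_edges v 2)"
  proof (rule outer_stress_space)
    fix i j assume "u $ i \<noteq> 0" "u $ j \<noteq> 0"
    then have "i \<in> {v 0, v 1, v 2}" "j \<in> {v 0, v 1, v 2}" using u(3) by blast+
    then show "i = j \<or> {i, j} \<in> cycle_edges v 2" unfolding ce by (auto simp: doubleton_eq_iff)
  qed
  moreover have "0 < outer u $ v 0 $ v 2" using base.prems(2)[of 1 2] base.prems(2)[of 0 1] by (simp add: u)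
  ultimately show ?case using psd_outer[of u] u(4,5) by (intro bexI[of _ "outer u"]) (auto simp: outer_mult)
next
  case (step m)
  have "inj_on v {..m}" using step.prems(1) by (rule inj_on_subset) auto
  then obtain w where w: "w \<in> stress_space UNIV (cycle_edges v m)" "psd w" "w *v x = 0" "w *v y = 0" "0 < w $ v 0 $ v m"
    using step.IH step.prems(2) by force
  have inj: "v i \<noteq> v j" if "i \<noteq> j" "i \<le> Suc m" "j \<le> Suc m" for i j
    using step.prems(1) that by (auto simp: inj_on_def)
  have ne: "v 0 \<noteq> v m" "v m \<noteq> v (Suc m)" "v 0 \<noteq> v (Suc m)" using inj step.hyps by auto
  obtain u where u: "u $ v 0 = det2 x y (v m) (v (Suc m))" "u $ v m = det2 x y (v (Suc m)) (v 0)" "u $ v (Suc m) = det2 x y (v 0) (v m)"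
    "\<And>k. k \<notin> {v 0, v m, v (Suc m)} \<Longrightarrow> u $ k = 0" "u \<bullet> x = 0" "u \<bullet> y = 0"
    using triangle_stress[OF ne] by metis
  have d: "0 < det2 x y (v m) (v (Suc m))" "0 < det2 x y (v 0) (v (Suc m))" "0 < det2 x y (v 0) (v m)"
    using step.prems(2) step.hyps by auto
  have um: "u $ v m < 0" using d(2) by (simp add: u det2_def)
  define q where "q = u $ v 0 * u $ v m"
  have q: "q < 0" using d(1) um by (simp add: q_def u(1) mult_less_0_iff)
  \<comment> \<open>The closing entry of the shorter cycle is positive and the triangle has the
    negative entry q at the same pair, so a positive multiple cancels it.\<close>
  define s where "s = - (w $ v 0 $ v m) / q"
  have s: "0 < s" "w $ v 0 $ v m + s * q = 0" using q w(5) by (auto simp: s_def divide_pos_neg divide_less_0_iff zero_less_divide_iff)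
  define w' where "w' = w + s *\<^sub>R outer u"
  have w'n: "w' $ i $ j = w $ i $ j + s * (u $ i * u $ j)" for i j by (simp add: w'_def)
  have wsym: "w $ i $ j = w $ j $ i" for i j by (rule stress_spaceD(2)[OF w(1)])
  have "w' \<in> stress_space UNIV (cycle_edges v (Suc m))"
  proof (rule stress_spaceI)
    show "w' $ i $ j = w' $ j $ i" for i j using wsym[of i j] by (simp add: w'n mult.commute)
    fix i j assume nz: "w' $ i $ j \<noteq> 0"
    have "{i, j} \<in> cycle_edges v (Suc m)" if "i \<noteq> j"
    proof (rule ccontr)
      assume no: "{i, j} \<notin> cycle_edges v (Suc m)"
      have zero: "w' $ v 0 $ v m = 0" "w' $ v m $ v 0 = 0"
        using s(2) wsym[of "v 0" "v m"] by (simp_all add: w'n q_def mult.commute)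
      have n0m: "{i, j} \<noteq> {v 0, v m}" using zero nz by (auto simp: doubleton_eq_iff)
      have "cycle_edges v m \<subseteq> insert {v 0, v m} (cycle_edges v (Suc m))" by (auto simp: cycle_edges_def)
      then have "{i, j} \<notin> cycle_edges v m" using no n0m by blast
      then have "w $ i $ j = 0" using stress_spaceD(4)[OF w(1), of i j] that by blast
      then have "u $ i \<noteq> 0" "u $ j \<noteq> 0" using nz by (auto simp: w'n)
      then have "i \<in> {v 0, v m, v (Suc m)}" "j \<in> {v 0, v m, v (Suc m)}" using u(4) by blast+
      moreover have "{v 0, v (Suc m)} \<in> cycle_edges v (Suc m)" "{v m, v (Suc m)} \<in> cycle_edges v (Suc m)"
        by (auto simp: cycle_edges_def)
      ultimately show False using no n0m that by (auto simp: insert_commute)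
    qed
    then show "i \<in> UNIV \<and> j \<in> UNIV \<and> (i = j \<or> {i, j} \<in> cycle_edges v (Suc m))" by blast
  qed
  moreover have "psd w'" unfolding w'_def using w(2) s(1) by (intro psd_add psd_scaleR psd_outer) auto
  moreover have "w' *v z = w *v z + s *\<^sub>R (outer u *v z)" for z
    unfolding w'_def scaleR_matrix_vector_assoc by (rule matrix_vector_mult_add_rdistrib)
  moreover have "0 < w' $ v 0 $ v (Suc m)"
  proof -
    have "w $ v 0 $ v (Suc m) = 0"
    proof (rule ccontr)
      assume "w $ v 0 $ v (Suc m) \<noteq> 0"
      then have "{v 0, v (Suc m)} \<in> cycle_edges v m" using stress_spaceD(4)[OF w(1)] ne(3) by blast
      then have "v (Suc m) \<in> v ` {..m}" by (auto simp: cycle_edges_def doubleton_eq_iff)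
      then show False using inj by force
    qed
    then show ?thesis using d(1,3) s(1) by (simp add: w'n u(1,3))
  qed
  ultimately show ?case using w(3,4) u(5,6) by (intro bexI[of _ w']) (auto simp: outer_mult)
qed

text \<open>All neighbours in S of the end of a longest path lie on the path. There are at least
  two, so one is not the predecessor of the end and closes a cycle.\<close>

lemma cycle_exists:
  fixes S :: "'n::finite set"
  assumes S: "S \<noteq> {}" and deg: "\<And>i. i \<in> S \<Longrightarrow> \<exists>j\<in>S. \<exists>k\<in>S. j \<noteq> k \<and> j \<noteq> i \<and> k \<noteq> i \<and> {i, j} \<in> E \<and> {i, k} \<in> E"
  shows "\<exists>v m. 2 \<le> m \<and> inj_on v {..m} \<and> cycle_edges v m \<subseteq> E"
proof -
  define path where "path m v \<longleftrightarrow> inj_on v {..m} \<and> v ` {..m} \<subseteq> S \<and> (\<forall>i<m. {v i, v (Suc i)} \<in> E)" for m :: nat and v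
  obtain s where "s \<in> S" using S by blast
  then have 0: "path 0 (\<lambda>_. s)" by (auto simp: path_def)
  have bound: "m \<le> card S" if "path m v" for m v
  proof -
    have "card (v ` {..m}) = Suc m" using that by (simp add: path_def card_image)
    then show ?thesis using card_mono[of S "v ` {..m}"] that by (simp add: path_def)
  qed
  define m where "m = (GREATEST m. \<exists>v. path m v)"
  have "\<exists>v. path m v" unfolding m_def
    by (rule GreatestI_nat[of "\<lambda>m. \<exists>v. path m v" 0 "card S"]) (use 0 bound in blast)+
  then obtain v where v: "path m v" by blast
  have max: "m' \<le> m" if "path m' v'" for m' v' unfolding m_def
    by (rule Greatest_le_nat[of "\<lambda>m. \<exists>v. path m v" _ "card S"]) (use that bound in blast)+
  have on: "\<exists>i<m. a = v i" if "a \<in> S" "{v m, a} \<in> E" "a \<noteq> v m" for a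
  proof (rule ccontr)
    assume no: "\<not> (\<exists>i<m. a = v i)"
    have na: "a \<noteq> v i" if "i \<le> m" for i using no \<open>a \<noteq> v m\<close> that by (cases "i = m") auto
    have "path (Suc m) (v(Suc m := a))"
      unfolding path_def
    proof (intro conjI allI impI)
      have "inj_on v {..m}" using v by (simp add: path_def)
      then show "inj_on (v(Suc m := a)) {..Suc m}" 
        using na unfolding inj_on_def by (auto simp: le_Suc_eq) metis+
      show "(v(Suc m := a)) ` {..Suc m} \<subseteq> S" using v \<open>a \<in> S\<close> by (auto simp: path_def le_Suc_eq)
      fix i assume "i < Suc m"
      then show "{(v(Suc m := a)) i, (v(Suc m := a)) (Suc i)} \<in> E"
        using v \<open>{v m, a} \<in> E\<close> by (cases "i = m") (auto simp: path_def)
    qed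
    then show False using max by fastforce
  qed
  have "v m \<in> S" using v by (auto simp: path_def)
  then obtain j k where jk: "j \<in> S" "k \<in> S" "j \<noteq> k" "j \<noteq> v m" "k \<noteq> v m" "{v m, j} \<in> E" "{v m, k} \<in> E" using deg by metis
  obtain p where p: "p < m" "j = v p" using on jk by blast
  obtain q where q: "q < m" "k = v q" using on jk by blast
  have "p \<noteq> q" using p q jk by auto
  then obtain l where l: "l + 2 \<le> m" "{v m, v l} \<in> E"
    using p q jk by (cases "p < q") (metis add_2_eq_Suc' less_eq_Suc_le le_less_trans Suc_leI nat_neq_iff order_less_le_trans)+
  define v' where "v' i = v (l + i)" for i
  have "inj_on v' {..m - l}" 
  proof (rule inj_onI)
    fix x y assume "x \<in> {..m - l}" "y \<in> {..m - l}" "v' x = v' y"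
    then have "l + x = l + y" using v l unfolding path_def v'_def by (intro inj_onD[of v "{..m}"]) auto
    then show "x = y" by simp
  qed
  moreover have "cycle_edges v' (m - l) \<subseteq> E"
    using v l by (auto simp: cycle_edges_def v'_def path_def insert_commute)
  ultimately show ?thesis using l by (intro exI[of _ v'] exI[of _ "m - l"]) auto
qed

section \<open>Thresholds at most three\<close>

text \<open>One sample is constant, the other has distinct entries. In the support of a nonzero
  stress some vertex has at most one neighbour; its row has at most two nonzero entries, and the two
  kernel equations force them to vanish.\<close>

lemma forest_stress_free:
  fixes E :: "'n::finite set set"
  assumes forest: "\<And>S. S \<noteq> {} \<Longrightarrow> \<exists>i\<in>S. \<forall>j\<in>S. \<forall>k\<in>S. j \<noteq> i \<longrightarrow> k \<noteq> i \<longrightarrow> {i, j} \<in> E \<longrightarrow> {i, k} \<in> E \<longrightarrow> j = k"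
  shows "\<exists>X. stress_free E {1..2::nat} X"
proof -
  obtain t :: "'n \<Rightarrow> nat" where t: "inj t" using finite_imp_inj_to_nat_seg[of "UNIV :: 'n set"] by auto
  define x :: "real^'n" where "x = (\<chi> i. 1)"
  define y :: "real^'n" where "y = (\<chi> i. real (t i))"
  define X where "X k = (if k = 1 then x else y)" for k :: nat
  have "stress_free E {1..2::nat} X"
    unfolding stress_free_def
  proof (intro ballI impI, rule ccontr)
    fix w assume w: "w \<in> stress_space UNIV E" "\<forall>k\<in>{1..2}. w *v X k = 0" and "w \<noteq> 0"
    have "w *v X 1 = 0" "w *v X 2 = 0" using w(2) by auto
    then have "w *v x = 0" "w *v y = 0" by (simp_all add: X_def)
    then have rows: "(\<Sum>j\<in>UNIV. w $ i $ j) = 0" "(\<Sum>j\<in>UNIV. w $ i $ j * real (t j)) = 0" for i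
      by (simp_all add: vec_eq_iff matrix_vector_mult_def x_def y_def)
    define S where "S = {i. \<exists>j. w $ i $ j \<noteq> 0}"
    have "S \<noteq> {}" using \<open>w \<noteq> 0\<close> by (auto simp: S_def vec_eq_iff)
    then obtain i where i: "i \<in> S" "\<forall>j\<in>S. \<forall>k\<in>S. j \<noteq> i \<longrightarrow> k \<noteq> i \<longrightarrow> {i, j} \<in> E \<longrightarrow> {i, k} \<in> E \<longrightarrow> j = k"
      using forest by blast
    have nb: "j \<in> S \<and> {i, j} \<in> E" if "w $ i $ j \<noteq> 0" "j \<noteq> i" for j
    proof
      have "w $ j $ i \<noteq> 0" using that(1) stress_spaceD(2)[OF w(1), of i j] by simp
      then show "j \<in> S" by (auto simp: S_def)
      show "{i, j} \<in> E" using stress_spaceD(4)[OF w(1) that(1)] that(2) by blast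
    qed
    have "\<exists>j. j \<noteq> i \<and> (\<forall>k. k \<noteq> i \<longrightarrow> k \<noteq> j \<longrightarrow> w $ i $ k = 0) \<or> (\<forall>k. k \<noteq> i \<longrightarrow> w $ i $ k = 0)"
      using nb i(2) by metis
    then consider j where "j \<noteq> i" "\<forall>k. k \<noteq> i \<longrightarrow> k \<noteq> j \<longrightarrow> w $ i $ k = 0" | "\<forall>k. k \<noteq> i \<longrightarrow> w $ i $ k = 0" by blast
    then have "\<forall>k. w $ i $ k = 0"
    proof cases
      case (1 j)
      have red: "(\<Sum>k\<in>UNIV. w $ i $ k * f k) = w $ i $ i * f i + w $ i $ j * f j" for f
      proof -
        have "(\<Sum>k\<in>UNIV. w $ i $ k * f k) = (\<Sum>k\<in>{i, j}. w $ i $ k * f k)"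
          using 1(2) by (intro sum.mono_neutral_right) auto
        then show ?thesis using 1(1) by simp
      qed
      have 2: "w $ i $ i + w $ i $ j = 0" using rows(1)[of i] red[of "\<lambda>_. 1"] by simp
      have "w $ i $ i * real (t i) + w $ i $ j * real (t j) = 0" using rows(2)[of i] red[of "\<lambda>k. real (t k)"] by simp
      then have "w $ i $ i * real (t i) - w $ i $ i * real (t j) = 0" using 2 by (auto simp: add_eq_0_iff)
      then have "w $ i $ i * (real (t i) - real (t j)) = 0" by (simp add: algebra_simps)
      moreover have "t i \<noteq> t j" using t 1(1) by (auto dest: injD)
      ultimately have "w $ i $ i = 0" by simp
      then show ?thesis using 1(2) 2 by (metis add_0)
    next
      case 2
      have "(\<Sum>k\<in>UNIV. w $ i $ k) = (\<Sum>k\<in>{i}. w $ i $ k)" using 2 by (intro sum.mono_neutral_right) auto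
      then show ?thesis using 2 rows(1)[of i] by (metis sum.empty sum.insert finite.emptyI empty_iff add.right_neutral)
    qed
    then show False using i(1) by (auto simp: S_def)
  qed
  then show ?thesis by blast
qed

lemma generic_mle_1:
  fixes E :: "'n::finite set set"
  assumes simple: "simple_graph E"
    and ae: "\<And>\<mu>. equiv_lebesgue_distribution \<mu> \<Longrightarrow> AE X in (\<Pi>\<^sub>M k\<in>{1..1}. \<mu>). mle_exists E 1 X"
  shows "\<exists>X. stress_free E {1..1::nat} X"
proof (cases "E = {}")
  case True
  define X :: "nat \<Rightarrow> real^'n" where "X = (\<lambda>_. \<chi> i. 1)"
  have "stress_free E {1..1::nat} X"
    unfolding stress_free_def
  proof (intro ballI impI)
    fix w assume w: "w \<in> stress_space UNIV E" "\<forall>k\<in>{1..1}. w *v X k = 0"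
    have off: "w $ i $ j = 0" if "j \<noteq> i" for i j using stress_spaceD(4)[OF w(1), of i j] that True by auto
    have "w $ i $ i = 0" for i
    proof -
      have "(\<Sum>j\<in>UNIV. w $ i $ j) = 0" using w(2) by (simp add: vec_eq_iff matrix_vector_mult_def X_def)
      also have "(\<Sum>j\<in>UNIV. w $ i $ j) = (\<Sum>j\<in>{i}. w $ i $ j)" using off by (intro sum.mono_neutral_right) auto
      finally show ?thesis by simp
    qed
    then show "w = 0" using off unfolding vec_eq_iff by (metis zero_index)
  qed
  then show ?thesis by blast
next
  case False
  then obtain e where e: "e \<in> E" "card e = 2" using simple by (auto simp: simple_graph_def)
  then obtain i j where ij: "{i, j} \<in> E" "i \<noteq> j" by (auto simp: card_2_iff)
  define U where "U = (\<lambda>_::nat. {x :: real^'n. x $ j \<noteq> 0})"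
  have "open (U k)" for k unfolding U_def by (intro open_Collect_neq continuous_intros)
  moreover have "axis j 1 \<in> U k" for k by (simp add: U_def)
  ultimately have "\<exists>X. (\<forall>k\<in>{1..1}. X k \<in> U k) \<and> mle_exists E 1 X"
    by (intro mle_exists_somewhere ae) blast+
  then obtain X where X: "X 1 $ j \<noteq> 0" "mle_exists E 1 X" by (auto simp: U_def)
  obtain w where "w \<in> stress_space UNIV E" "psd w" "w \<noteq> 0" "w *v X 1 = 0"
    using edge_psd_stress[OF ij X(1)] by blast
  then have "\<not> mle_exists E 1 X" by (intro not_mle_exists[of w]) auto
  then show ?thesis using X(2) by blast
qed

lemma generic_mle_2:
  fixes E :: "'n::finite set set"
  assumes ae: "\<And>\<mu>. equiv_lebesgue_distribution \<mu> \<Longrightarrow> AE X in (\<Pi>\<^sub>M k\<in>{1..2}. \<mu>). mle_exists E 2 X"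
  shows "\<exists>X. stress_free E {1..2::nat} X"
proof (rule ccontr)
  assume no: "\<nexists>X. stress_free E {1..2::nat} X"
  have "\<exists>S::'n set. S \<noteq> {} \<and> (\<forall>i\<in>S. \<exists>j\<in>S. \<exists>k\<in>S. j \<noteq> i \<and> k \<noteq> i \<and> {i, j} \<in> E \<and> {i, k} \<in> E \<and> j \<noteq> k)"
  proof (rule ccontr)
    assume nc: "\<not> ?thesis"
    have "\<exists>X. stress_free E {1..2::nat} X"
    proof (rule forest_stress_free, rule ccontr)
      fix S :: "'n set"
      assume "S \<noteq> {}" and
        nS: "\<not> (\<exists>i\<in>S. \<forall>j\<in>S. \<forall>k\<in>S. j \<noteq> i \<longrightarrow> k \<noteq> i \<longrightarrow> {i, j} \<in> E \<longrightarrow> {i, k} \<in> E \<longrightarrow> j = k)"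
      have "\<forall>i\<in>S. \<exists>j\<in>S. \<exists>k\<in>S. j \<noteq> i \<and> k \<noteq> i \<and> {i, j} \<in> E \<and> {i, k} \<in> E \<and> j \<noteq> k"
      proof
        fix i assume "i \<in> S"
        then have "\<not> (\<forall>j\<in>S. \<forall>k\<in>S. j \<noteq> i \<longrightarrow> k \<noteq> i \<longrightarrow> {i, j} \<in> E \<longrightarrow> {i, k} \<in> E \<longrightarrow> j = k)" using nS by blast
        then show "\<exists>j\<in>S. \<exists>k\<in>S. j \<noteq> i \<and> k \<noteq> i \<and> {i, j} \<in> E \<and> {i, k} \<in> E \<and> j \<noteq> k" by blast
      qed
      then show False using nc \<open>S \<noteq> {}\<close> by blast
    qed
    then show False using no by blast
  qed
  then obtain S :: "'n set" where S: "S \<noteq> {}"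
    "\<forall>i\<in>S. \<exists>j\<in>S. \<exists>k\<in>S. j \<noteq> i \<and> k \<noteq> i \<and> {i, j} \<in> E \<and> {i, k} \<in> E \<and> j \<noteq> k"
    by (elim exE conjE)
  obtain v m where v: "2 \<le> m" "inj_on v {..m}" "cycle_edges v m \<subseteq> E"
    
  proof -
    have "\<exists>v m. 2 \<le> m \<and> inj_on v {..m} \<and> cycle_edges v m \<subseteq> E"
    proof (rule cycle_exists[OF S(1)])
      fix i assume "i \<in> S"
      from bspec[OF S(2) this] obtain j k where "j \<in> S" "k \<in> S" "j \<noteq> i" "k \<noteq> i" "{i, j} \<in> E" "{i, k} \<in> E" "j \<noteq> k"
        by (elim bexE conjE)
      then show "\<exists>j\<in>S. \<exists>k\<in>S. j \<noteq> k \<and> j \<noteq> i \<and> k \<noteq> i \<and> {i, j} \<in> E \<and> {i, k} \<in> E" by (intro bexI[of _ j] bexI[of _ k] conjI)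
    qed
    then show thesis using that by blast
  qed
  define P where "P = {p :: (real^'n) \<times> (real^'n). \<forall>i\<in>{..m}. \<forall>j\<in>{..m}. i < j \<longrightarrow> 0 < det2 (fst p) (snd p) (v i) (v j)}"
  have "open P"
  proof -
    have "P = (\<Inter>i\<in>{..m}. \<Inter>j\<in>{..m}. {p. i < j \<longrightarrow> 0 < det2 (fst p) (snd p) (v i) (v j)})" by (auto simp: P_def)
    moreover have "open {p :: (real^'n) \<times> (real^'n). i < j \<longrightarrow> 0 < det2 (fst p) (snd p) (v i) (v j)}" for i j
      by (cases "i < j") (auto simp: det2_def intro!: open_Collect_less continuous_intros)
    ultimately show ?thesis by (auto intro!: open_INT)
  qed
  \<comment> \<open>Ones and the positions along the cycle: the minor at i < j is j - i, so P is not
    empty.\<close>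
  define x0 :: "real^'n" where "x0 = (\<chi> i. 1)"
  define y0 :: "real^'n" where "y0 = (\<chi> i. real (the_inv_into {..m} v i))"
  have y0: "y0 $ v i = real i" if "i \<le> m" for i using the_inv_into_f_f[OF v(2), of i] that by (simp add: y0_def)
  have "(x0, y0) \<in> P" unfolding P_def by (simp add: det2_def x0_def y0)
  then obtain A B where AB: "open A" "open B" "(x0, y0) \<in> A \<times> B" "A \<times> B \<subseteq> P" using open_prod_elim[OF \<open>open P\<close>] by metis
  define U where "U k = (if k = 1 then A else B)" for k :: nat
  have "open (U k)" "U k \<noteq> {}" for k using AB by (auto simp: U_def)
  then have "\<exists>X. (\<forall>k\<in>{1..2}. X k \<in> U k) \<and> mle_exists E 2 X" by (intro mle_exists_somewhere ae) blast+
  then obtain X where X: "\<forall>k\<in>{1..2}. X k \<in> U k" "mle_exists E 2 X" by blast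
  have "X 1 \<in> U 1" "X 2 \<in> U 2" using X(1) by auto
  then have "(X 1, X 2) \<in> P" using AB(4) by (auto simp: U_def)
  then have det: "0 < det2 (X 1) (X 2) (v i) (v j)" if "i < j" "j \<le> m" for i j using that by (auto simp: P_def)
  obtain w where w: "w \<in> stress_space UNIV (cycle_edges v m)" "psd w" "w *v X 1 = 0" "w *v X 2 = 0" "0 < w $ v 0 $ v m"
    using cycle_psd_stress[OF v(1,2) det] by blast
  have "w \<in> stress_space UNIV E" using w(1) stress_space_mono[OF order_refl v(3)] by blast
  moreover have "w \<noteq> 0" using w(5) by auto
  moreover have "w *v X k = 0" if "k \<in> {1..2}" for k
  proof -
    have "k = 1 \<or> k = 2" using that by auto
    then show ?thesis using w(3,4) by blast
  qed
  ultimately have "\<not> mle_exists E 2 X" using w(2) by (intro not_mle_exists[of w]) auto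
  then show False using X(2) by blast
qed

text \<open>Samples are numbered from 1 to 3, columns by the type \<open>3\<close>, whose elements
  are 1, 2 and 3 with 3 equal to 0.\<close>

definition sample_index :: "3 \<Rightarrow> nat" where
  "sample_index a = (if a = 1 then 1 else if a = 2 then 2 else 3)"

lemma sample_index_range: "range sample_index = {1..3}"
proof -
  have "{1..3::nat} = {1, 2, 3}" by auto
  moreover have "range sample_index = sample_index ` {1, 2, 3}" unfolding UNIV_3[symmetric] by (rule refl)
  moreover have "sample_index 1 = 1" "sample_index 2 = 2" "sample_index 3 = 3" by (auto simp: sample_index_def)
  ultimately show ?thesis by auto
qed

definition configuration :: "(nat \<Rightarrow> real^'n) \<Rightarrow> (real^3)^'n" where
  "configuration Y = (\<chi> i a. Y (sample_index a) $ i)"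

lemma configuration_kernel:
  fixes w :: "real^'n^'n::finite"
  shows "w ** configuration Y = 0 \<longleftrightarrow> (\<forall>k\<in>{1..3}. w *v Y k = 0)"
proof -
  have "w ** configuration Y = 0 \<longleftrightarrow> (\<forall>a i. (w *v Y (sample_index a)) $ i = 0)"
    by (auto simp: vec_eq_iff matrix_matrix_mult_def matrix_vector_mult_def configuration_def)
  also have "\<dots> \<longleftrightarrow> (\<forall>k\<in>range sample_index. w *v Y k = 0)" by (simp add: vec_eq_iff)
  finally show ?thesis unfolding sample_index_range .
qed

lemma generic_mle_3:
  fixes E :: "'n::finite set set"
  assumes simple: "simple_graph E"
    and ae: "\<And>\<mu>. equiv_lebesgue_distribution \<mu> \<Longrightarrow> AE X in (\<Pi>\<^sub>M k\<in>{1..3}. \<mu>). mle_exists E 3 X"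
  shows "\<exists>X. stress_free E {1..3::nat} X"
proof (cases "\<forall>S. 2 \<le> card S \<longrightarrow> card (induced E S) + 3 \<le> 2 * card S")
  case True
  have "finite_graph UNIV E" using simple by unfold_locales (auto simp: simple_graph_def)
  then obtain C :: "(real^3)^'n" where C: "\<forall>w\<in>stresses UNIV E C. w = 0" using sparse_stress_free[of UNIV E] True by blast
  define Y where "Y k = (\<chi> i. C $ i $ (the_inv_into UNIV sample_index k))" for k
  have "inj sample_index"
    unfolding inj_on_def using exhaust_3 by (auto simp: sample_index_def split: if_splits)
  then have "configuration Y = C" by (simp add: configuration_def Y_def the_inv_into_f_f vec_eq_iff)
  then have "stress_free E {1..3::nat} Y"
    unfolding stress_free_def using C configuration_kernel[of _ Y] by (auto simp: stresses_def)
  then show ?thesis by blast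
next
  case False
  interpret finite_graph UNIV E using simple by unfold_locales (auto simp: simple_graph_def)
  obtain S :: "'n set" where S: "2 \<le> card S" "\<not> card (induced E S) + 3 \<le> 2 * card S" using False by blast
  then have "2 * card S \<le> card (induced E S) + 2" by simp
  then obtain V0 E0 where VE: "E0 \<subseteq> E" "circuit V0 E0" using dense_has_circuit[OF subset_UNIV S(1)] by blast
  obtain C :: "(real^3)^'n" and w0 d where d: "d > 0"
    and rob: "\<And>C'. dist C' C < d \<Longrightarrow> \<exists>w\<in>stresses V0 E0 C'. (\<forall>y. 0 \<le> quadratic w y) \<and> (\<forall>i j. {i, j} \<in> E0 \<longrightarrow> 0 < w $ i $ j * w0 $ i $ j)"
    using circuit_robust_psd[OF VE(2)] unfolding robust_psd_def by blast
  interpret C: circuit V0 E0 by fact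
  have "E0 \<noteq> {}" using C.card_E C.card_V by auto
  then obtain e where e: "e \<in> E0" "card e = 2" using C.edge by blast
  then obtain i0 j0 where ij: "{i0, j0} \<in> E0" by (auto simp: card_2_iff)
  define Y where "Y k = (\<chi> i. C $ i $ (the_inv_into UNIV sample_index k))" for k
  have "inj sample_index"
    unfolding inj_on_def using exhaust_3 by (auto simp: sample_index_def split: if_splits)
  then have CY: "configuration Y = C" by (simp add: configuration_def Y_def the_inv_into_f_f vec_eq_iff)
  \<comment> \<open>Samples in balls of radius r move each entry by at most r, hence the
    configuration by at most \<open>3 * real CARD('n) * r\<close>, which is less than d.\<close>
  define r where "r = d / (3 * real CARD('n) + 1)"
  have r: "r > 0" using d by (simp add: r_def)
  have near: "dist (configuration X) C < d" if X: "\<forall>k\<in>{1..3}. X k \<in> ball (Y k) r" for X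
  proof -
    have entry: "\<bar>(configuration X - C) $ i $ a\<bar> \<le> r" for i a
    proof -
      have "sample_index a \<in> {1..3}" unfolding sample_index_range[symmetric] by blast
      then have "norm (X (sample_index a) - Y (sample_index a)) < r" using X by (auto simp: dist_norm norm_minus_commute)
      moreover have "(configuration X - C) $ i $ a = (X (sample_index a) - Y (sample_index a)) $ i"
        unfolding CY[symmetric] by (simp add: configuration_def)
      ultimately show ?thesis using component_le_norm_cart[of "X (sample_index a) - Y (sample_index a)" i] by simp
    qed
    have "norm ((configuration X - C) $ i) \<le> 3 * r" for i
    proof -
      have "norm ((configuration X - C) $ i) \<le> (\<Sum>a\<in>UNIV. \<bar>(configuration X - C) $ i $ a\<bar>)" by (rule norm_le_l1_cart)
      also have "\<dots> \<le> (\<Sum>a\<in>(UNIV::3 set). r)" using entry by (intro sum_mono)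
      finally show ?thesis by simp
    qed
    then have "(\<Sum>i\<in>UNIV. norm ((configuration X - C) $ i)) \<le> (\<Sum>i\<in>(UNIV::'n set). 3 * r)" by (intro sum_mono)
    moreover have "norm (configuration X - C) \<le> (\<Sum>i\<in>UNIV. norm ((configuration X - C) $ i))"
      unfolding norm_vec_def by (rule L2_set_le_sum) simp
    ultimately have "norm (configuration X - C) \<le> 3 * real CARD('n) * r" by simp
    also have "\<dots> < (3 * real CARD('n) + 1) * r" using r by (simp add: distrib_right)
    also have "\<dots> = d" by (simp add: r_def)
    finally show ?thesis by (simp add: dist_norm)
  qed
  have "\<exists>X. (\<forall>k\<in>{1..3}. X k \<in> ball (Y k) r) \<and> mle_exists E 3 X"
    using r by (intro mle_exists_somewhere ae) auto
  then obtain X where X: "\<forall>k\<in>{1..3}. X k \<in> ball (Y k) r" "mle_exists E 3 X" by blast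
  obtain w where w: "w \<in> stresses V0 E0 (configuration X)" "\<forall>y. 0 \<le> quadratic w y" "\<forall>i j. {i, j} \<in> E0 \<longrightarrow> 0 < w $ i $ j * w0 $ i $ j"
    using rob[OF near[OF X(1)]] by blast
  have ws: "w \<in> stress_space V0 E0" by (rule stressesD(1)[OF w(1)])
  then have "w \<in> stress_space UNIV E" using stress_space_mono[OF subset_UNIV VE(1)] by blast
  moreover have "psd w" using stress_spaceD(1)[OF ws] w(2) by (simp add: psd_def)
  moreover have "0 < w $ i0 $ j0 * w0 $ i0 $ j0" using w(3) ij by blast
  then have "w \<noteq> 0" by auto
  moreover have "\<forall>k\<in>{1..3}. w *v X k = 0" using stressesD(2)[OF w(1)] configuration_kernel by blast
  ultimately have "\<not> mle_exists E 3 X" by (intro not_mle_exists[of w]) auto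
  then show ?thesis using X(2) by blast
qed

text \<open>A matrix that kills all unit vectors is zero; this makes the minimum defining
  \<open>stress_rank\<close> exist and be at most n.\<close>

lemma stress_free_card:
  obtains X where "stress_free (E :: 'n::finite set set) {1..CARD('n)} X"
proof -
  obtain h where h: "bij_betw h {1..CARD('n)} (UNIV :: 'n set)"
    using finite_same_card_bij[of "{1..CARD('n)}" "UNIV :: 'n set"] by auto
  have "stress_free E {1..CARD('n)} (\<lambda>k. axis (h k) 1)"
    unfolding stress_free_def
  proof (intro ballI impI)
    fix w :: "real^'n^'n" assume "\<forall>k\<in>{1..CARD('n)}. w *v axis (h k) 1 = 0"
    then have "\<forall>i\<in>h ` {1..CARD('n)}. w *v axis i 1 = 0" by blast
    then have "w *v axis i 1 = 0" for i using bij_betw_imp_surj_on[OF h] by blast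
    then have "w $ j $ i = 0" for i j by (metis axis_column zero_index)
    then show "w = 0" by (simp add: vec_eq_iff)
  qed
  then show thesis by (rule that)
qed

definition stress_rank :: "'n::finite set set \<Rightarrow> nat" where
  "stress_rank E = (LEAST N. 1 \<le> N \<and> (\<exists>X. stress_free E {1..N} X))"

lemma stress_rank_attained: "1 \<le> stress_rank E \<and> (\<exists>X. stress_free E {1..stress_rank E} X)"
  unfolding stress_rank_def
proof (rule LeastI)
  show "1 \<le> CARD('a) \<and> (\<exists>X. stress_free E {1..CARD('a)} X)"
    using stress_free_card[of E] by (metis One_nat_def Suc_leI zero_less_card_finite)
qed

lemma mlt_le_stress_rank: "mlt E \<le> stress_rank E"
  unfolding mlt_def using stress_rank_attained[of E] stress_free_mle[of "stress_rank E" E] by (intro Least_le) blast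

lemma stress_rank_le_mlt:
  assumes simple: "simple_graph E" and "mlt E \<le> 3"
  shows "stress_rank E \<le> mlt E"
proof -
  have "1 \<le> mlt E \<and> (\<forall>\<mu>. equiv_lebesgue_distribution \<mu> \<longrightarrow> (AE X in (\<Pi>\<^sub>M k\<in>{1..mlt E}. \<mu>). mle_exists E (mlt E) X))"
    unfolding mlt_def
  \<comment> \<open>The least element has the defining property only because some sample size has
    it, and \<open>stress_rank E\<close> does.\<close>
  proof (rule LeastI[of _ "stress_rank E"], intro conjI allI impI)
    show "1 \<le> stress_rank E" using stress_rank_attained[of E] by blast
    obtain X where X: "stress_free E {1..stress_rank E} X" using stress_rank_attained[of E] by blast
    show "AE X in (\<Pi>\<^sub>M k\<in>{1..stress_rank E}. \<mu>). mle_exists E (stress_rank E) X" if "equiv_lebesgue_distribution \<mu>" for \<mu>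
      by (rule stress_free_mle[OF \<open>1 \<le> stress_rank E\<close> X that])
  qed
  then have 1: "1 \<le> mlt E"
    and ae: "\<And>\<mu>. equiv_lebesgue_distribution \<mu> \<Longrightarrow> AE X in (\<Pi>\<^sub>M k\<in>{1..mlt E}. \<mu>). mle_exists E (mlt E) X" by blast+
  have "\<exists>X. stress_free E {1..mlt E} X"
  proof -
    consider "mlt E = 1" | "mlt E = 2" | "mlt E = 3" using 1 assms(2) by linarith
    then show ?thesis
    proof cases
      case 1 show ?thesis unfolding 1 by (rule generic_mle_1[OF simple ae[unfolded 1]])
    next
      case 2 show ?thesis unfolding 2 by (rule generic_mle_2[OF ae[unfolded 2]])
    next
      case 3 show ?thesis unfolding 3 by (rule generic_mle_3[OF simple ae[unfolded 3]])
    qed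
  qed
  then show ?thesis unfolding stress_rank_def using 1 by (intro Least_le) blast
qed

section \<open>The generic completion rank\<close>

lemma dim_stress_space:
  fixes E :: "'n::finite set set"
  assumes simple: "simple_graph E"
  shows "dim (stress_space UNIV E) = card E + CARD('n)"
proof -
  let ?B = "edge_matrix ` graph_support E"
  have inj: "inj_on edge_matrix (graph_support E)"
  proof (rule inj_onI)
    fix e e' assume e: "e \<in> graph_support E" "edge_matrix e = edge_matrix e'"
    then obtain i j where "e = {i, j}" by (auto simp: graph_support_def)
    then show "e = e'" using e(2) edge_matrix_nth[of e i j] edge_matrix_nth[of e' i j] by (simp split: if_splits)
  qed
  have "independent ?B"
  proof (rule ccontr)
    assume "\<not> independent ?B"
    then obtain u v where u: "v \<in> ?B" "u v \<noteq> 0" "(\<Sum>v\<in>?B. u v *\<^sub>R v) = 0"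
      using dependent_finite[of ?B] by auto
    obtain e where e: "e \<in> graph_support E" "v = edge_matrix e" using u(1) by blast
    then obtain i j where ij: "e = {i, j}" by (auto simp: graph_support_def)
    have "(\<Sum>e\<in>graph_support E. u (edge_matrix e) *\<^sub>R edge_matrix e) = 0" using u(3) by (simp add: sum.reindex[OF inj])
    then have "(if {i, j} \<in> graph_support E then u (edge_matrix {i, j}) else 0) = 0"
      using edge_combination_nth[where c = "\<lambda>e. u (edge_matrix e)" and E = E and i = i and j = j] by simp
    then show False using u(2) e ij by simp
  qed
  moreover have "?B \<subseteq> stress_space UNIV E"
  proof
    fix v assume "v \<in> ?B"
    then obtain e where e: "e \<in> graph_support E" "v = edge_matrix e" by blast
    have "(\<Sum>e'\<in>graph_support E. (if e' = e then 1 else 0) *\<^sub>R edge_matrix e') = v"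
      using e by (simp add: if_distrib[of "\<lambda>x. x *\<^sub>R _"] cong: if_cong)
    then show "v \<in> stress_space UNIV E" using edge_combination_stress_space by metis
  qed
  moreover have "stress_space UNIV E \<subseteq> span ?B"
  proof
    fix w assume "w \<in> stress_space UNIV E"
    then obtain c where "w = (\<Sum>e\<in>graph_support E. c e *\<^sub>R edge_matrix e)" using stress_edge_combination by blast
    then show "w \<in> span ?B" by (simp add: span_sum span_scale span_base)
  qed
  ultimately have "dim (stress_space UNIV E) = card ?B" using dim_unique by blast
  also have "\<dots> = card (graph_support E)" using inj by (rule card_image)
  also have "graph_support E = E \<union> range (\<lambda>i. {i})"
  proof
    show "graph_support E \<subseteq> E \<union> range (\<lambda>i. {i})" by (auto simp: graph_support_def)
    show "E \<union> range (\<lambda>i. {i}) \<subseteq> graph_support E"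
    proof
      fix e assume "e \<in> E \<union> range (\<lambda>i. {i})"
      then consider "e \<in> E" | i where "e = {i, i}" by auto
      then show "e \<in> graph_support E"
      proof cases
        case 1
        then have "card e = 2" using simple by (simp add: simple_graph_def)
        then obtain i j where "e = {i, j}" by (auto simp: card_2_iff)
        then show ?thesis using 1 by (simp add: graph_support_iff)
      next
        case 2 then show ?thesis unfolding 2 graph_support_iff by simp
      qed
    qed
  qed
  also have "card (E \<union> range (\<lambda>i. {i})) = card E + card (range (\<lambda>i::'n. {i}))"
    using simple by (intro card_Un_disjoint) (auto simp: simple_graph_def)
  also have "card (range (\<lambda>i::'n. {i})) = CARD('n)" by (simp add: card_image inj_on_def)
  finally show ?thesis .
qed

lemma graph_projection_nth: "graph_projection E A $ i $ j = (if {i, j} \<in> graph_support E then A $ i $ j else 0)"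
  by (simp add: graph_projection_def graph_support_iff)

lemma graph_projection_stress_space:
  assumes "transpose A = A"
  shows "graph_projection E A \<in> stress_space UNIV E"
  using symmetric_nth[OF assms]
  by (intro stress_spaceI) (auto simp: graph_projection_nth graph_support_iff insert_commute split: if_splits)

lemma graph_projection_id:
  assumes "w \<in> stress_space UNIV E"
  shows "graph_projection E w = w"
  using stress_spaceD(4)[OF assms] by (auto simp: vec_eq_iff graph_projection_nth graph_support_iff)

lemma linear_graph_projection: "linear (graph_projection E)"
  by (rule linearI) (auto simp: vec_eq_iff graph_projection_nth)

lemma inner_matrix: "(A :: real^'n^'m) \<bullet> B = (\<Sum>i\<in>UNIV. \<Sum>j\<in>UNIV. A $ i $ j * B $ i $ j)"
  by (simp add: inner_vec_def)

lemma inner_graph_projection: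
  assumes "w \<in> stress_space UNIV E"
  shows "w \<bullet> graph_projection E A = w \<bullet> A"
proof -
  have "w $ i $ j * graph_projection E A $ i $ j = w $ i $ j * A $ i $ j" for i j
    using stress_spaceD(4)[OF assms, of i j] by (auto simp: graph_projection_nth graph_support_iff)
  then show ?thesis unfolding inner_matrix by (intro sum.cong refl)
qed

lemma inner_edge_combination:
  assumes "e \<in> graph_support E"
  shows "edge_matrix e \<bullet> (\<Sum>e'\<in>graph_support E. c e' *\<^sub>R edge_matrix e') = c e * (edge_matrix e \<bullet> edge_matrix e)"
proof -
  have "edge_matrix e \<bullet> edge_matrix e' = 0" if "e' \<noteq> e" for e' :: "'a set"
    unfolding inner_matrix by (intro sum.neutral ballI) (use that in \<open>simp split: if_split\<close>)
  then have "(\<Sum>e'\<in>graph_support E. c e' * (edge_matrix e \<bullet> edge_matrix e')) = (\<Sum>e'\<in>{e}. c e' * (edge_matrix e \<bullet> edge_matrix e'))"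
    using assms by (intro sum.mono_neutral_right) auto
  then show ?thesis by (simp add: inner_sum_right)
qed

lemma column_nth: "column k A $ i = A $ i $ k"
  by (simp add: column_def)

section \<open>Samples as columns of a square matrix\<close>

lemma stress_free_reindex:
  assumes h: "h ` J = K" and free: "stress_free E K X"
  shows "stress_free E J (\<lambda>j. X (h j))"
  using assms unfolding stress_free_def by blast

text \<open>Selecting r columns of an n by n matrix avoids a type of size r, and the idle columns
  leave room to make the matrix invertible, as \<open>rank_column_product\<close> demands.\<close>

lemma stress_free_matrix:
  fixes E :: "'n::finite set set"
  assumes "card (J :: 'n set) = r"
  shows "(\<exists>X. stress_free E {1..r} X) \<longleftrightarrow> (\<exists>P. stress_free E J (\<lambda>j. column j P))"
proof -
  obtain h where "bij_betw h J {1..r}" using finite_same_card_bij[of J "{1..r}"] assms by auto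
  then have h: "h ` J = {1..r}" "inj_on h J" by (auto simp: bij_betw_def)
  show ?thesis
  proof
    assume "\<exists>X. stress_free E {1..r} X"
    then obtain X where "stress_free E {1..r} X" by blast
    then have "stress_free E J (\<lambda>j. X (h j))" by (rule stress_free_reindex[OF h(1)])
    moreover have "column j (\<chi> i k. X (h k) $ i) = X (h j)" for j by (simp add: vec_eq_iff column_nth)
    ultimately have "stress_free E J (\<lambda>j. column j (\<chi> i k. X (h k) $ i))" by simp
    then show "\<exists>P. stress_free E J (\<lambda>j. column j P)" by blast
  next
    assume "\<exists>P. stress_free E J (\<lambda>j. column j P)"
    then obtain P where "stress_free E J (\<lambda>j. column j P)" by blast
    moreover have "inv_into J h ` {1..r} = J" using h by (metis inv_into_image_cancel order_refl)
    ultimately have "stress_free E {1..r} (\<lambda>k. column (inv_into J h k) P)"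
      using stress_free_reindex[of "inv_into J h" "{1..r}" J E "\<lambda>j. column j P"] by blast
    then show "\<exists>X. stress_free E {1..r} X" by blast
  qed
qed

lemma det_polynomial: "(det :: real^'n^'n::finite \<Rightarrow> real) \<in> function_algebra coordinate_functions"
proof -
  have coord: "(\<lambda>A. A $ i $ j) \<in> function_algebra (coordinate_functions :: (real^'n^'n \<Rightarrow> real) set)" for i j
  proof -
    have "(\<lambda>A::real^'n^'n. A $ i $ j) = (\<lambda>A. A \<bullet> axis i (axis j 1))" by (simp add: inner_axis)
    then show ?thesis by (auto intro!: function_algebra.gen simp: axis_in_Basis_iff)
  qed
  show ?thesis unfolding det_def[abs_def]
    by (intro function_algebra_sum function_algebra.mult function_algebra.const function_algebra_prod coord)
qed

text \<open>The Gram determinant and the determinant are polynomials that are each nonzero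
  somewhere, hence nonzero at a common point.\<close>

lemma stress_free_invertible:
  fixes E :: "'n::finite set set"
  assumes "stress_free E J (\<lambda>j. column j P)"
  obtains Q :: "real^'n^'n" where "det Q \<noteq> 0" "stress_free E J (\<lambda>j. column j Q)"
proof -
  let ?G = "\<lambda>Q :: real^'n^'n. det (stress_gram E J (\<lambda>j. column j Q))"
  have fin: "finite (J :: 'n set)" by simp
  have "?G \<in> function_algebra coordinate_functions"
  proof (rule function_algebra_compose[OF stress_gram_polynomial])
    fix g :: "('n \<Rightarrow> real^'n) \<Rightarrow> real" assume "g \<in> product_generators J coordinate_functions"
    then obtain k b where kb: "g = (\<lambda>X. X k \<bullet> b)" "b \<in> Basis" by auto
    then obtain i where "b = axis i 1" unfolding Basis_vec_def by auto
    then have "(\<lambda>Q::real^'n^'n. g (\<lambda>j. column j Q)) = (\<lambda>Q. Q \<bullet> axis i (axis k 1))"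
      unfolding kb by (simp add: inner_axis column_nth)
    then show "(\<lambda>Q::real^'n^'n. g (\<lambda>j. column j Q)) \<in> function_algebra coordinate_functions"
      by (auto intro!: function_algebra.gen simp: axis_in_Basis_iff)
  qed
  then have "\<exists>Q. \<forall>b\<in>{True, False}. (if b then ?G else det) Q \<noteq> 0"
  proof (intro polynomial_common_nonzero)
    fix b
    show "\<exists>Q. (if b then ?G else det) Q \<noteq> 0"
    proof (cases b)
      case True
      then show ?thesis using assms det_stress_gram[OF fin, of E "\<lambda>j. column j P"] by auto
    next
      case False
      then show ?thesis by (auto intro!: exI[of _ "mat 1"])
    qed
  qed (auto intro: det_polynomial)
  then obtain Q where "?G Q \<noteq> 0" "det Q \<noteq> 0" by auto
  then show thesis using that det_stress_gram[OF fin, of E] by blast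
qed

definition column_product :: "'n set \<Rightarrow> real^'n^'n \<Rightarrow> real^'n^'n \<Rightarrow> real^'n^'n::finite" where
  "column_product J A B = (\<chi> i j. \<Sum>k\<in>J. A $ i $ k * B $ j $ k)"

lemma bounded_bilinear_column_product: "bounded_bilinear (column_product J)"
proof -
  have "bilinear (column_product J)"
    unfolding bilinear_def
    by (intro conjI allI linearI)
      (auto simp: column_product_def vec_eq_iff sum.distrib sum_distrib_left algebra_simps)
  then show ?thesis by (simp add: bilinear_conv_bounded_bilinear)
qed

lemma column_product_symmetric: "transpose (column_product J A A) = column_product J A A"
  by (simp add: column_product_def transpose_def mult.commute)

text \<open>The product is X D X^T with D the coordinate projection onto J, and invertible factors
  keep the rank.\<close>

lemma rank_column_product:
  fixes X :: "real^'n^'n::finite"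
  assumes X: "det X \<noteq> 0"
  shows "rank (column_product J X X) = card J"
proof -
  define D :: "real^'n^'n" where "D = (\<chi> i j. if i = j \<and> i \<in> J then 1 else 0)"
  have D: "D *v y = (\<chi> i. if i \<in> J then y $ i else 0)" for y
    by (simp add: D_def matrix_vector_mult_def vec_eq_iff if_distrib[of "\<lambda>x. x * _"] cong: if_cong)
  have "range ((*v) D) = {y. \<forall>i. i \<notin> J \<longrightarrow> y $ i = 0}"
  proof
    show "range ((*v) D) \<subseteq> {y. \<forall>i. i \<notin> J \<longrightarrow> y $ i = 0}" by (auto simp: D)
    show "{y. \<forall>i. i \<notin> J \<longrightarrow> y $ i = 0} \<subseteq> range ((*v) D)"
    proof
      fix y assume "y \<in> {y :: real^'n. \<forall>i. i \<notin> J \<longrightarrow> y $ i = 0}"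
      then have "y = D *v y" by (simp add: D vec_eq_iff)
      then show "y \<in> range ((*v) D)" by blast
    qed
  qed
  then have rD: "rank D = card J" unfolding rank_dim_range using dim_substandard_cart[of J, where 'a = real] by (simp add: dim_vec_eq[symmetric])
  have eq: "column_product J X X = X ** D ** transpose X"
  proof -
    have "(X ** D) $ i $ k = (if k \<in> J then X $ i $ k else 0)" for i k
    proof -
      have "(X ** D) $ i $ k = (\<Sum>l\<in>UNIV. if l = k then X $ i $ l * (if k \<in> J then 1 else 0) else 0)"
        unfolding matrix_matrix_mult_def D_def vec_lambda_beta by (intro sum.cong refl) auto
      then show ?thesis by simp
    qed
    then have "(X ** D ** transpose X) $ i $ j = (\<Sum>k\<in>UNIV. (if k \<in> J then X $ i $ k else 0) * X $ j $ k)" for i j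
      by (simp add: matrix_matrix_mult_def transpose_def)
    also have "(\<Sum>k\<in>UNIV. (if k \<in> J then X $ i $ k else 0) * X $ j $ k) = (\<Sum>k\<in>J. X $ i $ k * X $ j $ k)" for i j
      by (intro sum.mono_neutral_cong_right) auto
    finally show ?thesis by (simp add: vec_eq_iff column_product_def)
  qed
  obtain Z where Z: "X ** Z = mat 1" "Z ** X = mat 1" using X invertible_det_nz[of X] invertible_def by blast
  have tZ: "transpose X ** transpose Z = mat 1" using Z(2) by (metis matrix_transpose_mul transpose_mat)
  have "Z ** (X ** D ** transpose X) ** transpose Z = (Z ** X) ** D ** (transpose X ** transpose Z)" by (simp add: matrix_mul_assoc)
  then have "D = Z ** (X ** D ** transpose X) ** transpose Z" using Z tZ by simp
  then have "rank D \<le> rank (X ** D ** transpose X)"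
    by (metis rank_mul_le_left rank_mul_le_right order_trans)
  moreover have "rank (X ** D ** transpose X) \<le> rank D"
    by (metis rank_mul_le_left rank_mul_le_right order_trans)
  ultimately show ?thesis using rD eq by simp
qed

lemma inner_column_product:
  fixes w :: "real^'n^'n::finite"
  shows "w \<bullet> column_product J A B = (\<Sum>k\<in>J. column k A \<bullet> (w *v column k B))"
proof -
  have "w \<bullet> column_product J A B = (\<Sum>i\<in>UNIV. \<Sum>j\<in>UNIV. \<Sum>k\<in>J. A $ i $ k * (w $ i $ j * B $ j $ k))"
    by (simp add: inner_matrix column_product_def sum_distrib_left mult_ac)
  also have "\<dots> = (\<Sum>i\<in>UNIV. \<Sum>k\<in>J. \<Sum>j\<in>UNIV. A $ i $ k * (w $ i $ j * B $ j $ k))"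
    by (intro sum.cong sum.swap refl)
  also have "\<dots> = (\<Sum>k\<in>J. \<Sum>i\<in>UNIV. \<Sum>j\<in>UNIV. A $ i $ k * (w $ i $ j * B $ j $ k))"
    by (rule sum.swap)
  also have "\<dots> = (\<Sum>k\<in>J. column k A \<bullet> (w *v column k B))"
    by (simp add: inner_vec_def matrix_vector_mult_def column_nth sum_distrib_left)
  finally show ?thesis .
qed

text \<open>
  The map \<open>X \<mapsto> graph_projection E (column_product J X X)\<close> is a submersion onto the stress space
  at a stress-free configuration. The summand \<open>Z - \<rho> Z\<close> makes it a submersion onto all matrices,
  so that the open mapping theorem for full-dimensional targets applies.
\<close>

lemma stress_free_full_dimension:
  fixes E :: "'n::finite set set"
  assumes Y: "det Y \<noteq> 0" "stress_free E J (\<lambda>j. column j Y)"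
  shows "set_dimension (graph_projection E ` symmetric_of_rank (card J)) = dim (stress_space UNIV E)"
proof -
  let ?V = "stress_space UNIV E" and ?\<pi> = "graph_projection E" and ?c = "column_product J"
  \<comment> \<open>Symmetrization followed by projection: a linear retraction of all matrices onto
    the stress space.\<close>
  define \<rho> :: "real^'n^'n \<Rightarrow> real^'n^'n" where "\<rho> A = ?\<pi> ((1/2) *\<^sub>R (A + transpose A))" for A
  have lt: "linear (transpose :: real^'n^'n \<Rightarrow> real^'n^'n)" by (rule linearI) (auto simp: transpose_def vec_eq_iff)
  have bp: "bounded_linear ?\<pi>" using linear_graph_projection linear_conv_bounded_linear by blast
  have l\<rho>: "linear \<rho>"
    unfolding \<rho>_def
    by (intro linear_compose[OF _ linear_graph_projection, unfolded o_def] linear_compose_scale_right linear_compose_add lt linear_ident)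
  have b\<rho>: "bounded_linear \<rho>" using l\<rho> linear_conv_bounded_linear by blast
  have \<rho>V: "\<rho> A \<in> ?V" for A
    unfolding \<rho>_def by (rule graph_projection_stress_space) (simp add: transpose_def vec_eq_iff)
  have \<rho>id: "\<rho> A = A" if "A \<in> ?V" for A
  proof -
    have "(1/2) *\<^sub>R (A + transpose A) = A" using stress_spaceD(1)[OF that] by (simp add: vec_eq_iff)
    then show ?thesis using graph_projection_id[OF that] by (simp add: \<rho>_def)
  qed
  define f where "f p = ?\<pi> (?c (fst p) (fst p)) + (snd p - \<rho> (snd p))" for p :: "(real^'n^'n) \<times> (real^'n^'n)"
  define L where "L H = ?\<pi> (?c Y H + ?c H Y)" for H
  define f' where "f' p = L (fst p) + (snd p - \<rho> (snd p))" for p :: "(real^'n^'n) \<times> (real^'n^'n)"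
  interpret c: bounded_bilinear ?c by (rule bounded_bilinear_column_product)
  have lL: "linear L"
    unfolding L_def
    by (intro linear_compose[OF _ linear_graph_projection, unfolded o_def] linear_compose_add
        bounded_linear.linear c.bounded_linear_left c.bounded_linear_right)
  have LV: "L H \<in> ?V" for H
    unfolding L_def
    by (rule graph_projection_stress_space) (simp add: column_product_def transpose_def vec_eq_iff mult.commute add.commute)
  have derf: "(f has_derivative f') (at (Y, 0))"
  proof -
    have "((\<lambda>p. ?c (fst p) (fst p)) has_derivative (\<lambda>p. ?c Y (fst p) + ?c (fst p) Y)) (at (Y, 0 :: real^'n^'n))"
      using c.FDERIV[OF bounded_linear.has_derivative[OF bounded_linear_fst has_derivative_ident] bounded_linear.has_derivative[OF bounded_linear_fst has_derivative_ident], of "(Y, 0 :: real^'n^'n)" UNIV]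
      by simp
    then have "((\<lambda>p. ?\<pi> (?c (fst p) (fst p))) has_derivative (\<lambda>p. L (fst p))) (at (Y, 0 :: real^'n^'n))"
      unfolding L_def by (rule bounded_linear.has_derivative[OF bp])
    moreover have "((\<lambda>p. snd p - \<rho> (snd p)) has_derivative (\<lambda>p. snd p - \<rho> (snd p))) (at (Y, 0 :: real^'n^'n))"
      by (intro bounded_linear_imp_has_derivative bounded_linear_sub bounded_linear_snd bounded_linear_compose[OF b\<rho> bounded_linear_snd])
    ultimately show ?thesis unfolding f_def[abs_def] f'_def[abs_def] by (rule has_derivative_add)
  qed
  have LsurjV: "range L = ?V"
  proof (rule ccontr)
    assume ne: "range L \<noteq> ?V"
    have sub: "subspace (range L)" using linear_subspace_image[OF lL subspace_UNIV] .
    have spL: "span (range L) = range L" using sub span_eq_iff by blast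
    have spV: "span ?V = ?V" using subspace_stress_space span_eq_iff by blast
    have "span (range L) \<subset> span ?V" unfolding spL spV using ne LV by auto
    then obtain w where w: "w \<noteq> 0" "w \<in> span ?V" "\<And>y. y \<in> span (range L) \<Longrightarrow> orthogonal w y"
      using orthogonal_to_subspace_exists_gen by blast
    have wV: "w \<in> ?V" using w(2) unfolding spV .
    have sym: "transpose w = w" by (rule stress_spaceD(1)[OF wV])
    have "w *v column k Y = 0" if k: "k \<in> J" for k
    proof -
      \<comment> \<open>The test direction for a stress w orthogonal to the range: w paired with the
        derivative is twice the sum of the squared norms of \<open>w *v column k Y\<close>.\<close>
      define H where "H = (\<chi> i k. (w *v column k Y) $ i)"
      have cH: "column k H = w *v column k Y" for k by (simp add: H_def vec_eq_iff column_nth)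
      have "w \<bullet> L H = 0" using w(3)[of "L H"] span_base[of "L H" "range L"] by (simp add: orthogonal_def)
      then have "w \<bullet> ?c Y H + w \<bullet> ?c H Y = 0"
        unfolding L_def inner_graph_projection[OF wV] by (simp add: inner_add_right)
      moreover have "w \<bullet> ?c Y H = (\<Sum>k\<in>J. (w *v column k Y) \<bullet> (w *v column k Y))"
        unfolding inner_column_product cH using symmetric_inner[OF sym] by simp
      moreover have "w \<bullet> ?c H Y = (\<Sum>k\<in>J. (w *v column k Y) \<bullet> (w *v column k Y))"
        unfolding inner_column_product cH by simp
      ultimately have "(\<Sum>k\<in>J. (w *v column k Y) \<bullet> (w *v column k Y)) = 0" by simp
      then have "\<forall>k\<in>J. (w *v column k Y) \<bullet> (w *v column k Y) = 0"
        using sum_nonneg_eq_0_iff[of J "\<lambda>k. (w *v column k Y) \<bullet> (w *v column k Y)"] by simp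
      then show ?thesis using k by simp
    qed
    then show False using Y(2) wV w(1) unfolding stress_free_def by blast
  qed
  have lf': "linear f'" using has_derivative_linear[OF derf] .
  have "surj f'"
  proof -
    have "\<exists>p. A = f' p" for A
    proof -
      have "\<rho> A \<in> range L" using \<rho>V LsurjV by blast
      then obtain H where "\<rho> A = L H" by blast
      then have "A = f' (H, A)" by (simp add: f'_def)
      then show ?thesis by blast
    qed
    then show ?thesis by (simp add: surj_def)
  qed
  then obtain g' where g': "linear g'" "f' \<circ> g' = id" using linear_surjective_right_inverse[OF lf'] by blast
  \<comment> \<open>On this open set the product has rank exactly \<open>card J\<close>, as the
    definition of the completion rank demands.\<close>
  define T where "T = {p :: (real^'n^'n) \<times> (real^'n^'n). det (fst p) \<noteq> 0}"
  have "open T" unfolding T_def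
    by (intro open_Collect_neq continuous_intros continuous_on_compose2[OF continuous_on_det[of UNIV]]) auto
  have contf: "continuous_on UNIV f"
    unfolding f_def[abs_def]
    by (intro continuous_intros bounded_linear.continuous_on[OF bp] bounded_linear.continuous_on[OF b\<rho>] c.continuous_on)
  have "f (Y, 0) \<in> interior (f ` T)"
    by (rule sussmann_open_mapping[OF open_UNIV contf UNIV_I derf _ g'(2) subset_UNIV])
      (use g'(1) \<open>open T\<close> Y(1) in \<open>auto simp: linear_conv_bounded_linear interior_open T_def\<close>)
  moreover have "f (Y, 0) \<in> ?V"
    using graph_projection_stress_space[OF column_product_symmetric, of E J Y] l\<rho> by (simp add: f_def linear_0)
  ultimately have ne: "?V \<inter> interior (f ` T) \<noteq> {}" by blast
  have "?V \<inter> interior (f ` T) \<subseteq> ?\<pi> ` symmetric_of_rank (card J)"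
  proof
    fix v assume "v \<in> ?V \<inter> interior (f ` T)"
    then have "v \<in> f ` T" "v \<in> ?V" using subsetD[OF interior_subset[of "f ` T"]] by auto
    then obtain p where p: "det (fst p) \<noteq> 0" "v = f p" "v \<in> ?V" unfolding T_def by blast
    define A where "A = ?c (fst p) (fst p)"
    have "transpose A = A" unfolding A_def by (rule column_product_symmetric)
    then have piA: "?\<pi> A \<in> ?V" by (rule graph_projection_stress_space)
    \<comment> \<open>\<rho> kills the auxiliary summand and fixes the stress space, so the first
      component alone yields the preimage.\<close>
    have "\<rho> (snd p - \<rho> (snd p)) = 0" using linear_diff[OF l\<rho>] \<rho>id[OF \<rho>V] by simp
    then have "\<rho> v = \<rho> (?\<pi> A)" unfolding p(2) f_def A_def[symmetric] using linear_add[OF l\<rho>] by simp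
    then have "v = ?\<pi> A" using \<rho>id p(3) piA by simp
    moreover have "A \<in> symmetric_of_rank (card J)"
      using \<open>transpose A = A\<close> rank_column_product[OF p(1), of J]
      by (simp add: symmetric_of_rank_def symmetric_matrix_def A_def)
    ultimately show "v \<in> ?\<pi> ` symmetric_of_rank (card J)" by blast
  qed
  moreover have "?\<pi> ` symmetric_of_rank (card J) \<subseteq> ?V"
    using graph_projection_stress_space by (auto simp: symmetric_of_rank_def symmetric_matrix_def)
  moreover have "openin (top_of_set ?V) (?V \<inter> interior (f ` T))" by (rule openin_open_Int) simp
  ultimately show ?thesis using set_dimension_openin[OF subspace_stress_space _ _ ne] by blast
qed

text \<open>A symmetric matrix of rank r may be indefinite and then is no X X^T; in P B P^T, formed
  over the columns in J, the middle factor carries the signature.\<close>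

definition column_form :: "'n set \<Rightarrow> real^'n^'n \<Rightarrow> real^'n^'n \<Rightarrow> real^'n^'n \<Rightarrow> real^'n^'n::finite" where
  "column_form J A B C = (\<chi> i j. \<Sum>k\<in>J. \<Sum>l\<in>J. A $ i $ k * B $ k $ l * C $ j $ l)"

text \<open>A symmetric matrix equals its compression to its range: the columns of P form an
  orthonormal basis of the range of A, and B is A in this basis.\<close>

lemma symmetric_rank_form:
  fixes A :: "real^'n^'n::finite"
  assumes A: "A \<in> symmetric_of_rank (card (J :: 'n set))"
  obtains P B where "A = column_form J P B P"
proof -
  have sym: "transpose A = A" and rk: "rank A = card J" using A by (auto simp: symmetric_of_rank_def symmetric_matrix_def)
  define W where "W = range ((*v) A)"
  have W: "subspace W" "dim W = card J"
    using linear_subspace_image[OF matrix_vector_mul_linear subspace_UNIV, of A] rk by (auto simp: W_def rank_dim_range)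
  obtain S where S: "S \<subseteq> W" "pairwise orthogonal S" "\<And>x. x \<in> S \<Longrightarrow> norm x = 1" "independent S" "card S = dim W" "span S = W"
    using orthonormal_basis_subspace[OF W(1)] by blast
  have finS: "finite S" using S(4) by (rule independent_imp_finite)
  obtain h where "bij_betw h J S" using finite_same_card_bij[of J S] finS S(5) W(2) by auto
  then have h: "inj_on h J" "h ` J = S" by (auto simp: bij_betw_def)
  have proj: "(\<Sum>k\<in>J. (h k \<bullet> y) *\<^sub>R h k) = y" if y: "y \<in> W" for y
  proof -
    have "y \<in> span S" using y S(6) by simp
    then have "(\<Sum>v\<in>S. (v \<bullet> y) *\<^sub>R v) = y"
    proof (induction rule: span_induct_alt)
      case base
      then show ?case by simp
    next
      case (step c x y)
      have "(\<Sum>v\<in>S. (v \<bullet> x) *\<^sub>R v) = (\<Sum>v\<in>{x}. (v \<bullet> x) *\<^sub>R v)"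
      proof (rule sum.mono_neutral_right[OF finS])
        show "\<forall>v\<in>S - {x}. (v \<bullet> x) *\<^sub>R v = 0"
          using S(2) step.hyps(1) by (auto simp: pairwise_def orthogonal_def)
      qed (use step.hyps(1) in simp)
      also have "\<dots> = x" using S(3)[OF step.hyps(1)] by (simp add: dot_square_norm)
      finally have x: "(\<Sum>v\<in>S. (v \<bullet> x) *\<^sub>R v) = x" .
      have "(\<Sum>v\<in>S. (v \<bullet> (c *\<^sub>R x + y)) *\<^sub>R v) = c *\<^sub>R (\<Sum>v\<in>S. (v \<bullet> x) *\<^sub>R v) + (\<Sum>v\<in>S. (v \<bullet> y) *\<^sub>R v)"
        by (simp add: inner_add_right scaleR_add_left sum.distrib scaleR_sum_right)
      then show ?case using x step.IH by simp
    qed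
    then show ?thesis using sum.reindex[OF h(1), of "\<lambda>v. (v \<bullet> y) *\<^sub>R v"] h(2) by simp
  qed
  define P where "P = (\<chi> i k. h k $ i)"
  define B where "B = (\<chi> k l. h k \<bullet> (A *v h l))"
  have col: "(\<Sum>k\<in>J. (h k \<bullet> (A *v y)) * h k $ i) = (A *v y) $ i" for y i
  proof -
    have "A *v y \<in> W" by (simp add: W_def)
    from arg_cong[OF proj[OF this], of "\<lambda>v. v $ i"] show ?thesis by (simp add: sum_component)
  qed
  have "A $ i $ j = column_form J P B P $ i $ j" for i j
  proof -
    have "column_form J P B P $ i $ j = (\<Sum>k\<in>J. \<Sum>l\<in>J. h k $ i * (h k \<bullet> (A *v h l)) * h l $ j)"
      by (simp add: column_form_def P_def B_def)
    also have "\<dots> = (\<Sum>l\<in>J. (\<Sum>k\<in>J. (h k \<bullet> (A *v h l)) * h k $ i) * h l $ j)"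
      by (subst sum.swap) (simp add: sum_distrib_left mult_ac)
    also have "\<dots> = (\<Sum>l\<in>J. (A *v h l) $ i * h l $ j)" by (simp add: col)
    also have "\<dots> = (\<Sum>l\<in>J. (h l \<bullet> (A *v axis i 1)) * h l $ j)"
    proof (intro sum.cong refl arg_cong2[of _ _ _ _ "(*)"])
      fix l
      have "h l \<bullet> (A *v axis i 1) = (A *v h l) \<bullet> axis i 1" by (rule symmetric_inner[OF sym])
      then show "(A *v h l) $ i = h l \<bullet> (A *v axis i 1)" by (simp add: inner_axis)
    qed
    also have "\<dots> = (A *v axis i 1) $ j" by (rule col)
    also have "\<dots> = A $ j $ i" by (rule axis_column)
    also have "\<dots> = A $ i $ j" by (rule symmetric_nth[OF sym])
    finally show ?thesis by simp
  qed
  then have "A = column_form J P B P" by (simp add: vec_eq_iff)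
  then show thesis by (rule that)
qed

lemma inner_column_form:
  fixes w :: "real^'n^'n::finite"
  shows "w \<bullet> column_form J A B C = (\<Sum>k\<in>J. \<Sum>l\<in>J. B $ k $ l * (column k A \<bullet> (w *v column l C)))"
proof -
  have "w \<bullet> column_form J A B C = (\<Sum>i\<in>UNIV. \<Sum>j\<in>UNIV. \<Sum>(k, l)\<in>J \<times> J. B $ k $ l * (A $ i $ k * (w $ i $ j * C $ j $ l)))"
    by (simp add: inner_matrix column_form_def sum_distrib_left sum.cartesian_product case_prod_unfold mult_ac)
  also have "\<dots> = (\<Sum>i\<in>UNIV. \<Sum>(k, l)\<in>J \<times> J. \<Sum>j\<in>UNIV. B $ k $ l * (A $ i $ k * (w $ i $ j * C $ j $ l)))"
    unfolding case_prod_unfold by (intro sum.cong sum.swap refl)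
  also have "\<dots> = (\<Sum>(k, l)\<in>J \<times> J. \<Sum>i\<in>UNIV. \<Sum>j\<in>UNIV. B $ k $ l * (A $ i $ k * (w $ i $ j * C $ j $ l)))"
    unfolding case_prod_unfold by (rule sum.swap)
  also have "\<dots> = (\<Sum>(k, l)\<in>J \<times> J. B $ k $ l * (column k A \<bullet> (w *v column l C)))"
    unfolding case_prod_unfold
    by (intro sum.cong refl) (simp add: inner_vec_def matrix_vector_mult_def column_nth sum_distrib_left)
  also have "\<dots> = (\<Sum>k\<in>J. \<Sum>l\<in>J. B $ k $ l * (column k A \<bullet> (w *v column l C)))"
    by (simp add: sum.cartesian_product)
  finally show ?thesis .
qed

lemma line_derivative_form:
  fixes P B H C :: "real^'n^'n::finite"
  shows "line_derivative (\<lambda>p. w \<bullet> column_form J (fst p) (snd p) (fst p)) (P, B) (H, C)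
    (w \<bullet> column_form J H B P + w \<bullet> column_form J P C P + w \<bullet> column_form J P B H)"
proof -
  have "((\<lambda>t. (P + t *\<^sub>R H) $ i $ k * (B + t *\<^sub>R C) $ k $ l * (P + t *\<^sub>R H) $ j $ l) has_field_derivative
      H $ i $ k * B $ k $ l * P $ j $ l + P $ i $ k * C $ k $ l * P $ j $ l + P $ i $ k * B $ k $ l * H $ j $ l) (at 0)" for i j k l
    by (auto intro!: derivative_eq_intros simp: algebra_simps)
  then have "((\<lambda>t. \<Sum>i\<in>UNIV. \<Sum>j\<in>UNIV. w $ i $ j * (\<Sum>k\<in>J. \<Sum>l\<in>J. (P + t *\<^sub>R H) $ i $ k * (B + t *\<^sub>R C) $ k $ l * (P + t *\<^sub>R H) $ j $ l))
      has_field_derivative (\<Sum>i\<in>UNIV. \<Sum>j\<in>UNIV. w $ i $ j * (\<Sum>k\<in>J. \<Sum>l\<in>J.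
        H $ i $ k * B $ k $ l * P $ j $ l + P $ i $ k * C $ k $ l * P $ j $ l + P $ i $ k * B $ k $ l * H $ j $ l))) (at 0)"
    by (intro DERIV_sum DERIV_cmult)
  then show ?thesis
    unfolding line_derivative_def by (simp add: inner_matrix column_form_def sum.distrib distrib_left)
qed

lemma form_polynomial:
  fixes w :: "real^'n^'n::finite"
  shows "(\<lambda>p. w \<bullet> column_form J (fst p) (snd p) (fst p)) \<in> function_algebra coordinate_functions"
proof -
  have fst: "(\<lambda>p :: (real^'n^'n) \<times> (real^'n^'n). fst p $ i $ k) \<in> function_algebra coordinate_functions" for i k
  proof -
    have "(\<lambda>p :: (real^'n^'n) \<times> (real^'n^'n). fst p $ i $ k) = (\<lambda>p. p \<bullet> (axis i (axis k 1), 0))"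
      by (simp add: inner_Pair_0 inner_axis)
    moreover have "(axis i (axis k 1), 0) \<in> (Basis :: ((real^'n^'n) \<times> (real^'n^'n)) set)"
      by (auto simp: Basis_prod_def axis_in_Basis_iff)
    ultimately show ?thesis by (auto intro!: function_algebra.gen)
  qed
  have snd: "(\<lambda>p :: (real^'n^'n) \<times> (real^'n^'n). snd p $ i $ k) \<in> function_algebra coordinate_functions" for i k
  proof -
    have "(\<lambda>p :: (real^'n^'n) \<times> (real^'n^'n). snd p $ i $ k) = (\<lambda>p. p \<bullet> (0, axis i (axis k 1)))"
      by (simp add: inner_Pair_0 inner_axis)
    moreover have "(0, axis i (axis k 1)) \<in> (Basis :: ((real^'n^'n) \<times> (real^'n^'n)) set)"
      by (auto simp: Basis_prod_def axis_in_Basis_iff)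
    ultimately show ?thesis by (auto intro!: function_algebra.gen)
  qed
  show ?thesis
    unfolding inner_matrix column_form_def vec_lambda_beta
    by (intro function_algebra_sum function_algebra.mult function_algebra.const fst snd)
qed

text \<open>
  If the projection has full dimension, then it contains an open subset of the stress space by
  invariance of domain, so its coordinate functions are algebraically independent polynomials in
  the parametrization \<open>(P, B) \<mapsto> P B P\<^sup>T\<close>. A stress killed by the columns of \<open>P\<close> is a linear
  dependency between their differentials at \<open>(P, B)\<close>.
\<close>

lemma full_dimension_stress_free:
  fixes E :: "'n::finite set set"
  assumes full: "set_dimension (graph_projection E ` symmetric_of_rank (card (J :: 'n set))) = dim (stress_space UNIV E)"
    and pos: "0 < dim (stress_space UNIV E)"
  shows "\<exists>P. stress_free E J (\<lambda>j. column j P)"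
proof -
  let ?V = "stress_space UNIV E" and ?\<pi> = "graph_projection E" and ?D = "graph_support E"
  let ?A = "?\<pi> ` symmetric_of_rank (card J)"
  let ?N = "\<lambda>e :: 'n set. edge_matrix e \<bullet> edge_matrix e"
  define K where "K = {k. \<exists>(L::(real^'n^'n) set) U T. subspace L \<and> dim L = k \<and> openin (top_of_set L) U \<and> U \<noteq> {} \<and>
                     T \<subseteq> ?A \<and> U homeomorphic T}"
  have AV: "?A \<subseteq> ?V"
    using graph_projection_stress_space by (auto simp: symmetric_of_rank_def symmetric_matrix_def)
  have Sup: "Sup K = dim ?V" using full by (simp add: set_dimension_def K_def)
  \<comment> \<open>On natural numbers the supremum of the empty set is 0, which \<open>pos\<close>
    excludes; a finite nonempty set attains its supremum.\<close>
  have "K \<noteq> {}"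
  proof
    assume "K = {}"
    then have "Sup K = 0" by (simp add: Sup_nat_def)
    then show False using Sup pos by linarith
  qed
  moreover have "finite K"
  proof (rule finite_subset)
    show "K \<subseteq> {..DIM(real^'n^'n)}"
    proof
      fix k assume "k \<in> K"
      then obtain L :: "(real^'n^'n) set" where "dim L = k" unfolding K_def by blast
      then show "k \<in> {..DIM(real^'n^'n)}" using dim_subset_UNIV[of L] by (auto simp del: DIM_cart)
    qed
  qed simp
  ultimately have "dim ?V \<in> K" using Sup Max_in[of K] by (simp add: Sup_nat_def)
  then obtain L U T where L: "subspace (L :: (real^'n^'n) set)" "dim L = dim ?V" and U: "openin (top_of_set L) U" "U \<noteq> {}"
    and T: "T \<subseteq> ?A" "U homeomorphic T" unfolding K_def by blast
  obtain f g where fg: "homeomorphism U T f g" using T(2) unfolding homeomorphic_def by blast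
  have cf: "continuous_on U f" and fU: "f ` U = T" and inj: "inj_on f U"
    using fg unfolding homeomorphism_def by (auto intro: inj_on_inverseI)
  have "f \<in> U \<rightarrow> ?V" using fU T(1) AV by blast
  from invariance_of_domain_subspaces[OF U(1) L(1) subspace_stress_space _ cf this inj]
  have "openin (top_of_set ?V) T" using L(2) fU by simp
  moreover obtain v0 where "v0 \<in> T" using U(2) fU by blast
  ultimately obtain r where r: "r > 0" "ball v0 r \<inter> ?V \<subseteq> T" unfolding openin_contains_ball by blast
  have v0: "v0 \<in> ?V" using \<open>v0 \<in> T\<close> T(1) AV by blast
  define F where "F e p = edge_matrix e \<bullet> column_form J (fst p) (snd p) (fst p)" for e :: "'n set" and p :: "(real^'n^'n) \<times> (real^'n^'n)"
  have Npos: "?N e > 0" if e: "e \<in> ?D" for e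
  proof -
    obtain i j where "e = {i, j}" using e by (auto simp: graph_support_def)
    then have "edge_matrix e $ i $ j \<noteq> 0" by simp
    then have "edge_matrix e \<noteq> 0" by (metis zero_index)
    then show ?thesis by simp
  qed
  \<comment> \<open>Bounds the norm of a combination of edge matrices by its coordinates, so that a
    box of half-width \<open>r / c0\<close> lands in the ball of radius r; the summand 1 keeps it
    positive and the estimate strict.\<close>
  define c0 where "c0 = (\<Sum>e\<in>?D. norm (edge_matrix e) / ?N e) + 1"
  have c0: "c0 > 0" unfolding c0_def by (intro add_nonneg_pos sum_nonneg) auto
  have ind: "alg_indep ?D F"
  proof (rule alg_indep_if_box[of ?D "r / c0" "\<lambda>e. edge_matrix e \<bullet> v0"])
    fix z assume z: "\<forall>e\<in>?D. \<bar>z e - edge_matrix e \<bullet> v0\<bar> < r / c0"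
    define v where "v = v0 + (\<Sum>e\<in>?D. ((z e - edge_matrix e \<bullet> v0) / ?N e) *\<^sub>R edge_matrix e)"
    have vV: "v \<in> ?V" unfolding v_def by (rule subspace_add[OF subspace_stress_space v0 edge_combination_stress_space])
    have "norm (v - v0) \<le> (\<Sum>e\<in>?D. norm (((z e - edge_matrix e \<bullet> v0) / ?N e) *\<^sub>R edge_matrix e))"
      unfolding v_def by (simp only: add_diff_cancel_left') (rule norm_sum)
    also have "\<dots> \<le> (\<Sum>e\<in>?D. r / c0 * (norm (edge_matrix e) / ?N e))"
    proof (rule sum_mono)
      fix e assume e: "e \<in> ?D"
      have "norm (((z e - edge_matrix e \<bullet> v0) / ?N e) *\<^sub>R edge_matrix e) = \<bar>z e - edge_matrix e \<bullet> v0\<bar> * (norm (edge_matrix e) / ?N e)"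
        by (simp add: abs_divide)
      also have "\<dots> \<le> r / c0 * (norm (edge_matrix e) / ?N e)"
        using z e by (intro mult_right_mono) (auto intro: less_imp_le)
      finally show "norm (((z e - edge_matrix e \<bullet> v0) / ?N e) *\<^sub>R edge_matrix e) \<le> r / c0 * (norm (edge_matrix e) / ?N e)" .
    qed
    also have "\<dots> = r / c0 * (c0 - 1)" by (simp add: c0_def sum_distrib_left)
    also have "\<dots> < r / c0 * c0" using r(1) c0 by (intro mult_strict_left_mono) auto
    also have "\<dots> = r" using c0 by simp
    finally have "v \<in> ball v0 r" by (simp add: dist_norm norm_minus_commute)
    then have "v \<in> ?A" using r(2) vV T(1) by blast
    then obtain A where A: "A \<in> symmetric_of_rank (card J)" "v = ?\<pi> A" by blast
    obtain P B where PB: "A = column_form J P B P" using symmetric_rank_form[OF A(1)] by blast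
    have "F e (P, B) = z e" if e: "e \<in> ?D" for e
    proof -
      have "(\<Sum>e'\<in>?D. (if e' = e then 1 else 0) *\<^sub>R edge_matrix e') = edge_matrix e"
        using e by (simp add: if_distrib[of "\<lambda>x. x *\<^sub>R _"] cong: if_cong)
      then have eV: "edge_matrix e \<in> ?V" using edge_combination_stress_space by metis
      have "F e (P, B) = edge_matrix e \<bullet> v" unfolding F_def A(2) inner_graph_projection[OF eV] by (simp add: PB)
      also have "\<dots> = z e"
        unfolding v_def inner_add_right inner_edge_combination[OF e] using Npos[OF e] by simp
      finally show ?thesis .
    qed
    then show "\<exists>p. \<forall>e\<in>?D. F e p = z e" by blast
  qed (use r(1) c0 in auto)
  define F' where "F' e p q = edge_matrix e \<bullet> column_form J (fst q) (snd p) (fst p) + edge_matrix e \<bullet> column_form J (fst p) (snd q) (fst p)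
      + edge_matrix e \<bullet> column_form J (fst p) (snd p) (fst q)" for e :: "'n set" and p q :: "(real^'n^'n) \<times> (real^'n^'n)"
  have "\<exists>p. \<forall>\<mu>. (\<forall>q. (\<Sum>e\<in>?D. \<mu> e * F' e p q) = 0) \<longrightarrow> (\<forall>e\<in>?D. \<mu> e = 0)"
  proof (rule jacobian_criterion[OF _ ind])
    fix e p q
    show "F e \<in> function_algebra coordinate_functions" unfolding F_def[abs_def] by (rule form_polynomial)
    show "line_derivative (F e) p q (F' e p q)"
      unfolding F_def[abs_def] F'_def using line_derivative_form[of "edge_matrix e" J "fst p" "snd p" "fst q" "snd q"] by simp
    show "linear (F' e p)"
      unfolding F'_def inner_column_form
      by (rule linearI)
        (simp_all add: column_nth inner_vec_def matrix_vector_mult_def sum.distrib sum_distrib_left algebra_simps)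
  qed simp
  then obtain p where p: "\<And>\<mu>. (\<forall>q. (\<Sum>e\<in>?D. \<mu> e * F' e p q) = 0) \<Longrightarrow> \<forall>e\<in>?D. \<mu> e = 0" by blast
  have "stress_free E J (\<lambda>j. column j (fst p))"
    unfolding stress_free_def
  proof (intro ballI impI)
    fix w assume w: "w \<in> ?V" "\<forall>k\<in>J. w *v column k (fst p) = 0"
    have sym: "transpose w = w" by (rule stress_spaceD(1)[OF w(1)])
    obtain c where c: "w = (\<Sum>e\<in>?D. c e *\<^sub>R edge_matrix e)" using stress_edge_combination[OF w(1)] by blast
    have wi: "w \<bullet> M = (\<Sum>e\<in>?D. c e * (edge_matrix e \<bullet> M))" for M
      unfolding c by (simp add: inner_sum_left)
    \<comment> \<open>Each of the three terms of the differential has a column of P on at least one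
      side, and w kills it.\<close>
    have right: "w \<bullet> column_form J M B (fst p) = 0" for M B
      unfolding inner_column_form using w(2) by simp
    have left: "w \<bullet> column_form J (fst p) B M = 0" for M B
      unfolding inner_column_form symmetric_inner[OF sym] using w(2) by simp
    have "(\<Sum>e\<in>?D. c e * F' e p q) = 0" for q
    proof -
      have "(\<Sum>e\<in>?D. c e * F' e p q) = w \<bullet> column_form J (fst q) (snd p) (fst p) + w \<bullet> column_form J (fst p) (snd q) (fst p)
          + w \<bullet> column_form J (fst p) (snd p) (fst q)"
        unfolding wi F'_def by (simp add: distrib_left sum.distrib)
      then show ?thesis using right left by simp
    qed
    then have "\<forall>e\<in>?D. c e = 0" using p by blast
    then show "w = 0" unfolding c by simp
  qed
  then show ?thesis by blast
qed

lemma full_dimension_iff: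
  fixes E :: "'n::finite set set"
  assumes simple: "simple_graph E" and r: "r \<le> CARD('n)"
  shows "set_dimension (graph_projection E ` symmetric_of_rank r) = card E + CARD('n) \<longleftrightarrow> (\<exists>X. stress_free E {1..r} X)"
proof -
  obtain J :: "'n set" where J: "card J = r" using obtain_subset_with_card_n[OF r] by blast
  show ?thesis
    unfolding stress_free_matrix[OF J] dim_stress_space[OF simple, symmetric]
  proof
    assume "\<exists>P. stress_free E J (\<lambda>j. column j P)"
    then obtain P where "stress_free E J (\<lambda>j. column j P)" by blast
    then obtain Q where "det Q \<noteq> 0" "stress_free E J (\<lambda>j. column j Q)" by (rule stress_free_invertible)
    then show "set_dimension (graph_projection E ` symmetric_of_rank r) = dim (stress_space UNIV E)"
      using stress_free_full_dimension J by blast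
  next
    assume "set_dimension (graph_projection E ` symmetric_of_rank r) = dim (stress_space UNIV E)"
    then show "\<exists>P. stress_free E J (\<lambda>j. column j P)"
      using full_dimension_stress_free[of E J] J dim_stress_space[OF simple] by simp
  qed
qed

text \<open>The two conditions are compared only for ranks up to n; both hold at n, so both minima
  lie in this range and agree.\<close>

lemma gcr_eq_stress_rank:
  fixes E :: "'n::finite set set"
  assumes simple: "simple_graph E"
  shows "gcr E = stress_rank E"
proof -
  let ?P = "\<lambda>r::nat. 1 \<le> r \<and> set_dimension (graph_projection E ` symmetric_of_rank r) = card E + CARD('n)"
  let ?Q = "\<lambda>r::nat. 1 \<le> r \<and> (\<exists>X. stress_free E {1..r} X)"
  have eq: "?P r \<longleftrightarrow> ?Q r" if "r \<le> CARD('n)" for r using full_dimension_iff[OF simple that] by simp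
  have Qn: "?Q CARD('n)" using stress_free_card[of E] by (metis One_nat_def Suc_leI zero_less_card_finite)
  then have Pn: "?P CARD('n)" using eq by blast
  have "(LEAST r. ?P r) \<le> CARD('n)" using Pn by (rule Least_le)
  moreover have "?P (LEAST r. ?P r)" using Pn by (rule LeastI)
  ultimately have "?Q (LEAST r. ?P r)" using eq by blast
  then have 1: "(LEAST r. ?Q r) \<le> (LEAST r. ?P r)" by (rule Least_le)
  have "(LEAST r. ?Q r) \<le> CARD('n)" using Qn by (rule Least_le)
  moreover have "?Q (LEAST r. ?Q r)" using Qn by (rule LeastI)
  ultimately have "?P (LEAST r. ?Q r)" using eq by blast
  then have "(LEAST r. ?P r) \<le> (LEAST r. ?Q r)" by (rule Least_le)
  with 1 show ?thesis unfolding gcr_def stress_rank_def by (rule antisym[rotated])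
qed

theorem mainTheorem4:
  fixes E :: "'n::finite set set"
  assumes "simple_graph E"
    and "mlt E \<le> 3 \<or> gcr E \<le> 4"
  shows "mlt E = gcr E"
proof (cases "mlt E \<le> 3")
  case True
  then show ?thesis
    using gcr_eq_stress_rank[OF assms(1)] mlt_le_stress_rank[of E] stress_rank_le_mlt[OF assms(1)] by simp
next
  case False
  then show ?thesis
    using gcr_eq_stress_rank[OF assms(1)] mlt_le_stress_rank[of E] assms(2) by simp
qed

end
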